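(* Let $X,X_1,\dots,X_n$ be i.i.d. centered Gaussian random vectors in $\mathbb H$ with covariance operator $\Sigma$, and let $\mu_r$ be an eigenvalue of $\Sigma$ of multiplicity $1$ with unit eigenvector $\theta_r$. Let $t\ge1$ and $\gamma\in(0,1/2)$. There exists a constant $C_\gamma>0$ (depending only on $\gamma$) such that, if $$\mathbb E\|\hat\Sigma-\Sigma\|_\infty\le\frac{(1-2\gamma)\bar g_r}{2},\qquad 1+b_r\ge2\gamma$$ and $$C_\gamma\|\Sigma\|_\infty\left(\sqrt{\frac tn}\vee\frac tn\right)\le\frac{\gamma\bar g_r}{2},$$ then, for every $u\in\mathbb H$, with probability at least $1-e^{-t}$, $$\bigl|\bigl\langle\hat\theta_r-\sqrt{1+b_r}\,\theta_r,u\bigr\rangle\bigr|\le C_\gamma\frac{\|\Sigma\|_\infty}{\bar g_r}\sqrt{\frac tn}\,\|u\|.$$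
   Context: $\mathbb H$ is a real separable Hilbert space; $\|\cdot\|_\infty$ is the operator norm; $(u\otimes v)x=\langle v,x\rangle u$. $\Sigma=\mathbb E(X\otimes X)$ is the (trace class) covariance operator, $\hat\Sigma=n^{-1}\sum_{j=1}^nX_j\otimes X_j$. $\Sigma=\sum_{s\ge1}\mu_sP_s$, where $\mu_1>\mu_2>\dots>0$ are the distinct positive eigenvalues and $P_s$ the corresponding spectral projectors; here $P_r=\theta_r\otimes\theta_r$. For a nonnegative compact operator $A$, $\sigma_j(A)$ denote its eigenvalues in nonincreasing order repeated with multiplicity; let $j_r$ be the unique index with $\sigma_{j_r}(\Sigma)=\mu_r$. $\hat P_r$ is the orthogonal projector on the eigenspace of $\hat\Sigma$ corresponding to $\sigma_{j_r}(\hat\Sigma)$, and $\hat\theta_r$ is a corresponding unit eigenvector (so $\hat P_r=\hat\theta_r\otimes\hat\theta_r$ when this empirical eigenvalue is simple) with sign chosen so that $\langle\hat\theta_r,\theta_r\rangle\ge0$. Spectral gap: $g_r=\mu_r-\mu_{r+1}$ (with $\mu_{r+1}:=0$ if $\mu_r$ is the smallest positive eigenvalue), $\bar g_1=g_1$ and $\bar g_r=\min(g_{r-1},g_r)$ for $r\ge2$. $C_r=\sum_{s\ne r}\frac1{\mu_r-\mu_s}P_s$; for $E=\hat\Sigma-\Sigma$, $L_r(E)=C_rEP_r+P_rEC_r$, $S_r(E)=\hat P_r-P_r-L_r(E)$; $W_r=\mathbb ES_r(\hat\Sigma-\Sigma)$ and $b_r=\langle W_r\theta_r,\theta_r\rangle\in\mathbb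 R$. *)

theory Defs
  imports "HOL-Probability.Probability"
begin

section \<open>Gaussian vectors and covariance operators\<close>

text \<open>Throughout, a real separable Hilbert space is a type of sort
  \<^verbatim>\<open>{real_inner, banach, second_countable_topology}\<close>, and operators are plain functions on it;
  for bounded operators \<^const>\<open>onorm\<close> is the operator norm.  Operator-valued expectations are
  taken pointwise, as Bochner integrals in the Hilbert space.\<close>

definition centered_gaussian ::
    "'w measure \<Rightarrow> ('w \<Rightarrow> 'h::{real_inner,banach,second_countable_topology}) \<Rightarrow> bool" where
  "centered_gaussian M X \<longleftrightarrow> X \<in> borel_measurable M \<and>
     (\<forall>u. \<exists>\<sigma>\<ge>0. distr M borel (\<lambda>\<omega>. inner (X \<omega>) u) =
        (if \<sigma> = 0 then return borel 0 else density lborel (normal_density 0 \<sigma>)))"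

definition tensor :: "'h::real_inner \<Rightarrow> 'h \<Rightarrow> 'h \<Rightarrow> 'h" where
  "tensor u v x = inner v x *\<^sub>R u"

definition covariance ::
    "'w measure \<Rightarrow> ('w \<Rightarrow> 'h::{real_inner,banach,second_countable_topology}) \<Rightarrow> 'h \<Rightarrow> 'h" where
  "covariance M X x = (\<integral>\<omega>. tensor (X \<omega>) (X \<omega>) x \<partial>M)"

definition sample_covariance ::
    "(nat \<Rightarrow> 'w \<Rightarrow> 'h::real_inner) \<Rightarrow> nat \<Rightarrow> 'w \<Rightarrow> 'h \<Rightarrow> 'h" where
  "sample_covariance Y n \<omega> x = (1 / real n) *\<^sub>R (\<Sum>j=1..n. tensor (Y j \<omega>) (Y j \<omega>) x)"


section \<open>Spectral quantities of a nonnegative compact operator\<close>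

definition eigenspace :: "('h::real_vector \<Rightarrow> 'h) \<Rightarrow> real \<Rightarrow> 'h set" where
  "eigenspace A l = {x. A x = l *\<^sub>R x}"

definition pos_eigenvalues :: "('h::real_vector \<Rightarrow> 'h) \<Rightarrow> real set" where
  "pos_eigenvalues A = {l. 0 < l \<and> (\<exists>x. x \<noteq> 0 \<and> x \<in> eigenspace A l)}"

text \<open>The \<open>s\<close>-th largest distinct positive eigenvalue (counting from 1), and 0 if there are fewer
  than \<open>s\<close> of them.\<close>

definition distinct_eigenvalue :: "('h::real_vector \<Rightarrow> 'h) \<Rightarrow> nat \<Rightarrow> real" where
  "distinct_eigenvalue A s =
     (let is_sth = (\<lambda>l. l \<in> pos_eigenvalues A \<and> finite {k \<in> pos_eigenvalues A. l < k} \<and>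
                        card {k \<in> pos_eigenvalues A. l < k} + 1 = s)
      in if \<exists>l. is_sth l then (THE l. is_sth l) else 0)"

text \<open>All eigenvalues in nonincreasing order repeated with multiplicity: every \<open>l > 0\<close> is listed as
  often as the dimension of its eigenspace says (so not at all if it is not an eigenvalue), and the
  list is continued by zeros if there are only finitely many positive ones.  Here counting starts
  from 0, which is immaterial since an index is only ever carried over from one operator to
  another.\<close>

definition eigenvalue_seq :: "('h::real_vector \<Rightarrow> 'h) \<Rightarrow> nat \<Rightarrow> real" where
  "eigenvalue_seq A =
     (THE s. decseq s \<and> (\<forall>j. 0 \<le> s j) \<and>
        (\<forall>l>0. finite {j. s j = l} \<and> card {j. s j = l} = dim (eigenspace A l)))"

definition eigenvalue_index :: "('h::real_vector \<Rightarrow> 'h) \<Rightarrow> nat \<Rightarrow> nat" where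
  "eigenvalue_index A r = (THE j. eigenvalue_seq A j = distinct_eigenvalue A r)"

definition gap :: "('h::real_vector \<Rightarrow> 'h) \<Rightarrow> nat \<Rightarrow> real" where
  "gap A s = distinct_eigenvalue A s - distinct_eigenvalue A (Suc s)"

definition spectral_gap :: "('h::real_vector \<Rightarrow> 'h) \<Rightarrow> nat \<Rightarrow> real" where
  "spectral_gap A r = (if r = 1 then gap A 1 else min (gap A (r - 1)) (gap A r))"

definition orthogonal_projection :: "'h::real_inner set \<Rightarrow> 'h \<Rightarrow> 'h" where
  "orthogonal_projection V x = (THE y. y \<in> V \<and> (\<forall>z\<in>V. inner (x - y) z = 0))"

definition spectral_projector :: "('h::real_inner \<Rightarrow> 'h) \<Rightarrow> real \<Rightarrow> 'h \<Rightarrow> 'h" where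
  "spectral_projector A l = orthogonal_projection (eigenspace A l)"

text \<open>The operator \<open>C\<^sub>r\<close>.  The series converges strongly, not in operator norm, if there are
  infinitely many eigenvalues; the indices with \<open>distinct_eigenvalue A s = 0\<close> are padding.\<close>

definition reduced_resolvent ::
    "('h::{real_inner,banach,second_countable_topology} \<Rightarrow> 'h) \<Rightarrow> nat \<Rightarrow> 'h \<Rightarrow> 'h" where
  "reduced_resolvent A r x =
     (\<Sum>\<^sub>\<infinity>s\<in>{s. 1 \<le> s \<and> s \<noteq> r \<and> 0 < distinct_eigenvalue A s}.
        (1 / (distinct_eigenvalue A r - distinct_eigenvalue A s)) *\<^sub>R
          spectral_projector A (distinct_eigenvalue A s) x)"


section \<open>Perturbation of spectral projectors and the bias\<close>

definition linear_term ::
    "('h::{real_inner,banach,second_countable_topology} \<Rightarrow> 'h) \<Rightarrow> nat \<Rightarrow> ('h \<Rightarrow> 'h) \<Rightarrow> 'h \<Rightarrow> 'h" where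
  "linear_term A r E x =
     (let P = spectral_projector A (distinct_eigenvalue A r); C = reduced_resolvent A r
      in C (E (P x)) + P (E (C x)))"

definition empirical_eigenvalue ::
    "'w measure \<Rightarrow> ('w \<Rightarrow> 'h::{real_inner,banach,second_countable_topology}) \<Rightarrow>
     (nat \<Rightarrow> 'w \<Rightarrow> 'h) \<Rightarrow> nat \<Rightarrow> nat \<Rightarrow> 'w \<Rightarrow> real" where
  "empirical_eigenvalue M X Y n r \<omega> =
     eigenvalue_seq (sample_covariance Y n \<omega>) (eigenvalue_index (covariance M X) r)"

definition estimation_error ::
    "'w measure \<Rightarrow> ('w \<Rightarrow> 'h::{real_inner,banach,second_countable_topology}) \<Rightarrow>
     (nat \<Rightarrow> 'w \<Rightarrow> 'h) \<Rightarrow> nat \<Rightarrow> 'w \<Rightarrow> 'h \<Rightarrow> 'h" where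
  "estimation_error M X Y n \<omega> x = sample_covariance Y n \<omega> x - covariance M X x"

definition remainder ::
    "'w measure \<Rightarrow> ('w \<Rightarrow> 'h::{real_inner,banach,second_countable_topology}) \<Rightarrow>
     (nat \<Rightarrow> 'w \<Rightarrow> 'h) \<Rightarrow> nat \<Rightarrow> nat \<Rightarrow> 'w \<Rightarrow> 'h \<Rightarrow> 'h" where
  "remainder M X Y n r \<omega> x =
     spectral_projector (sample_covariance Y n \<omega>) (empirical_eigenvalue M X Y n r \<omega>) x
     - spectral_projector (covariance M X) (distinct_eigenvalue (covariance M X) r) x
     - linear_term (covariance M X) r (estimation_error M X Y n \<omega>) x"

definition mean_remainder ::
    "'w measure \<Rightarrow> ('w \<Rightarrow> 'h::{real_inner,banach,second_countable_topology}) \<Rightarrow>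
     (nat \<Rightarrow> 'w \<Rightarrow> 'h) \<Rightarrow> nat \<Rightarrow> nat \<Rightarrow> 'h \<Rightarrow> 'h" where
  "mean_remainder M X Y n r x = (\<integral>\<omega>. remainder M X Y n r \<omega> x \<partial>M)"

definition bias ::
    "'w measure \<Rightarrow> ('w \<Rightarrow> 'h::{real_inner,banach,second_countable_topology}) \<Rightarrow>
     (nat \<Rightarrow> 'w \<Rightarrow> 'h) \<Rightarrow> nat \<Rightarrow> nat \<Rightarrow> 'h \<Rightarrow> real" where
  "bias M X Y n r \<theta> = inner (mean_remainder M X Y n r \<theta>) \<theta>"

text \<open>\<open>X\<close> is the generic vector that determines the covariance operator, \<open>Y 1, \<dots>, Y n\<close> are the
  observations.\<close>

definition gaussian_sample ::
    "'w measure \<Rightarrow> ('w \<Rightarrow> 'h::{real_inner,banach,second_countable_topology}) \<Rightarrow>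
     (nat \<Rightarrow> 'w \<Rightarrow> 'h) \<Rightarrow> nat \<Rightarrow> bool" where
  "gaussian_sample M X Y n \<longleftrightarrow> prob_space M \<and> 1 \<le> n \<and> centered_gaussian M X \<and>
     prob_space.indep_vars M (\<lambda>_. borel) Y {1..n} \<and>
     (\<forall>j\<in>{1..n}. distr M borel (Y j) = distr M borel X)"

definition simple_eigenpair ::
    "('h::real_inner \<Rightarrow> 'h) \<Rightarrow> nat \<Rightarrow> 'h \<Rightarrow> bool" where
  "simple_eigenpair A r \<theta> \<longleftrightarrow> 1 \<le> r \<and> distinct_eigenvalue A r \<in> pos_eigenvalues A \<and>
     dim (eigenspace A (distinct_eigenvalue A r)) = 1 \<and>
     \<theta> \<in> eigenspace A (distinct_eigenvalue A r) \<and> norm \<theta> = 1"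

definition empirical_eigenvector ::
    "'w measure \<Rightarrow> ('w \<Rightarrow> 'h::{real_inner,banach,second_countable_topology}) \<Rightarrow>
     (nat \<Rightarrow> 'w \<Rightarrow> 'h) \<Rightarrow> nat \<Rightarrow> nat \<Rightarrow> 'h \<Rightarrow> ('w \<Rightarrow> 'h) \<Rightarrow> bool" where
  "empirical_eigenvector M X Y n r \<theta> \<theta>h \<longleftrightarrow> \<theta>h \<in> borel_measurable M \<and>
     (\<forall>\<omega>\<in>space M. \<theta>h \<omega> \<in> eigenspace (sample_covariance Y n \<omega>) (empirical_eigenvalue M X Y n r \<omega>) \<and>
        norm (\<theta>h \<omega>) = 1 \<and> 0 \<le> inner (\<theta>h \<omega>) \<theta>)"


section \<open>The sequence space of square-summable reals\<close>

typedef ell2 = "{x::nat \<Rightarrow> real. summable (\<lambda>i. (x i)\<^sup>2)}"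
  morphisms coord Abs_ell2
  by (rule exI[of _ "\<lambda>_. 0"]) simp

setup_lifting type_definition_ell2

lemma summable_coord: "summable (\<lambda>i. (coord x i)\<^sup>2)"
  using coord[of x] by simp

lemma summable_mult_square:
  fixes x y :: "nat \<Rightarrow> real"
  assumes "summable (\<lambda>i. (x i)\<^sup>2)" "summable (\<lambda>i. (y i)\<^sup>2)"
  shows "summable (\<lambda>i. x i * y i)"
proof (rule summable_comparison_test')
  show "summable (\<lambda>i. (x i)\<^sup>2 + (y i)\<^sup>2)"
    using assms by (rule summable_add)
  show "norm (x i * y i) \<le> (x i)\<^sup>2 + (y i)\<^sup>2" for i
  proof -
    have "0 \<le> (\<bar>x i\<bar> - \<bar>y i\<bar>)\<^sup>2" by simp
    then have "2 * (\<bar>x i\<bar> * \<bar>y i\<bar>) \<le> (x i)\<^sup>2 + (y i)\<^sup>2"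
      by (simp add: power2_diff)
    moreover have "0 \<le> \<bar>x i\<bar> * \<bar>y i\<bar>" by simp
    ultimately have "\<bar>x i\<bar> * \<bar>y i\<bar> \<le> (x i)\<^sup>2 + (y i)\<^sup>2" by linarith
    then show ?thesis by (simp add: abs_mult)
  qed
qed

lemma summable_add_square:
  fixes x y :: "nat \<Rightarrow> real"
  assumes "summable (\<lambda>i. (x i)\<^sup>2)" "summable (\<lambda>i. (y i)\<^sup>2)"
  shows "summable (\<lambda>i. (x i + y i)\<^sup>2)"
proof -
  have "(x i + y i)\<^sup>2 = (x i)\<^sup>2 + (y i)\<^sup>2 + 2 * (x i * y i)" for i
    by (simp add: power2_sum)
  then show ?thesis
    using assms summable_mult_square[OF assms] by (auto intro!: summable_add summable_mult)
qed

instantiation ell2 :: real_vector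
begin

lift_definition zero_ell2 :: ell2 is "\<lambda>_. 0" by simp
lift_definition plus_ell2 :: "ell2 \<Rightarrow> ell2 \<Rightarrow> ell2" is "\<lambda>x y i. x i + y i"
  by (rule summable_add_square)
lift_definition uminus_ell2 :: "ell2 \<Rightarrow> ell2" is "\<lambda>x i. - x i" by simp
lift_definition minus_ell2 :: "ell2 \<Rightarrow> ell2 \<Rightarrow> ell2" is "\<lambda>x y i. x i - y i"
proof -
  fix x y :: "nat \<Rightarrow> real"
  assume "summable (\<lambda>i. (x i)\<^sup>2)" "summable (\<lambda>i. (y i)\<^sup>2)"
  then show "summable (\<lambda>i. (x i - y i)\<^sup>2)"
    using summable_add_square[of x "\<lambda>i. - y i"] by simp
qed
lift_definition scaleR_ell2 :: "real \<Rightarrow> ell2 \<Rightarrow> ell2" is "\<lambda>c x i. c * x i"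
  by (auto simp: power_mult_distrib intro: summable_mult)

instance
  by standard (transfer; simp add: algebra_simps fun_eq_iff)+

end

instantiation ell2 :: real_inner
begin

definition inner_ell2 :: "ell2 \<Rightarrow> ell2 \<Rightarrow> real" where
  "inner_ell2 x y = (\<Sum>i. coord x i * coord y i)"
definition norm_ell2 :: "ell2 \<Rightarrow> real" where "norm_ell2 x = sqrt (inner x x)"
definition sgn_ell2 :: "ell2 \<Rightarrow> ell2" where "sgn_ell2 x = x /\<^sub>R norm x"
definition dist_ell2 :: "ell2 \<Rightarrow> ell2 \<Rightarrow> real" where "dist_ell2 x y = norm (x - y)"
definition uniformity_ell2 :: "(ell2 \<times> ell2) filter" where
  "uniformity_ell2 = (INF e\<in>{0<..}. principal {(x, y). dist x y < e})"
definition open_ell2 :: "ell2 set \<Rightarrow> bool" where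
  "open_ell2 U \<longleftrightarrow> (\<forall>x\<in>U. eventually (\<lambda>(x', y). x' = x \<longrightarrow> y \<in> U) uniformity)"

instance
proof
  fix x y z :: ell2 and r :: real and U :: "ell2 set"
  show "inner x y = inner y x"
    by (simp add: inner_ell2_def mult.commute)
  show "inner (x + y) z = inner x z + inner y z"
    by (simp add: inner_ell2_def plus_ell2.rep_eq distrib_right
        suminf_add summable_mult_square summable_coord)
  show "inner (r *\<^sub>R x) y = r * inner x y"
    by (simp add: inner_ell2_def scaleR_ell2.rep_eq mult.assoc
        suminf_mult summable_mult_square summable_coord)
  show "0 \<le> inner x x"
    unfolding inner_ell2_def by (rule suminf_nonneg) (auto intro: summable_mult_square summable_coord)
  have "(\<Sum>i. coord x i * coord x i) = 0 \<longleftrightarrow> (\<forall>i. coord x i * coord x i = 0)"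
    by (rule suminf_eq_zero_iff) (auto intro: summable_mult_square summable_coord)
  then show "inner x x = 0 \<longleftrightarrow> x = 0"
    by (auto simp: inner_ell2_def zero_ell2.rep_eq fun_eq_iff simp flip: coord_inject)
  show "norm x = sqrt (inner x x)" by (rule norm_ell2_def)
  show "sgn x = x /\<^sub>R norm x" by (rule sgn_ell2_def)
  show "dist x y = norm (x - y)" by (rule dist_ell2_def)
  show "(uniformity :: (ell2 \<times> ell2) filter) = (INF e\<in>{0<..}. principal {(x, y). dist x y < e})"
    by (rule uniformity_ell2_def)
  show "open U \<longleftrightarrow> (\<forall>x\<in>U. eventually (\<lambda>(x', y). x' = x \<longrightarrow> y \<in> U) uniformity)"
    by (rule open_ell2_def)
qed

end

lemma norm_ell2_square: "(norm (x::ell2))\<^sup>2 = (\<Sum>i. (coord x i)\<^sup>2)"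
  unfolding power2_norm_eq_inner inner_ell2_def by (simp add: power2_eq_square)

lemma partial_sum_le_norm_ell2: "(\<Sum>i<N. (coord x i)\<^sup>2) \<le> (norm (x::ell2))\<^sup>2"
  unfolding norm_ell2_square by (rule sum_le_suminf) (auto intro: summable_coord)

lemma abs_coord_le_norm: "\<bar>coord x i\<bar> \<le> norm (x::ell2)"
proof -
  have "(coord x i)\<^sup>2 \<le> (\<Sum>j<Suc i. (coord x j)\<^sup>2)"
    by (rule member_le_sum) auto
  then have "\<bar>coord x i\<bar>\<^sup>2 \<le> (norm x)\<^sup>2"
    using partial_sum_le_norm_ell2[of x "Suc i"] by simp
  then show ?thesis by (rule power2_le_imp_le) simp
qed

instance ell2 :: banach
proof
  fix X :: "nat \<Rightarrow> ell2"
  assume "Cauchy X"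
  have "Cauchy (\<lambda>m. coord (X m) i)" for i
  proof (rule CauchyI)
    fix e :: real assume "0 < e"
    then obtain K where K: "\<And>m n. m \<ge> K \<Longrightarrow> n \<ge> K \<Longrightarrow> norm (X m - X n) < e"
      using CauchyD[OF \<open>Cauchy X\<close>] by blast
    show "\<exists>K. \<forall>m\<ge>K. \<forall>n\<ge>K. norm (coord (X m) i - coord (X n) i) < e"
    proof (intro exI allI impI)
      fix m n assume "K \<le> m" "K \<le> n"
      then show "norm (coord (X m) i - coord (X n) i) < e"
        using K[of m n] abs_coord_le_norm[of "X m - X n" i] by (simp add: minus_ell2.rep_eq)
    qed
  qed
  then have "\<forall>i. \<exists>l. (\<lambda>m. coord (X m) i) \<longlonglongrightarrow> l"
    using Cauchy_convergent_iff convergent_def by blast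
  then obtain f where f: "\<And>i. (\<lambda>m. coord (X m) i) \<longlonglongrightarrow> f i" by metis
  have tail: "\<exists>K. \<forall>m\<ge>K. \<forall>N. (\<Sum>i<N. (f i - coord (X m) i)\<^sup>2) \<le> e\<^sup>2" if "0 < e" for e
  proof -
    obtain K where K: "\<And>m n. m \<ge> K \<Longrightarrow> n \<ge> K \<Longrightarrow> norm (X m - X n) < e"
      using CauchyD[OF \<open>Cauchy X\<close> \<open>0 < e\<close>] by blast
    have "(\<Sum>i<N. (f i - coord (X m) i)\<^sup>2) \<le> e\<^sup>2" if "K \<le> m" for m N
    proof (rule LIMSEQ_le_const2)
      show "(\<lambda>n. \<Sum>i<N. (coord (X n) i - coord (X m) i)\<^sup>2) \<longlonglongrightarrow> (\<Sum>i<N. (f i - coord (X m) i)\<^sup>2)"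
        by (intro tendsto_intros f)
      have "(\<Sum>i<N. (coord (X n) i - coord (X m) i)\<^sup>2) \<le> e\<^sup>2" if "K \<le> n" for n
      proof -
        have "(\<Sum>i<N. (coord (X n) i - coord (X m) i)\<^sup>2) \<le> (norm (X n - X m))\<^sup>2"
          using partial_sum_le_norm_ell2[of "X n - X m" N] by (simp add: minus_ell2.rep_eq)
        also have "\<dots> \<le> e\<^sup>2"
          using K[OF that \<open>K \<le> m\<close>] by (intro power_mono) auto
        finally show ?thesis .
      qed
      then show "\<exists>K. \<forall>n\<ge>K. (\<Sum>i<N. (coord (X n) i - coord (X m) i)\<^sup>2) \<le> e\<^sup>2" by blast
    qed
    then show ?thesis by blast
  qed
  obtain K where K: "\<And>m N. m \<ge> K \<Longrightarrow> (\<Sum>i<N. (f i - coord (X m) i)\<^sup>2) \<le> 1\<^sup>2"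
    using tail[of 1] by auto
  have "summable (\<lambda>i. (f i - coord (X K) i)\<^sup>2)"
  proof (rule summableI_nonneg_bounded)
    show "(\<Sum>i<N. (f i - coord (X K) i)\<^sup>2) \<le> 1\<^sup>2" for N by (rule K) simp
  qed simp
  from summable_add_square[OF this summable_coord[of "X K"]]
  have sf: "summable (\<lambda>i. (f i)\<^sup>2)" by simp
  define L where "L = Abs_ell2 f"
  have L: "coord L = f" unfolding L_def using sf by (simp add: Abs_ell2_inverse)
  have "X \<longlonglongrightarrow> L"
  proof (rule metric_LIMSEQ_I)
    fix e :: real assume "0 < e"
    then obtain K where K: "\<And>m N. m \<ge> K \<Longrightarrow> (\<Sum>i<N. (f i - coord (X m) i)\<^sup>2) \<le> (e/2)\<^sup>2"
      using tail[of "e/2"] by auto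
    have "dist (X m) L < e" if "K \<le> m" for m
    proof -
      have "(norm (L - X m))\<^sup>2 \<le> (e/2)\<^sup>2"
        unfolding norm_ell2_square
        by (rule suminf_le_const[OF summable_coord])
          (use K[OF that] in \<open>simp add: minus_ell2.rep_eq L\<close>)
      then have "norm (L - X m) \<le> e/2"
        by (rule power2_le_imp_le) (use \<open>0 < e\<close> in simp)
      then show ?thesis using \<open>0 < e\<close> by (simp add: dist_norm norm_minus_commute)
    qed
    then show "\<exists>K. \<forall>m\<ge>K. dist (X m) L < e" by blast
  qed
  then show "convergent X" by (rule convergentI)
qed

definition ell2_of_list :: "rat list \<Rightarrow> ell2" where
  "ell2_of_list q = Abs_ell2 (\<lambda>i. if i < length q then of_rat (q ! i) else 0)"

lemma coord_ell2_of_list: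
  "coord (ell2_of_list q) = (\<lambda>i. if i < length q then of_rat (q ! i) else 0)"
proof -
  have "summable (\<lambda>i. (if i < length q then real_of_rat (q ! i) else 0)\<^sup>2)"
    by (rule summable_finite[of "{..<length q}"]) auto
  then show ?thesis by (simp add: ell2_of_list_def Abs_ell2_inverse)
qed

lemma ell2_of_list_dense:
  assumes "0 < e"
  shows "\<exists>q. dist (ell2_of_list q) x < e"
proof -
  define d where "d = e\<^sup>2 / 4"
  have d: "0 < d" using assms by (simp add: d_def)
  have "(\<lambda>N. \<Sum>i<N. (coord x i)\<^sup>2) \<longlonglongrightarrow> (\<Sum>i. (coord x i)\<^sup>2)"
    using summable_LIMSEQ[OF summable_coord] .
  from LIMSEQ_D[OF this d] obtain N where
    "norm ((\<Sum>i<N. (coord x i)\<^sup>2) - (\<Sum>i. (coord x i)\<^sup>2)) < d" by auto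
  then have N: "(\<Sum>i. (coord x (i + N))\<^sup>2) < d"
    using suminf_minus_initial_segment[OF summable_coord, of x N] by (simp add: abs_less_iff)
  define h where "h = sqrt (d / (real N + 1))"
  have h: "0 < h" using d by (simp add: h_def)
  have "\<exists>a. \<bar>real_of_rat a - coord x i\<bar> < h" for i
  proof -
    obtain a where "coord x i < real_of_rat a" "real_of_rat a < coord x i + h"
      using of_rat_dense[of "coord x i" "coord x i + h"] h by auto
    then show ?thesis by (intro exI[of _ a]) auto
  qed
  then obtain a where a: "\<And>i. \<bar>real_of_rat (a i) - coord x i\<bar> < h" by metis
  define q where "q = map a [0..<N]"
  let ?z = "ell2_of_list q - x"
  have "(norm ?z)\<^sup>2 = (\<Sum>i. (coord ?z (i + N))\<^sup>2) + (\<Sum>i<N. (coord ?z i)\<^sup>2)"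
    unfolding norm_ell2_square by (rule suminf_split_initial_segment[OF summable_coord])
  also have "(\<Sum>i. (coord ?z (i + N))\<^sup>2) = (\<Sum>i. (coord x (i + N))\<^sup>2)"
    by (simp add: minus_ell2.rep_eq coord_ell2_of_list q_def)
  also have "(\<Sum>i<N. (coord ?z i)\<^sup>2) \<le> (\<Sum>i<N. d / (real N + 1))"
  proof (rule sum_mono)
    fix i assume "i \<in> {..<N}"
    then have "(coord ?z i)\<^sup>2 = \<bar>real_of_rat (a i) - coord x i\<bar>\<^sup>2"
      by (simp add: minus_ell2.rep_eq coord_ell2_of_list q_def)
    also have "\<dots> \<le> h\<^sup>2" using a[of i] by (intro power_mono) auto
    finally show "(coord ?z i)\<^sup>2 \<le> d / (real N + 1)" using d by (simp add: h_def)
  qed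
  also have "\<dots> \<le> d" using d by (simp add: field_simps)
  finally have "(norm ?z)\<^sup>2 < d + d" using N by simp
  moreover have "e\<^sup>2 = 4 * d" by (simp add: d_def)
  ultimately have "(norm ?z)\<^sup>2 < e\<^sup>2" using d by linarith
  then have "norm ?z < e" by (rule power2_less_imp_less) (use assms in simp)
  then show ?thesis by (auto simp: dist_norm)
qed

instance ell2 :: second_countable_topology
proof
  define B where "B = (\<lambda>(q, k). ball (ell2_of_list q) (1 / real (Suc k))) ` UNIV"
  have "countable B" unfolding B_def by simp
  moreover have "topological_basis B"
  proof (rule topological_basisI)
    fix U assume "U \<in> B" then show "open U" by (auto simp: B_def)
  next
    fix U and x :: ell2 assume "open U" "x \<in> U"
    then obtain e where e: "0 < e" "ball x e \<subseteq> U" using openE by blast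
    then obtain k where k: "1 / real (Suc k) < e / 2"
      using nat_approx_posE[of "e / 2"] by auto
    obtain q where q: "dist (ell2_of_list q) x < 1 / real (Suc k)"
      using ell2_of_list_dense[of "1 / real (Suc k)" x] by auto
    have "ball (ell2_of_list q) (1 / real (Suc k)) \<subseteq> ball x e"
    proof
      fix y assume "y \<in> ball (ell2_of_list q) (1 / real (Suc k))"
      then have "dist (ell2_of_list q) y < 1 / real (Suc k)" by simp
      then show "y \<in> ball x e"
        using q k dist_triangle3[of x y "ell2_of_list q"] by simp
    qed
    then show "\<exists>V\<in>B. x \<in> V \<and> V \<subseteq> U"
      using e q unfolding B_def
      by (intro bexI[of _ "ball (ell2_of_list q) (1 / real (Suc k))"]) auto
  qed
  ultimately show "\<exists>B::ell2 set set. countable B \<and> open = generate_topology B"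
    using topological_basis_imp_subbasis by blast
qed


section \<open>The constant\<close>

text \<open>The constant has to depend on \<open>\<gamma>\<close> only, and in particular not on the Hilbert space or its
  dimension.  An existential quantifier inside a proposition about a type \<open>'h\<close> could not express this,
  because type variables are quantified outermost.  So the constant is a term without type
  variables: one that is admissible for the space \<open>ell2\<close>, into which every real separable Hilbert
  space embeds isometrically, with the sample space \<open>nat \<Rightarrow> ell2\<close> (equipped with any probability
  measure), which can carry all the random vectors involved.  Hence this constant is positive and
  admissible for all types \<open>'w\<close>, \<open>'h\<close> if and only if there is any one positive constant which is.\<close>

definition admissible_constant ::
    "'w itself \<Rightarrow> 'h::{real_inner,banach,second_countable_topology} itself \<Rightarrow> real \<Rightarrow> real \<Rightarrow> bool" where
  "admissible_constant _ _ \<gamma> C \<longleftrightarrow>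
     (\<forall>(M::'w measure) (X::'w \<Rightarrow> 'h) Y n r \<theta> \<theta>h t u.
        gaussian_sample M X Y n \<longrightarrow>
        simple_eigenpair (covariance M X) r \<theta> \<longrightarrow>
        empirical_eigenvector M X Y n r \<theta> \<theta>h \<longrightarrow>
        1 \<le> t \<longrightarrow>
        (\<integral>\<omega>. onorm (estimation_error M X Y n \<omega>) \<partial>M)
          \<le> (1 - 2 * \<gamma>) * spectral_gap (covariance M X) r / 2 \<longrightarrow>
        2 * \<gamma> \<le> 1 + bias M X Y n r \<theta> \<longrightarrow>
        C * onorm (covariance M X) * max (sqrt (t / real n)) (t / real n)
          \<le> \<gamma> * spectral_gap (covariance M X) r / 2 \<longrightarrow>
        1 - exp (- t) \<le> measure M {\<omega> \<in> space M.
          \<bar>inner (\<theta>h \<omega> - sqrt (1 + bias M X Y n r \<theta>) *\<^sub>R \<theta>) u\<bar>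
            \<le> C * (onorm (covariance M X) / spectral_gap (covariance M X) r) * sqrt (t / real n) * norm u})"

definition bound_constant :: "real \<Rightarrow> real" where
  "bound_constant \<gamma> =
     (SOME C. 0 < C \<and> admissible_constant TYPE(nat \<Rightarrow> ell2) TYPE(ell2) \<gamma> C)"

end

theory Submission
  imports Defs
begin

text \<open>For two independent copies \<open>z\<close>, \<open>z'\<close> of the Gaussian sample, rotate \<open>z\<close> into \<open>z'\<close> in \<open>K\<close> steps.
  The increments of a functional \<open>f\<close> along this path are equidistributed by rotation invariance, so by
  Jensen's inequality \<open>E exp (l (f z' - f z))\<close> is at most \<open>E exp (l K D)\<close> with \<open>D\<close> a single increment,
  which for large \<open>K\<close> is linear in one copy given the other (Maurey and Pisier's argument, in discrete
  form).  For \<open>f\<close> the norm of the estimation error this bound involves \<open>f\<close> itself and yields that the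
  error exceeds \<open>(1 - \<gamma>) g / 2\<close> with exponentially small probability, where \<open>g\<close> is the spectral gap.
  For \<open>f\<close> a coordinate of the empirical projector applied to \<open>\<theta>\<close>, first-order perturbation theory bounds
  the increments as long as the error stays below \<open>g / 2\<close> along the path, and \<open>f\<close> concentrates around
  its mean at scale \<open>(\<parallel>\<Sigma>\<parallel> / g) sqrt (t / n)\<close>.  Reflection in the line through \<open>\<theta>\<close> preserves the law of
  the sample, so the mean of the empirical projector maps \<open>\<theta>\<close> to \<open>(1 + b) \<theta>\<close>.  On the good event, dividing
  the coordinates by that of \<open>\<theta>\<close>, which is close to \<open>sqrt (1 + b)\<close>, gives the claim for the eigenvector.\<close>

section \<open>Spectral theory of nonnegative compact operators\<close>

text \<open>Perturbation theory controls the projector only where the error is below half the gap,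
  while the rotation argument needs exponential moments on the whole product space. The two are
  reconciled by cutting off increments. That a whole path stays in the good set reduces to finitely
  many events, because the sample covariance at any angle is a combination of four others; their
  number depends on \<gamma> only, and the margin between \<open>\<tau>1\<close> and
  \<open>\<tau>2\<close> pays for the interpolation. The operator norm is a supremum over all
  directions, whose exponential moments are not known to be finite beforehand, so its concentration
  is proved for maxima over finitely many directions, with bounds that do not depend on their
  number. The constant of the statement is an arbitrary one among those admissible on
  \<open>ell2\<close>, so exhibiting an explicit constant for every space is not enough:
  admissibility itself has to be carried from \<open>ell2\<close> to the other spaces.\<close>

lemma weakly_Cauchy_subseq:
  fixes s :: "nat \<Rightarrow> 'h::{real_inner,second_countable_topology}"
  assumes "bounded (range s)"
  obtains r :: "nat \<Rightarrow> nat" where "strict_mono r" "\<And>z. convergent (\<lambda>n. inner z (s (r n)))"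
proof -
  obtain C where C: "\<And>n. norm (s n) \<le> C" "0 < C"
    using assms unfolding bounded_pos by auto
  obtain D :: "'h set" where D: "countable D" "\<And>X. open X \<Longrightarrow> X \<noteq> {} \<Longrightarrow> \<exists>d\<in>D. d \<in> X"
    using countable_dense_setE by blast
  have "D \<noteq> {}" using D(2)[of UNIV] by auto
  define d where "d = from_nat_into D"
  have d: "\<exists>i. dist (d i) z < e" if e: "0 < e" for z e
  proof -
    obtain x where "x \<in> D" "x \<in> ball z e" using D(2)[of "ball z e"] e by force
    then obtain i where "d i = x"
      unfolding d_def using from_nat_into_surj[OF \<open>countable D\<close>] by blast
    then show ?thesis using \<open>x \<in> ball z e\<close> by (auto simp: dist_commute)
  qed
  define g where "g = (\<lambda>n i. inner (d i) (s n))"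
  define B where "B = (\<lambda>i. {- (norm (d i) * C) .. norm (d i) * C})"
  have g: "g n \<in> PiE UNIV B" for n
  proof -
    have "\<bar>inner (d i) (s n)\<bar> \<le> norm (d i) * C" for i
      using Cauchy_Schwarz_ineq2[of "d i" "s n"] C(1)[of n]
      by (meson mult_left_mono norm_ge_zero order_trans)
    then show ?thesis by (auto simp: g_def B_def abs_le_iff minus_le_iff)
  qed
  \<comment> \<open>Compactness of a countable product of intervals takes the place of a diagonal
    extraction: one subsequence makes the inner products with the whole dense sequence
    converge.\<close>
  have "compactin (product_topology (\<lambda>i. euclidean) UNIV) (PiE UNIV B)"
    unfolding compactin_PiE by (auto simp: B_def)
  then have "compact (PiE UNIV B)"
    by (simp add: euclidean_product_topology)
  then have "seq_compact (PiE UNIV B)" by (rule compact_imp_seq_compact)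
  then obtain l r where r: "strict_mono (r :: nat \<Rightarrow> nat)" "(g \<circ> r) \<longlonglongrightarrow> l"
    using g seq_compactE by metis
  have lim: "(\<lambda>n. inner (d i) (s (r n))) \<longlonglongrightarrow> l i" for i
  proof -
    have "isCont (\<lambda>x::nat \<Rightarrow> real. x i) l"
      using continuous_on_product_coordinates[of i] continuous_on_eq_continuous_at by blast
    from isCont_tendsto_compose[OF this r(2)] show ?thesis by (simp add: g_def o_def)
  qed
  have "convergent (\<lambda>n. inner z (s (r n)))" for z
  proof (rule Cauchy_convergent, rule CauchyI)
    fix e :: real assume e: "0 < e"
    \<comment> \<open>Each of the two replacements of \<open>z\<close> by \<open>d i\<close> costs
      less than \<open>e / 4\<close>, which leaves \<open>e / 2\<close> for the Cauchy sequence
      along \<open>d i\<close>.\<close>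
    obtain i where i: "dist (d i) z < e / (4 * C)" using d[of "e / (4*C)" z] e C by auto
    have "Cauchy (\<lambda>n. inner (d i) (s (r n)))" using lim[of i] by (rule LIMSEQ_imp_Cauchy)
    from CauchyD[OF this, of "e/2"] e obtain M where
      M: "\<And>m n. m \<ge> M \<Longrightarrow> n \<ge> M \<Longrightarrow> \<bar>inner (d i) (s (r m)) - inner (d i) (s (r n))\<bar> < e/2" by auto
    have close: "\<bar>inner z (s (r n)) - inner (d i) (s (r n))\<bar> < e/4" for n
    proof -
      have "\<bar>inner (z - d i) (s (r n))\<bar> \<le> norm (z - d i) * norm (s (r n))"
        by (rule Cauchy_Schwarz_ineq2)
      also have "\<dots> \<le> norm (z - d i) * C" using C by (simp add: mult_left_mono)
      also have "\<dots> < e / (4 * C) * C"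
        using i C by (intro mult_strict_right_mono) (auto simp: dist_norm norm_minus_commute)
      finally show ?thesis using C by (simp add: inner_diff_left)
    qed
    show "\<exists>M. \<forall>m\<ge>M. \<forall>n\<ge>M. norm (inner z (s (r m)) - inner z (s (r n))) < e"
    proof (intro exI[of _ M] allI impI)
      fix m n assume "M \<le> m" "M \<le> n"
      then show "norm (inner z (s (r m)) - inner z (s (r n))) < e"
        using M[of m n] close[of m] close[of n] unfolding real_norm_def by linarith
    qed
  qed
  with r(1) show thesis by (rule that)
qed

text \<open>The quadratic is evaluated at its minimiser \<open>- b / d\<close>. For
  \<open>d = 0\<close> a nonconstant affine function would take negative values, and the chosen
  \<open>t\<close> makes it \<open>- 1\<close>.\<close>

lemma quadratic_discriminant_le:
  fixes a b d :: real
  assumes "\<And>t. 0 \<le> a + 2 * t * b + t\<^sup>2 * d" "0 \<le> d"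
  shows "b\<^sup>2 \<le> a * d"
proof (cases "d = 0")
  case True
  have "b = 0"
  proof (rule ccontr)
    assume "b \<noteq> 0"
    have "0 \<le> a + 2 * (- (a + 1) / (2 * b)) * b" using assms(1)[of "- (a + 1) / (2 * b)"] True by simp
    also have "\<dots> = - 1" using \<open>b \<noteq> 0\<close> by (simp add: field_simps)
    finally show False by simp
  qed
  then show ?thesis using True by simp
next
  case False
  then have "0 < d" using assms by simp
  have "0 \<le> (a + 2 * (- b / d) * b + (- b / d)\<^sup>2 * d) * d"
    using assms(1)[of "- b / d"] \<open>0 < d\<close> by (intro mult_nonneg_nonneg) auto
  also have "\<dots> = a * d - b\<^sup>2"
    using \<open>0 < d\<close> by (simp add: field_simps power2_eq_square)
  finally show ?thesis by simp
qed

text \<open>The last condition is compactness: bounded weakly Cauchy sequences are mapped to convergent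
  ones.\<close>

locale compact_nonneg =
  fixes A :: "'h::{real_inner,banach,second_countable_topology} \<Rightarrow> 'h"
  assumes bounded_linear: "bounded_linear A"
    and symmetric: "inner (A x) y = inner x (A y)"
    and nonneg: "0 \<le> inner (A x) x"
    and compact: "bounded (range s) \<Longrightarrow> (\<And>z. convergent (\<lambda>n. inner z (s n))) \<Longrightarrow>
      convergent (\<lambda>n. A (s n))"
begin

sublocale bounded_linear A by (rule bounded_linear)

lemma Cauchy_Schwarz: "(inner (A x) y)\<^sup>2 \<le> inner (A x) x * inner (A y) y"
proof (rule quadratic_discriminant_le)
  fix t :: real
  have "inner (A (x + t *\<^sub>R y)) (x + t *\<^sub>R y) =
     inner (A x) x + 2 * t * inner (A x) y + t\<^sup>2 * inner (A y) y"
    using symmetric[of y x]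
    by (simp add: add scaleR inner_add_left inner_add_right inner_commute power2_eq_square algebra_simps)
  then show "0 \<le> inner (A x) x + 2 * t * inner (A x) y + t\<^sup>2 * inner (A y) y"
    using nonneg[of "x + t *\<^sub>R y"] by simp
qed (rule nonneg)

lemma inner_le_onorm: "inner (A x) x \<le> onorm A * (norm x)\<^sup>2"
proof -
  have "inner (A x) x \<le> norm (A x) * norm x" by (rule norm_cauchy_schwarz)
  also have "\<dots> \<le> onorm A * norm x * norm x"
    by (intro mult_right_mono onorm bounded_linear) auto
  finally show ?thesis by (simp add: power2_eq_square)
qed

text \<open>A maximising sequence on the unit sphere has a weakly Cauchy subsequence, so by
  compactness its images converge. Near-maximisers are approximate eigenvectors and
  \<open>c > 0\<close>, so the subsequence converges itself, to an eigenvector in the closed set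
  \<open>W\<close>.\<close>

lemma Rayleigh_maximizer:
  assumes W: "subspace W" "closed W" "\<And>x. x \<in> W \<Longrightarrow> A x \<in> W"
    and x0: "x0 \<in> W" "0 < inner (A x0) x0"
  obtains e c where "e \<in> W" "norm e = 1" "0 < c" "A e = c *\<^sub>R e"
    "\<And>x. x \<in> W \<Longrightarrow> inner (A x) x \<le> c * (norm x)\<^sup>2"
proof -
  define Q where "Q = (\<lambda>x. inner (A x) x) ` {x\<in>W. norm x = 1}"
  define c where "c = Sup Q"
  have bdd: "bdd_above Q"
    unfolding Q_def
  proof (rule bdd_aboveI2)
    fix x assume "x \<in> {x \<in> W. norm x = 1}"
    then show "inner (A x) x \<le> onorm A" using inner_le_onorm[of x] by simp
  qed
  have x0nz: "x0 \<noteq> 0" using x0 by (auto simp: zero)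
  have scale: "inner (A x) x = inner (A (x /\<^sub>R norm x)) (x /\<^sub>R norm x) * (norm x)\<^sup>2" for x
    by (cases "x = 0") (simp_all add: zero scaleR power2_eq_square field_simps)
  have le_c: "inner (A x) x \<le> c * (norm x)\<^sup>2" if "x \<in> W" for x
  proof (cases "x = 0")
    case False
    have "x /\<^sub>R norm x \<in> {x\<in>W. norm x = 1}"
      using False that W(1) by (simp add: subspace_def)
    then have "inner (A (x /\<^sub>R norm x)) (x /\<^sub>R norm x) \<le> c"
      unfolding c_def by (intro cSup_upper bdd) (auto simp: Q_def simp del: inner_scaleR_right)
    then show ?thesis by (subst scale) (auto intro: mult_right_mono)
  qed (simp add: zero)
  have c: "0 < c"
  proof -
    have "0 < c * (norm x0)\<^sup>2" using le_c[OF x0(1)] x0(2) by linarith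
    then show ?thesis by (simp add: zero_less_mult_iff)
  qed
  have Qne: "Q \<noteq> {}"
    using x0 x0nz W(1) by (auto simp: Q_def subspace_def intro!: exI[of _ "x0 /\<^sub>R norm x0"])
  have "\<exists>x. x \<in> W \<and> norm x = 1 \<and> c - 1 / real (Suc n) < inner (A x) x" for n
  proof -
    have "\<exists>q\<in>Q. c - 1 / real (Suc n) < q"
      by (subst less_cSup_iff[symmetric, OF Qne bdd]) (simp add: c_def[symmetric])
    then show ?thesis by (auto simp: Q_def)
  qed
  then obtain x where x: "\<And>n. x n \<in> W" "\<And>n. norm (x n) = 1"
    "\<And>n. c - 1 / real (Suc n) < inner (A (x n)) (x n)" by metis
  have "bounded (range x)" unfolding bounded_iff using x(2) by (auto intro!: exI[of _ 1])
  then obtain r where r: "strict_mono (r :: nat \<Rightarrow> nat)"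
    "\<And>z. convergent (\<lambda>n. inner z (x (r n)))"
    by (rule weakly_Cauchy_subseq) blast
  have "bounded (range (x \<circ> r))" using x(2) unfolding bounded_iff by (auto intro!: exI[of _ 1])
  from compact[OF this] r(2) obtain y where y: "(\<lambda>n. A (x (r n))) \<longlonglongrightarrow> y"
    by (auto simp: convergent_def)
  \<comment> \<open>The Cauchy-Schwarz inequality of the form at \<open>v\<close> and
    \<open>A v\<close>, followed by the Rayleigh bound at \<open>A v\<close>, which lies in
    \<open>W\<close> by invariance.\<close>
  have sq: "(norm (A v))\<^sup>2 \<le> c * inner (A v) v" if "v \<in> W" for v
  proof (cases "A v = 0")
    case False
    have "(inner (A v) (A v))\<^sup>2 \<le> inner (A v) v * inner (A (A v)) (A v)" by (rule Cauchy_Schwarz)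
    also have "\<dots> \<le> inner (A v) v * (c * (norm (A v))\<^sup>2)"
      by (intro mult_left_mono nonneg le_c W that)
    finally have "(norm (A v))\<^sup>2 * (norm (A v))\<^sup>2 \<le> (c * inner (A v) v) * (norm (A v))\<^sup>2"
      unfolding power2_norm_eq_inner[symmetric] by (simp add: power2_eq_square[of "(norm _)\<^sup>2"] mult_ac)
    then show ?thesis by (rule mult_right_le_imp_le) (use False in simp)
  qed simp
  have near: "(norm (A v - c *\<^sub>R v))\<^sup>2 \<le> c * (c - inner (A v) v)" if "v \<in> W" "norm v = 1" for v
  proof -
    have "(norm (A v - c *\<^sub>R v))\<^sup>2 = (norm (A v))\<^sup>2 - 2 * c * inner (A v) v + c\<^sup>2 * (norm v)\<^sup>2"
      using inner_commute[of v "A v"] unfolding power2_norm_eq_inner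
      by (simp add: inner_diff_left inner_diff_right power2_eq_square right_diff_distrib)
    then show ?thesis using sq[OF that(1)] that(2) by (simp add: power2_eq_square algebra_simps)
  qed
  have "(\<lambda>n. A (x (r n)) - c *\<^sub>R x (r n)) \<longlonglongrightarrow> 0"
  proof (rule Lim_null_comparison)
    have "(\<lambda>n. 1 / real (Suc n)) \<longlonglongrightarrow> 0"
      using LIMSEQ_inverse_real_of_nat by (simp add: inverse_eq_divide)
    then have "(\<lambda>n. sqrt (c * (1 / real (Suc n)))) \<longlonglongrightarrow> sqrt (c * 0)" by (intro tendsto_intros)
    from LIMSEQ_subseq_LIMSEQ[OF this r(1)]
    show "(\<lambda>n. sqrt (c * (1 / real (Suc (r n))))) \<longlonglongrightarrow> 0" by (simp add: o_def)
    show "\<forall>\<^sub>F n in sequentially. norm (A (x (r n)) - c *\<^sub>R x (r n)) \<le> sqrt (c * (1 / real (Suc (r n))))"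
    proof (intro always_eventually allI real_le_rsqrt)
      fix n
      have "(norm (A (x (r n)) - c *\<^sub>R x (r n)))\<^sup>2 \<le> c * (c - inner (A (x (r n))) (x (r n)))"
        by (rule near[OF x(1,2)])
      also have "\<dots> \<le> c * (1 / real (Suc (r n)))"
        using x(3)[of "r n"] c by (intro mult_left_mono) auto
      finally show "(norm (A (x (r n)) - c *\<^sub>R x (r n)))\<^sup>2 \<le> c * (1 / real (Suc (r n)))" .
    qed
  qed
  from tendsto_diff[OF y this] have "(\<lambda>n. c *\<^sub>R x (r n)) \<longlonglongrightarrow> y" by simp
  from tendsto_scaleR[OF tendsto_const[of "1 / c"] this]
  have lim: "(\<lambda>n. x (r n)) \<longlonglongrightarrow> (1 / c) *\<^sub>R y" using c by simp
  define e where "e = (1 / c) *\<^sub>R y"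
  have e: "e \<in> W"
    unfolding e_def by (rule closed_sequentially[OF W(2) _ lim]) (rule x(1))
  have "norm e = 1"
  proof (rule LIMSEQ_unique)
    show "(\<lambda>n. norm (x (r n))) \<longlonglongrightarrow> norm e" unfolding e_def by (intro tendsto_norm lim)
    show "(\<lambda>n. norm (x (r n))) \<longlonglongrightarrow> 1" by (simp add: x(2))
  qed
  moreover have "A e = c *\<^sub>R e"
    unfolding LIMSEQ_unique[OF tendsto[OF lim] y, folded e_def] using c by (simp add: e_def)
  ultimately show thesis using e c le_c by (intro that[of e c]) auto
qed

end

section \<open>Greedy eigenvectors and the eigenvalue sequence\<close>

definition top_vector :: "('h::real_inner \<Rightarrow> 'h) \<Rightarrow> 'h set \<Rightarrow> 'h \<Rightarrow> bool" where
  "top_vector A F e \<longleftrightarrow> (\<forall>f\<in>F. inner f e = 0) \<and> norm e = 1 \<and>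
     (\<exists>c>0. A e = c *\<^sub>R e \<and> (\<forall>x. (\<forall>f\<in>F. inner f x = 0) \<longrightarrow> inner (A x) x \<le> c * (norm x)\<^sup>2))"

text \<open>Greedy eigenvectors: each maximizes the Rayleigh quotient orthogonally to the previous ones.
  Once there is no further positive eigenvalue, the sequence is continued by zero vectors.\<close>

function eigvec :: "('h::real_inner \<Rightarrow> 'h) \<Rightarrow> nat \<Rightarrow> 'h" where
  "eigvec A m = (let F = eigvec A ` {..<m} in
     if \<exists>e. top_vector A F e then (SOME e. top_vector A F e) else 0)"
  by auto
termination by (relation "Wellfounded.measure snd") auto

declare eigvec.simps[simp del]

definition eigval :: "('h::real_inner \<Rightarrow> 'h) \<Rightarrow> nat \<Rightarrow> real" where
  "eigval A m = inner (A (eigvec A m)) (eigvec A m)"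

text \<open>At the first index \<open>j\<close> where the sequences differ, let \<open>u\<close> be
  the larger one. The decreasing sequence \<open>v\<close> attains the value \<open>u j\<close> only
  before \<open>j\<close>, where both agree, so \<open>u\<close> attains it at least once more,
  contradicting equal counts.\<close>

lemma decseq_counts_eqI:
  fixes s s' :: "nat \<Rightarrow> real"
  assumes s: "decseq s" "\<And>j. 0 \<le> s j" "\<And>l. 0 < l \<Longrightarrow> finite {j. s j = l}"
    and s': "decseq s'" "\<And>j. 0 \<le> s' j" "\<And>l. 0 < l \<Longrightarrow> finite {j. s' j = l}"
    and card: "\<And>l. 0 < l \<Longrightarrow> card {j. s j = l} = card {j. s' j = l}"
  shows "s = s'"
proof (rule ccontr)
  assume "s \<noteq> s'"
  then have ex: "\<exists>j. s j \<noteq> s' j" by auto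
  define j where "j = (LEAST j. s j \<noteq> s' j)"
  have j: "s j \<noteq> s' j" "\<And>i. i < j \<Longrightarrow> s i = s' i"
    using LeastI_ex[OF ex] not_less_Least by (auto simp: j_def)
  have *: "u j \<le> v j"
    if "decseq v" "\<And>j. 0 \<le> v j" "\<And>l. 0 < l \<Longrightarrow> finite {j. u j = l}"
      "\<And>l. 0 < l \<Longrightarrow> card {j. u j = l} = card {j. v j = l}" "\<And>i. i < j \<Longrightarrow> u i = v i" for u v :: "nat \<Rightarrow> real"
  proof (rule ccontr)
    assume "\<not> u j \<le> v j"
    then have lt: "v j < u j" by simp
    then have pos: "0 < u j" using that(2)[of j] by linarith
    have "{i. v i = u j} \<subseteq> {i. u i = u j} - {j}"
    proof
      fix i assume "i \<in> {i. v i = u j}"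
      then have i: "v i = u j" by simp
      have "i < j"
      proof (rule ccontr)
        assume "\<not> i < j"
        then have "v i \<le> v j" using that(1) by (simp add: decseq_def)
        then show False using i lt by simp
      qed
      then show "i \<in> {i. u i = u j} - {j}" using i that(5) by auto
    qed
    then have "card {i. v i = u j} \<le> card ({i. u i = u j} - {j})"
      by (intro card_mono) (use that(3)[OF pos] in auto)
    also have "\<dots> < card {i. u i = u j}"
      by (rule card_Diff1_less) (use that(3)[OF pos] in auto)
    finally show False using that(4)[OF pos] by simp
  qed
  have "s j \<le> s' j" by (rule *) (use s s' card j in auto)
  moreover have "s' j \<le> s j" by (rule *) (use s s' card j in auto)
  ultimately show False using j by simp
qed

lemma orthogonal_projection_eqI:
  assumes "subspace V" "y \<in> V" "\<And>z. z \<in> V \<Longrightarrow> inner (x - y) z = 0"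
  shows "orthogonal_projection V x = y"
  unfolding orthogonal_projection_def
proof (rule the_equality)
  fix y' assume y': "y' \<in> V \<and> (\<forall>z\<in>V. inner (x - y') z = 0)"
  have "y' - y \<in> V" using y' assms by (simp add: subspace_diff)
  then have "inner (x - y) (y' - y) = 0" "inner (x - y') (y' - y) = 0" using y' assms by auto
  then have "inner (y' - y) (y' - y) = 0"
    by (simp add: inner_diff_left algebra_simps)
  then show "y' = y" by simp
qed (use assms in auto)

context compact_nonneg
begin

lemma subspace_eigenspace: "subspace (eigenspace A c)"
  by (auto simp: subspace_def eigenspace_def zero add scaleR scaleR_add_right)

abbreviation "eg \<equiv> eigvec A"
abbreviation "el \<equiv> eigval A"

lemma eigvec_dichotomy: "top_vector A (eg ` {..<m}) (eg m) \<or>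
    eg m = 0 \<and> (\<nexists>e. top_vector A (eg ` {..<m}) e)"
proof (cases "\<exists>e. top_vector A (eg ` {..<m}) e")
  case True
  then have "eg m = (SOME e. top_vector A (eg ` {..<m}) e)" by (subst eigvec.simps) (simp add: Let_def)
  then show ?thesis using someI_ex[OF True] by simp
next
  case False
  then have "eg m = 0" by (subst eigvec.simps) (auto simp only: Let_def if_False)
  then show ?thesis using False by blast
qed

lemma A_eg: "A (eg m) = el m *\<^sub>R eg m"
proof -
  consider "top_vector A (eg ` {..<m}) (eg m)" | "eg m = 0" using eigvec_dichotomy by blast
  then show ?thesis
  proof cases
    case 1
    then obtain c where "norm (eg m) = 1" "A (eg m) = c *\<^sub>R eg m" by (auto simp: top_vector_def)
    then show ?thesis by (simp add: eigval_def norm_eq_1)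
  qed (simp add: eigval_def zero)
qed

lemma el_nonneg: "0 \<le> el m" unfolding eigval_def by (rule nonneg)

lemma norm_eg: "norm (eg m) = (if el m = 0 then 0 else 1)"
proof -
  consider "top_vector A (eg ` {..<m}) (eg m)" | "eg m = 0" using eigvec_dichotomy by blast
  then show ?thesis
  proof cases
    case 1
    then obtain c where "c > 0" "norm (eg m) = 1" "A (eg m) = c *\<^sub>R eg m" by (auto simp: top_vector_def)
    then show ?thesis by (simp add: eigval_def norm_eq_1)
  qed (simp add: eigval_def zero)
qed

lemma eg_orthogonal: "i \<noteq> j \<Longrightarrow> inner (eg i) (eg j) = 0"
proof -
  have *: "inner (eg i) (eg j) = 0" if "i < j" for i j
    using eigvec_dichotomy[of j] that by (auto simp: top_vector_def)
  assume "i \<noteq> j"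
  then show ?thesis using *[of i j] *[of j i] by (cases "i < j") (auto simp: inner_commute)
qed

text \<open>The exhausted case, where \<open>eg m\<close> and \<open>el m\<close> are zero, is
  covered too: if the form were positive somewhere on the orthogonal complement,
  \<open>Rayleigh_maximizer\<close> would produce a further top vector.\<close>

lemma Rayleigh_le:
  assumes "\<And>i. i < m \<Longrightarrow> inner (eg i) x = 0"
  shows "inner (A x) x \<le> el m * (norm x)\<^sup>2"
proof -
  let ?F = "eg ` {..<m}"
  consider "top_vector A ?F (eg m)" | "eg m = 0" "\<nexists>e. top_vector A ?F e" using eigvec_dichotomy by blast
  then show ?thesis
  proof cases
    case 1
    then obtain c where "norm (eg m) = 1" "A (eg m) = c *\<^sub>R eg m"
      "\<forall>x. (\<forall>f\<in>?F. inner f x = 0) \<longrightarrow> inner (A x) x \<le> c * (norm x)\<^sup>2"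
      by (auto simp: top_vector_def)
    moreover from this have "el m = c" by (simp add: eigval_def norm_eq_1)
    ultimately show ?thesis using assms by auto
  next
    case 2
    define W where "W = {x. \<forall>f\<in>?F. inner f x = 0}"
    have "inner (A x) x \<le> 0"
    proof (rule ccontr)
      assume neg: "\<not> inner (A x) x \<le> 0"
      have "subspace W" by (auto simp: W_def subspace_def inner_add_right)
      moreover have "closed W"
      proof -
        have "W = (\<Inter>f\<in>?F. {x. inner f x = 0})" by (auto simp: W_def)
        moreover have "closed {x. inner f x = 0}" for f :: 'h
          by (intro closed_Collect_eq continuous_intros)
        ultimately show ?thesis by auto
      qed
      moreover have "A y \<in> W" if "y \<in> W" for y
        using that symmetric by (auto simp: W_def A_eg simp flip: symmetric)
      moreover have "x \<in> W" using assms by (auto simp: W_def)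
      ultimately obtain e c where "e \<in> W" "norm e = 1" "0 < c" "A e = c *\<^sub>R e"
        "\<And>x. x \<in> W \<Longrightarrow> inner (A x) x \<le> c * (norm x)\<^sup>2"
        using Rayleigh_maximizer[of W x] neg by (metis not_le)
      then have "top_vector A ?F e" unfolding top_vector_def W_def by blast
      with 2 show False by blast
    qed
    then show ?thesis using 2 by (simp add: eigval_def)
  qed
qed

lemma decseq_el: "decseq el"
proof (rule decseq_SucI)
  fix m
  have "inner (A (eg (Suc m))) (eg (Suc m)) \<le> el m * (norm (eg (Suc m)))\<^sup>2"
    by (rule Rayleigh_le) (simp add: eg_orthogonal)
  then show "el (Suc m) \<le> el m"
    using norm_eg[of "Suc m"] el_nonneg[of m] by (auto simp: eigval_def split: if_splits)
qed

lemma inner_eg_eg: "inner (eg i) (eg j) = (if i = j \<and> el i \<noteq> 0 then 1 else 0)"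
proof (cases "i = j")
  case True
  then show ?thesis using norm_eg[of i] by (auto simp: norm_eq_1)
qed (simp add: eg_orthogonal)

lemma eg_eq_0: "el i = 0 \<Longrightarrow> eg i = 0"
  using norm_eg[of i] by simp

text \<open>The Cauchy-Schwarz inequality of the form, applied to \<open>x\<close> and
  \<open>A x\<close>.\<close>

lemma A_eq_0I:
  assumes "inner (A x) x \<le> 0"
  shows "A x = 0"
proof -
  have "inner (A x) x = 0" using assms nonneg[of x] by simp
  then have "(inner (A x) (A x))\<^sup>2 \<le> 0" using Cauchy_Schwarz[of x "A x"] by simp
  then show ?thesis by simp
qed

lemma Bessel_eg: "finite I \<Longrightarrow> (\<Sum>i\<in>I. (inner (eg i) x)\<^sup>2) \<le> (norm x)\<^sup>2"
proof -
  assume I: "finite I"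
  let ?p = "\<Sum>i\<in>I. inner (eg i) x *\<^sub>R eg i"
  have xp: "inner x ?p = (\<Sum>i\<in>I. (inner (eg i) x)\<^sup>2)"
    by (simp add: inner_sum_right power2_eq_square inner_commute)
  have "inner ?p ?p = (\<Sum>i\<in>I. inner (eg i) x * (\<Sum>j\<in>I. inner (eg j) x * inner (eg i) (eg j)))"
    by (simp add: inner_sum_left inner_sum_right inner_commute[of "eg _" "eg _"])
  also have "\<dots> = (\<Sum>i\<in>I. (inner (eg i) x)\<^sup>2)"
  proof (rule sum.cong[OF refl])
    fix i assume "i \<in> I"
    have "(\<Sum>j\<in>I. inner (eg j) x * inner (eg i) (eg j)) = (\<Sum>j\<in>I. if j = i then inner (eg i) x else 0)"
      by (intro sum.cong refl) (auto simp: inner_eg_eg eg_eq_0)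
    then show "inner (eg i) x * (\<Sum>j\<in>I. inner (eg j) x * inner (eg i) (eg j)) = (inner (eg i) x)\<^sup>2"
      using I \<open>i \<in> I\<close> by (simp add: power2_eq_square)
  qed
  finally have pp: "inner ?p ?p = (\<Sum>i\<in>I. (inner (eg i) x)\<^sup>2)" .
  have "0 \<le> inner (x - ?p) (x - ?p)" by simp
  also have "\<dots> = (norm x)\<^sup>2 - (\<Sum>i\<in>I. (inner (eg i) x)\<^sup>2)"
    using xp pp by (simp add: inner_diff_left inner_diff_right inner_commute power2_norm_eq_inner)
  finally show ?thesis by simp
qed

lemma inner_eg_tendsto_0: "(\<lambda>i. inner z (eg i)) \<longlonglongrightarrow> 0"
proof -
  have "summable (\<lambda>i. (inner (eg i) z)\<^sup>2)"
    by (rule summableI_nonneg_bounded[where x="(norm z)\<^sup>2"]) (auto intro: Bessel_eg)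
  from summable_LIMSEQ_zero[OF this] have "(\<lambda>i. (inner (eg i) z)\<^sup>2) \<longlonglongrightarrow> 0" .
  from tendsto_real_sqrt[OF this] have "(\<lambda>i. \<bar>inner (eg i) z\<bar>) \<longlonglongrightarrow> 0" by simp
  then show ?thesis by (simp add: tendsto_rabs_zero_iff inner_commute)
qed

text \<open>The vectors \<open>eg n\<close> tend weakly to zero, so by compactness their images
  converge in norm to some \<open>y\<close>. Pairing the images with \<open>y\<close> gives the
  limit \<open>inner y y\<close>, and moving \<open>A\<close> to the other side gives 0.\<close>

lemma el_tendsto_0: "el \<longlonglongrightarrow> 0"
proof -
  have "bounded (range eg)" unfolding bounded_iff using norm_eg by (auto intro!: exI[of _ 1])
  moreover have "convergent (\<lambda>n. inner z (eg n))" for z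
    using inner_eg_tendsto_0 by (auto simp: convergent_def)
  ultimately obtain y where y: "(\<lambda>n. A (eg n)) \<longlonglongrightarrow> y" using compact by (auto simp: convergent_def)
  have "inner y y = 0"
  proof (rule LIMSEQ_unique)
    show "(\<lambda>n. inner (A y) (eg n)) \<longlonglongrightarrow> 0" by (rule inner_eg_tendsto_0)
    have "(\<lambda>n. inner y (A (eg n))) \<longlonglongrightarrow> inner y y" by (intro tendsto_intros y)
    then show "(\<lambda>n. inner (A y) (eg n)) \<longlonglongrightarrow> inner y y" by (simp add: symmetric)
  qed
  then have "(\<lambda>n. norm (A (eg n))) \<longlonglongrightarrow> 0" using tendsto_norm[OF y] by simp
  moreover have "norm (A (eg n)) = el n" for n
    using norm_eg[of n] el_nonneg[of n] by (auto simp: A_eg)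
  ultimately show ?thesis by simp
qed

lemma finite_el_ge: "0 < c \<Longrightarrow> finite {i. c \<le> el i}"
proof -
  assume "0 < c"
  then have "\<forall>\<^sub>F i in sequentially. el i < c" using order_tendstoD(2)[OF el_tendsto_0] by blast
  then obtain N where "\<And>i. i \<ge> N \<Longrightarrow> el i < c" by (auto simp: eventually_sequentially)
  then have "{i. c \<le> el i} \<subseteq> {..<N}" by (auto simp: not_less[symmetric])
  then show ?thesis using finite_subset by blast
qed

lemma finite_el_eq: "0 < c \<Longrightarrow> finite {i. el i = c}"
  by (rule finite_subset[OF _ finite_el_ge[of c]]) auto

lemma eigenspace_orthogonal:
  assumes "x \<in> eigenspace A c" "y \<in> eigenspace A d" "c \<noteq> d"
  shows "inner x y = 0"
proof -
  have "c * inner x y = d * inner x y"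
    using symmetric[of x y] assms(1,2) by (simp add: eigenspace_def)
  then show ?thesis using assms(3) by simp
qed

lemma eg_in_eigenspace: "eg i \<in> eigenspace A (el i)"
  by (simp add: eigenspace_def A_eg)

lemma inner_eg_proj:
  assumes "finite I"
  shows "inner (eg j) (\<Sum>i\<in>I. inner (eg i) x *\<^sub>R eg i) = (if j \<in> I then inner (eg j) x else 0)"
proof -
  have "inner (eg j) (\<Sum>i\<in>I. inner (eg i) x *\<^sub>R eg i) = (\<Sum>i\<in>I. if i = j then inner (eg j) x else 0)"
    unfolding inner_sum_right by (intro sum.cong refl) (auto simp: inner_eg_eg eg_eq_0)
  then show ?thesis using assms by simp
qed

text \<open>The part of \<open>x\<close> not captured by the sum stays in the eigenspace and is
  orthogonal to every \<open>eg i\<close>. Its Rayleigh bound therefore holds with every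
  \<open>el m\<close>, hence with 0 in the limit, so \<open>A\<close> annihilates it, and
  \<open>c > 0\<close> forces it to vanish.\<close>

lemma eigenspace_expansion:
  assumes "0 < c" "x \<in> eigenspace A c"
  shows "x = (\<Sum>i | el i = c. inner (eg i) x *\<^sub>R eg i)"
proof -
  let ?I = "{i. el i = c}"
  define y where "y = x - (\<Sum>i\<in>?I. inner (eg i) x *\<^sub>R eg i)"
  have "(\<Sum>i\<in>?I. inner (eg i) x *\<^sub>R eg i) \<in> eigenspace A c"
    using eg_in_eigenspace by (intro subspace_sum[OF subspace_eigenspace] subspace_scale[OF subspace_eigenspace]) auto
  then have y: "y \<in> eigenspace A c"
    unfolding y_def using assms by (intro subspace_diff subspace_eigenspace)
  have orth: "inner (eg i) y = 0" for i
  proof (cases "el i = c")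
    case True
    then show ?thesis by (simp add: y_def inner_diff_right inner_eg_proj finite_el_eq[OF assms(1)])
  next
    case False
    then show ?thesis using eigenspace_orthogonal[OF eg_in_eigenspace y] by simp
  qed
  have "inner (A y) y \<le> 0"
  proof (rule LIMSEQ_le_const)
    show "(\<lambda>m. el m * (norm y)\<^sup>2) \<longlonglongrightarrow> 0" using tendsto_mult_left_zero[OF el_tendsto_0] .
    show "\<exists>N. \<forall>m\<ge>N. inner (A y) y \<le> el m * (norm y)\<^sup>2" using Rayleigh_le orth by blast
  qed
  then have "A y = 0" by (rule A_eq_0I)
  then have "y = 0" using y assms(1) by (simp add: eigenspace_def)
  then show ?thesis by (simp add: y_def)
qed

lemma inj_on_eg: "inj_on eg {i. el i \<noteq> 0}"
proof (rule inj_onI)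
  fix i j assume "i \<in> {i. el i \<noteq> 0}" "j \<in> {i. el i \<noteq> 0}" "eg i = eg j"
  then show "i = j" using inner_eg_eg[of i j] inner_eg_eg[of i i] by (auto split: if_splits)
qed

lemma independent_eg:
  assumes "I \<subseteq> {i. el i \<noteq> 0}"
  shows "independent (eg ` I)"
proof (rule pairwise_orthogonal_independent)
  show "pairwise orthogonal (eg ` I)"
    unfolding pairwise_image by (auto simp: pairwise_def orthogonal_def inner_eg_eg)
  show "0 \<notin> eg ` I"
  proof
    assume "0 \<in> eg ` I"
    then obtain i where "i \<in> I" "eg i = 0" by auto
    then show False using norm_eg[of i] assms by auto
  qed
qed

lemma dim_eigenspace:
  assumes "0 < c"
  shows "dim (eigenspace A c) = card {i. el i = c}"
proof -
  have "eigenspace A c \<subseteq> span (eg ` {i. el i = c})"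
  proof
    fix x assume "x \<in> eigenspace A c"
    then have "x = (\<Sum>i | el i = c. inner (eg i) x *\<^sub>R eg i)" by (rule eigenspace_expansion[OF assms])
    also have "\<dots> \<in> span (eg ` {i. el i = c})" by (intro span_sum span_scale span_base) auto
    finally show "x \<in> span (eg ` {i. el i = c})" .
  qed
  moreover have "eg ` {i. el i = c} \<subseteq> eigenspace A c" using eg_in_eigenspace by auto
  ultimately have "dim (eigenspace A c) = card (eg ` {i. el i = c})"
    using assms by (intro dim_unique[of "eg ` {i. el i = c}"] independent_eg) auto
  also have "\<dots> = card {i. el i = c}"
    by (rule card_image) (rule inj_on_subset[OF inj_on_eg], use assms in auto)
  finally show ?thesis .
qed

text \<open>This identifies the definite description in the statement with the greedy sequence, for
  which min-max arguments are available.\<close>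

lemma eigenvalue_seq_eq: "eigenvalue_seq A = el"
  unfolding eigenvalue_seq_def
proof (rule the_equality)
  show "decseq el \<and> (\<forall>j. 0 \<le> el j) \<and>
      (\<forall>l>0. finite {j. el j = l} \<and> card {j. el j = l} = dim (eigenspace A l))"
    using decseq_el el_nonneg finite_el_eq dim_eigenspace by simp
  fix s assume s: "decseq s \<and> (\<forall>j. 0 \<le> s j) \<and>
      (\<forall>l>0. finite {j. s j = l} \<and> card {j. s j = l} = dim (eigenspace A l))"
  show "s = el"
    by (rule decseq_counts_eqI) (use s decseq_el el_nonneg finite_el_eq dim_eigenspace in simp_all)
qed

lemma pos_eigenvalues_eq: "pos_eigenvalues A = {c. 0 < c \<and> (\<exists>i. el i = c)}"
proof -
  have "(\<exists>x. x \<noteq> 0 \<and> x \<in> eigenspace A c) \<longleftrightarrow> (\<exists>i. el i = c)" if "0 < c" for c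
  proof
    assume "\<exists>x. x \<noteq> 0 \<and> x \<in> eigenspace A c"
    then obtain x where x: "x \<noteq> 0" "x \<in> eigenspace A c" by auto
    have "x = (\<Sum>i | el i = c. inner (eg i) x *\<^sub>R eg i)" by (rule eigenspace_expansion[OF that x(2)])
    then show "\<exists>i. el i = c" using x(1) by (metis (mono_tags, lifting) Collect_empty_eq sum.empty)
  next
    assume "\<exists>i. el i = c"
    then obtain i where i: "el i = c" by auto
    then have "norm (eg i) = 1" using norm_eg that by auto
    then show "\<exists>x. x \<noteq> 0 \<and> x \<in> eigenspace A c" using eg_in_eigenspace[of i] i by (metis norm_zero zero_neq_one)
  qed
  then show ?thesis unfolding pos_eigenvalues_def by auto
qed

lemma spectral_projector_pos:
  assumes "0 < c"
  shows "spectral_projector A c x = (\<Sum>i | el i = c. inner (eg i) x *\<^sub>R eg i)"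
  unfolding spectral_projector_def
proof (rule orthogonal_projection_eqI[OF subspace_eigenspace])
  show "(\<Sum>i | el i = c. inner (eg i) x *\<^sub>R eg i) \<in> eigenspace A c"
    using eg_in_eigenspace by (intro subspace_sum[OF subspace_eigenspace] subspace_scale[OF subspace_eigenspace]) auto
  fix z assume "z \<in> eigenspace A c"
  then have z: "z = (\<Sum>i | el i = c. inner (eg i) z *\<^sub>R eg i)" by (rule eigenspace_expansion[OF assms])
  let ?w = "x - (\<Sum>i | el i = c. inner (eg i) x *\<^sub>R eg i)"
  have w: "inner (eg i) ?w = 0" if "el i = c" for i
    using that by (simp add: inner_diff_right inner_eg_proj finite_el_eq[OF assms])
  have "inner ?w z = inner ?w (\<Sum>i | el i = c. inner (eg i) z *\<^sub>R eg i)" using z by (rule arg_cong)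
  also have "\<dots> = (\<Sum>i | el i = c. inner (eg i) z * inner (eg i) ?w)"
    by (subst inner_commute) (simp only: inner_sum_left inner_scaleR_left)
  also have "\<dots> = 0" using w by simp
  finally show "inner ?w z = 0" .
qed

lemma eg_span_expansion:
  assumes "finite I" "x \<in> span (eg ` I)"
  shows "x = (\<Sum>i\<in>I. inner (eg i) x *\<^sub>R eg i)"
proof -
  let ?V = "{x. x = (\<Sum>i\<in>I. inner (eg i) x *\<^sub>R eg i)}"
  have "subspace ?V"
  proof (intro subspaceI; clarify)
    fix c x assume "x = (\<Sum>i\<in>I. inner (eg i) x *\<^sub>R eg i)"
    then have h: "c *\<^sub>R x = c *\<^sub>R (\<Sum>i\<in>I. inner (eg i) x *\<^sub>R eg i)" by (rule arg_cong)
    have "(\<Sum>i\<in>I. inner (eg i) (c *\<^sub>R x) *\<^sub>R eg i) = c *\<^sub>R (\<Sum>i\<in>I. inner (eg i) x *\<^sub>R eg i)"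
      by (simp only: inner_scaleR_right scaleR_sum_right scaleR_scaleR)
    then show "c *\<^sub>R x = (\<Sum>i\<in>I. inner (eg i) (c *\<^sub>R x) *\<^sub>R eg i)"
      by (rule trans[OF h sym])
  qed (simp_all add: inner_add_right scaleR_add_left sum.distrib)
  moreover have "eg ` I \<subseteq> ?V"
  proof
    fix y assume "y \<in> eg ` I"
    then obtain j where j: "j \<in> I" "y = eg j" by auto
    have "(\<Sum>i\<in>I. inner (eg i) (eg j) *\<^sub>R eg i) = (\<Sum>i\<in>I. if i = j then eg j else 0)"
      by (intro sum.cong refl) (auto simp: inner_eg_eg eg_eq_0)
    then show "y \<in> ?V" using j assms(1) by simp
  qed
  ultimately have "span (eg ` I) \<subseteq> ?V" by (intro span_minimal)
  then show ?thesis using assms(2) by blast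
qed

text \<open>The zero vectors that continue the sequence contribute nothing, hence the case
  distinction.\<close>

lemma norm_eg_sum:
  assumes "finite I"
  shows "(norm (\<Sum>i\<in>I. c i *\<^sub>R eg i))\<^sup>2 = (\<Sum>i\<in>I. if el i = 0 then 0 else (c i)\<^sup>2)"
proof -
  have "(norm (\<Sum>i\<in>I. c i *\<^sub>R eg i))\<^sup>2 = (\<Sum>i\<in>I. (norm (c i *\<^sub>R eg i))\<^sup>2)"
    by (rule norm_sum_Pythagorean[OF assms]) (auto simp: pairwise_def orthogonal_def eg_orthogonal)
  also have "\<dots> = (\<Sum>i\<in>I. if el i = 0 then 0 else (c i)\<^sup>2)"
    by (intro sum.cong refl) (auto simp: norm_eg power_mult_distrib)
  finally show ?thesis .
qed

lemma Rayleigh_ge_span: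
  assumes "x \<in> span (eg ` {..m})"
  shows "el m * (norm x)\<^sup>2 \<le> inner (A x) x"
proof -
  let ?c = "\<lambda>i. inner (eg i) x"
  have x: "x = (\<Sum>i\<le>m. ?c i *\<^sub>R eg i)" using eg_span_expansion[OF _ assms] by simp
  have n: "(norm x)\<^sup>2 = (\<Sum>i\<le>m. if el i = 0 then 0 else (?c i)\<^sup>2)"
    by (subst x) (rule norm_eg_sum, simp)
  have "A x = (\<Sum>i\<le>m. ?c i *\<^sub>R (el i *\<^sub>R eg i))"
    by (subst x) (simp only: sum scaleR A_eg)
  then have "inner (A x) x = (\<Sum>i\<le>m. el i * (?c i)\<^sup>2)"
    by (simp add: inner_sum_left power2_eq_square mult_ac)
  moreover have "el m * (norm x)\<^sup>2 \<le> (\<Sum>i\<le>m. el i * (?c i)\<^sup>2)"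
    unfolding n sum_distrib_left
    using decseq_el by (intro sum_mono) (auto simp: decseq_def intro!: mult_right_mono)
  ultimately show ?thesis by simp
qed

end

text \<open>The min-max dimension count: the span of \<open>m + 1\<close> eigenvectors of
  \<open>A\<close> contains a nonzero \<open>z\<close> orthogonal to the first \<open>m\<close>
  eigenvectors of \<open>B\<close>, because \<open>f\<close> maps it into a span of \<open>m\<close>
  vectors and cannot be injective. Relative to the squared norm of \<open>z\<close>, the form of
  \<open>A\<close> is at least \<open>eigval A m\<close> there and that of \<open>B\<close> at most
  \<open>eigval B m\<close>.\<close>

lemma eigval_le_perturbed:
  assumes A: "compact_nonneg A" and B: "compact_nonneg B" and e: "0 \<le> e"
    and le: "\<And>x. inner (A x) x \<le> inner (B x) x + e * (norm x)\<^sup>2"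
  shows "eigval A m \<le> eigval B m + e"
proof (cases "eigval A m = 0")
  case True
  then show ?thesis using compact_nonneg.el_nonneg[OF B, of m] e by simp
next
  case False
  interpret A: compact_nonneg A by (rule A)
  interpret B: compact_nonneg B by (rule B)
  define f where "f = (\<lambda>x. \<Sum>k<m. inner (eigvec B k) x *\<^sub>R eigvec B k)"
  have lin: "linear f"
    by (rule linearI) (auto simp: f_def inner_add_right scaleR_add_left sum.distrib scaleR_sum_right)
  have pos: "eigval A i \<noteq> 0" if "i \<le> m" for i
    using A.decseq_el that False A.el_nonneg[of m] by (auto simp: decseq_def) (metis order_antisym)
  let ?S = "eigvec A ` {..m}"
  have ind: "independent ?S" using pos by (intro A.independent_eg) auto
  have "inj_on (eigvec A) {..m}" by (rule inj_on_subset[OF A.inj_on_eg]) (use pos in auto)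
  then have card: "card ?S = Suc m" by (simp add: card_image)
  have "\<not> inj_on f (span ?S)"
  proof
    assume inj: "inj_on f (span ?S)"
    have "independent (f ` ?S)" by (rule linear_independent_injective_image[OF lin ind inj])
    moreover have "f ` ?S \<subseteq> span (eigvec B ` {..<m})"
      unfolding f_def by (intro image_subsetI span_sum span_scale span_base) auto
    ultimately have "card (f ` ?S) \<le> card (eigvec B ` {..<m})"
      by (intro independent_span_bound[THEN conjunct2]) auto
    also have "\<dots> \<le> m" using card_image_le[of "{..<m}" "eigvec B"] by simp
    finally have "card (f ` ?S) \<le> m" .
    moreover have "card (f ` ?S) = card ?S"
      by (rule card_image) (rule inj_on_subset[OF inj span_superset])
    ultimately show False using card by simp
  qed
  then obtain x y where xy: "x \<in> span ?S" "y \<in> span ?S" "x \<noteq> y" "f x = f y" by (auto simp: inj_on_def)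
  define z where "z = x - y"
  have z: "z \<in> span ?S" "z \<noteq> 0" "f z = 0"
    using xy by (auto simp: z_def span_diff linear_diff[OF lin])
  \<comment> \<open>As \<open>inner (f z) z\<close> is a sum of squares, \<open>f z = 0\<close>
    means orthogonality to all these eigenvectors of \<open>B\<close>.\<close>
  have "(\<Sum>k<m. (inner (eigvec B k) z)\<^sup>2) = inner (f z) z"
    by (simp add: f_def inner_sum_left power2_eq_square)
  then have "(\<Sum>k<m. (inner (eigvec B k) z)\<^sup>2) = 0" using z(3) by simp
  then have "inner (eigvec B k) z = 0" if "k < m" for k
    using that by (subst (asm) sum_nonneg_eq_0_iff) auto
  then have "inner (B z) z \<le> eigval B m * (norm z)\<^sup>2" by (rule B.Rayleigh_le)
  then have "eigval A m * (norm z)\<^sup>2 \<le> (eigval B m + e) * (norm z)\<^sup>2"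
    using A.Rayleigh_ge_span[OF z(1)] le[of z] by (simp add: distrib_right)
  then show ?thesis by (rule mult_right_le_imp_le) (use z in simp)
qed

lemma Weyl:
  assumes A: "compact_nonneg A" and B: "compact_nonneg B" and e: "0 \<le> e"
    and le: "\<And>x. norm (A x - B x) \<le> e * norm x"
  shows "\<bar>eigval A m - eigval B m\<bar> \<le> e"
proof -
  have *: "\<bar>inner (A x) x - inner (B x) x\<bar> \<le> e * (norm x)\<^sup>2" for x
  proof -
    have "\<bar>inner (A x - B x) x\<bar> \<le> norm (A x - B x) * norm x" by (rule Cauchy_Schwarz_ineq2)
    also have "\<dots> \<le> e * norm x * norm x" by (intro mult_right_mono le) auto
    finally show ?thesis by (simp add: inner_diff_left power2_eq_square)
  qed
  have "inner (A x) x \<le> inner (B x) x + e * (norm x)\<^sup>2" for x using *[of x] by linarith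
  then have 1: "eigval A m \<le> eigval B m + e" by (rule eigval_le_perturbed[OF A B e])
  have "inner (B x) x \<le> inner (A x) x + e * (norm x)\<^sup>2" for x using *[of x] by linarith
  then have "eigval B m \<le> eigval A m + e" by (rule eigval_le_perturbed[OF B A e])
  with 1 show ?thesis by linarith
qed

section \<open>Isolated simple eigenvalues\<close>

lemma distinct_eigenvalue_unique:
  assumes "l \<in> pos_eigenvalues A" "finite {k \<in> pos_eigenvalues A. l < k}"
    "l' \<in> pos_eigenvalues A" "finite {k \<in> pos_eigenvalues A. l' < k}"
    "card {k \<in> pos_eigenvalues A. l < k} = card {k \<in> pos_eigenvalues A. l' < k}"
  shows "l = l'"
proof -
  have *: "\<not> a < b" if "b \<in> pos_eigenvalues A" "finite {k \<in> pos_eigenvalues A. a < k}"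
    "card {k \<in> pos_eigenvalues A. a < k} = card {k \<in> pos_eigenvalues A. b < k}" for a b
  proof
    assume "a < b"
    then have "{k \<in> pos_eigenvalues A. b < k} \<subset> {k \<in> pos_eigenvalues A. a < k}" using that(1) by auto
    from psubset_card_mono[OF that(2) this] that(3) show False by simp
  qed
  show ?thesis using *[of l' l] *[of l l'] assms by (metis linorder_less_linear)
qed

lemma distinct_eigenvalueI:
  assumes "l \<in> pos_eigenvalues A" "finite {k \<in> pos_eigenvalues A. l < k}"
    "card {k \<in> pos_eigenvalues A. l < k} + 1 = s"
  shows "distinct_eigenvalue A s = l"
proof -
  let ?P = "\<lambda>l. l \<in> pos_eigenvalues A \<and> finite {k \<in> pos_eigenvalues A. l < k} \<and>
    card {k \<in> pos_eigenvalues A. l < k} + 1 = s"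
  have P: "?P l" using assms by simp
  have "(THE l. ?P l) = l"
  proof (rule the_equality, rule P)
    fix l' assume "?P l'"
    then show "l' = l" using assms by (intro distinct_eigenvalue_unique[of l' A l]) auto
  qed
  moreover have "\<exists>l. ?P l" using P by blast
  ultimately show ?thesis unfolding distinct_eigenvalue_def Let_def by simp
qed

lemma distinct_eigenvalue_cases:
  obtains "distinct_eigenvalue A s = 0" "\<nexists>l. l \<in> pos_eigenvalues A \<and> finite {k \<in> pos_eigenvalues A. l < k} \<and>
      card {k \<in> pos_eigenvalues A. l < k} + 1 = s"
  | "distinct_eigenvalue A s \<in> pos_eigenvalues A" "finite {k \<in> pos_eigenvalues A. distinct_eigenvalue A s < k}"
    "card {k \<in> pos_eigenvalues A. distinct_eigenvalue A s < k} + 1 = s"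
proof (cases "\<exists>l. l \<in> pos_eigenvalues A \<and> finite {k \<in> pos_eigenvalues A. l < k} \<and>
      card {k \<in> pos_eigenvalues A. l < k} + 1 = s")
  case True
  then obtain l where l: "l \<in> pos_eigenvalues A" "finite {k \<in> pos_eigenvalues A. l < k}"
      "card {k \<in> pos_eigenvalues A. l < k} + 1 = s" by blast
  from distinct_eigenvalueI[OF l] l show thesis by (intro that(2)) simp_all
next
  case False
  then have "distinct_eigenvalue A s = 0" unfolding distinct_eigenvalue_def Let_def by (subst if_not_P) simp_all
  then show thesis using False by (rule that(1))
qed

lemma pos_eigenvalues_pos: "l \<in> pos_eigenvalues A \<Longrightarrow> 0 < l"
  by (simp add: pos_eigenvalues_def)

lemma distinct_eigenvalue_nonneg: "0 \<le> distinct_eigenvalue A s"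
  by (rule distinct_eigenvalue_cases[of A s]) (auto dest: pos_eigenvalues_pos)

context compact_nonneg
begin

lemma finite_pos_eigenvalues_gt: "0 < l \<Longrightarrow> finite {k \<in> pos_eigenvalues A. l < k}"
  by (rule finite_subset[OF _ finite_imageI[OF finite_el_ge[of l], of el]])
    (auto simp: pos_eigenvalues_eq)

text \<open>Only finitely many eigenvalues exceed a given positive \<open>k\<close>, so a largest
  one below \<open>distinct_eigenvalue A r\<close> exists as soon as there is any. Exactly one more
  eigenvalue lies above it, so it carries the number \<open>Suc r\<close>. If there is none, the
  default value 0 makes the first claim true.\<close>

lemma distinct_eigenvalue_Suc:
  assumes mu: "distinct_eigenvalue A r \<in> pos_eigenvalues A"
  shows "distinct_eigenvalue A (Suc r) < distinct_eigenvalue A r"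
    and "k \<in> pos_eigenvalues A \<Longrightarrow> k < distinct_eigenvalue A r \<Longrightarrow> k \<le> distinct_eigenvalue A (Suc r)"
proof -
  let ?S = "pos_eigenvalues A" and ?m = "distinct_eigenvalue A r"
  have m: "0 < ?m" using mu by (rule pos_eigenvalues_pos)
  have up: "card {k \<in> ?S. ?m < k} + 1 = r"
    by (rule distinct_eigenvalue_cases[of A r]) (use m in simp_all)
  show "distinct_eigenvalue A (Suc r) < ?m"
  proof (rule distinct_eigenvalue_cases[of A "Suc r"])
    assume *: "card {k \<in> ?S. distinct_eigenvalue A (Suc r) < k} + 1 = Suc r"
    show ?thesis
    proof (rule ccontr)
      assume "\<not> distinct_eigenvalue A (Suc r) < ?m"
      then have "{k \<in> ?S. distinct_eigenvalue A (Suc r) < k} \<subseteq> {k \<in> ?S. ?m < k}" by auto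
      from card_mono[OF finite_pos_eigenvalues_gt[OF m] this] * up show False by simp
    qed
  qed (use m in simp)
  assume k: "k \<in> ?S" "k < ?m"
  define F where "F = {l \<in> ?S. k \<le> l \<and> l < ?m}"
  have "F \<subseteq> insert k {l \<in> ?S. k < l}" by (auto simp: F_def)
  then have F: "finite F" "k \<in> F"
    using finite_pos_eigenvalues_gt[OF pos_eigenvalues_pos[OF k(1)]] k finite_subset
    by (auto simp: F_def)
  define l where "l = Max F"
  have l: "l \<in> F" "\<And>l'. l' \<in> F \<Longrightarrow> l' \<le> l" using F Max_in[of F] unfolding l_def by (blast, simp)
  have "{j \<in> ?S. l < j} = insert ?m {j \<in> ?S. ?m < j}"
  proof (intro set_eqI iffI)
    fix j assume j: "j \<in> {j \<in> ?S. l < j}"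
    then have "j \<notin> F" using l(2) by force
    then show "j \<in> insert ?m {j \<in> ?S. ?m < j}" using j l(1) by (auto simp: F_def)
  qed (use l(1) mu in \<open>auto simp: F_def\<close>)
  then have "card {j \<in> ?S. l < j} + 1 = Suc r"
    using up finite_pos_eigenvalues_gt[OF m] by simp
  then have "distinct_eigenvalue A (Suc r) = l"
    using l(1) by (intro distinct_eigenvalueI finite_pos_eigenvalues_gt) (auto simp: F_def dest: pos_eigenvalues_pos)
  then show "k \<le> distinct_eigenvalue A (Suc r)" using l(2) F(2) by simp
qed

lemma distinct_eigenvalue_pred:
  assumes mu: "distinct_eigenvalue A r \<in> pos_eigenvalues A" and k: "k \<in> pos_eigenvalues A" "distinct_eigenvalue A r < k"
  shows "r \<noteq> 1" "distinct_eigenvalue A (r - 1) \<le> k"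
proof -
  let ?S = "pos_eigenvalues A" and ?m = "distinct_eigenvalue A r"
  have m: "0 < ?m" using mu by (rule pos_eigenvalues_pos)
  have up: "card {k \<in> ?S. ?m < k} + 1 = r"
    by (rule distinct_eigenvalue_cases[of A r]) (use m in simp_all)
  define F where "F = {k \<in> ?S. ?m < k}"
  have F: "finite F" "k \<in> F" using finite_pos_eigenvalues_gt[OF m] k by (auto simp: F_def)
  then have "card F \<noteq> 0" by auto
  then show "r \<noteq> 1" using up by (simp add: F_def)
  define l where "l = Min F"
  have l: "l \<in> F" "\<And>l'. l' \<in> F \<Longrightarrow> l \<le> l'" using F Min_in[of F] unfolding l_def by (blast, simp)
  have "{j \<in> ?S. l < j} = F - {l}"
  proof (intro set_eqI iffI)
    fix j assume j: "j \<in> F - {l}"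
    then have "l \<le> j" using l(2) by blast
    then show "j \<in> {j \<in> ?S. l < j}" using j by (auto simp: F_def)
  qed (use l(1) in \<open>auto simp: F_def\<close>)
  then have "card {j \<in> ?S. l < j} = card F - 1" using l(1) F(1) by simp
  moreover have "card F + 1 = r" using up by (simp add: F_def)
  ultimately have "card {j \<in> ?S. l < j} + 1 = r - 1" using \<open>card F \<noteq> 0\<close> by linarith
  then have "distinct_eigenvalue A (r - 1) = l"
    using l(1) by (intro distinct_eigenvalueI finite_pos_eigenvalues_gt) (auto simp: F_def dest: pos_eigenvalues_pos)
  then show "distinct_eigenvalue A (r - 1) \<le> k" using l(2) F(2) by simp
qed

lemma distinct_eigenvalue_pred_gt:
  assumes mu: "distinct_eigenvalue A r \<in> pos_eigenvalues A" and r: "2 \<le> r"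
  shows "distinct_eigenvalue A r < distinct_eigenvalue A (r - 1)"
proof -
  let ?S = "pos_eigenvalues A" and ?m = "distinct_eigenvalue A r"
  have m: "0 < ?m" using mu by (rule pos_eigenvalues_pos)
  have up: "card {k \<in> ?S. ?m < k} + 1 = r"
    by (rule distinct_eigenvalue_cases[of A r]) (use m in simp_all)
  define F where "F = {k \<in> ?S. ?m < k}"
  have F: "finite F" using finite_pos_eigenvalues_gt[OF m] by (auto simp: F_def)
  have "F \<noteq> {}" using up r by (auto simp: F_def[symmetric])
  define l where "l = Min F"
  have l: "l \<in> F" "\<And>l'. l' \<in> F \<Longrightarrow> l \<le> l'" using F \<open>F \<noteq> {}\<close> Min_in[of F] by (auto simp: l_def)
  have "{j \<in> ?S. l < j} = F - {l}"
  proof (intro set_eqI iffI)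
    fix j assume j: "j \<in> F - {l}"
    then have "l \<le> j" using l(2) by blast
    then show "j \<in> {j \<in> ?S. l < j}" using j by (auto simp: F_def)
  qed (use l(1) in \<open>auto simp: F_def\<close>)
  then have "card {j \<in> ?S. l < j} + 1 = r - 1"
    using up l(1) F(1) r by (simp add: F_def[symmetric])
  then have "distinct_eigenvalue A (r - 1) = l"
    using l(1) by (intro distinct_eigenvalueI finite_pos_eigenvalues_gt) (auto simp: F_def dest: pos_eigenvalues_pos)
  then show ?thesis using l(1) by (auto simp: F_def)
qed

text \<open>The last claim covers the zeros that continue the sequence as well, since
  \<open>distinct_eigenvalue A (Suc r)\<close> is never negative.\<close>

lemma spectral_gap_facts:
  assumes mu: "distinct_eigenvalue A r \<in> pos_eigenvalues A" and r: "1 \<le> r"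
  shows "0 < spectral_gap A r" "spectral_gap A r \<le> distinct_eigenvalue A r"
    and "el i \<noteq> distinct_eigenvalue A r \<Longrightarrow> spectral_gap A r \<le> \<bar>el i - distinct_eigenvalue A r\<bar>"
proof -
  let ?m = "distinct_eigenvalue A r"
  have below: "spectral_gap A r \<le> gap A r" by (simp add: spectral_gap_def)
  have above: "spectral_gap A r \<le> gap A (r - 1)" if "r \<noteq> 1" using that by (simp add: spectral_gap_def)
  have gap_r: "gap A r = ?m - distinct_eigenvalue A (Suc r)" by (simp add: gap_def)
  have gap_p: "gap A (r - 1) = distinct_eigenvalue A (r - 1) - ?m" using r by (simp add: gap_def)
  show "0 < spectral_gap A r"
    using distinct_eigenvalue_Suc(1)[OF mu] distinct_eigenvalue_pred_gt[OF mu] r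
    by (cases "r = 1") (simp_all add: spectral_gap_def gap_r gap_p gap_r[simplified] gap_def)
  show "spectral_gap A r \<le> ?m"
    using below gap_r distinct_eigenvalue_nonneg[of A "Suc r"] by linarith
  assume ne: "el i \<noteq> ?m"
  show "spectral_gap A r \<le> \<bar>el i - ?m\<bar>"
  proof (cases "el i < ?m")
    case True
    have "el i \<le> distinct_eigenvalue A (Suc r)"
    proof (cases "el i = 0")
      case False
      then have "el i \<in> pos_eigenvalues A" using el_nonneg[of i] by (auto simp: pos_eigenvalues_eq)
      then show ?thesis using distinct_eigenvalue_Suc(2)[OF mu] True by blast
    qed (simp add: distinct_eigenvalue_nonneg)
    then show ?thesis using below gap_r True by linarith
  next
    case False
    then have gt: "?m < el i" using ne by linarith
    then have "el i \<in> pos_eigenvalues A" using pos_eigenvalues_pos[OF mu] by (auto simp: pos_eigenvalues_eq)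
    from distinct_eigenvalue_pred[OF mu this gt] show ?thesis using above gap_p gt by linarith
  qed
qed

text \<open>Multiplicity one leaves a single index with this eigenvalue, and \<open>\<theta>\<close>
  differs from its greedy eigenvector by a sign only, which cancels in the rank-one
  projector.\<close>

lemma simple_eigenpair_facts:
  assumes "simple_eigenpair A r \<theta>"
  shows "el (eigenvalue_index A r) = distinct_eigenvalue A r"
    and "i \<noteq> eigenvalue_index A r \<Longrightarrow> el i \<noteq> distinct_eigenvalue A r"
    and "spectral_projector A (distinct_eigenvalue A r) x = inner \<theta> x *\<^sub>R \<theta>"
proof -
  let ?m = "distinct_eigenvalue A r" and ?j = "eigenvalue_index A r"
  have m: "0 < ?m" using assms pos_eigenvalues_pos by (auto simp: simple_eigenpair_def)
  have "card {i. el i = ?m} = 1"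
    using assms dim_eigenspace[OF m] by (simp add: simple_eigenpair_def)
  then obtain j where j: "{i. el i = ?m} = {j}" by (auto simp: card_1_singleton_iff)
  have "?j = (THE j. el j = ?m)" by (simp add: eigenvalue_index_def eigenvalue_seq_eq)
  also have "\<dots> = j" using j by (intro the_equality) auto
  finally have [simp]: "?j = j" .
  show "el ?j = ?m" using j by auto
  show "i \<noteq> ?j \<Longrightarrow> el i \<noteq> ?m" using j by auto
  have th: "\<theta> \<in> eigenspace A ?m" "norm \<theta> = 1" using assms by (auto simp: simple_eigenpair_def)
  have t: "\<theta> = inner (eg j) \<theta> *\<^sub>R eg j" using eigenspace_expansion[OF m th(1)] j by simp
  have nj: "norm (eg j) = 1" using norm_eg[of j] j m by auto
  define c where "c = inner (eg j) \<theta>"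
  have c: "\<theta> = c *\<^sub>R eg j" using t by (simp add: c_def)
  then have "\<bar>c\<bar> = 1" using th(2) nj by (metis mult.right_neutral norm_scaleR)
  then have "c = 1 \<or> c = - 1" by linarith
  then show "spectral_projector A ?m x = inner \<theta> x *\<^sub>R \<theta>"
    using c by (auto simp: spectral_projector_pos[OF m] j)
qed

section \<open>Perturbation of spectral projectors\<close>

text \<open>\<open>el N = 0\<close> says that the rank is at most \<open>N\<close>; what is
  orthogonal to the first \<open>N\<close> eigenvectors then lies in the kernel. Empirical
  covariance operators are of this kind, so finite sums suffice for them.\<close>

lemma A_orthogonal_rest:
  assumes "el N = 0"
  shows "A (x - (\<Sum>i<N. inner (eg i) x *\<^sub>R eg i)) = 0"
proof (rule A_eq_0I)
  let ?y = "x - (\<Sum>i<N. inner (eg i) x *\<^sub>R eg i)"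
  have "inner (A ?y) ?y \<le> el N * (norm ?y)\<^sup>2"
    by (rule Rayleigh_le) (simp add: inner_diff_right inner_eg_proj)
  then show "inner (A ?y) ?y \<le> 0" using assms by simp
qed

lemma inner_eg_rest:
  assumes "el N = 0"
  shows "inner (eg j) (x - (\<Sum>i<N. inner (eg i) x *\<^sub>R eg i)) = 0"
proof (cases "j < N")
  case True
  then show ?thesis by (simp add: inner_diff_right inner_eg_proj)
next
  case False
  then have "el j \<le> el N" using decseq_el by (simp add: decseq_def)
  then have "eg j = 0" using assms el_nonneg[of j] by (intro eg_eq_0) simp
  then show ?thesis by simp
qed

text \<open>\<open>w\<close> is the resolvent at the simple eigenvalue, applied to the part of
  \<open>u\<close> orthogonal to \<open>eg j\<close>. The kernel component \<open>u0\<close> belongs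
  to the eigenvalue 0, at distance \<open>el j\<close>, which is why \<eta> bounds
  \<open>el j\<close> as well as the gaps.\<close>

lemma resolvent_vector:
  assumes N: "el N = 0" and j: "0 < \<eta>" "\<eta> \<le> el j"
    and gap: "\<And>i. i \<noteq> j \<Longrightarrow> \<eta> \<le> \<bar>el i - el j\<bar>"
  obtains w where "inner (eg j) w = 0" "A w - el j *\<^sub>R w = u - inner (eg j) u *\<^sub>R eg j"
    "norm w \<le> norm u / \<eta>"
proof -
  have jN: "j < N"
  proof (rule ccontr)
    assume "\<not> j < N"
    then have "el j \<le> el N" using decseq_el by (simp add: decseq_def)
    then show False using N j by simp
  qed
  define I where "I = {..<N} - {j}"
  define c where "c = (\<lambda>i. inner (eg i) u)"
  define u0 where "u0 = u - (\<Sum>i<N. c i *\<^sub>R eg i)"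
  define p where "p = (\<Sum>i\<in>I. (c i / (el i - el j)) *\<^sub>R eg i)"
  define w where "w = p - (1 / el j) *\<^sub>R u0"
  have I: "finite I" "j \<notin> I" "\<And>f::nat \<Rightarrow> 'h. (\<Sum>i<N. f i) = f j + (\<Sum>i\<in>I. f i)"
    "\<And>f::nat \<Rightarrow> real. (\<Sum>i<N. f i) = f j + (\<Sum>i\<in>I. f i)"
    using jN by (simp_all add: I_def sum.remove[of "{..<N}" j])
  have ne: "el i - el j \<noteq> 0" if "i \<in> I" for i using gap[of i] j(1) that by (auto simp: I_def)
  have A0: "A u0 = 0" unfolding u0_def c_def by (rule A_orthogonal_rest[OF N])
  have e0: "inner (eg i) u0 = 0" for i unfolding u0_def c_def by (rule inner_eg_rest[OF N])
  have "A p = (\<Sum>i\<in>I. (c i / (el i - el j)) *\<^sub>R (el i *\<^sub>R eg i))"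
    unfolding p_def by (simp only: sum scaleR A_eg)
  then have "A p - el j *\<^sub>R p = (\<Sum>i\<in>I. (c i / (el i - el j)) *\<^sub>R (el i *\<^sub>R eg i) - el j *\<^sub>R ((c i / (el i - el j)) *\<^sub>R eg i))"
    by (simp only: p_def scaleR_sum_right sum_subtractf)
  also have "\<dots> = (\<Sum>i\<in>I. c i *\<^sub>R eg i)"
  proof (rule sum.cong[OF refl])
    fix i assume "i \<in> I"
    have "q *\<^sub>R (k *\<^sub>R eg i) - m *\<^sub>R (q *\<^sub>R eg i) = (q * (k - m)) *\<^sub>R eg i" for q k m
      by (simp add: right_diff_distrib scaleR_diff_left mult.commute)
    from this[of "c i / (el i - el j)" "el i" "el j"] show "(c i / (el i - el j)) *\<^sub>R (el i *\<^sub>R eg i) - el j *\<^sub>R ((c i / (el i - el j)) *\<^sub>R eg i) = c i *\<^sub>R eg i"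
      using ne[OF \<open>i \<in> I\<close>] by simp
  qed
  finally have Ap: "A p - el j *\<^sub>R p = (\<Sum>i\<in>I. c i *\<^sub>R eg i)" .
  have "A w - el j *\<^sub>R w = (A p - el j *\<^sub>R p) + u0"
    using j by (simp add: w_def diff scaleR A0 scaleR_diff_right)
  also have "\<dots> = u - c j *\<^sub>R eg j"
    unfolding Ap u0_def I(3) by simp
  finally have w2: "A w - el j *\<^sub>R w = u - inner (eg j) u *\<^sub>R eg j" by (simp add: c_def)
  have pu: "inner p u0 = 0" unfolding p_def by (simp add: inner_sum_left e0)
  have w1: "inner (eg j) w = 0"
  proof -
    have "inner (eg j) p = 0"
      unfolding p_def inner_sum_right using I(2) by (intro sum.neutral) (auto simp: inner_eg_eg)
    then show ?thesis by (simp add: w_def inner_diff_right e0)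
  qed
  have "(norm w)\<^sup>2 = (norm p)\<^sup>2 + (norm u0)\<^sup>2 / (el j)\<^sup>2"
    unfolding w_def power2_norm_eq_inner
    using pu by (simp add: inner_diff_left inner_diff_right inner_commute[of u0 p] power2_eq_square)
  also have "(norm p)\<^sup>2 \<le> (\<Sum>i\<in>I. (c i)\<^sup>2 / \<eta>\<^sup>2)"
    unfolding p_def norm_eg_sum[OF I(1)]
  proof (rule sum_mono)
    fix i assume i: "i \<in> I"
    then have "\<eta>\<^sup>2 \<le> \<bar>el i - el j\<bar>\<^sup>2" using gap[of i] j by (intro power_mono) (auto simp: I_def)
    then have "(c i)\<^sup>2 / (el i - el j)\<^sup>2 \<le> (c i)\<^sup>2 / \<eta>\<^sup>2"
      using j ne[OF i] by (intro divide_left_mono) auto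
    then show "(if el i = 0 then 0 else (c i / (el i - el j))\<^sup>2) \<le> (c i)\<^sup>2 / \<eta>\<^sup>2"
      by (auto simp: power_divide)
  qed
  also have "(norm u0)\<^sup>2 / (el j)\<^sup>2 \<le> (norm u0)\<^sup>2 / \<eta>\<^sup>2"
    using j by (intro divide_left_mono power_mono) auto
  finally have "(norm w)\<^sup>2 \<le> ((\<Sum>i\<in>I. (c i)\<^sup>2) + (norm u0)\<^sup>2) / \<eta>\<^sup>2"
    by (simp add: sum_divide_distrib add_divide_distrib)
  also have "(\<Sum>i\<in>I. (c i)\<^sup>2) + (norm u0)\<^sup>2 \<le> (norm u)\<^sup>2"
  proof -
    define q where "q = (\<Sum>i<N. c i *\<^sub>R eg i)"
    have "inner q u0 = 0" unfolding q_def by (simp add: inner_sum_left e0)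
    moreover have u: "u = q + u0" by (simp add: u0_def q_def)
    ultimately have "(norm u)\<^sup>2 = (norm q)\<^sup>2 + (norm u0)\<^sup>2"
      unfolding u power2_norm_eq_inner by (simp add: inner_add_left inner_add_right inner_commute[of u0 q])
    moreover have "(norm q)\<^sup>2 = (\<Sum>i<N. (c i)\<^sup>2)"
      unfolding q_def by (subst norm_eg_sum) (auto simp: c_def eg_eq_0 intro!: sum.cong)
    moreover have "(\<Sum>i\<in>I. (c i)\<^sup>2) \<le> (\<Sum>i<N. (c i)\<^sup>2)"
      unfolding I_def by (intro sum_mono2) auto
    ultimately show ?thesis by linarith
  qed
  finally have "(norm w)\<^sup>2 \<le> (norm u / \<eta>)\<^sup>2"
    by (simp add: power_divide divide_right_mono)
  then have "norm w \<le> norm u / \<eta>" by (rule power2_le_imp_le) (use j in simp)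
  with w1 w2 show thesis by (rule that)
qed

text \<open>Iterating \<open>x - c (A - l)\<^sup>2 x\<close> kills all eigencomponents but those for \<open>l\<close>.  This exhibits
  the spectral projector as a limit of explicit polynomials, which gives its measurability.\<close>

definition damped :: "real \<Rightarrow> 'h \<Rightarrow> 'h" where
  "damped l x = (let y = A x - l *\<^sub>R x in x - (1 / (1 + (el 0)\<^sup>2)) *\<^sub>R (A y - l *\<^sub>R y))"

lemma damped_tendsto_projector:
  assumes N: "el N = 0" and l: "0 \<le> l" "l \<le> el 0"
  shows "(\<lambda>m. ((damped l) ^^ m) x) \<longlonglongrightarrow> spectral_projector A l x"
    and "spectral_projector A l x \<in> eigenspace A l"
    and "\<And>z. z \<in> eigenspace A l \<Longrightarrow> inner (x - spectral_projector A l x) z = 0"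
proof -
  \<comment> \<open>The normalisation makes \<open>c * (k - l)\<^sup>2 < 1\<close> for
    \<open>k\<close> and \<open>l\<close> between 0 and \<open>el 0\<close>, so the factor
    \<open>t k\<close> of an eigenvector for \<open>k\<close> lies strictly between 0 and 1 unless
    \<open>k = l\<close>.\<close>
  define c where "c = 1 / (1 + (el 0)\<^sup>2)"
  have c: "0 < c" "c * (el 0)\<^sup>2 < 1"
    by (auto simp: c_def divide_simps add_pos_nonneg)
  define t where "t = (\<lambda>k. 1 - c * (k - l)\<^sup>2)"
  have T: "damped l y = t k *\<^sub>R y" if "A y = k *\<^sub>R y" for y k
  proof -
    have "A y - l *\<^sub>R y = (k - l) *\<^sub>R y" by (simp add: that scaleR_diff_left)
    moreover have "A ((k - l) *\<^sub>R y) - l *\<^sub>R ((k - l) *\<^sub>R y) = ((k - l) * (k - l)) *\<^sub>R y"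
      by (simp only: scaleR that scaleR_scaleR scaleR_diff_left[symmetric]) (simp add: algebra_simps)
    ultimately show ?thesis
      by (simp add: damped_def Let_def t_def c_def power2_eq_square scaleR_diff_left)
  qed
  have lin: "linear (damped l)"
    by (rule linearI) (simp_all add: damped_def Let_def add scaleR diff scaleR_add_right scaleR_diff_right algebra_simps)
  define a where "a = (\<lambda>i. inner (eg i) x)"
  define x0 where "x0 = x - (\<Sum>i<N. a i *\<^sub>R eg i)"
  have A0: "A x0 = 0 *\<^sub>R x0" unfolding x0_def a_def using A_orthogonal_rest[OF N] by simp
  have iter: "((damped l) ^^ m) x = (\<Sum>i<N. (t (el i) ^ m * a i) *\<^sub>R eg i) + t 0 ^ m *\<^sub>R x0" for m
  proof (induction m)
    case 0
    show ?case by (simp add: x0_def)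
  next
    case (Suc m)
    have "((damped l) ^^ Suc m) x = (\<Sum>i<N. (t (el i) ^ m * a i) *\<^sub>R (t (el i) *\<^sub>R eg i)) + t 0 ^ m *\<^sub>R (t 0 *\<^sub>R x0)"
      by (simp add: Suc linear_add[OF lin] linear_sum[OF lin] linear_scale[OF lin] T[OF A_eg] T[OF A0])
    then show ?case by (simp add: mult_ac)
  qed
  have t_lim: "(\<lambda>m. t k ^ m) \<longlonglongrightarrow> (if k = l then 1 else 0)" if "0 \<le> k" "k \<le> el 0" for k
  proof (cases "k = l")
    case False
    have "\<bar>k - l\<bar> \<le> el 0" using that l by linarith
    then have "(k - l)\<^sup>2 \<le> (el 0)\<^sup>2" by (metis abs_ge_zero power2_abs power_mono)
    then have "c * (k - l)\<^sup>2 \<le> c * (el 0)\<^sup>2" using c by (intro mult_left_mono) auto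
    then have "c * (k - l)\<^sup>2 < 1" using c by linarith
    moreover have "0 < c * (k - l)\<^sup>2" using c False by simp
    ultimately show ?thesis using False LIMSEQ_realpow_zero[of "t k"] by (simp add: t_def)
  qed (simp add: t_def)
  have eli: "el i \<le> el 0" for i using decseq_el by (simp add: decseq_def)
  \<comment> \<open>For \<open>l = 0\<close> the eigenspace is the kernel, and the remainder
    \<open>x0\<close> belongs to the projection.\<close>
  define y where "y = (\<Sum>i<N. ((if el i = l then 1 else 0) * a i) *\<^sub>R eg i) + (if 0 = l then 1 else 0) *\<^sub>R x0"
  have lim: "(\<lambda>m. ((damped l) ^^ m) x) \<longlonglongrightarrow> y"
    unfolding iter y_def by (intro tendsto_intros t_lim el_nonneg eli order_refl)
  have y1: "y \<in> eigenspace A l"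
    unfolding y_def
  proof (intro subspace_add[OF subspace_eigenspace] subspace_sum[OF subspace_eigenspace])
    show "((if el i = l then 1 else 0) * a i) *\<^sub>R eg i \<in> eigenspace A l" for i
      using eg_in_eigenspace[of i] by (auto simp: eigenspace_def scaleR zero)
    show "(if 0 = l then 1 else 0) *\<^sub>R x0 \<in> eigenspace A l"
      using A0 by (auto simp: eigenspace_def zero)
  qed
  have y2: "inner (x - y) z = 0" if z: "z \<in> eigenspace A l" for z
  proof -
    have "x = (\<Sum>i<N. a i *\<^sub>R eg i) + x0" by (simp add: x0_def)
    then have "x - y = (\<Sum>i<N. a i *\<^sub>R eg i - ((if el i = l then 1 else 0) * a i) *\<^sub>R eg i) + (x0 - (if 0 = l then 1 else 0) *\<^sub>R x0)"
      unfolding y_def sum_subtractf by simp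
    moreover have "inner (a i *\<^sub>R eg i - ((if el i = l then 1 else 0) * a i) *\<^sub>R eg i) z = 0" for i
      using eigenspace_orthogonal[OF eg_in_eigenspace z] by auto
    moreover have "inner (x0 - (if 0 = l then 1 else 0) *\<^sub>R x0) z = 0"
      using eigenspace_orthogonal[of x0 0 z l] z A0 by (auto simp: eigenspace_def)
    ultimately show ?thesis by (simp add: inner_add_left inner_sum_left del: inner_diff_left)
  qed
  have "spectral_projector A l x = y"
    unfolding spectral_projector_def by (intro orthogonal_projection_eqI subspace_eigenspace y1 y2)
  then show "(\<lambda>m. ((damped l) ^^ m) x) \<longlonglongrightarrow> spectral_projector A l x"
    "spectral_projector A l x \<in> eigenspace A l"
    "\<And>z. z \<in> eigenspace A l \<Longrightarrow> inner (x - spectral_projector A l x) z = 0"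
    using lim y1 y2 by auto
qed

lemma simple_spectral_projector:
  assumes "0 < el j" "\<And>i. i \<noteq> j \<Longrightarrow> el i \<noteq> el j"
  shows "spectral_projector A (el j) x = inner (eg j) x *\<^sub>R eg j"
proof -
  have "{i. el i = el j} = {j}" using assms(2) by auto
  then show ?thesis by (simp add: spectral_projector_pos[OF assms(1)])
qed

end

text \<open>With \<open>h\<close> the component of the eigenvector \<open>\<beta>\<close> of \<open>B\<close> orthogonal to that of \<open>A\<close>,
  \<open>\<langle>h, u\<rangle> = \<langle>(A - B) \<beta>, w\<rangle> + (\<mu> - \<lambda>) \<langle>h, w\<rangle>\<close> for the resolvent vector \<open>w\<close> of \<open>u\<close>.\<close>

lemma projector_expansion:
  assumes A: "compact_nonneg A"
    and N: "eigval A N = 0" and eta: "0 < \<eta>" "\<eta> \<le> eigval A j"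
    and gapA: "\<And>i. i \<noteq> j \<Longrightarrow> \<eta> \<le> \<bar>eigval A i - eigval A j\<bar>"
    and th: "norm \<theta> = 1"
  obtains w where "norm w \<le> 2 * norm u / \<eta>"
    "\<And>B \<epsilon>. compact_nonneg B \<Longrightarrow> 0 < eigval B j \<Longrightarrow> 0 \<le> \<epsilon> \<Longrightarrow> (\<And>x. norm (A x - B x) \<le> \<epsilon> * norm x) \<Longrightarrow>
      \<bar>inner (eigvec A j) \<theta> * inner (eigvec A j) u - inner (eigvec B j) \<theta> * inner (eigvec B j) u
      + inner (A (eigvec A j) - B (eigvec A j)) w\<bar> \<le> 28 * \<epsilon>\<^sup>2 * norm u / \<eta>\<^sup>2"
proof -
  interpret A: compact_nonneg A by (rule A)
  define a where "a = eigvec A j"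
  have na: "norm a = 1" using A.norm_eg[of j] eta by (auto simp: a_def)
  have au: "\<bar>inner a \<theta>\<bar> \<le> 1" "\<bar>inner a u\<bar> \<le> norm u"
    using Cauchy_Schwarz_ineq2[of a \<theta>] Cauchy_Schwarz_ineq2[of a u] na th by auto
  define res where "res v w \<longleftrightarrow> inner a w = 0 \<and> A w - eigval A j *\<^sub>R w = v - inner a v *\<^sub>R a \<and> norm w \<le> norm v / \<eta>" for v w
  have res_ex: "\<exists>w. res v w" for v
    using A.resolvent_vector[OF N eta gapA, of v] unfolding a_def res_def by blast
  obtain wu where wu: "res u wu" using res_ex by blast
  obtain wt where wt: "res \<theta> wt" using res_ex by blast
  \<comment> \<open>The derivative of \<open>inner a \<theta> * inner a u\<close> along the
    eigenvector has two terms, hence two resolvent vectors. Their combination is fixed before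
    \<open>B\<close> is.\<close>
  define w where "w = inner a \<theta> *\<^sub>R wu + inner a u *\<^sub>R wt"
  have nw: "norm w \<le> 2 * norm u / \<eta>"
  proof -
    have "norm w \<le> \<bar>inner a \<theta>\<bar> * norm wu + \<bar>inner a u\<bar> * norm wt"
      unfolding w_def by (rule order_trans[OF norm_triangle_ineq]) simp
    also have "\<dots> \<le> 1 * (norm u / \<eta>) + norm u * (1 / \<eta>)"
      using au wu wt th eta by (intro add_mono mult_mono) (auto simp: res_def)
    finally show ?thesis by simp
  qed
  have main: "\<bar>inner (eigvec A j) \<theta> * inner (eigvec A j) u - inner (eigvec B j) \<theta> * inner (eigvec B j) u
      + inner (A (eigvec A j) - B (eigvec A j)) w\<bar> \<le> 28 * \<epsilon>\<^sup>2 * norm u / \<eta>\<^sup>2"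
    if B: "compact_nonneg B" and posB: "0 < eigval B j" and eps: "0 \<le> \<epsilon>" "\<And>x. norm (A x - B x) \<le> \<epsilon> * norm x" for B \<epsilon>
  proof -
  interpret B: compact_nonneg B by (rule B)
  \<comment> \<open>The sign makes \<open>inner a b\<close> nonnegative and cancels in the product
    of the two coordinates.\<close>
  define b where "b = (if 0 \<le> inner a (eigvec B j) then eigvec B j else - eigvec B j)"
  have nb: "norm b = 1" using B.norm_eg[of j] posB by (auto simp: b_def)
  have ab: "0 \<le> inner a b" by (simp add: b_def)
  have Bb: "B b = eigval B j *\<^sub>R b" by (simp add: b_def B.A_eg B.neg)
  have fb: "inner (eigvec B j) \<theta> * inner (eigvec B j) u = inner b \<theta> * inner b u" by (simp add: b_def)
  define c where "c = inner a b"
  define h where "h = b - c *\<^sub>R a"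
  define d where "d = eigval B j - eigval A j"
  have d: "\<bar>d\<bar> \<le> \<epsilon>" unfolding d_def using Weyl[OF B A eps(1)] eps(2) by (simp add: norm_minus_commute)
  have ha: "inner h a = 0" using na by (simp add: h_def inner_diff_left c_def inner_commute[of b a] norm_eq_1)
  have c2: "c\<^sup>2 = 1 - (norm h)\<^sup>2"
  proof -
    have "b = h + c *\<^sub>R a" by (simp add: h_def)
    then have "(norm b)\<^sup>2 = (norm h)\<^sup>2 + c\<^sup>2 * (norm a)\<^sup>2"
      using ha unfolding power2_norm_eq_inner
      by (simp add: inner_add_left inner_add_right inner_commute[of a h] power2_eq_square)
    then show ?thesis using na nb by simp
  qed
  have c0: "0 \<le> c" using ab by (simp add: c_def)
  have h1: "norm h \<le> 1"
  proof -
    have "(norm h)\<^sup>2 \<le> 1\<^sup>2" using c2 by (metis diff_ge_0_iff_ge one_power2 zero_le_power2)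
    then show ?thesis by (rule power2_le_imp_le) simp
  qed
  have c1: "c \<le> 1"
  proof -
    have "c\<^sup>2 \<le> 1\<^sup>2" using c2 by simp
    then show ?thesis by (rule power2_le_imp_le) simp
  qed
  have c_near: "1 - c \<le> (norm h)\<^sup>2"
  proof -
    have "c * c \<le> c" using c0 c1 by (simp add: mult_left_le)
    then show ?thesis using c2 by (simp add: power2_eq_square)
  qed
  have key: "norm w \<le> norm v / \<eta>" "inner h v = inner (A b - B b) w + d * inner h w" if "res v w" for v w
  proof -
    have w: "inner a w = 0" "A w - eigval A j *\<^sub>R w = v - inner a v *\<^sub>R a" "norm w \<le> norm v / \<eta>"
      using that by (simp_all add: res_def)
    have "inner h v = inner h (A w - eigval A j *\<^sub>R w)"
      by (simp add: w(2) inner_diff_right ha)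
    also have "\<dots> = inner (A h) w - eigval A j * inner h w"
      by (simp add: inner_diff_right A.symmetric)
    also have "A h = A b - c *\<^sub>R (eigval A j *\<^sub>R a)"
      unfolding h_def by (simp add: A.diff A.scaleR a_def A.A_eg)
    also have "inner (A b - c *\<^sub>R (eigval A j *\<^sub>R a)) w = inner (A b) w"
      using w(1) by (simp add: inner_diff_left)
    also have "A b = (A b - B b) + eigval B j *\<^sub>R b" by (simp add: Bb)
    also have "inner ((A b - B b) + eigval B j *\<^sub>R b) w = inner (A b - B b) w + eigval B j * inner b w"
      by (simp add: inner_add_left)
    also have "inner b w = inner h w" using w(1) by (simp add: h_def inner_diff_left)
    finally show "inner h v = inner (A b - B b) w + d * inner h w"
      by (simp add: d_def algebra_simps)
    show "norm w \<le> norm v / \<eta>" by (rule w(3))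
  qed
  have h2: "norm h \<le> 2 * \<epsilon> / \<eta>"
  proof (cases "h = 0")
    case False
    \<comment> \<open>Testing the identity with \<open>v = h\<close> bounds the norm of
      \<open>h\<close> to first order in \<epsilon>.\<close>
    obtain w where "res h w" using res_ex by blast
    note w = key[OF this]
    have "inner (A b - B b) w \<le> norm (A b - B b) * norm w" by (rule norm_cauchy_schwarz)
    also have "\<dots> \<le> (\<epsilon> * 1) * (norm h / \<eta>)" using eps(2)[of b] nb w(1) eps(1) by (intro mult_mono) auto
    finally have 1: "inner (A b - B b) w \<le> \<epsilon> * norm h / \<eta>" by simp
    have "d * inner h w \<le> \<bar>d\<bar> * \<bar>inner h w\<bar>" by (simp add: abs_mult[symmetric])
    also have "\<dots> \<le> \<epsilon> * (norm h * norm w)" using d Cauchy_Schwarz_ineq2[of h w] eps(1) by (intro mult_mono) auto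
    also have "\<dots> \<le> \<epsilon> * (1 * (norm h / \<eta>))" using h1 w(1) eps(1) by (intro mult_left_mono mult_mono) auto
    finally have 2: "d * inner h w \<le> \<epsilon> * norm h / \<eta>" by simp
    have "norm h * norm h \<le> (2 * \<epsilon> / \<eta>) * norm h"
      using 1 2 w(2) by (simp add: power2_norm_eq_inner[symmetric] power2_eq_square)
    then show ?thesis by (rule mult_right_le_imp_le) (use False in simp)
  qed (use eps eta in simp)
  have bma: "norm (b - a) \<le> 2 * norm h"
  proof -
    have "(norm (b - a))\<^sup>2 = 2 - 2 * c"
      using na nb unfolding power2_norm_eq_inner
      by (simp add: inner_diff_left inner_diff_right c_def inner_commute[of b a] norm_eq_1)
    also have "\<dots> \<le> 4 * (norm h)\<^sup>2" using c_near zero_le_power2[of "norm h"] by linarith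
    also have "\<dots> = (2 * norm h)\<^sup>2" by (simp add: power_mult_distrib)
    finally show ?thesis by (rule power2_le_imp_le) simp
  qed
  \<comment> \<open>Replacing \<open>b\<close> by \<open>a\<close> and dropping
    \<open>d * inner h w\<close> cost only second-order terms, because \<open>b - a\<close>,
    \<open>h\<close> and \<open>d\<close> are of first order.\<close>
  have lin: "\<bar>inner h v - inner (A a - B a) w\<bar> \<le> 6 * \<epsilon>\<^sup>2 * norm v / \<eta>\<^sup>2" if "res v w" for v w
  proof -
    note w = key[OF that]
    have "\<bar>inner (A (b - a) - B (b - a)) w\<bar> \<le> norm (A (b - a) - B (b - a)) * norm w" by (rule Cauchy_Schwarz_ineq2)
    also have "\<dots> \<le> (\<epsilon> * (2 * norm h)) * (norm v / \<eta>)"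
      using eps(2)[of "b - a"] bma eps(1) w(1) eta
      by (intro mult_mono) (auto intro: order_trans[OF _ mult_left_mono])
    finally have 1: "\<bar>inner (A (b - a) - B (b - a)) w\<bar> \<le> (\<epsilon> * (2 * norm h)) * (norm v / \<eta>)" .
    have "\<bar>d * inner h w\<bar> \<le> \<epsilon> * (norm h * norm w)"
      unfolding abs_mult using d Cauchy_Schwarz_ineq2[of h w] eps(1) by (intro mult_mono) auto
    also have "\<dots> \<le> \<epsilon> * (norm h * (norm v / \<eta>))" using w(1) eps(1) by (intro mult_left_mono) auto
    finally have 2: "\<bar>d * inner h w\<bar> \<le> (\<epsilon> * norm h) * (norm v / \<eta>)" by simp
    have "inner h v - inner (A a - B a) w = inner (A (b - a) - B (b - a)) w + d * inner h w"
      using w(2) by (simp add: A.diff B.diff inner_diff_left)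
    moreover have "(\<epsilon> * (2 * norm h)) * (norm v / \<eta>) + (\<epsilon> * norm h) * (norm v / \<eta>) = 3 * \<epsilon> * norm h * (norm v / \<eta>)"
      by (simp only: distrib_right[symmetric]) simp
    ultimately have "\<bar>inner h v - inner (A a - B a) w\<bar> \<le> 3 * \<epsilon> * norm h * (norm v / \<eta>)"
      using 1 2 by linarith
    also have "\<dots> \<le> 3 * \<epsilon> * (2 * \<epsilon> / \<eta>) * (norm v / \<eta>)"
      using h2 eps(1) eta by (intro mult_right_mono mult_left_mono) auto
    also have "\<dots> = 6 * \<epsilon>\<^sup>2 * norm v / \<eta>\<^sup>2" by (simp add: power2_eq_square)
    finally show ?thesis .
  qed
  note lu = lin[OF wu]
  have lt: "\<bar>inner h \<theta> - inner (A a - B a) wt\<bar> \<le> 6 * \<epsilon>\<^sup>2 / \<eta>\<^sup>2"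
    using lin[OF wt] th by simp
  have at: "\<bar>inner a \<theta>\<bar> \<le> 1" "\<bar>inner a u\<bar> \<le> norm u" "\<bar>inner h \<theta>\<bar> \<le> norm h" "\<bar>inner h u\<bar> \<le> norm h * norm u"
    using Cauchy_Schwarz_ineq2[of a \<theta>] Cauchy_Schwarz_ineq2[of a u] Cauchy_Schwarz_ineq2[of h \<theta>]
      Cauchy_Schwarz_ineq2[of h u] na th by auto
  \<comment> \<open>In units of \<open>\<epsilon>\<^sup>2 * norm u / \<eta>\<^sup>2\<close>, the
    linearisation errors \<open>R1\<close> and \<open>R2\<close> are at most 6 each;
    \<open>R3\<close>, which stems from \<open>c\<close> differing from 1, and \<open>R4\<close>,
    which is quadratic in \<open>h\<close>, are at most 8 each. Together these are the 28 of the
    claim.\<close>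
  define R1 where "R1 = inner a \<theta> * (inner h u - inner (A a - B a) wu)"
  define R2 where "R2 = inner a u * (inner h \<theta> - inner (A a - B a) wt)"
  define R3 where "R3 = (1 - c) * (inner a \<theta> * inner h u + inner h \<theta> * inner a u)"
  define R4 where "R4 = (norm h)\<^sup>2 * (inner a \<theta> * inner a u) - inner h \<theta> * inner h u"
  have hh: "(norm h)\<^sup>2 \<le> 4 * \<epsilon>\<^sup>2 / \<eta>\<^sup>2"
    using power_mono[OF h2, of 2] by (simp add: power_divide power_mult_distrib)
  have "inner a \<theta> * inner a u - inner b \<theta> * inner b u + inner (A a - B a) w = R3 + R4 - R1 - R2"
  proof -
    have "b = h + c *\<^sub>R a" by (simp add: h_def)
    then have "inner b \<theta> * inner b u = inner h \<theta> * inner h u + c * (inner a \<theta> * inner h u + inner h \<theta> * inner a u)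
      + c\<^sup>2 * (inner a \<theta> * inner a u)"
      by (simp add: inner_add_left power2_eq_square algebra_simps)
    then show ?thesis
      unfolding R1_def R2_def R3_def R4_def c2 w_def by (simp add: inner_add_right algebra_simps)
  qed
  moreover have "\<bar>R1\<bar> \<le> 1 * (6 * \<epsilon>\<^sup>2 * norm u / \<eta>\<^sup>2)"
    unfolding R1_def abs_mult using at(1) lu by (intro mult_mono) auto
  moreover have "\<bar>R2\<bar> \<le> norm u * (6 * \<epsilon>\<^sup>2 / \<eta>\<^sup>2)"
    unfolding R2_def abs_mult using at(2) lt by (intro mult_mono) auto
  moreover have "\<bar>R3\<bar> \<le> (norm h)\<^sup>2 * (2 * norm u)"
  proof -
    have "\<bar>inner a \<theta> * inner h u\<bar> \<le> 1 * (norm h * norm u)" unfolding abs_mult using at by (intro mult_mono) auto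
    moreover have "\<bar>inner h \<theta> * inner a u\<bar> \<le> norm h * norm u" unfolding abs_mult using at by (intro mult_mono) auto
    moreover have "norm h * norm u \<le> norm u" using h1 by (simp add: mult_left_le_one_le)
    ultimately have "\<bar>inner a \<theta> * inner h u + inner h \<theta> * inner a u\<bar> \<le> 2 * norm u" by linarith
    then show ?thesis unfolding R3_def abs_mult using c_near c1 by (intro mult_mono) auto
  qed
  moreover have "\<bar>R4\<bar> \<le> (norm h)\<^sup>2 * (2 * norm u)"
  proof -
    have "\<bar>inner a \<theta> * inner a u\<bar> \<le> 1 * norm u" unfolding abs_mult using at by (intro mult_mono) auto
    then have 1: "\<bar>(norm h)\<^sup>2 * (inner a \<theta> * inner a u)\<bar> \<le> (norm h)\<^sup>2 * norm u"
      by (simp add: abs_mult mult_left_mono)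
    have 2: "\<bar>inner h \<theta> * inner h u\<bar> \<le> norm h * (norm h * norm u)"
      unfolding abs_mult using at by (intro mult_mono) auto
    show ?thesis unfolding R4_def using 1 2 by (simp add: power2_eq_square algebra_simps)
  qed
  moreover have "(norm h)\<^sup>2 * (2 * norm u) \<le> (4 * \<epsilon>\<^sup>2 / \<eta>\<^sup>2) * (2 * norm u)"
    using hh by (intro mult_right_mono) auto
  ultimately have "\<bar>inner a \<theta> * inner a u - inner b \<theta> * inner b u + inner (A a - B a) w\<bar>
      \<le> 28 * \<epsilon>\<^sup>2 * norm u / \<eta>\<^sup>2"
  proof -
    define K where "K = \<epsilon>\<^sup>2 * norm u / \<eta>\<^sup>2"
    have K: "1 * (6 * \<epsilon>\<^sup>2 * norm u / \<eta>\<^sup>2) = 6 * K" "norm u * (6 * \<epsilon>\<^sup>2 / \<eta>\<^sup>2) = 6 * K"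
      "(4 * \<epsilon>\<^sup>2 / \<eta>\<^sup>2) * (2 * norm u) = 8 * K" "28 * \<epsilon>\<^sup>2 * norm u / \<eta>\<^sup>2 = 28 * K"
      by (simp_all add: K_def)
    assume "inner a \<theta> * inner a u - inner b \<theta> * inner b u + inner (A a - B a) w = R3 + R4 - R1 - R2"
      "\<bar>R1\<bar> \<le> 1 * (6 * \<epsilon>\<^sup>2 * norm u / \<eta>\<^sup>2)" "\<bar>R2\<bar> \<le> norm u * (6 * \<epsilon>\<^sup>2 / \<eta>\<^sup>2)"
      "\<bar>R3\<bar> \<le> (norm h)\<^sup>2 * (2 * norm u)" "\<bar>R4\<bar> \<le> (norm h)\<^sup>2 * (2 * norm u)"
      "(norm h)\<^sup>2 * (2 * norm u) \<le> (4 * \<epsilon>\<^sup>2 / \<eta>\<^sup>2) * (2 * norm u)"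
    then show ?thesis unfolding K by linarith
  qed
  then show ?thesis by (simp add: fb a_def[symmetric])
  qed
  from nw main show thesis by (rule that)
qed

section \<open>Transport along an isometric embedding\<close>

text \<open>One setting for two uses: \<iota> an isometric embedding with adjoint \<kappa>, or
  \<iota> and \<kappa> both equal to a reflection. \<open>A'\<close> acts as \<open>A\<close> on the
  range of \<iota> and vanishes on its orthogonal complement.\<close>

locale isometric_conjugate =
  fixes \<iota> :: "'h::{real_inner,banach,second_countable_topology} \<Rightarrow> 'k::{real_inner,banach,second_countable_topology}"
    and \<kappa> :: "'k \<Rightarrow> 'h" and A :: "'h \<Rightarrow> 'h" and A' :: "'k \<Rightarrow> 'k"
  assumes lin: "linear \<iota>" and iso: "inner (\<iota> x) (\<iota> y) = inner x y"
    and adj: "inner (\<iota> x) z = inner x (\<kappa> z)"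
    and linA: "linear A" and conj: "A' z = \<iota> (A (\<kappa> z))"
begin

lemma norm_emb: "norm (\<iota> x) = norm x" by (simp add: norm_eq_sqrt_inner iso)

lemma inj_emb: "\<iota> x = \<iota> y \<longleftrightarrow> x = y"
proof
  assume "\<iota> x = \<iota> y"
  then have "norm (\<iota> (x - y)) = 0" using lin by (simp add: linear_diff)
  then show "x = y" by (simp add: norm_emb)
qed simp

lemma coemb_emb: "\<kappa> (\<iota> x) = x"
proof -
  have "inner y (\<kappa> (\<iota> x) - x) = 0" for y
    using adj[of y "\<iota> x"] iso[of y x] by (simp add: inner_diff_right)
  from this[of "\<kappa> (\<iota> x) - x"] show ?thesis by simp
qed

lemma A'_emb: "A' (\<iota> x) = \<iota> (A x)" by (simp add: conj coemb_emb)

lemma emb_0: "\<iota> 0 = 0" using lin by (rule linear_0)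
lemma emb_scaleR: "\<iota> (c *\<^sub>R x) = c *\<^sub>R \<iota> x" using lin by (rule linear_scale)
lemma emb_diff: "\<iota> (x - y) = \<iota> x - \<iota> y" using lin by (rule linear_diff)

lemma emb_in_eigenspace: "\<iota> x \<in> eigenspace A' l \<longleftrightarrow> x \<in> eigenspace A l"
  by (simp add: eigenspace_def A'_emb emb_scaleR[symmetric] inj_emb)

text \<open>For a nonzero eigenvalue an eigenvector is a multiple of its image under
  \<open>A'\<close> and lies in the range of \<iota>; for 0 the orthogonal complement of the range
  would have to be added.\<close>

lemma eigenspace_conj:
  assumes "l \<noteq> 0"
  shows "eigenspace A' l = \<iota> ` eigenspace A l"
proof (intro set_eqI iffI)
  fix z assume "z \<in> eigenspace A' l"
  then have "\<iota> (A (\<kappa> z)) = l *\<^sub>R z" by (simp add: eigenspace_def conj)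
  then have "z = \<iota> ((1 / l) *\<^sub>R A (\<kappa> z))" using assms by (simp add: emb_scaleR)
  then show "z \<in> \<iota> ` eigenspace A l"
    using \<open>z \<in> eigenspace A' l\<close> emb_in_eigenspace by (metis image_eqI)
qed (auto simp: emb_in_eigenspace)

lemma dim_emb_image: "dim (\<iota> ` V) = dim V"
proof -
  obtain B where B: "B \<subseteq> V" "independent B" "V \<subseteq> span B" "card B = dim V" using basis_exists by blast
  have inj: "inj \<iota>" by (rule injI) (simp add: inj_emb)
  have "independent (\<iota> ` B)"
    by (rule linear_independent_injective_image[OF lin B(2) inj_on_subset[OF inj subset_UNIV]])
  moreover have "\<iota> ` V \<subseteq> span (\<iota> ` B)"
    using B(3) by (simp add: linear_span_image[OF lin] image_mono)
  moreover have "card (\<iota> ` B) = card B" by (rule card_image[OF inj_on_subset[OF inj subset_UNIV]])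
  ultimately show ?thesis using B(1,4) by (intro dim_unique[of "\<iota> ` B"]) auto
qed

lemma pos_eigenvalues_conj: "pos_eigenvalues A' = pos_eigenvalues A"
proof -
  have "(\<exists>z. z \<noteq> 0 \<and> z \<in> eigenspace A' l) \<longleftrightarrow> (\<exists>x. x \<noteq> 0 \<and> x \<in> eigenspace A l)" if "0 < l" for l
    using that inj_emb[of _ 0] by (auto simp: eigenspace_conj emb_0)
  then show ?thesis by (auto simp: pos_eigenvalues_def)
qed

lemma distinct_eigenvalue_conj: "distinct_eigenvalue A' = distinct_eigenvalue A"
  by (intro ext) (simp add: distinct_eigenvalue_def pos_eigenvalues_conj)

lemma spectral_gap_conj: "spectral_gap A' = spectral_gap A"
  by (intro ext) (simp add: spectral_gap_def gap_def distinct_eigenvalue_conj)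

lemma dim_eigenspace_conj: "0 < l \<Longrightarrow> dim (eigenspace A' l) = dim (eigenspace A l)"
  by (simp add: eigenspace_conj dim_emb_image)

lemma eigenvalue_seq_conj: "eigenvalue_seq A' = eigenvalue_seq A"
  unfolding eigenvalue_seq_def by (simp add: dim_eigenspace_conj cong: conj_cong)

lemma eigenvalue_index_conj: "eigenvalue_index A' = eigenvalue_index A"
  by (intro ext) (simp add: eigenvalue_index_def eigenvalue_seq_conj distinct_eigenvalue_conj)

lemma simple_eigenpair_conj: "simple_eigenpair A r \<theta> \<Longrightarrow> simple_eigenpair A' r (\<iota> \<theta>)"
  by (auto simp: simple_eigenpair_def distinct_eigenvalue_conj pos_eigenvalues_conj dim_eigenspace_conj
      emb_in_eigenspace norm_emb dest: pos_eigenvalues_pos)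

lemma subspace_eigenspace_conj: "subspace (eigenspace A' l)"
proof -
  have "linear \<kappa>"
  proof (rule linearI)
    show "\<kappa> (x + y) = \<kappa> x + \<kappa> y" for x y
    proof -
      have "inner w (\<kappa> (x + y) - (\<kappa> x + \<kappa> y)) = 0" for w
        by (simp add: inner_diff_right inner_add_right adj[symmetric])
      from this[of "\<kappa> (x + y) - (\<kappa> x + \<kappa> y)"] show ?thesis by simp
    qed
    show "\<kappa> (c *\<^sub>R x) = c *\<^sub>R \<kappa> x" for c x
    proof -
      have "inner w (\<kappa> (c *\<^sub>R x) - c *\<^sub>R \<kappa> x) = 0" for w
        by (simp add: inner_diff_right adj[symmetric])
      from this[of "\<kappa> (c *\<^sub>R x) - c *\<^sub>R \<kappa> x"] show ?thesis by simp
    qed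
  qed
  then have "linear (\<iota> \<circ> (A \<circ> \<kappa>))" using lin linA by (intro linear_compose)
  then have "linear A'" by (simp add: conj[abs_def] o_def)
  then show ?thesis
    by (auto simp: subspace_def eigenspace_def linear_0 linear_add linear_scale scaleR_add_right)
qed

text \<open>The eigenvalue 0 is included although its eigenspace may grow: pairing with
  \<open>z\<close> only sees \<open>\<kappa> z\<close>, which is in the eigenspace of
  \<open>A\<close>. The assumptions say that the definite description on the side of
  \<open>A\<close> does denote the projection.\<close>

lemma spectral_projector_conj:
  assumes "spectral_projector A l x \<in> eigenspace A l"
    and "\<And>z. z \<in> eigenspace A l \<Longrightarrow> inner (x - spectral_projector A l x) z = 0"
  shows "spectral_projector A' l (\<iota> x) = \<iota> (spectral_projector A l x)"
  unfolding spectral_projector_def[of A']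
proof (rule orthogonal_projection_eqI[OF subspace_eigenspace_conj])
  show "\<iota> (spectral_projector A l x) \<in> eigenspace A' l" using assms(1) by (simp add: emb_in_eigenspace)
  fix z assume z: "z \<in> eigenspace A' l"
  have "\<kappa> z \<in> eigenspace A l"
  proof (cases "l = 0")
    case True
    then show ?thesis using z inj_emb[of _ 0] by (auto simp: eigenspace_def conj emb_0)
  next
    case False
    then show ?thesis using z by (auto simp: eigenspace_conj coemb_emb)
  qed
  then show "inner (\<iota> x - \<iota> (spectral_projector A l x)) z = 0"
    using assms(2) by (simp add: emb_diff[symmetric] adj)
qed

lemma norm_coemb_le: "norm (\<kappa> z) \<le> norm z"
proof (cases "\<kappa> z = 0")
  case False
  have "norm (\<kappa> z) * norm (\<kappa> z) = inner (\<iota> (\<kappa> z)) z"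
    by (simp add: adj power2_norm_eq_inner[symmetric] power2_eq_square)
  also have "\<dots> \<le> norm (\<kappa> z) * norm z" using norm_cauchy_schwarz[of "\<iota> (\<kappa> z)" z] by (simp add: norm_emb)
  finally show ?thesis using False by simp
qed simp

lemma onorm_conj:
  assumes "bounded_linear A"
  shows "onorm A' = onorm A"
proof (rule antisym)
  show "onorm A' \<le> onorm A"
  proof (rule onorm_bound)
    show "0 \<le> onorm A" by (rule onorm_pos_le[OF assms])
    have "norm (A' z) \<le> onorm A * norm (\<kappa> z)" for z by (simp add: conj norm_emb onorm[OF assms])
    also have "onorm A * norm (\<kappa> z) \<le> onorm A * norm z" for z
      by (intro mult_left_mono norm_coemb_le onorm_pos_le assms)
    finally show "norm (A' z) \<le> onorm A * norm z" for z .
  qed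
  have "bounded_linear A'"
  proof (rule bounded_linear_intro[where K="onorm A"])
    fix x y and c :: real
    interpret A: bounded_linear A by (rule assms)
    have k: "\<kappa> (x + y) = \<kappa> x + \<kappa> y" for x y
    proof -
      have "inner w (\<kappa> (x + y) - (\<kappa> x + \<kappa> y)) = 0" for w
        by (simp add: inner_diff_right inner_add_right adj[symmetric])
      from this[of "\<kappa> (x + y) - (\<kappa> x + \<kappa> y)"] show ?thesis by simp
    qed
    show "A' (x + y) = A' x + A' y" by (simp add: conj k A.add linear_add[OF lin])
    have "\<kappa> (c *\<^sub>R x) = c *\<^sub>R \<kappa> x"
    proof -
      have "inner w (\<kappa> (c *\<^sub>R x) - c *\<^sub>R \<kappa> x) = 0" for w
        by (simp add: inner_diff_right adj[symmetric])
      from this[of "\<kappa> (c *\<^sub>R x) - c *\<^sub>R \<kappa> x"] show ?thesis by simp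
    qed
    then show "A' (c *\<^sub>R x) = c *\<^sub>R A' x" by (simp add: conj A.scaleR emb_scaleR)
    have "norm (A' x) \<le> onorm A * norm (\<kappa> x)" by (simp add: conj norm_emb onorm[OF assms])
    also have "\<dots> \<le> onorm A * norm x"
      by (intro mult_left_mono norm_coemb_le onorm_pos_le assms)
    finally show "norm (A' x) \<le> norm x * onorm A" by (simp add: mult.commute)
  qed
  then have bl: "bounded_linear A'" .
  show "onorm A \<le> onorm A'"
  proof (rule onorm_bound)
    show "norm (A x) \<le> onorm A' * norm x" for x
      using onorm[OF bl, of "\<iota> x"] by (simp add: A'_emb norm_emb)
  qed (rule onorm_pos_le[OF bl])
qed

end

section \<open>The reduced resolvent\<close>

text \<open>Absolute convergence may fail, so summability is derived from orthogonality: by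
  Pythagoras a finite sum beyond \<open>N\<close> has squared norm at most a tail of a convergent
  numerical series. The limit along initial segments then serves for all finite subsets.\<close>

lemma orthogonal_summable_on:
  fixes f :: "nat \<Rightarrow> 'h::{real_inner,banach}"
  assumes orth: "\<And>i j. i \<in> I \<Longrightarrow> j \<in> I \<Longrightarrow> i \<noteq> j \<Longrightarrow> inner (f i) (f j) = 0"
    and bound: "\<And>F. finite F \<Longrightarrow> F \<subseteq> I \<Longrightarrow> (\<Sum>i\<in>F. (norm (f i))\<^sup>2) \<le> K"
  shows "f summable_on I"
proof -
  define a where "a = (\<lambda>i. if i \<in> I then (norm (f i))\<^sup>2 else 0)"
  have pyth: "(norm (sum f F))\<^sup>2 = sum a F" if "finite F" "F \<subseteq> I" for F
  proof -
    have "(norm (sum f F))\<^sup>2 = (\<Sum>i\<in>F. (norm (f i))\<^sup>2)"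
      using that orth by (intro norm_sum_Pythagorean) (auto simp: pairwise_def orthogonal_def subset_eq)
    also have "\<dots> = sum a F" using that(2) by (intro sum.cong) (auto simp: a_def)
    finally show ?thesis .
  qed
  have "summable a"
  proof (rule summableI_nonneg_bounded)
    show "sum a {..<n} \<le> K" for n
    proof -
      have "sum a {..<n} = (\<Sum>i\<in>{..<n} \<inter> I. (norm (f i))\<^sup>2)"
        by (simp add: a_def sum.inter_restrict)
      then show ?thesis using bound[of "{..<n} \<inter> I"] by simp
    qed
  qed (simp add: a_def)
  then have tail: "\<exists>N. \<forall>F. finite F \<longrightarrow> F \<subseteq> I - {..<N} \<longrightarrow> norm (sum f F) < e" if "0 < e" for e
  proof -
    have "\<exists>N. \<forall>m\<ge>N. \<forall>n. norm (sum a {m..<n}) < e\<^sup>2"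
      using \<open>summable a\<close> \<open>0 < e\<close> unfolding summable_Cauchy by simp
    then obtain N where N: "\<And>m n. m \<ge> N \<Longrightarrow> norm (sum a {m..<n}) < e\<^sup>2" by blast
    have "norm (sum f F) < e" if F: "finite F" "F \<subseteq> I - {..<N}" for F
    proof -
      have "(norm (sum f F))\<^sup>2 = sum a F" by (rule pyth) (use F in auto)
      also have "\<dots> \<le> sum a {N..<Suc (Max (insert 0 F))}"
      proof (rule sum_mono2)
        show "F \<subseteq> {N..<Suc (Max (insert 0 F))}"
        proof
          fix i assume "i \<in> F"
          then have "i \<le> Max (insert 0 F)" using F(1) by (intro Max_ge) auto
          moreover have "N \<le> i" using F(2) \<open>i \<in> F\<close> by fastforce
          ultimately show "i \<in> {N..<Suc (Max (insert 0 F))}" by simp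
        qed
      qed (auto simp: a_def)
      also have "\<dots> < e\<^sup>2" using N[of N "Suc (Max (insert 0 F))"] by simp
      finally show ?thesis by (rule power2_less_imp_less) (use \<open>0 < e\<close> in simp)
    qed
    then show ?thesis by blast
  qed
  define s where "s n = sum f ({..<n} \<inter> I)" for n
  have s_diff: "sum f F - s n = sum f (F - {..<n})" if "finite F" "{..<n} \<inter> I \<subseteq> F" "F \<subseteq> I" for F n
  proof -
    have eq: "F - {..<n} = F - ({..<n} \<inter> I)" using that(3) by auto
    have "sum f (F - ({..<n} \<inter> I)) = sum f F - sum f ({..<n} \<inter> I)" by (rule sum_diff[OF that(1,2)])
    then show ?thesis unfolding eq s_def by (rule sym)
  qed
  have close: "\<exists>N. \<forall>F. finite F \<longrightarrow> {..<N} \<inter> I \<subseteq> F \<longrightarrow> F \<subseteq> I \<longrightarrow> norm (sum f F - s N) < e" if e: "0 < e" for e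
  proof -
    obtain N where N: "\<And>F. finite F \<Longrightarrow> F \<subseteq> I - {..<N} \<Longrightarrow> norm (sum f F) < e" using tail[OF e] by blast
    have "norm (sum f F - s N) < e" if "finite F" "{..<N} \<inter> I \<subseteq> F" "F \<subseteq> I" for F
      unfolding s_diff[OF that] by (rule N) (use that in auto)
    then show ?thesis by blast
  qed
  have "Cauchy s"
  proof (rule CauchyI)
    fix e :: real assume "0 < e"
    then obtain N where N: "\<And>F. finite F \<Longrightarrow> {..<N} \<inter> I \<subseteq> F \<Longrightarrow> F \<subseteq> I \<Longrightarrow> norm (sum f F - s N) < e / 2"
      using close[of "e/2"] by auto
    have n: "norm (s n - s N) < e / 2" if "N \<le> n" for n
      using N[of "{..<n} \<inter> I"] that unfolding s_def[of n] by fastforce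
    show "\<exists>N. \<forall>m\<ge>N. \<forall>n\<ge>N. norm (s m - s n) < e"
    proof (intro exI[of _ N] allI impI)
      fix m k assume "N \<le> m" "N \<le> k"
      have "norm (s m - s k) \<le> norm (s m - s N) + norm (s k - s N)"
        using norm_triangle_ineq4[of "s m - s N" "s k - s N"] by simp
      then show "norm (s m - s k) < e" using n[OF \<open>N \<le> m\<close>] n[OF \<open>N \<le> k\<close>] by linarith
    qed
  qed
  then have "convergent s" by (rule Cauchy_convergent)
  then obtain L where L: "s \<longlonglongrightarrow> L" unfolding convergent_def ..
  have "(f has_sum L) I"
    unfolding has_sum_def
  proof (rule tendstoI)
    fix e :: real assume e: "0 < e"
    obtain N where N: "\<And>F. finite F \<Longrightarrow> {..<N} \<inter> I \<subseteq> F \<Longrightarrow> F \<subseteq> I \<Longrightarrow> norm (sum f F - s N) < e / 3"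
      using close[of "e/3"] e by auto
    have "norm (L - s N) \<le> e / 3"
    proof (rule tendsto_upperbound)
      show "(\<lambda>n. norm (s n - s N)) \<longlonglongrightarrow> norm (L - s N)" by (intro tendsto_intros L)
      show "\<forall>\<^sub>F n in sequentially. norm (s n - s N) \<le> e / 3"
        unfolding eventually_sequentially
      proof (intro exI[of _ N] allI impI)
        fix n assume "N \<le> n"
        then show "norm (s n - s N) \<le> e / 3"
          using N[of "{..<n} \<inter> I"] unfolding s_def[of n] by fastforce
      qed
    qed simp
    then have d: "dist (sum f F) L < e" if "finite F" "{..<N} \<inter> I \<subseteq> F" "F \<subseteq> I" for F
      using N[OF that] norm_triangle_ineq4[of "sum f F - s N" "L - s N"] e by (simp add: dist_norm)
    show "\<forall>\<^sub>F F in finite_subsets_at_top I. dist (sum f F) L < e"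
      unfolding eventually_finite_subsets_at_top
    proof (intro exI[of _ "{..<N} \<inter> I"] conjI allI impI)
      show "dist (sum f F) L < e" if "finite F \<and> {..<N} \<inter> I \<subseteq> F \<and> F \<subseteq> I" for F
        using that by (intro d) simp_all
    qed simp_all
  qed
  then show ?thesis by (rule has_sum_imp_summable)
qed

context compact_nonneg
begin

text \<open>The coefficients are at most \<open>1 / g\<close> in absolute value, so Bessel's
  inequality gives convergence and boundedness. The two claims about the eigenspace are what removes
  the linear term from the bias.\<close>

lemma bounded_linear_reduced_resolvent:
  assumes mu: "distinct_eigenvalue A r \<in> pos_eigenvalues A" and r: "1 \<le> r"
  shows "bounded_linear (reduced_resolvent A r)"
    and "x \<in> eigenspace A (distinct_eigenvalue A r) \<Longrightarrow> reduced_resolvent A r x = 0"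
    and "z \<in> eigenspace A (distinct_eigenvalue A r) \<Longrightarrow> inner (reduced_resolvent A r x) z = 0"
proof -
  let ?m = "distinct_eigenvalue A r"
  define I where "I = {s. 1 \<le> s \<and> s \<noteq> r \<and> 0 < distinct_eigenvalue A s}"
  define d where "d = distinct_eigenvalue A"
  define P where "P = (\<lambda>s x. spectral_projector A (d s) x)"
  define v where "v = (\<lambda>x s. (1 / (?m - d s)) *\<^sub>R P s x)"
  define g where "g = spectral_gap A r"
  have g: "0 < g" unfolding g_def by (rule spectral_gap_facts[OF mu r])
  have Cdef: "reduced_resolvent A r x = infsum (v x) I" for x
    by (simp add: reduced_resolvent_def I_def v_def P_def d_def)
  have dpos: "0 < d s" if "s \<in> I" for s using that by (simp add: I_def d_def)
  have card: "card {k \<in> pos_eigenvalues A. d s < k} + 1 = s" "d s \<in> pos_eigenvalues A" if "0 < d s" for s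
    using distinct_eigenvalue_cases[of A s "card {k \<in> pos_eigenvalues A. d s < k} + 1 = s \<and> d s \<in> pos_eigenvalues A"] that
    by (auto simp: d_def)
  have d_inj: "s = s'" if "0 < d s" "d s = d s'" for s s'
    using card(1)[of s] card(1)[of s'] that by simp
  have dm: "d s \<noteq> ?m" if "s \<in> I" for s
    using d_inj[of s r] dpos[OF that] that by (auto simp: d_def[symmetric] I_def)
  have P_eq: "P s x = (\<Sum>i | el i = d s. inner (eg i) x *\<^sub>R eg i)" if "s \<in> I" for s x
    unfolding P_def by (rule spectral_projector_pos[OF dpos[OF that]])
  have P_eig: "P s x \<in> eigenspace A (d s)" if "s \<in> I" for s x
  proof -
    have "eg i \<in> eigenspace A (d s)" if "el i = d s" for i using eg_in_eigenspace[of i] that by simp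
    then show ?thesis unfolding P_eq[OF that]
      by (intro subspace_sum[OF subspace_eigenspace] subspace_scale[OF subspace_eigenspace]) simp
  qed
  have P_norm: "(norm (P s x))\<^sup>2 = (\<Sum>i | el i = d s. (inner (eg i) x)\<^sup>2)" if "s \<in> I" for s x
    unfolding P_eq[OF that]
    by (subst norm_eg_sum[OF finite_el_eq[OF dpos[OF that]]], intro sum.cong refl) (use dpos[OF that] in auto)
  have coeff: "(1 / (?m - d s))\<^sup>2 \<le> 1 / g\<^sup>2" if s: "s \<in> I" for s
  proof -
    obtain i where "el i = d s" using card(2)[OF dpos[OF s]] by (auto simp: pos_eigenvalues_eq)
    then have "g \<le> \<bar>?m - d s\<bar>"
      using spectral_gap_facts(3)[OF mu r, of i] dm[OF s] by (simp add: g_def abs_minus_commute)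
    then have "g\<^sup>2 \<le> \<bar>?m - d s\<bar>\<^sup>2" using g by (intro power_mono) auto
    then have "1 / (?m - d s)\<^sup>2 \<le> 1 / g\<^sup>2" using g by (intro frac_le) auto
    then show ?thesis by (simp add: power_divide)
  qed
  have v_orth: "inner (v x i) (v x j) = 0" if "i \<in> I" "j \<in> I" "i \<noteq> j" for x i j
    using eigenspace_orthogonal[OF P_eig[OF that(1)] P_eig[OF that(2)]] d_inj[OF dpos[OF that(1)]] that(3)
    by (auto simp: v_def)
  have P_sum: "(\<Sum>s\<in>F. (norm (P s x))\<^sup>2) \<le> (norm x)\<^sup>2" if F: "finite F" "F \<subseteq> I" for F x
  proof -
    have "(\<Sum>s\<in>F. (norm (P s x))\<^sup>2) = (\<Sum>s\<in>F. \<Sum>i | el i = d s. (inner (eg i) x)\<^sup>2)"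
      using F(2) by (intro sum.cong refl P_norm) auto
    also have "\<dots> = (\<Sum>i\<in>(\<Union>s\<in>F. {i. el i = d s}). (inner (eg i) x)\<^sup>2)"
    proof (rule sum.UNION_disjoint[symmetric, OF F(1)])
      show "\<forall>s\<in>F. finite {i. el i = d s}" using F(2) dpos finite_el_eq by blast
      show "\<forall>s\<in>F. \<forall>s'\<in>F. s \<noteq> s' \<longrightarrow> {i. el i = d s} \<inter> {i. el i = d s'} = {}"
        using F(2) dpos d_inj by (metis (mono_tags, lifting) Int_emptyI mem_Collect_eq subsetD)
    qed
    also have "\<dots> \<le> (norm x)\<^sup>2"
      using F finite_el_eq dpos by (intro Bessel_eg) blast
    finally show ?thesis .
  qed
  have v_sum: "(\<Sum>s\<in>F. (norm (v x s))\<^sup>2) \<le> (norm x)\<^sup>2 / g\<^sup>2" if F: "finite F" "F \<subseteq> I" for F x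
  proof -
    have "(norm (v x s))\<^sup>2 = (1 / (?m - d s))\<^sup>2 * (norm (P s x))\<^sup>2" for s
      by (simp only: v_def norm_scaleR power_mult_distrib power2_abs)
    then have "(\<Sum>s\<in>F. (norm (v x s))\<^sup>2) \<le> (\<Sum>s\<in>F. 1 / g\<^sup>2 * (norm (P s x))\<^sup>2)"
      using coeff F(2) by (intro sum_mono) (auto simp del: times_divide_eq_left intro!: mult_right_mono)
    also have "\<dots> \<le> 1 / g\<^sup>2 * (norm x)\<^sup>2"
      unfolding sum_distrib_left[symmetric] using P_sum[OF F] by (intro mult_left_mono) auto
    finally show ?thesis by simp
  qed
  have summ: "v x summable_on I" for x
    by (rule orthogonal_summable_on[OF v_orth v_sum])
  have v_add: "v (x + y) s = v x s + v y s" if "s \<in> I" for x y s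
    by (simp add: v_def P_eq[OF that] inner_add_right scaleR_add_left sum.distrib scaleR_add_right)
  have v_scale: "v (c *\<^sub>R x) s = c *\<^sub>R v x s" if "s \<in> I" for c x s
    by (simp add: v_def P_eq[OF that] scaleR_sum_right mult_ac)
  show "bounded_linear (reduced_resolvent A r)"
  proof (rule bounded_linear_intro[where K = "1 / g"])
    fix x y :: 'h and c :: real
    have "infsum (v (x + y)) I = infsum (\<lambda>s. v x s + v y s) I" by (rule infsum_cong) (rule v_add)
    also have "\<dots> = infsum (v x) I + infsum (v y) I" by (rule infsum_add[OF summ summ])
    finally show "reduced_resolvent A r (x + y) = reduced_resolvent A r x + reduced_resolvent A r y" by (simp add: Cdef)
    have "infsum (v (c *\<^sub>R x)) I = infsum (\<lambda>s. c *\<^sub>R v x s) I" by (rule infsum_cong) (rule v_scale)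
    also have "\<dots> = c *\<^sub>R infsum (v x) I" by (rule infsum_scaleR_right)
    finally show "reduced_resolvent A r (c *\<^sub>R x) = c *\<^sub>R reduced_resolvent A r x" by (simp add: Cdef)
    have "(sum (v x) \<longlongrightarrow> infsum (v x) I) (finite_subsets_at_top I)"
      by (rule infsum_tendsto[OF summ])
    then have "((\<lambda>F. norm (sum (v x) F)) \<longlongrightarrow> norm (infsum (v x) I)) (finite_subsets_at_top I)"
      by (rule tendsto_norm)
    then have "norm (infsum (v x) I) \<le> norm x * (1 / g)"
    proof (rule tendsto_upperbound)
      show "\<forall>\<^sub>F F in finite_subsets_at_top I. norm (sum (v x) F) \<le> norm x * (1 / g)"
      proof (rule eventually_finite_subsets_at_top_weakI)
        fix F assume F: "finite F" "F \<subseteq> I"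
        have "(norm (sum (v x) F))\<^sup>2 = (\<Sum>s\<in>F. (norm (v x s))\<^sup>2)"
          using F v_orth by (intro norm_sum_Pythagorean) (auto simp: pairwise_def orthogonal_def subset_eq)
        also have "\<dots> \<le> (norm x * (1 / g))\<^sup>2" using v_sum[OF F] by (simp add: power_divide)
        finally show "norm (sum (v x) F) \<le> norm x * (1 / g)"
          by (rule power2_le_imp_le) (use g in simp)
      qed
    qed simp
    then show "norm (reduced_resolvent A r x) \<le> norm x * (1 / g)" by (simp add: Cdef)
  qed
  show "reduced_resolvent A r x = 0" if x: "x \<in> eigenspace A ?m"
  proof -
    have "v x s = 0" if "s \<in> I" for s
    proof -
      have "P s x = 0"
        unfolding P_eq[OF that]
        using eigenspace_orthogonal[OF eg_in_eigenspace x] dm[OF that] by (intro sum.neutral) auto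
      then show ?thesis by (simp add: v_def)
    qed
    then show ?thesis unfolding Cdef by (rule infsum_0)
  qed
  show "inner (reduced_resolvent A r x) z = 0" if z: "z \<in> eigenspace A ?m"
  proof -
    have "infsum (\<lambda>s. inner (v x s) z) I = inner (infsum (v x) I) z"
      using summ[of x] summable_on_bounded_linear[OF bounded_linear_inner_left summ, of x z]
      by (intro infsum_bounded_linear_strong[OF _ bounded_linear_inner_left]) simp
    moreover have "inner (v x s) z = 0" if "s \<in> I" for s
      using eigenspace_orthogonal[OF P_eig[OF that] z] dm[OF that] by (simp add: v_def)
    ultimately show ?thesis unfolding Cdef by (simp add: infsum_0)
  qed
qed

end

section \<open>Empirical covariance operators\<close>

text \<open>The sample covariance as a function of the data instead of the sample point, so that
  independent copies and their rotations can be inserted.\<close>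

definition scov :: "nat \<Rightarrow> (nat \<Rightarrow> 'h::real_inner) \<Rightarrow> 'h \<Rightarrow> 'h" where
  "scov n z x = (1 / real n) *\<^sub>R (\<Sum>j=1..n. inner (z j) x *\<^sub>R z j)"

lemma sample_covariance_eq_scov: "sample_covariance Y n \<omega> = scov n (\<lambda>j. Y j \<omega>)"
  by (intro ext) (simp add: sample_covariance_def scov_def tensor_def)

lemma scov_cong: "(\<And>j. 1 \<le> j \<Longrightarrow> j \<le> n \<Longrightarrow> z j = z' j) \<Longrightarrow> scov n z = scov n z'"
  by (intro ext) (simp add: scov_def)

lemma inner_scov: "inner (scov n z x) y = (\<Sum>j=1..n. inner (z j) x * inner (z j) y) / real n"
  by (simp add: scov_def inner_sum_left)

lemma compact_nonneg_scov:
  fixes z :: "nat \<Rightarrow> 'h::{real_inner,banach,second_countable_topology}"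
  shows "compact_nonneg (scov n z)"
proof (rule compact_nonneg.intro)
  have bl: "bounded_linear (\<lambda>x. inner (z j) x *\<^sub>R z j)" for j
    by (intro bounded_linear_intros)
  show "bounded_linear (scov n z)"
    unfolding scov_def[abs_def]
    by (intro bounded_linear_compose[OF bounded_linear_scaleR_right] bounded_linear_sum bl)
  show "inner (scov n z x) y = inner x (scov n z y)" for x y
    by (subst inner_commute[of x]) (simp add: inner_scov mult.commute)
  show "0 \<le> inner (scov n z x) x" for x
    by (simp add: inner_scov sum_nonneg)
  fix s :: "nat \<Rightarrow> 'h"
  assume "bounded (range s)" "\<And>y. convergent (\<lambda>k. inner y (s k))"
  then have "\<forall>y. \<exists>l. (\<lambda>k. inner y (s k)) \<longlonglongrightarrow> l" by (simp add: convergent_def)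
  then obtain l where l: "\<And>y. (\<lambda>k. inner y (s k)) \<longlonglongrightarrow> l y" by metis
  have "(\<lambda>k. scov n z (s k)) \<longlonglongrightarrow> (1 / real n) *\<^sub>R (\<Sum>j=1..n. l (z j) *\<^sub>R z j)"
    unfolding scov_def by (intro tendsto_intros l)
  then show "convergent (\<lambda>k. scov n z (s k))" by (auto simp: convergent_def)
qed

text \<open>Eigenvectors for nonzero eigenvalues lie in the span of the \<open>n\<close>
  observations, but \<open>n + 1\<close> of them would be independent.\<close>

lemma eigval_scov_eq_0:
  fixes z :: "nat \<Rightarrow> 'h::{real_inner,banach,second_countable_topology}"
  shows "eigval (scov n z) n = 0"
proof (rule ccontr)
  interpret compact_nonneg "scov n z" by (rule compact_nonneg_scov)
  assume "el n \<noteq> 0"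
  then have pos: "el i \<noteq> 0" if "i \<le> n" for i
    using decseqD[OF decseq_el that] el_nonneg[of n] by simp
  have "eg i \<in> span (z ` {1..n})" if "i \<le> n" for i
  proof -
    have "el i *\<^sub>R eg i \<in> span (z ` {1..n})"
      unfolding A_eg[symmetric] scov_def by (intro span_scale span_sum span_base) auto
    then have "(1 / el i) *\<^sub>R (el i *\<^sub>R eg i) \<in> span (z ` {1..n})" by (rule span_scale)
    then show ?thesis using pos[OF that] by simp
  qed
  then have sub: "eg ` {..n} \<subseteq> span (z ` {1..n})" by auto
  have ind: "independent (eg ` {..n})" by (rule independent_eg) (use pos in auto)
  have "card (eg ` {..n}) \<le> card (z ` {1..n})"
    by (rule independent_span_bound[THEN conjunct2, OF _ ind sub]) simp
  also have "\<dots> \<le> n" using card_image_le[of "{1..n}" z] by simp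
  finally have "card (eg ` {..n}) \<le> n" .
  moreover have "card (eg ` {..n}) = Suc n"
    by (subst card_image[OF inj_on_subset[OF inj_on_eg]]) (use pos in auto)
  ultimately show False by simp
qed

section \<open>Gaussian vectors\<close>

text \<open>In a separable space the norm is determined by countably many inner products, so
  distances to fixed points are measurable, and every open set is a countable union of
  balls.\<close>

lemma borel_measurable_innerI:
  fixes f :: "'a \<Rightarrow> 'h::{real_inner,second_countable_topology}"
  assumes meas[measurable]: "\<And>c. (\<lambda>x. inner (f x) c) \<in> borel_measurable N"
  shows "f \<in> borel_measurable N"
proof -
  obtain D :: "'h set" where D: "countable D" "\<And>X. open X \<Longrightarrow> X \<noteq> {} \<Longrightarrow> \<exists>d\<in>D. d \<in> X"
    using countable_dense_setE by blast
  have dense: "closure D = UNIV"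
  proof (intro set_eqI iffI UNIV_I)
    fix x show "x \<in> closure D"
      unfolding closure_approachable
    proof (intro allI impI)
      fix e :: real assume "0 < e"
      then have "ball x e \<noteq> {}" by simp
      then obtain d where "d \<in> D" "d \<in> ball x e" using D(2)[of "ball x e"] open_ball by blast
      then show "\<exists>y\<in>D. dist y x < e" by (auto simp: dist_commute)
    qed
  qed
  have norm_iff: "norm y \<le> q \<longleftrightarrow> (\<forall>c\<in>D. inner y c \<le> q * norm c)" if "0 \<le> q" for y :: 'h and q
  proof
    assume "norm y \<le> q"
    then show "\<forall>c\<in>D. inner y c \<le> q * norm c"
      by (meson mult_right_mono norm_cauchy_schwarz norm_ge_zero order_trans)
  next
    assume *: "\<forall>c\<in>D. inner y c \<le> q * norm c"
    have "D \<subseteq> {c. inner y c \<le> q * norm c}" using * by auto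
    moreover have "closed {c. inner y c \<le> q * norm c}" by (intro closed_Collect_le continuous_intros)
    ultimately have "closure D \<subseteq> {c. inner y c \<le> q * norm c}" by (rule closure_minimal)
    then have "inner y y \<le> q * norm y" using dense by auto
    then have "norm y * norm y \<le> q * norm y" by (simp add: power2_norm_eq_inner[symmetric] power2_eq_square)
    then show "norm y \<le> q" using that by (cases "y = 0") (auto simp: mult_le_cancel_right)
  qed
  have nm: "(\<lambda>x. norm (f x - d)) \<in> borel_measurable N" for d
  proof (subst borel_measurable_iff_le, intro allI)
    fix q :: real
    show "{x \<in> space N. norm (f x - d) \<le> q} \<in> sets N"
    proof (cases "0 \<le> q")
      case True
      have "{x \<in> space N. norm (f x - d) \<le> q} = {x \<in> space N. \<forall>c\<in>D. inner (f x) c - inner d c \<le> q * norm c}"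
        using norm_iff[OF True] by (simp add: inner_diff_left)
      also have "\<dots> \<in> sets N"
        by (rule sets.sets_Collect_countable_All'[OF _ D(1)]) measurable
      finally show ?thesis .
    next
      case False
      then have "\<not> norm (f x - d) \<le> q" for x using norm_ge_zero[of "f x - d"] by linarith
      then have eq: "{x \<in> space N. norm (f x - d) \<le> q} = {}" by blast
      show ?thesis unfolding eq by simp
    qed
  qed
  show ?thesis
  proof (rule borel_measurableI)
    fix U :: "'h set" assume U: "open U"
    let ?B = "{(d, k). d \<in> D \<and> ball d (1 / real (Suc k)) \<subseteq> U}"
    have mem: "x \<in> U \<longleftrightarrow> (\<exists>d k. d \<in> D \<and> ball d (1 / real (Suc k)) \<subseteq> U \<and> norm (x - d) < 1 / real (Suc k))" for x
    proof
      assume "x \<in> U"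
      then obtain e where e: "0 < e" "ball x e \<subseteq> U" using U openE by blast
      then obtain k where k: "1 / real (Suc k) < e / 2" using nat_approx_posE[of "e / 2"] by auto
      have "0 < 1 / real (Suc k)" by simp
      then obtain d where d: "d \<in> D" "dist d x < 1 / real (Suc k)"
        using dense closure_approachable[of x D] by (metis UNIV_I)
      have "ball d (1 / real (Suc k)) \<subseteq> ball x e"
      proof
        fix y assume "y \<in> ball d (1 / real (Suc k))"
        then show "y \<in> ball x e" using d k dist_triangle3[of x y d] by simp
      qed
      then have "ball d (1 / real (Suc k)) \<subseteq> U" using e(2) by (rule subset_trans)
      then show "\<exists>d k. d \<in> D \<and> ball d (1 / real (Suc k)) \<subseteq> U \<and> norm (x - d) < 1 / real (Suc k)"
        using d by (intro exI[of _ d] exI[of _ k]) (simp add: dist_norm norm_minus_commute)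
    next
      assume "\<exists>d k. d \<in> D \<and> ball d (1 / real (Suc k)) \<subseteq> U \<and> norm (x - d) < 1 / real (Suc k)"
      then obtain d k where "ball d (1 / real (Suc k)) \<subseteq> U" "x \<in> ball d (1 / real (Suc k))"
        by (auto simp: dist_norm norm_minus_commute)
      then show "x \<in> U" by (rule subsetD)
    qed
    have "f -` U \<inter> space N = {x \<in> space N. \<exists>d k. d \<in> D \<and> ball d (1 / real (Suc k)) \<subseteq> U \<and> norm (f x - d) < 1 / real (Suc k)}"
      unfolding mem[symmetric] by blast
    also have "\<dots> = (\<Union>(d, k)\<in>?B. {x \<in> space N. norm (f x - d) < 1 / real (Suc k)})"
      by blast
    also have "\<dots> \<in> sets N"
    proof (rule sets.countable_UN')
      show "countable ?B" by (rule countable_subset[of _ "D \<times> UNIV"]) (use D(1) in auto)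
      have "{x \<in> space N. norm (f x - d) < c} \<in> sets N" for d c
        using nm[of d] by measurable
      then show "(\<lambda>(d, k). {x \<in> space N. norm (f x - d) < 1 / real (Suc k)}) ` ?B \<subseteq> sets N" by auto
    qed
    finally show "f -` U \<inter> space N \<in> sets N" .
  qed
qed

section \<open>Moments and exponential moments of Gaussian variables\<close>

lemma normal_distr_eq_scaled:
  assumes "0 < \<sigma>"
  shows "density lborel (normal_density 0 \<sigma>) = distr std_normal_distribution borel (\<lambda>x. \<sigma> * x)"
proof -
  interpret prob_space std_normal_distribution by (rule prob_space_normal_density) simp
  have "distributed std_normal_distribution lborel (\<lambda>x. x) std_normal_density"
    unfolding distributed_def by (auto intro!: distr_id2)
  from normal_density_affine[OF this, of \<sigma> 0] assms
  have "distributed std_normal_distribution lborel (\<lambda>x. \<sigma> * x) (normal_density 0 \<sigma>)" by simp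
  then show ?thesis unfolding distributed_def by (simp cong: distr_cong)
qed

text \<open>Completing the square: tilting by a quadratic exponential yields, up to a factor, a
  normal density with variance \<open>s\<^sup>2\<close> and mean
  \<open>b * s\<^sup>2\<close>.\<close>

lemma normal_density_exp_quadratic:
  fixes a b x :: real
  assumes "a < 1 / 2"
  defines "s \<equiv> sqrt (1 / (1 - 2 * a))"
  shows "std_normal_density x * exp (a * x\<^sup>2 + b * x) =
    s * exp (b\<^sup>2 * s\<^sup>2 / 2) * normal_density (b * s\<^sup>2) s x"
proof -
  have s: "s\<^sup>2 = 1 / (1 - 2 * a)" "0 < s" using assms by (simp_all add: s_def)
  have sq: "sqrt (2 * pi * s\<^sup>2) = sqrt (2 * pi) * s" using s(2) by (simp add: real_sqrt_mult)
  have "- x\<^sup>2 / 2 + (a * x\<^sup>2 + b * x) = b\<^sup>2 * s\<^sup>2 / 2 + (- (x - b * s\<^sup>2)\<^sup>2 / (2 * s\<^sup>2))"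
  proof -
    define p where "p = 1 - 2 * a"
    have p: "0 < p" "a = (1 - p) / 2" using assms(1) by (simp_all add: p_def)
    show ?thesis unfolding s(1) p_def[symmetric] using p(1) unfolding p(2)
      by (simp add: field_simps power2_eq_square)
  qed
  then have "exp (- x\<^sup>2 / 2) * exp (a * x\<^sup>2 + b * x) = exp (b\<^sup>2 * s\<^sup>2 / 2) * exp (- (x - b * s\<^sup>2)\<^sup>2 / (2 * s\<^sup>2))"
    by (simp only: exp_add[symmetric])
  then show ?thesis
    using s(2) unfolding normal_density_def sq by (simp add: field_simps)
qed

text \<open>For \<open>4 * a \<le> 1\<close> the tilted variance \<open>1 / (1 - 2 * a)\<close> is
  at most 2 and at most \<open>1 + 4 * a\<close>, which turns the exact value into an exponent that
  is linear in \<open>a\<close> and \<open>b\<^sup>2\<close>.\<close>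

lemma nn_integral_std_normal_exp_quadratic:
  fixes a b :: real
  assumes a: "0 \<le> a" "4 * a \<le> 1"
  shows "(\<integral>\<^sup>+x. ennreal (exp (a * x\<^sup>2 + b * x)) \<partial>std_normal_distribution) \<le> ennreal (exp (2 * a + b\<^sup>2))"
proof -
  define s where "s = sqrt (1 / (1 - 2 * a))"
  define K where "K = s * exp (b\<^sup>2 * s\<^sup>2 / 2)"
  have s: "s\<^sup>2 = 1 / (1 - 2 * a)" "0 < s" using a by (simp_all add: s_def)
  have "(\<integral>\<^sup>+x. ennreal (exp (a * x\<^sup>2 + b * x)) \<partial>std_normal_distribution)
      = (\<integral>\<^sup>+x. ennreal K * ennreal (normal_density (b * s\<^sup>2) s x) \<partial>lborel)"
    using normal_density_exp_quadratic[of a _ b] a s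
    by (subst nn_integral_density)
      (auto simp: K_def s_def ennreal_mult[symmetric] normal_density_nonneg intro!: nn_integral_cong)
  also have "\<dots> = ennreal K * 1"
  proof -
    interpret prob_space "density lborel (normal_density (b * s\<^sup>2) s)"
      by (rule prob_space_normal_density[OF s(2)])
    show ?thesis
      using emeasure_space_1 by (subst nn_integral_cmult) (auto simp: emeasure_density)
  qed
  also have "K \<le> exp (2 * a + b\<^sup>2)"
  proof -
    have "1 / (1 - 2 * a) \<le> 1 + 4 * a"
    proof -
      have "a * a \<le> a * (1 / 4)" using a by (intro mult_left_mono) auto
      then have "1 \<le> (1 + 4 * a) * (1 - 2 * a)" by (simp add: algebra_simps)
      then show ?thesis using a by (simp add: divide_le_eq)
    qed
    also have "\<dots> \<le> (exp (2 * a))\<^sup>2" using exp_ge_add_one_self[of "4 * a"] by (simp add: exp_double[symmetric])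
    finally have "s\<^sup>2 \<le> (exp (2 * a))\<^sup>2" by (simp add: s(1))
    then have 1: "s \<le> exp (2 * a)" by (rule power2_le_imp_le) simp
    have "s\<^sup>2 \<le> 2" unfolding s(1) using a by (simp add: divide_le_eq)
    then have "b\<^sup>2 * s\<^sup>2 / 2 \<le> b\<^sup>2" using mult_left_mono[of "s\<^sup>2" 2 "b\<^sup>2"] by simp
    then have "K \<le> exp (2 * a) * exp (b\<^sup>2)" unfolding K_def using 1 s by (intro mult_mono) auto
    then show ?thesis by (simp add: exp_add)
  qed
  finally show ?thesis by (simp add: ennreal_leI)
qed

lemma std_normal_fourth_moment:
  "(\<integral>x. x ^ 4 \<partial>std_normal_distribution) = 3" "integrable std_normal_distribution (\<lambda>x. x ^ 4)"
  using std_normal_distribution_even_moments[of 2] by (simp_all add: fact_numeral)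

lemma std_normal_second_moment:
  "(\<integral>x. x\<^sup>2 \<partial>std_normal_distribution) = 1" "integrable std_normal_distribution (\<lambda>x. x\<^sup>2)"
  using std_normal_distribution_even_moments[of 1] by (simp_all add: fact_numeral)

text \<open>Writing the marginal as a multiple of a standard normal variable treats the degenerate
  case \<open>\<sigma> = 0\<close> along with the others.\<close>

lemma centered_gaussian_marginal:
  fixes X :: "'w \<Rightarrow> 'h::{real_inner,banach,second_countable_topology}"
  assumes "centered_gaussian M X"
  obtains \<sigma> where "0 \<le> \<sigma>" "distr M borel (\<lambda>\<omega>. inner (X \<omega>) u) = distr std_normal_distribution borel (\<lambda>x. \<sigma> * x)"
proof -
  obtain \<sigma> where s: "0 \<le> \<sigma>" "distr M borel (\<lambda>\<omega>. inner (X \<omega>) u) =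
        (if \<sigma> = 0 then return borel 0 else density lborel (normal_density 0 \<sigma>))"
    using assms unfolding centered_gaussian_def by blast
  interpret prob_space std_normal_distribution by (rule prob_space_normal_density) simp
  have "(*) (0::real) = (\<lambda>x. 0)" by (simp add: fun_eq_iff)
  then have "distr std_normal_distribution borel ((*) (0::real)) = return borel 0"
    using distr_const[of "0::real" borel] by simp
  then show thesis using s normal_distr_eq_scaled[of \<sigma>] by (intro that[of \<sigma>]) auto
qed

lemma centered_gaussian_integral:
  fixes X :: "'w \<Rightarrow> 'h::{real_inner,banach,second_countable_topology}"
    and g :: "real \<Rightarrow> 'b::{banach,second_countable_topology}"
  assumes X: "X \<in> borel_measurable M"
    and s: "distr M borel (\<lambda>\<omega>. inner (X \<omega>) u) = distr std_normal_distribution borel (\<lambda>x. \<sigma> * x)"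
    and g: "g \<in> borel_measurable borel"
  shows "(\<integral>\<omega>. g (inner (X \<omega>) u) \<partial>M) = (\<integral>x. g (\<sigma> * x) \<partial>std_normal_distribution)"
    and "integrable M (\<lambda>\<omega>. g (inner (X \<omega>) u)) \<longleftrightarrow> integrable std_normal_distribution (\<lambda>x. g (\<sigma> * x))"
proof -
  have m: "(\<lambda>\<omega>. inner (X \<omega>) u) \<in> borel_measurable M" "(\<lambda>x. \<sigma> * x) \<in> borel_measurable std_normal_distribution"
    using X by simp_all
  show "(\<integral>\<omega>. g (inner (X \<omega>) u) \<partial>M) = (\<integral>x. g (\<sigma> * x) \<partial>std_normal_distribution)"
    unfolding integral_distr[OF m(1) g, symmetric] integral_distr[OF m(2) g, symmetric] s ..
  show "integrable M (\<lambda>\<omega>. g (inner (X \<omega>) u)) \<longleftrightarrow> integrable std_normal_distribution (\<lambda>x. g (\<sigma> * x))"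
    unfolding integrable_distr_eq[OF m(1) g, symmetric] integrable_distr_eq[OF m(2) g, symmetric] s ..
qed

section \<open>Covariance operators\<close>

lemma covariance_eq: "covariance M X x = (\<integral>\<omega>. inner (X \<omega>) x *\<^sub>R X \<omega> \<partial>M)"
  by (simp add: covariance_def tensor_def)

lemma integrable_inner_scaleR:
  fixes X :: "'w \<Rightarrow> 'h::{real_inner,banach,second_countable_topology}"
  assumes [measurable]: "X \<in> borel_measurable M" and X2: "integrable M (\<lambda>\<omega>. (norm (X \<omega>))\<^sup>2)"
  shows "integrable M (\<lambda>\<omega>. inner (X \<omega>) x *\<^sub>R X \<omega>)"
proof (rule Bochner_Integration.integrable_bound)
  show "integrable M (\<lambda>\<omega>. norm x * (norm (X \<omega>))\<^sup>2)" using X2 by simp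
  have "norm (inner v x *\<^sub>R v) \<le> norm x * (norm v)\<^sup>2" for v
    using mult_right_mono[OF Cauchy_Schwarz_ineq2[of v x], of "norm v"] by (simp add: power2_eq_square mult_ac)
  then show "AE \<omega> in M. norm (inner (X \<omega>) x *\<^sub>R X \<omega>) \<le> norm (norm x * (norm (X \<omega>))\<^sup>2)"
    by (intro AE_I2) simp
qed measurable

lemma inner_covariance:
  fixes X :: "'w \<Rightarrow> 'h::{real_inner,banach,second_countable_topology}"
  assumes "X \<in> borel_measurable M" "integrable M (\<lambda>\<omega>. (norm (X \<omega>))\<^sup>2)"
  shows "inner (covariance M X x) y = (\<integral>\<omega>. inner (X \<omega>) x * inner (X \<omega>) y \<partial>M)"
    and "integrable M (\<lambda>\<omega>. inner (X \<omega>) x * inner (X \<omega>) y)"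
proof -
  note i = integrable_inner_scaleR[OF assms, of x]
  show "inner (covariance M X x) y = (\<integral>\<omega>. inner (X \<omega>) x * inner (X \<omega>) y \<partial>M)"
    unfolding covariance_eq by (subst integral_inner_left[OF i, symmetric]) simp
  show "integrable M (\<lambda>\<omega>. inner (X \<omega>) x * inner (X \<omega>) y)"
    using integrable_inner_left[OF i, of y] by simp
qed

text \<open>Compactness comes from dominated convergence: along a bounded weakly Cauchy sequence the
  integrands converge pointwise and are dominated by a multiple of
  \<open>(norm (X \<omega>))\<^sup>2\<close>.\<close>

lemma compact_nonneg_covariance:
  fixes X :: "'w \<Rightarrow> 'h::{real_inner,banach,second_countable_topology}"
  assumes X[measurable]: "X \<in> borel_measurable M" and X2: "integrable M (\<lambda>\<omega>. (norm (X \<omega>))\<^sup>2)"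
  shows "compact_nonneg (covariance M X)"
proof (rule compact_nonneg.intro)
  note i = integrable_inner_scaleR[OF X X2]
  show "bounded_linear (covariance M X)"
  proof (rule bounded_linear_intro[where K="\<integral>\<omega>. (norm (X \<omega>))\<^sup>2 \<partial>M"])
    show "covariance M X (x + y) = covariance M X x + covariance M X y" for x y
      unfolding covariance_eq by (simp add: inner_add_right scaleR_add_left i)
    show "covariance M X (c *\<^sub>R x) = c *\<^sub>R covariance M X x" for c x
      unfolding covariance_eq by (simp flip: scaleR_scaleR)
    show "norm (covariance M X x) \<le> norm x * (\<integral>\<omega>. (norm (X \<omega>))\<^sup>2 \<partial>M)" for x
    proof -
      have "norm (covariance M X x) \<le> (\<integral>\<omega>. norm (inner (X \<omega>) x *\<^sub>R X \<omega>) \<partial>M)"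
        unfolding covariance_eq by (rule integral_norm_bound)
      also have "\<dots> \<le> (\<integral>\<omega>. norm x * (norm (X \<omega>))\<^sup>2 \<partial>M)"
      proof (rule integral_mono)
        show "norm (inner (X \<omega>) x *\<^sub>R X \<omega>) \<le> norm x * (norm (X \<omega>))\<^sup>2" for \<omega>
          using mult_right_mono[OF Cauchy_Schwarz_ineq2[of "X \<omega>" x], of "norm (X \<omega>)"]
          by (simp add: power2_eq_square mult_ac)
      qed (use integrable_norm[OF i] X2 in auto)
      finally show ?thesis by simp
    qed
  qed
  show "inner (covariance M X x) y = inner x (covariance M X y)" for x y
    by (subst inner_commute[of x]) (simp add: inner_covariance[OF X X2] mult.commute)
  show "0 \<le> inner (covariance M X x) x" for x
    by (simp add: inner_covariance[OF X X2])
  fix s :: "nat \<Rightarrow> 'h"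
  assume s: "bounded (range s)" "\<And>z. convergent (\<lambda>n. inner z (s n))"
  obtain C where C: "\<And>n. norm (s n) \<le> C" using s(1) by (auto simp: bounded_iff)
  from s(2) have "\<forall>z. \<exists>l. (\<lambda>n. inner z (s n)) \<longlonglongrightarrow> l" by (simp add: convergent_def)
  then obtain l where l: "\<And>z. (\<lambda>n. inner z (s n)) \<longlonglongrightarrow> l z" by metis
  have "(\<lambda>n. \<integral>\<omega>. inner (X \<omega>) (s n) *\<^sub>R X \<omega> \<partial>M) \<longlonglongrightarrow> (\<integral>\<omega>. l (X \<omega>) *\<^sub>R X \<omega> \<partial>M)"
  proof (rule integral_dominated_convergence[where w="\<lambda>\<omega>. C * (norm (X \<omega>))\<^sup>2"])
    have "(\<lambda>\<omega>. l (X \<omega>)) \<in> borel_measurable M"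
      by (rule borel_measurable_LIMSEQ_real[where u="\<lambda>n \<omega>. inner (X \<omega>) (s n)"]) (simp_all add: l)
    then show "(\<lambda>\<omega>. l (X \<omega>) *\<^sub>R X \<omega>) \<in> borel_measurable M" by measurable
    show "AE \<omega> in M. (\<lambda>n. inner (X \<omega>) (s n) *\<^sub>R X \<omega>) \<longlonglongrightarrow> l (X \<omega>) *\<^sub>R X \<omega>"
      by (intro AE_I2 tendsto_intros l)
    show "AE \<omega> in M. norm (inner (X \<omega>) (s n) *\<^sub>R X \<omega>) \<le> C * (norm (X \<omega>))\<^sup>2" for n
    proof (rule AE_I2)
      fix \<omega>
      have "\<bar>inner (X \<omega>) (s n)\<bar> \<le> norm (X \<omega>) * C"
        using Cauchy_Schwarz_ineq2[of "X \<omega>" "s n"] mult_left_mono[OF C[of n], of "norm (X \<omega>)"] by simp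
      from mult_right_mono[OF this, of "norm (X \<omega>)"]
      show "norm (inner (X \<omega>) (s n) *\<^sub>R X \<omega>) \<le> C * (norm (X \<omega>))\<^sup>2"
        by (simp add: power2_eq_square mult_ac)
    qed
  qed (use X2 in simp_all)
  then show "convergent (\<lambda>n. covariance M X (s n))"
    unfolding covariance_eq by (auto simp: convergent_def)
qed

text \<open>An orthonormal basis, padded by zero vectors in finite dimension: the eigenvectors of the
  covariance of a discrete distribution charging a dense sequence.\<close>

lemma orthonormal_basis_exists:
  obtains e :: "nat \<Rightarrow> 'h::{real_inner,banach,second_countable_topology}"
  where "\<And>i j. i \<noteq> j \<Longrightarrow> inner (e i) (e j) = 0" "\<And>i. norm (e i) = 0 \<or> norm (e i) = 1"
    "\<And>x. (\<And>i. inner (e i) x = 0) \<Longrightarrow> x = 0"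
proof -
  obtain D :: "'h set" where D: "countable D" "\<And>X. open X \<Longrightarrow> X \<noteq> {} \<Longrightarrow> \<exists>d\<in>D. d \<in> X"
    using countable_dense_setE by blast
  have "D \<noteq> {}" using D(2)[of UNIV] by auto
  \<comment> \<open>Normalising keeps \<open>Z\<close> bounded and hence square integrable; the
    geometric distribution charges every index, so what holds almost everywhere holds for each
    \<open>Z k\<close>.\<close>
  define Z where "Z k = sgn (from_nat_into D k)" for k
  define M where "M = measure_pmf (geometric_pmf (1 / 2 :: real))"
  interpret prob_space M unfolding M_def by (rule measure_pmf.prob_space_axioms)
  have Z[measurable]: "Z \<in> borel_measurable M" by (simp add: M_def)
  have nZ: "norm (Z k) \<le> 1" for k by (simp add: Z_def norm_sgn)
  have Z2: "integrable M (\<lambda>k. (norm (Z k))\<^sup>2)"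
    by (rule integrable_const_bound[where B=1]) (use nZ in \<open>auto simp: abs_square_le_1\<close>)
  interpret A: compact_nonneg "covariance M Z" by (rule compact_nonneg_covariance[OF Z Z2])
  show thesis
  proof (rule that[of "A.eg"])
    show "inner (A.eg i) (A.eg j) = 0" if "i \<noteq> j" for i j using that by (rule A.eg_orthogonal)
    show "norm (A.eg i) = 0 \<or> norm (A.eg i) = 1" for i by (simp add: A.norm_eg)
    fix x assume x: "\<And>i. inner (A.eg i) x = 0"
    have "inner (covariance M Z x) x \<le> 0"
    proof (rule LIMSEQ_le_const)
      show "(\<lambda>m. A.el m * (norm x)\<^sup>2) \<longlonglongrightarrow> 0" using tendsto_mult_left_zero[OF A.el_tendsto_0] .
      show "\<exists>N. \<forall>m\<ge>N. inner (covariance M Z x) x \<le> A.el m * (norm x)\<^sup>2" using A.Rayleigh_le x by blast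
    qed
    then have "(\<integral>k. (inner (Z k) x)\<^sup>2 \<partial>M) \<le> 0"
      by (simp add: inner_covariance[OF Z Z2] power2_eq_square)
    moreover have "0 \<le> (\<integral>k. (inner (Z k) x)\<^sup>2 \<partial>M)" by (rule integral_nonneg_AE) simp
    ultimately have "(\<integral>k. (inner (Z k) x)\<^sup>2 \<partial>M) = 0" by (rule antisym)
    moreover have "integrable M (\<lambda>k. (inner (Z k) x)\<^sup>2)"
      using inner_covariance(2)[OF Z Z2, of x x] by (simp add: power2_eq_square)
    ultimately have "AE k in M. (inner (Z k) x)\<^sup>2 = 0"
      by (subst (asm) integral_nonneg_eq_0_iff_AE) auto
    then have Z0: "inner (Z k) x = 0" for k
      unfolding M_def AE_measure_pmf_iff by (simp add: set_pmf_geometric)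
    have D0: "inner d x = 0" if "d \<in> D" for d
    proof -
      obtain k where "from_nat_into D k = d" using from_nat_into_surj[OF D(1) \<open>d \<in> D\<close>] by blast
      then show ?thesis using Z0[of k] by (auto simp: Z_def sgn_div_norm)
    qed
    show "x = 0"
    proof (rule ccontr)
      assume "x \<noteq> 0"
      have "open {d. 0 < inner d x}" by (intro open_Collect_less continuous_intros)
      moreover have "{d. 0 < inner d x} \<noteq> {}" using \<open>x \<noteq> 0\<close> by (auto intro!: exI[of _ x])
      ultimately obtain d where "d \<in> D" "0 < inner d x" using D(2) by blast
      then show False using D0 by simp
    qed
  qed
qed

section \<open>Expansions in an orthonormal basis\<close>

locale orthonormal_basis =
  fixes e :: "nat \<Rightarrow> 'h::{real_inner,banach,second_countable_topology}"
  assumes orth: "i \<noteq> j \<Longrightarrow> inner (e i) (e j) = 0"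
    and norm_e: "norm (e i) = 0 \<or> norm (e i) = 1"
    and total: "(\<And>i. inner (e i) x = 0) \<Longrightarrow> x = 0"
begin

lemma inner_e_e: "inner (e i) (e i) * inner (e i) x = inner (e i) x"
  using norm_e[of i] by (auto simp: norm_eq_1)

lemma sum_norm_le: "finite F \<Longrightarrow> (\<Sum>i\<in>F. (inner (e i) x)\<^sup>2) \<le> (norm x)\<^sup>2"
proof -
  assume F: "finite F"
  let ?p = "\<Sum>i\<in>F. inner (e i) x *\<^sub>R e i"
  have "inner x ?p = (\<Sum>i\<in>F. (inner (e i) x)\<^sup>2)"
    by (simp add: inner_sum_right power2_eq_square inner_commute[of x])
  moreover have "inner ?p ?p = (\<Sum>i\<in>F. (inner (e i) x)\<^sup>2)"
  proof -
    have "inner (e i) ?p = inner (e i) x" if "i \<in> F" for i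
    proof -
      have "inner (e i) ?p = (\<Sum>j\<in>F. if j = i then inner (e i) x else 0)"
        unfolding inner_sum_right using inner_e_e[of i x]
        by (intro sum.cong refl) (auto simp: orth mult.commute)
      then show ?thesis using F that by simp
    qed
    then show ?thesis by (simp add: inner_sum_left power2_eq_square)
  qed
  moreover have "0 \<le> inner (x - ?p) (x - ?p)" by simp
  ultimately show ?thesis by (simp add: inner_diff_left inner_diff_right inner_commute power2_norm_eq_inner)
qed

lemma expansion_has_sum:
  assumes "summable (\<lambda>i. (c i)\<^sup>2)"
  obtains y where "((\<lambda>i. c i *\<^sub>R e i) has_sum y) UNIV" "\<And>i. inner (e i) y = c i * inner (e i) (e i)"
proof -
  have "(\<lambda>i. c i *\<^sub>R e i) summable_on UNIV"
  proof (rule orthogonal_summable_on[where K="suminf (\<lambda>i. (c i)\<^sup>2)"])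
    fix F :: "nat set" assume "finite F"
    have "(\<Sum>i\<in>F. (norm (c i *\<^sub>R e i))\<^sup>2) \<le> (\<Sum>i\<in>F. (c i)\<^sup>2)"
    proof (rule sum_mono)
      show "(norm (c i *\<^sub>R e i))\<^sup>2 \<le> (c i)\<^sup>2" for i using norm_e[of i] by (auto simp: power_mult_distrib)
    qed
    also have "\<dots> \<le> suminf (\<lambda>i. (c i)\<^sup>2)" by (rule sum_le_suminf[OF assms \<open>finite F\<close>]) simp
    finally show "(\<Sum>i\<in>F. (norm (c i *\<^sub>R e i))\<^sup>2) \<le> suminf (\<lambda>i. (c i)\<^sup>2)" .
  qed (simp add: orth)
  then obtain y where y: "((\<lambda>i. c i *\<^sub>R e i) has_sum y) UNIV" by (auto simp: summable_on_def)
  have "inner (e i) y = c i * inner (e i) (e i)" for i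
  proof (rule has_sum_unique)
    show "((\<lambda>j. inner (e i) (c j *\<^sub>R e j)) has_sum inner (e i) y) UNIV"
      by (rule has_sum_bounded_linear[OF bounded_linear_inner_right y])
    show "((\<lambda>j. inner (e i) (c j *\<^sub>R e j)) has_sum (c i * inner (e i) (e i))) UNIV"
      by (rule has_sum_finite_neutralI[where B="{i}"]) (auto simp: orth)
  qed
  with y show thesis by (rule that)
qed

lemma summable_coordinates: "summable (\<lambda>i. (inner (e i) x)\<^sup>2)"
  by (rule summableI_nonneg_bounded[where x="(norm x)\<^sup>2"]) (auto intro: sum_norm_le)

lemma expansion: "((\<lambda>i. inner (e i) x *\<^sub>R e i) has_sum x) UNIV"
proof -
  obtain y where y: "((\<lambda>i. inner (e i) x *\<^sub>R e i) has_sum y) UNIV"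
    "\<And>i. inner (e i) y = inner (e i) x * inner (e i) (e i)"
    using expansion_has_sum[OF summable_coordinates] by blast
  have "x - y = 0"
    by (rule total) (use y(2) inner_e_e in \<open>simp add: inner_diff_right mult.commute\<close>)
  then show ?thesis using y(1) by simp
qed

lemma Parseval: "(\<lambda>i. inner (e i) x * inner (e i) y) sums inner x y"
proof (rule has_sum_imp_sums)
  have "((\<lambda>i. inner (inner (e i) x *\<^sub>R e i) y) has_sum inner x y) UNIV"
    by (rule has_sum_bounded_linear[OF bounded_linear_inner_left expansion])
  then show "((\<lambda>i. inner (e i) x * inner (e i) y) has_sum inner x y) UNIV" by simp
qed

end

text \<open>A Paley-Zygmund argument: if \<open>V\<close> is the sum of the squared first coordinates, then \<open>E V\<^sup>2\<close> is
  at most a multiple of \<open>(E V)\<^sup>2\<close>, so \<open>V \<le> \<parallel>X\<parallel>\<^sup>2\<close> exceeds \<open>E V / 2\<close> with probability bounded below,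
  which bounds \<open>E V\<close>.\<close>

lemma centered_gaussian_integrable_norm2:
  fixes X :: "'w \<Rightarrow> 'h::{real_inner,banach,second_countable_topology}"
  assumes "prob_space M" and G: "centered_gaussian M X"
  shows "integrable M (\<lambda>\<omega>. (norm (X \<omega>))\<^sup>2)"
proof -
  interpret prob_space M by fact
  have X[measurable]: "X \<in> borel_measurable M" using G by (simp add: centered_gaussian_def)
  obtain e :: "nat \<Rightarrow> 'h" where "orthonormal_basis e"
    using orthonormal_basis_exists orthonormal_basis.intro by metis
  then interpret orthonormal_basis e .
  define g where "g i \<omega> = inner (X \<omega>) (e i)" for i \<omega>
  have g[measurable]: "g i \<in> borel_measurable M" for i unfolding g_def by measurable
  have "\<forall>i. \<exists>\<sigma>\<ge>0. distr M borel (g i) = distr std_normal_distribution borel (\<lambda>x. \<sigma> * x)"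
    unfolding g_def using centered_gaussian_marginal[OF G] by metis
  then obtain \<sigma> where \<sigma>: "\<And>i. 0 \<le> \<sigma> i" "\<And>i. distr M borel (g i) = distr std_normal_distribution borel (\<lambda>x. \<sigma> i * x)"
    by metis
  note tr = centered_gaussian_integral[OF X \<sigma>(2)[unfolded g_def]]
  have g2: "(\<integral>\<omega>. (g i \<omega>)\<^sup>2 \<partial>M) = (\<sigma> i)\<^sup>2" "integrable M (\<lambda>\<omega>. (g i \<omega>)\<^sup>2)" for i
    using std_normal_second_moment
    by (simp_all add: g_def tr(1)[of "\<lambda>x. x\<^sup>2"] tr(2)[of "\<lambda>x. x\<^sup>2"] power_mult_distrib)
  have g4: "(\<integral>\<omega>. (g i \<omega>) ^ 4 \<partial>M) = 3 * (\<sigma> i) ^ 4" "integrable M (\<lambda>\<omega>. (g i \<omega>) ^ 4)" for i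
    using std_normal_fourth_moment
    by (simp_all add: g_def tr(1)[of "\<lambda>x. x ^ 4"] tr(2)[of "\<lambda>x. x ^ 4"] power_mult_distrib)
  define V where "V N \<omega> = (\<Sum>i<N. (g i \<omega>)\<^sup>2)" for N \<omega>
  define m where "m N = (\<Sum>i<N. (\<sigma> i)\<^sup>2)" for N
  \<comment> \<open>The summand \<open>(1 / 2) ^ i\<close> keeps the weights positive where
    \<open>\<sigma> i = 0\<close> and adds less than 2 to any partial sum.\<close>
  define w where "w i = (\<sigma> i)\<^sup>2 + (1 / 2) ^ i" for i
  have V[measurable]: "V N \<in> borel_measurable M" for N unfolding V_def by measurable
  have EV: "(\<integral>\<omega>. V N \<omega> \<partial>M) = m N" "integrable M (V N)" for N
    unfolding V_def m_def by (simp_all add: g2)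
  have V_le: "V N \<omega> \<le> (norm (X \<omega>))\<^sup>2" for N \<omega>
    unfolding V_def g_def using sum_norm_le[of "{..<N}" "X \<omega>"] by (simp add: inner_commute)
  have w: "0 < w i" "(\<sigma> i)\<^sup>2 \<le> w i" for i by (simp_all add: w_def add_nonneg_pos)
  have w_sum: "(\<Sum>i<N. w i) \<le> m N + 2" for N
  proof -
    have "(\<Sum>i<N. (1 / 2 :: real) ^ i) = 2 - 2 * (1 / 2) ^ N" by (simp add: sum_gp_strict)
    also have "\<dots> \<le> 2" by simp
    finally show ?thesis by (simp add: w_def m_def sum.distrib)
  qed
  \<comment> \<open>With the weights \<open>w\<close>, the Cauchy-Schwarz inequality bounds the
    square of \<open>V N\<close> by a multiple of \<open>Q N\<close>, whose mean involves only
    fourth moments of single coordinates and not their joint law.\<close>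
  define Q where "Q N \<omega> = (\<Sum>i<N. (g i \<omega>) ^ 4 / w i)" for N \<omega>
  have V2: "(V N \<omega>)\<^sup>2 \<le> (m N + 2) * Q N \<omega>" for N \<omega>
  proof -
    have "(V N \<omega>)\<^sup>2 = (\<Sum>i<N. sqrt (w i) * ((g i \<omega>)\<^sup>2 / sqrt (w i)))\<^sup>2"
      unfolding V_def using w(1) by (simp add: less_imp_neq[THEN not_sym])
    also have "\<dots> \<le> (\<Sum>i<N. (sqrt (w i))\<^sup>2) * (\<Sum>i<N. ((g i \<omega>)\<^sup>2 / sqrt (w i))\<^sup>2)"
      by (rule Cauchy_Schwarz_ineq_sum)
    also have "\<dots> = (\<Sum>i<N. w i) * Q N \<omega>"
      unfolding Q_def using w(1) by (simp add: power_divide less_imp_le)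
    also have "\<dots> \<le> (m N + 2) * Q N \<omega>"
      using w w_sum unfolding Q_def by (intro mult_right_mono sum_nonneg) (auto simp: less_imp_le)
    finally show ?thesis .
  qed
  have EQ: "(\<integral>\<omega>. Q N \<omega> \<partial>M) \<le> 3 * (m N + 2)" "integrable M (Q N)" for N
  proof -
    show "integrable M (Q N)" unfolding Q_def by (simp add: g4)
    have "(\<integral>\<omega>. Q N \<omega> \<partial>M) = (\<Sum>i<N. 3 * (\<sigma> i) ^ 4 / w i)" unfolding Q_def by (simp add: g4)
    also have "\<dots> \<le> (\<Sum>i<N. 3 * w i)"
    proof (rule sum_mono)
      fix i
      have "((\<sigma> i)\<^sup>2)\<^sup>2 \<le> (w i)\<^sup>2" using w[of i] by (intro power_mono) auto
      then show "3 * (\<sigma> i) ^ 4 / w i \<le> 3 * w i"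
        using w(1)[of i] by (simp add: divide_le_eq power2_eq_square power4_eq_xxxx mult_ac)
    qed
    also have "\<dots> \<le> 3 * (m N + 2)" using w_sum[of N] by (simp add: sum_distrib_left[symmetric])
    finally show "(\<integral>\<omega>. Q N \<omega> \<partial>M) \<le> 3 * (m N + 2)" .
  qed
  have PZ: "1 / 48 \<le> prob {\<omega>\<in>space M. m N / 2 < V N \<omega>}" if m: "2 \<le> m N" for N
  proof -
    let ?E = "{\<omega>\<in>space M. m N / 2 < V N \<omega>}"
    have E: "?E \<in> sets M" by measurable
    \<comment> \<open>On the event, \<open>48 * m N * V N \<omega>\<close> is at most
      \<open>(V N \<omega>)\<^sup>2 + 576 * (m N)\<^sup>2\<close>. The splitting is such that the
      second-moment term is at most \<open>m N / 4\<close> in the mean and \<open>12 * m N\<close>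
      times the probability has to make up for the last quarter.\<close>
    have pt: "V N \<omega> \<le> m N / 2 + (m N + 2) * Q N \<omega> / (48 * m N) + 12 * m N * indicator ?E \<omega>"
      if "\<omega> \<in> space M" for \<omega>
    proof (cases "m N / 2 < V N \<omega>")
      case True
      have "(V N \<omega> - 24 * m N)\<^sup>2 = (V N \<omega>)\<^sup>2 + 576 * (m N)\<^sup>2 - 48 * m N * V N \<omega>"
        by (simp add: power2_eq_square algebra_simps)
      then have "48 * m N * V N \<omega> \<le> (V N \<omega>)\<^sup>2 + 576 * (m N)\<^sup>2"
        using zero_le_power2[of "V N \<omega> - 24 * m N"] by linarith
      then have "48 * m N * V N \<omega> \<le> (m N + 2) * Q N \<omega> + 576 * (m N)\<^sup>2" using V2[of N \<omega>] by linarith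
      then have "V N \<omega> \<le> (m N + 2) * Q N \<omega> / (48 * m N) + 12 * m N"
        using m by (simp add: field_simps power2_eq_square)
      then show ?thesis using True that m by simp
    next
      case False
      have "0 \<le> (m N + 2) * Q N \<omega> / (48 * m N)"
        using m w(1) unfolding Q_def by (intro divide_nonneg_nonneg mult_nonneg_nonneg sum_nonneg) (auto simp: less_imp_le)
      then show ?thesis using False by simp
    qed
    have iE: "integrable M (indicator ?E :: _ \<Rightarrow> real)" using E by (simp add: integrable_indicator_iff less_top[symmetric])
    have "m N \<le> (\<integral>\<omega>. m N / 2 + (m N + 2) * Q N \<omega> / (48 * m N) + 12 * m N * indicator ?E \<omega> \<partial>M)"
      unfolding EV(1)[symmetric, of N] using EV(2) EQ(2) iE pt
      by (intro integral_mono) (auto simp: EV(1))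
    also have "\<dots> = m N / 2 + (m N + 2) * (\<integral>\<omega>. Q N \<omega> \<partial>M) / (48 * m N) + 12 * m N * prob ?E"
      using EQ(2) iE E by (simp add: prob_space)
    also have "\<dots> \<le> m N / 2 + m N / 4 + 12 * m N * prob ?E"
    proof -
      have "(m N + 2) * (\<integral>\<omega>. Q N \<omega> \<partial>M) \<le> (2 * m N) * (3 * (2 * m N))"
        using m EQ(1)[of N] w(1) by (intro mult_mono) (auto simp: Q_def less_imp_le intro!: integral_nonneg_AE sum_nonneg)
      then have "(m N + 2) * (\<integral>\<omega>. Q N \<omega> \<partial>M) / (48 * m N) \<le> (2 * m N) * (3 * (2 * m N)) / (48 * m N)"
        using m by (intro divide_right_mono) auto
      also have "\<dots> = m N / 4" using m by simp
      finally have "(m N + 2) * (\<integral>\<omega>. Q N \<omega> \<partial>M) / (48 * m N) \<le> m N / 4" .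
      then show ?thesis by simp
    qed
    finally have "m N * (1 / 48) \<le> m N * prob ?E" by simp
    then show ?thesis by (rule mult_left_le_imp_le) (use m in simp)
  qed
  have "(\<lambda>k. prob {\<omega>\<in>space M. real k < (norm (X \<omega>))\<^sup>2}) \<longlonglongrightarrow> prob (\<Inter>k. {\<omega>\<in>space M. real k < (norm (X \<omega>))\<^sup>2})"
    by (rule finite_Lim_measure_decseq) (auto simp: decseq_def image_subset_iff)
  moreover have "(\<Inter>k. {\<omega>\<in>space M. real k < (norm (X \<omega>))\<^sup>2}) = {}"
  proof (rule equals0I)
    fix \<omega> assume \<omega>: "\<omega> \<in> (\<Inter>k. {\<omega>\<in>space M. real k < (norm (X \<omega>))\<^sup>2})"
    obtain k where "(norm (X \<omega>))\<^sup>2 < real k" using reals_Archimedean2 by blast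
    moreover have "real k < (norm (X \<omega>))\<^sup>2" using \<omega> by blast
    ultimately show False by simp
  qed
  ultimately have "(\<lambda>k. prob {\<omega>\<in>space M. real k < (norm (X \<omega>))\<^sup>2}) \<longlonglongrightarrow> 0" by simp
  \<comment> \<open>The norm is finite everywhere, so some level \<open>k\<close> is exceeded with
    probability below 1/48; hence no \<open>m N\<close> can be larger than
    \<open>2 * real k + 2\<close>.\<close>
  from order_tendstoD(2)[OF this, of "1 / 48"] obtain k where
    k: "prob {\<omega>\<in>space M. real k < (norm (X \<omega>))\<^sup>2} < 1 / 48" by (auto simp: eventually_sequentially)
  have m_bound: "m N \<le> 2 * real k + 2" for N
  proof (rule ccontr)
    assume neg: "\<not> m N \<le> 2 * real k + 2"
    then have "real k < (norm (X \<omega>))\<^sup>2" if "m N / 2 < V N \<omega>" for \<omega>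
      using V_le[of N \<omega>] that by linarith
    then have "{\<omega>\<in>space M. m N / 2 < V N \<omega>} \<subseteq> {\<omega>\<in>space M. real k < (norm (X \<omega>))\<^sup>2}"
      by blast
    then have "prob {\<omega>\<in>space M. m N / 2 < V N \<omega>} \<le> prob {\<omega>\<in>space M. real k < (norm (X \<omega>))\<^sup>2}"
      by (intro finite_measure_mono) auto
    then show False using PZ[of N] k neg by simp
  qed
  have V_lim: "(\<lambda>N. V N \<omega>) \<longlonglongrightarrow> (norm (X \<omega>))\<^sup>2" for \<omega>
    using Parseval[of "X \<omega>" "X \<omega>"]
    by (simp add: sums_def V_def g_def inner_commute power2_eq_square power2_norm_eq_inner[symmetric] flip: power2_norm_eq_inner)
  show ?thesis
  \<comment> \<open>Fatou's lemma along the partial sums of Parseval's identity.\<close>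
  proof (rule integrableI_nonneg)
    have "(\<integral>\<^sup>+\<omega>. ennreal ((norm (X \<omega>))\<^sup>2) \<partial>M) = (\<integral>\<^sup>+\<omega>. liminf (\<lambda>N. ennreal (V N \<omega>)) \<partial>M)"
      by (intro nn_integral_cong sym[OF lim_imp_Liminf] tendsto_ennrealI V_lim) simp
    also have "\<dots> \<le> liminf (\<lambda>N. \<integral>\<^sup>+\<omega>. ennreal (V N \<omega>) \<partial>M)" by (intro nn_integral_liminf) measurable
    also have "\<dots> \<le> liminf (\<lambda>N. ennreal (2 * real k + 2))"
    proof (intro Liminf_mono always_eventually allI)
      fix N
      have "(\<integral>\<^sup>+\<omega>. ennreal (V N \<omega>) \<partial>M) = ennreal (m N)"
        unfolding EV(1)[symmetric] by (rule nn_integral_eq_integral[OF EV(2)]) (simp add: V_def sum_nonneg)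
      then show "(\<integral>\<^sup>+\<omega>. ennreal (V N \<omega>) \<partial>M) \<le> ennreal (2 * real k + 2)"
        using ennreal_leI[OF m_bound[of N]] by (simp only:)
    qed
    also have "\<dots> = ennreal (2 * real k + 2)" by (rule Liminf_const) simp
    also have "\<dots> < \<infinity>" by (simp only: infinity_ennreal_def ennreal_less_top)
    finally show "(\<integral>\<^sup>+\<omega>. ennreal ((norm (X \<omega>))\<^sup>2) \<partial>M) < \<infinity>" .
  qed auto
qed

section \<open>Uniqueness of measures from characteristic functionals\<close>

text \<open>After division by the common total mass \<open>W\<close>, which is the value at
  \<open>s = 0\<close>, both sides are probability laws on the line with equal characteristic
  functions. If \<open>W\<close> is 0, both weights vanish almost everywhere.\<close>

lemma weighted_char_unique:
  assumes "prob_space M" "prob_space N"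
    and h[measurable]: "h \<in> borel_measurable M" and k[measurable]: "k \<in> borel_measurable N"
    and w[measurable]: "w \<in> borel_measurable M" and w_bound: "\<And>x. 0 \<le> w x" "\<And>x. w x \<le> B"
    and v[measurable]: "v \<in> borel_measurable N" and v_bound: "\<And>x. 0 \<le> v x" "\<And>x. v x \<le> B"
    and eq: "\<And>s. (\<integral>x. w x *\<^sub>R iexp (s * h x) \<partial>M) = (\<integral>x. v x *\<^sub>R iexp (s * k x) \<partial>N)"
    and A[measurable]: "A \<in> sets borel"
  shows "(\<integral>x. w x * indicator A (h x) \<partial>M) = (\<integral>x. v x * indicator A (k x) \<partial>N)"
proof -
  interpret M: prob_space M by fact
  interpret N: prob_space N by fact
  have wi: "integrable M w" by (rule M.integrable_const_bound[where B=B]) (use w_bound in auto)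
  have vi: "integrable N v" by (rule N.integrable_const_bound[where B=B]) (use v_bound in auto)
  define W where "W = (\<integral>x. w x \<partial>M)"
  have "complex_of_real W = complex_of_real (\<integral>x. v x \<partial>N)"
    using eq[of 0] by (simp add: W_def scaleR_conv_of_real)
  then have W': "W = (\<integral>x. v x \<partial>N)" by (simp only: of_real_eq_iff)
  show ?thesis
  proof (cases "W = 0")
    case True
    have "AE x in M. w x = 0" using True wi w_bound by (simp add: W_def integral_nonneg_eq_0_iff_AE)
    then have "(\<integral>x. w x * indicator A (h x) \<partial>M) = (\<integral>x. 0 \<partial>M)" by (intro integral_cong_AE) auto
    moreover have "AE x in N. v x = 0" using True vi v_bound by (simp add: W' integral_nonneg_eq_0_iff_AE)
    then have "(\<integral>x. v x * indicator A (k x) \<partial>N) = (\<integral>x. 0 \<partial>N)" by (intro integral_cong_AE) auto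
    ultimately show ?thesis by simp
  next
    case False
    have "0 \<le> W" unfolding W_def using w_bound by (intro integral_nonneg_AE) simp
    then have W: "0 < W" using False by simp
    have gen: "real_distribution (distr (density K (\<lambda>x. ennreal (u x / W))) borel g)"
      "char (distr (density K (\<lambda>x. ennreal (u x / W))) borel g) s = (1 / W) *\<^sub>R (\<integral>x. u x *\<^sub>R iexp (s * g x) \<partial>K)"
      "measure (distr (density K (\<lambda>x. ennreal (u x / W))) borel g) A = (1 / W) * (\<integral>x. u x * indicator A (g x) \<partial>K)"
      if K: "prob_space K" and [measurable]: "u \<in> borel_measurable K" "g \<in> borel_measurable K"
        and u: "\<And>x. 0 \<le> u x" "integrable K u" "W = (\<integral>x. u x \<partial>K)"
      for K :: "'c measure" and u g s
    proof -
      interpret K: prob_space K by fact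
      have "emeasure (density K (\<lambda>x. ennreal (u x / W))) (space K) = (\<integral>\<^sup>+x. ennreal (u x / W) \<partial>K)"
        by (subst emeasure_density) (auto intro!: nn_integral_cong)
      also have "\<dots> = ennreal (\<integral>x. u x / W \<partial>K)"
        by (rule nn_integral_eq_integral) (use u W in auto)
      also have "\<dots> = 1" using u(3) W by simp
      finally have "prob_space (density K (\<lambda>x. ennreal (u x / W)))" by (intro prob_spaceI) simp
      then interpret D: prob_space "density K (\<lambda>x. ennreal (u x / W))" .
      show "real_distribution (distr (density K (\<lambda>x. ennreal (u x / W))) borel g)"
        by (rule D.real_distribution_distr) simp
      show "char (distr (density K (\<lambda>x. ennreal (u x / W))) borel g) s = (1 / W) *\<^sub>R (\<integral>x. u x *\<^sub>R iexp (s * g x) \<partial>K)"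
        unfolding char_def using u W
        by (simp add: integral_distr integral_density divide_inverse_commute flip: scaleR_scaleR)
      have "(1 / W) * (\<integral>x. u x * indicator A (g x) \<partial>K) = (\<integral>x. (u x / W) *\<^sub>R indicator A (g x) \<partial>K)"
        by (subst integral_mult_right_zero[symmetric]) (simp add: field_simps)
      also have "\<dots> = (\<integral>x. indicator A (g x) \<partial>density K (\<lambda>x. ennreal (u x / W)))"
        using u(1) W by (subst integral_density) auto
      also have "\<dots> = (\<integral>x. indicator A x \<partial>distr (density K (\<lambda>x. ennreal (u x / W))) borel g)"
        by (rule integral_distr[symmetric]) auto
      also have "\<dots> = measure (distr (density K (\<lambda>x. ennreal (u x / W))) borel g) A" by simp
      finally show "measure (distr (density K (\<lambda>x. ennreal (u x / W))) borel g) A = (1 / W) * (\<integral>x. u x * indicator A (g x) \<partial>K)" ..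
    qed
    note gM = gen[OF M.prob_space_axioms w h w_bound(1) wi W_def]
    note gN = gen[OF N.prob_space_axioms v k v_bound(1) vi W']
    have "distr (density M (\<lambda>x. ennreal (w x / W))) borel h = distr (density N (\<lambda>x. ennreal (v x / W))) borel k"
      by (rule Levy_uniqueness[OF gM(1) gN(1)]) (rule ext, simp only: gM(2) gN(2) eq)
    then have "measure (distr (density M (\<lambda>x. ennreal (w x / W))) borel h) A =
        measure (distr (density N (\<lambda>x. ennreal (v x / W))) borel k) A" by (simp only:)
    then have "(1 / W) * (\<integral>x. w x * indicator A (h x) \<partial>M) = (1 / W) * (\<integral>x. v x * indicator A (k x) \<partial>N)"
      unfolding gM(3) gN(3) .
    then show ?thesis using W by auto
  qed
qed

lemma iexp_real: "iexp x = complex_of_real (cos x) + \<i> * complex_of_real (sin x)"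
  by (simp add: complex_eq_iff Re_exp Im_exp)

text \<open>Coordinates are treated one at a time: the weights \<open>w (1 + cos v)\<close> and \<open>w (1 + sin v)\<close> are
  nonnegative, so the uniqueness theorem on the line applies to them.\<close>

lemma char_functional_unique:
  fixes M N :: "'a measure"
  assumes "prob_space M" "prob_space N" and sets: "sets N = sets M"
    and L_meas: "\<And>h. h \<in> L \<Longrightarrow> h \<in> borel_measurable M"
    and L0: "(\<lambda>x. 0) \<in> L" and L_lin: "\<And>h k s. h \<in> L \<Longrightarrow> k \<in> L \<Longrightarrow> (\<lambda>x. h x + s * k x) \<in> L"
    and gen: "(\<lambda>x. x) \<in> measurable (sigma (space M) {h -` A \<inter> space M | h A. h \<in> L \<and> A \<in> sets borel}) M"
    and eq: "\<And>h. h \<in> L \<Longrightarrow> (\<integral>x. iexp (h x) \<partial>M) = (\<integral>x. iexp (h x) \<partial>N)"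
  shows "M = N"
proof -
  interpret M: prob_space M by fact
  interpret N: prob_space N by fact
  have sp: "space N = space M" using sets by (rule sets_eq_imp_space_eq)
  have L_measN: "h \<in> borel_measurable N" if "h \<in> L" for h
    using L_meas[OF that] measurable_cong_sets[OF sets refl] by auto
  define ind where "ind hs x = (if \<forall>(h, A)\<in>set hs. h x \<in> A then 1 else 0 :: real)" for hs :: "(('a \<Rightarrow> real) \<times> real set) list" and x
  define ok where "ok hs \<longleftrightarrow> (\<forall>(h, A)\<in>set hs. h \<in> L \<and> A \<in> sets borel)" for hs :: "(('a \<Rightarrow> real) \<times> real set) list"
  have ind_Cons: "ind ((h, A) # hs) x = ind hs x * indicator A (h x)" for h A hs x
    by (simp add: ind_def)
  have ind_meas: "ind hs \<in> borel_measurable M" if "ok hs" for hs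
    using that
  proof (induction hs)
    case Nil
    then show ?case by (simp add: ind_def)
  next
    case (Cons p hs)
    obtain h A where p: "p = (h, A)" by (cases p)
    then have h: "h \<in> borel_measurable M" "A \<in> sets borel" "ok hs" using Cons.prems L_meas by (auto simp: ok_def)
    have "(\<lambda>x. ind hs x * indicator A (h x)) \<in> borel_measurable M"
      using Cons.IH[OF h(3)] measurable_compose[OF h(1) borel_measurable_indicator[OF h(2)]]
      by (intro borel_measurable_times) simp_all
    then show ?case by (simp add: p ind_Cons[abs_def])
  qed
  then have ind_measN: "ind hs \<in> borel_measurable N" if "ok hs" for hs
    using that measurable_cong_sets[OF sets refl] by auto
  have ind01: "0 \<le> ind hs x" "ind hs x \<le> 1" for hs x by (simp_all add: ind_def)
  \<comment> \<open>Each induction step adds the indicator of one more functional, while the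
    exponent stays an arbitrary element of \<open>L\<close>.\<close>
  have main: "(\<integral>x. ind hs x *\<^sub>R iexp (v x) \<partial>M) = (\<integral>x. ind hs x *\<^sub>R iexp (v x) \<partial>N)" if "ok hs" "v \<in> L" for hs v
    using that
  proof (induction hs arbitrary: v)
    case Nil
    then show ?case using eq by (simp add: ind_def)
  next
    case (Cons p hs)
    obtain h A where p: "p = (h, A)" by (cases p)
    have h: "h \<in> L" and A[measurable]: "A \<in> sets borel" and hs: "ok hs" using Cons.prems(1) by (auto simp: ok_def p)
    note IH = Cons.IH[OF hs]
    note vL = Cons.prems(2)
    have m[measurable]: "h \<in> borel_measurable M" "v \<in> borel_measurable M" "ind hs \<in> borel_measurable M"
      "h \<in> borel_measurable N" "v \<in> borel_measurable N" "ind hs \<in> borel_measurable N"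
      using h vL hs L_meas L_measN ind_meas ind_measN by auto
    have int: "integrable K (\<lambda>x. ind hs x *\<^sub>R iexp (u x))"
      if "prob_space K" "u \<in> borel_measurable K" "ind hs \<in> borel_measurable K" for K and u :: "'a \<Rightarrow> real"
    proof -
      interpret K: prob_space K by fact
      show ?thesis
        by (rule K.integrable_const_bound[where B=1]) (use that ind01 in auto)
    qed
    have tw: "(\<integral>x. (ind hs x * indicator A (h x)) \<partial>M) = (\<integral>x. (ind hs x * indicator A (h x)) \<partial>N)"
      by (rule weighted_char_unique[where B=1, OF M.prob_space_axioms N.prob_space_axioms])
        (use ind01 IH[OF L_lin[OF L0 h]] in simp_all)
    have shift: "(\<integral>x. (ind hs x * (1 + cos (v x + a))) *\<^sub>R iexp (s * h x) \<partial>M) =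
        (\<integral>x. (ind hs x * (1 + cos (v x + a))) *\<^sub>R iexp (s * h x) \<partial>N)" for a s
    proof -
      have sh: "(\<lambda>x. s * h x) \<in> L" using L_lin[OF L0 h, of s] by simp
      have p1: "(\<lambda>x. s * h x + v x) \<in> L" using L_lin[OF sh vL, of 1] by simp
      have p2: "(\<lambda>x. s * h x - v x) \<in> L" using L_lin[OF sh vL, of "-1"] by simp
      \<comment> \<open>Writing the cosine with exponentials turns the weight into shifts of the
        exponent by \<open>v\<close> and \<open>- v\<close>, which stay in \<open>L\<close>.\<close>
      have pt: "(ind hs x * (1 + cos (v x + a))) *\<^sub>R iexp (s * h x) =
          ind hs x *\<^sub>R iexp (s * h x) + (iexp a / 2) * (ind hs x *\<^sub>R iexp (s * h x + v x))
          + (iexp (- a) / 2) * (ind hs x *\<^sub>R iexp (s * h x - v x))" for x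
      proof -
        have alg: "i0 * (1 + (E1 + E2) / 2) * F = i0 * (F + (F * E1 + F * E2) / 2)" for i0 E1 E2 F :: complex
          by (simp add: field_simps)
        have "complex_of_real (cos (v x + a)) = (iexp (v x + a) + iexp (- (v x + a))) / 2"
          by (simp only: iexp_real cos_minus sin_minus) simp
        then have "(ind hs x * (1 + cos (v x + a))) *\<^sub>R iexp (s * h x) =
          complex_of_real (ind hs x) * (iexp (s * h x) + (iexp (s * h x) * iexp (v x + a) + iexp (s * h x) * iexp (- (v x + a))) / 2)"
          by (simp only: scaleR_conv_of_real of_real_mult[of "ind hs x"] of_real_add[of 1] of_real_1 alg)
        moreover have "iexp (s * h x) * iexp (v x + a) = iexp a * iexp (s * h x + v x)"
          "iexp (s * h x) * iexp (- (v x + a)) = iexp (- a) * iexp (s * h x - v x)"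
          by (simp_all only: exp_add[symmetric]) (simp_all add: algebra_simps)
        moreover have "i0 * (F + (ea * G1 + eb * G2) / 2) = i0 * F + ea / 2 * (i0 * G1) + eb / 2 * (i0 * G2)"
          for i0 F ea eb G1 G2 :: complex by (simp add: field_simps)
        ultimately show ?thesis by (simp only: scaleR_conv_of_real)
      qed
      have split: "(\<integral>x. F0 x + c1 * F1 x + c2 * F2 x \<partial>K) = (\<integral>x. F0 x \<partial>K) + c1 * (\<integral>x. F1 x \<partial>K) + c2 * (\<integral>x. F2 x \<partial>K)"
        if "integrable K F0" "integrable K F1" "integrable K F2" for K and F0 F1 F2 :: "'a \<Rightarrow> complex" and c1 c2
        using that by simp
      have iM: "integrable M (\<lambda>x. ind hs x *\<^sub>R iexp (u x))" if "u \<in> L" for u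
        by (rule int[OF M.prob_space_axioms L_meas[OF that] m(3)])
      have iN: "integrable N (\<lambda>x. ind hs x *\<^sub>R iexp (u x))" if "u \<in> L" for u
        by (rule int[OF N.prob_space_axioms L_measN[OF that] m(6)])
      show ?thesis
        unfolding pt split[OF iM[OF sh] iM[OF p1] iM[OF p2]] split[OF iN[OF sh] iN[OF p1] iN[OF p2]]
          IH[OF sh] IH[OF p1] IH[OF p2] ..
    qed
    have tc: "(\<integral>x. (ind hs x * (1 + cos (v x + a))) * indicator A (h x) \<partial>M) =
        (\<integral>x. (ind hs x * (1 + cos (v x + a))) * indicator A (h x) \<partial>N)" for a
    proof -
      have b1: "0 \<le> ind hs x * (1 + cos (v x + a))" for x
        using ind01[of hs x] cos_ge_minus_one[of "v x + a"] by (intro mult_nonneg_nonneg) linarith+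
      have b2: "ind hs x * (1 + cos (v x + a)) \<le> 2" for x
        using mult_mono[of "ind hs x" 1 "1 + cos (v x + a)" 2] ind01[of hs x] cos_ge_minus_one[of "v x + a"] cos_le_one[of "v x + a"] by simp
      show ?thesis
        by (rule weighted_char_unique[where B=2, OF M.prob_space_axioms N.prob_space_axioms m(1) m(4) _ b1 b2 _ b1 b2 shift A])
          simp_all
    qed
    have tcos: "(\<integral>x. ind ((h, A) # hs) x * cos (v x + a) \<partial>M) = (\<integral>x. ind ((h, A) # hs) x * cos (v x + a) \<partial>N)" for a
    proof -
      have split: "(\<integral>x. (ind hs x * (1 + cos (v x + a))) * indicator A (h x) \<partial>K) =
         (\<integral>x. ind hs x * indicator A (h x) \<partial>K) + (\<integral>x. ind ((h, A) # hs) x * cos (v x + a) \<partial>K)"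
        if "prob_space K" and [measurable]: "h \<in> borel_measurable K" "v \<in> borel_measurable K" "ind hs \<in> borel_measurable K" for K
      proof -
        interpret K: prob_space K by fact
        have 1: "integrable K (\<lambda>x. ind hs x * indicator A (h x))"
          by (rule K.integrable_const_bound[where B=1]) (use ind01 in \<open>auto simp: indicator_def\<close>)
        have 2: "integrable K (\<lambda>x. ind ((h, A) # hs) x * cos (v x + a))"
          unfolding ind_Cons
          by (rule K.integrable_const_bound[where B=1])
            (use ind01 in \<open>auto simp: indicator_def abs_mult intro!: mult_le_one\<close>)
        show ?thesis
          unfolding Bochner_Integration.integral_add[OF 1 2, symmetric] by (simp add: ind_Cons algebra_simps)
      qed
      from split[OF M.prob_space_axioms m(1-3)] split[OF N.prob_space_axioms m(4-6)] tc[of a] tw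
      show ?thesis by simp
    qed
    \<comment> \<open>The sine is a cosine shifted by \<open>- pi / 2\<close>, so real and imaginary
      parts are both of the form treated in \<open>tcos\<close>.\<close>
    have fin: "(\<integral>x. ind ((h, A) # hs) x *\<^sub>R iexp (v x) \<partial>K) = complex_of_real (\<integral>x. ind ((h, A) # hs) x * cos (v x + 0) \<partial>K)
         + \<i> * complex_of_real (\<integral>x. ind ((h, A) # hs) x * cos (v x + (- pi / 2)) \<partial>K)"
      if "prob_space K" and [measurable]: "h \<in> borel_measurable K" "v \<in> borel_measurable K" "ind hs \<in> borel_measurable K" for K
    proof -
      interpret K: prob_space K by fact
      have i: "integrable K (\<lambda>x. complex_of_real (ind ((h, A) # hs) x * cos (v x + a)))" for a
        unfolding ind_Cons
        by (rule K.integrable_const_bound[where B=1])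
          (use ind01 in \<open>auto simp: indicator_def norm_mult abs_mult intro!: mult_le_one\<close>)
      have "ind ((h, A) # hs) x *\<^sub>R iexp (v x) = complex_of_real (ind ((h, A) # hs) x * cos (v x + 0))
        + \<i> * complex_of_real (ind ((h, A) # hs) x * cos (v x + (- pi / 2)))" for x
        by (simp only: iexp_real) (simp add: cos_diff scaleR_conv_of_real algebra_simps)
      then show ?thesis using i[of 0] i[of "- pi / 2"] by (simp del: of_real_mult)
    qed
    show ?case
      unfolding p fin[OF M.prob_space_axioms m(1-3)] fin[OF N.prob_space_axioms m(4-6)] tcos ..
  qed
  \<comment> \<open>Finite lists of conditions give a generator stable under intersections:
    concatenating lists intersects the sets.\<close>
  define E where "E = {{x\<in>space M. \<forall>(h, A)\<in>set hs. h x \<in> A} | hs. ok hs}"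
  have prob_eq: "measure M {x\<in>space M. \<forall>(h, A)\<in>set hs. h x \<in> A} = measure N {x\<in>space M. \<forall>(h, A)\<in>set hs. h x \<in> A}" 
    and E_sets: "{x\<in>space M. \<forall>(h, A)\<in>set hs. h x \<in> A} \<in> sets M" if ok: "ok hs" for hs
  proof -
    have [measurable]: "ind hs \<in> borel_measurable M" using ind_meas[OF ok] .
    have "ind hs x = 1 \<longleftrightarrow> (\<forall>(h, A)\<in>set hs. h x \<in> A)" for x by (simp add: ind_def)
    then have eqset: "{x\<in>space M. \<forall>(h, A)\<in>set hs. h x \<in> A} = ind hs -` {1} \<inter> space M" by blast
    show S: "{x\<in>space M. \<forall>(h, A)\<in>set hs. h x \<in> A} \<in> sets M" unfolding eqset by (rule measurable_sets[OF ind_meas[OF ok]]) simp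
    have I: "measure K {x\<in>space M. \<forall>(h, A)\<in>set hs. h x \<in> A} = (\<integral>x. ind hs x \<partial>K)"
      if "sets K = sets M" for K
    proof -
      have "space K = space M" using that by (rule sets_eq_imp_space_eq)
      moreover have "(\<integral>x. ind hs x \<partial>K) = (\<integral>x. indicator {x\<in>space M. \<forall>(h, A)\<in>set hs. h x \<in> A} x \<partial>K)"
        using \<open>space K = space M\<close> by (intro Bochner_Integration.integral_cong) (auto simp: ind_def)
      ultimately show ?thesis using S that by simp
    qed
    have "complex_of_real (\<integral>x. ind hs x \<partial>M) = complex_of_real (\<integral>x. ind hs x \<partial>N)"
      using main[OF ok L0] by (simp add: scaleR_conv_of_real)
    then show "measure M {x\<in>space M. \<forall>(h, A)\<in>set hs. h x \<in> A} = measure N {x\<in>space M. \<forall>(h, A)\<in>set hs. h x \<in> A}"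
      using I[of M] I[of N] sets by simp
  qed
  have E_sub: "E \<subseteq> sets M" using E_sets by (auto simp: E_def)
  let ?G = "{h -` A \<inter> space M | h A. h \<in> L \<and> A \<in> sets borel}"
  have G_E: "?G \<subseteq> E"
  proof
    fix S assume "S \<in> ?G"
    then obtain h A where "S = h -` A \<inter> space M" "h \<in> L" "A \<in> sets borel" by blast
    then show "S \<in> E" unfolding E_def by (auto simp: ok_def intro!: exI[of _ "[(h, A)]"])
  qed
  have GP: "?G \<subseteq> Pow (space M)" by auto
  have EP: "E \<subseteq> Pow (space M)" by (auto simp: E_def)
  have gen_eq: "sets M = sigma_sets (space M) E"
  proof
    show "sets M \<subseteq> sigma_sets (space M) E"
    proof
      fix S assume S: "S \<in> sets M"
      from measurable_sets[OF gen S] have "S \<in> sigma_sets (space M) ?G"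
        using GP sets.sets_into_space[OF S] by (simp add: Int_absorb2)
      then show "S \<in> sigma_sets (space M) E" using sigma_sets_mono'[OF G_E] by blast
    qed
    show "sigma_sets (space M) E \<subseteq> sets M" by (rule sets.sigma_sets_subset[OF E_sub])
  qed
  show ?thesis
  proof (rule measure_eqI_generator_eq[where E=E and \<Omega>="space M" and A="\<lambda>_. space M"])
    show "Int_stable E"
    proof (rule Int_stableI)
      fix S T assume "S \<in> E" "T \<in> E"
      then obtain hs ks where "S = {x\<in>space M. \<forall>(h, A)\<in>set hs. h x \<in> A}" "ok hs"
        "T = {x\<in>space M. \<forall>(h, A)\<in>set ks. h x \<in> A}" "ok ks" by (auto simp: E_def)
      then show "S \<inter> T \<in> E" unfolding E_def
        by (intro CollectI exI[of _ "hs @ ks"]) (auto simp: ok_def)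
    qed
    show "emeasure M X = emeasure N X" if "X \<in> E" for X
      using that prob_eq by (auto simp: E_def M.emeasure_eq_measure N.emeasure_eq_measure)
    show "range (\<lambda>_. space M) \<subseteq> E" by (auto simp: E_def ok_def intro!: exI[of _ "[]"])
  qed (use EP gen_eq sets in auto)
qed

section \<open>Rotation invariance of Gaussian samples\<close>

abbreviation seqM :: "(nat \<Rightarrow> 'h::topological_space) measure" where
  "seqM \<equiv> PiM UNIV (\<lambda>_. borel)"

definition seq_functional :: "nat \<Rightarrow> (nat \<Rightarrow> 'h) \<Rightarrow> (nat \<Rightarrow> 'h) \<Rightarrow> (nat \<Rightarrow> 'h::real_inner) \<times> (nat \<Rightarrow> 'h) \<Rightarrow> real" where
  "seq_functional m c d p = (\<Sum>j<m. inner (fst p j) (c j) + inner (snd p j) (d j))"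

lemma measurable_seq_component[measurable]:
  "(\<lambda>z. z j) \<in> borel_measurable (seqM :: (nat \<Rightarrow> 'h::topological_space) measure)"
  by (rule measurable_component_singleton) simp

lemma measurable_seqI:
  assumes "\<And>j. (\<lambda>x. f x j) \<in> borel_measurable N"
  shows "f \<in> measurable N (seqM :: (nat \<Rightarrow> 'h::topological_space) measure)"
proof -
  have "(\<lambda>x j. f x j) \<in> measurable N (seqM :: (nat \<Rightarrow> 'h) measure)"
    by (rule measurable_PiM_single') (auto simp: assms)
  then show ?thesis by simp
qed

lemma measurable_seq_functional[measurable]:
  fixes c d :: "nat \<Rightarrow> 'h::{real_inner,second_countable_topology}"
  shows "seq_functional m c d \<in> borel_measurable (seqM \<Otimes>\<^sub>M seqM)"
  unfolding seq_functional_def[abs_def] by measurable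

text \<open>Finite linear functionals of both sequences generate the product sigma-algebra, since a
  component is measurable once all its inner products are.\<close>

lemma seq_functional_unique:
  fixes P Q :: "((nat \<Rightarrow> 'h::{real_inner,second_countable_topology}) \<times> (nat \<Rightarrow> 'h)) measure"
  assumes "prob_space P" "prob_space Q" and sP: "sets P = sets (seqM \<Otimes>\<^sub>M seqM)" and sQ: "sets Q = sets (seqM \<Otimes>\<^sub>M seqM)"
    and eq: "\<And>m c d. (\<integral>p. iexp (seq_functional m c d p) \<partial>P) = (\<integral>p. iexp (seq_functional m c d p) \<partial>Q)"
  shows "P = Q"
proof (rule char_functional_unique[where L="{h. \<exists>m c d. h = seq_functional m c d}", OF assms(1,2)])
  let ?L = "{h :: (nat \<Rightarrow> 'h) \<times> (nat \<Rightarrow> 'h) \<Rightarrow> real. \<exists>m c d. h = seq_functional m c d}"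
  show "sets Q = sets P" using sP sQ by simp
  show "h \<in> borel_measurable P" if "h \<in> ?L" for h
    using that measurable_seq_functional measurable_cong_sets[OF sP refl] by blast
  show "(\<lambda>x. 0) \<in> ?L" by (auto simp: seq_functional_def fun_eq_iff intro!: exI[of _ "0::nat"])
  show "(\<lambda>x. h x + s * k x) \<in> ?L" if hk: "h \<in> ?L" "k \<in> ?L" for h k s
  proof -
    obtain m c d where h: "h = seq_functional m c d" using hk(1) by blast
    obtain m' c' d' where k: "k = seq_functional m' c' d'" using hk(2) by blast
    \<comment> \<open>Functionals with different numbers of terms are brought to a common length by
      zero coefficients.\<close>
    define cut where "cut l (e :: nat \<Rightarrow> 'h) j = (if j < l then e j else 0)" for l e j
    have ext: "seq_functional l e f x = (\<Sum>j<max m m'. inner (fst x j) (cut l e j) + inner (snd x j) (cut l f j))"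
      if "l \<le> max m m'" for l e f x
      unfolding seq_functional_def
      by (rule sum.mono_neutral_cong_left) (use that in \<open>auto simp: cut_def\<close>)
    have "(\<lambda>x. h x + s * k x) = seq_functional (max m m') (\<lambda>j. cut m c j + s *\<^sub>R cut m' c' j) (\<lambda>j. cut m d j + s *\<^sub>R cut m' d' j)"
    proof
      fix x
      show "h x + s * k x = seq_functional (max m m') (\<lambda>j. cut m c j + s *\<^sub>R cut m' c' j) (\<lambda>j. cut m d j + s *\<^sub>R cut m' d' j) x"
        unfolding h k ext[OF max.cobounded1] ext[OF max.cobounded2]
        by (simp add: seq_functional_def inner_add_right sum_distrib_left sum.distrib algebra_simps)
    qed
    then show ?thesis by blast
  qed
  show "(\<integral>x. iexp (h x) \<partial>P) = (\<integral>x. iexp (h x) \<partial>Q)" if "h \<in> ?L" for h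
    using that eq by auto
  let ?G = "{h -` A \<inter> space P | h A. h \<in> ?L \<and> A \<in> sets borel}"
  let ?S = "sigma (space P) ?G"
  have spP: "space P = UNIV" using sets_eq_imp_space_eq[OF sP] by (simp add: space_pair_measure space_PiM)
  have GP: "?G \<subseteq> Pow (space P)" by auto
  have fm: "seq_functional m c d \<in> borel_measurable ?S" for m c d
  proof (rule measurableI)
    fix A :: "real set" assume "A \<in> sets borel"
    then have "seq_functional m c d -` A \<inter> space P \<in> ?G" by blast
    then show "seq_functional m c d -` A \<inter> space ?S \<in> sets ?S"
      using GP by (simp add: space_measure_of_conv sets_measure_of sigma_sets.Basic)
  qed simp
  have single: "(\<Sum>i<Suc j. inner (f i) (if i = j then a else 0)) = inner (f j) a" for f :: "nat \<Rightarrow> 'h" and j a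
    by (subst sum.cong[OF refl, of _ _ "\<lambda>i. if i = j then inner (f j) a else 0"]) auto
  have "(\<lambda>p. fst p j) \<in> borel_measurable ?S" for j
  proof (rule borel_measurable_innerI)
    fix a :: 'h
    have "(\<lambda>p. inner (fst p j) a) = seq_functional (Suc j) (\<lambda>i. if i = j then a else 0) (\<lambda>_. 0)"
      using single by (simp add: fun_eq_iff seq_functional_def)
    then show "(\<lambda>p. inner (fst p j) a) \<in> borel_measurable ?S" using fm by simp
  qed
  moreover have "(\<lambda>p. snd p j) \<in> borel_measurable ?S" for j
  proof (rule borel_measurable_innerI)
    fix a :: 'h
    have "(\<lambda>p. inner (snd p j) a) = seq_functional (Suc j) (\<lambda>_. 0) (\<lambda>i. if i = j then a else 0)"
      using single by (simp add: fun_eq_iff seq_functional_def)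
    then show "(\<lambda>p. inner (snd p j) a) \<in> borel_measurable ?S" using fm by simp
  qed
  ultimately have "(\<lambda>p. (fst p, snd p)) \<in> measurable ?S (seqM \<Otimes>\<^sub>M seqM)"
    by (intro measurable_Pair measurable_seqI)
  then have "(\<lambda>p. p) \<in> measurable ?S (seqM \<Otimes>\<^sub>M seqM)" by simp
  then show "(\<lambda>x. x) \<in> measurable ?S P"
    by (subst measurable_cong_sets[OF refl sP])
qed

text \<open>The characteristic functional of independent centered Gaussian vectors with covariance
  forms \<open>\<kappa> j\<close>; independence is encoded in the sum in the exponent.\<close>

definition gaussian_seq :: "(nat \<Rightarrow> 'h \<Rightarrow> real) \<Rightarrow> (nat \<Rightarrow> 'h::{real_inner,second_countable_topology}) measure \<Rightarrow> bool" where
  "gaussian_seq \<kappa> \<mu> \<longleftrightarrow> prob_space \<mu> \<and> sets \<mu> = sets seqM \<and>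
     (\<forall>m c. (\<integral>z. iexp (\<Sum>j<m. inner (z j) (c j)) \<partial>\<mu>) = complex_of_real (exp (- (\<Sum>j<m. \<kappa> j (c j)) / 2)))"

lemma gaussian_pair_char:
  fixes \<mu> :: "(nat \<Rightarrow> 'h::{real_inner,second_countable_topology}) measure"
  assumes "gaussian_seq \<kappa> \<mu>"
  shows "(\<integral>p. iexp (seq_functional m c d p) \<partial>(\<mu> \<Otimes>\<^sub>M \<mu>)) =
    complex_of_real (exp (- (\<Sum>j<m. \<kappa> j (c j) + \<kappa> j (d j)) / 2))"
proof -
  interpret prob_space \<mu> using assms by (simp add: gaussian_seq_def)
  interpret P: pair_prob_space \<mu> \<mu> ..
  have sets: "sets \<mu> = sets seqM" using assms by (simp add: gaussian_seq_def)
  have char: "(\<integral>z. iexp (\<Sum>j<m. inner (z j) (c j)) \<partial>\<mu>) = complex_of_real (exp (- (\<Sum>j<m. \<kappa> j (c j)) / 2))" for c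
    using assms unfolding gaussian_seq_def by blast
  have [measurable]: "seq_functional m c d \<in> borel_measurable (\<mu> \<Otimes>\<^sub>M \<mu>)"
    using measurable_seq_functional measurable_cong_sets[OF sets_pair_measure_cong[OF sets sets] refl] by blast
  have "integrable (\<mu> \<Otimes>\<^sub>M \<mu>) (\<lambda>p. iexp (seq_functional m c d p))"
    by (rule P.integrable_const_bound[where B=1]) auto
  from P.integral_fst'[OF this]
  have "(\<integral>p. iexp (seq_functional m c d p) \<partial>(\<mu> \<Otimes>\<^sub>M \<mu>)) = (\<integral>x. \<integral>y. iexp (seq_functional m c d (x, y)) \<partial>\<mu> \<partial>\<mu>)" by simp
  also have "\<dots> = (\<integral>x. \<integral>y. iexp (\<Sum>j<m. inner (x j) (c j)) * iexp (\<Sum>j<m. inner (y j) (d j)) \<partial>\<mu> \<partial>\<mu>)"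
    by (simp only: seq_functional_def fst_conv snd_conv sum.distrib of_real_add distrib_left exp_add)
  also have "\<dots> = (\<integral>x. iexp (\<Sum>j<m. inner (x j) (c j)) \<partial>\<mu>) * (\<integral>y. iexp (\<Sum>j<m. inner (y j) (d j)) \<partial>\<mu>)"
    by simp
  also have "\<dots> = complex_of_real (exp (- (\<Sum>j<m. \<kappa> j (c j) + \<kappa> j (d j)) / 2))"
    unfolding char of_real_mult[symmetric] exp_add[symmetric] by (simp add: sum.distrib add_divide_distrib)
  finally show ?thesis .
qed

text \<open>A transformation of the pair preserves the law as soon as its transpose on coefficient
  sequences preserves the quadratic form in the exponent.\<close>

lemma gaussian_pair_invariant:
  fixes \<mu> :: "(nat \<Rightarrow> 'h::{real_inner,second_countable_topology}) measure"
  assumes G: "gaussian_seq \<kappa> \<mu>"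
    and T: "T \<in> measurable (seqM \<Otimes>\<^sub>M seqM) (seqM \<Otimes>\<^sub>M seqM)"
    and inv: "\<And>m c d. \<exists>c' d'. (\<forall>p. seq_functional m c d (T p) = seq_functional m c' d' p) \<and>
        (\<forall>j<m. \<kappa> j (c' j) + \<kappa> j (d' j) = \<kappa> j (c j) + \<kappa> j (d j))"
  shows "distr (\<mu> \<Otimes>\<^sub>M \<mu>) (\<mu> \<Otimes>\<^sub>M \<mu>) T = \<mu> \<Otimes>\<^sub>M \<mu>"
proof (rule seq_functional_unique)
  interpret prob_space \<mu> using G by (simp add: gaussian_seq_def)
  interpret P: pair_prob_space \<mu> \<mu> ..
  have sets: "sets \<mu> = sets seqM" using G by (simp add: gaussian_seq_def)
  note sp = sets_pair_measure_cong[OF sets sets]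
  have T'[measurable]: "T \<in> measurable (\<mu> \<Otimes>\<^sub>M \<mu>) (\<mu> \<Otimes>\<^sub>M \<mu>)"
    using T measurable_cong_sets[OF sp sp] by blast
  show "prob_space (distr (\<mu> \<Otimes>\<^sub>M \<mu>) (\<mu> \<Otimes>\<^sub>M \<mu>) T)" by (rule P.prob_space_distr[OF T'])
  show "prob_space (\<mu> \<Otimes>\<^sub>M \<mu>)" by (rule P.prob_space_axioms)
  show "sets (distr (\<mu> \<Otimes>\<^sub>M \<mu>) (\<mu> \<Otimes>\<^sub>M \<mu>) T) = sets (seqM \<Otimes>\<^sub>M seqM)" "sets (\<mu> \<Otimes>\<^sub>M \<mu>) = sets (seqM \<Otimes>\<^sub>M seqM)"
    using sp by simp_all
  fix m c d
  obtain c' d' where cd: "\<And>p. seq_functional m c d (T p) = seq_functional m c' d' p"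
    "\<And>j. j < m \<Longrightarrow> \<kappa> j (c' j) + \<kappa> j (d' j) = \<kappa> j (c j) + \<kappa> j (d j)"
    using inv[of m c d] by blast
  have [measurable]: "seq_functional m c d \<in> borel_measurable (\<mu> \<Otimes>\<^sub>M \<mu>)"
    using measurable_seq_functional measurable_cong_sets[OF sp refl] by blast
  have "(\<integral>p. iexp (seq_functional m c d p) \<partial>distr (\<mu> \<Otimes>\<^sub>M \<mu>) (\<mu> \<Otimes>\<^sub>M \<mu>) T) = (\<integral>p. iexp (seq_functional m c d (T p)) \<partial>(\<mu> \<Otimes>\<^sub>M \<mu>))"
    by (rule integral_distr) measurable
  also have "\<dots> = (\<integral>p. iexp (seq_functional m c' d' p) \<partial>(\<mu> \<Otimes>\<^sub>M \<mu>))" by (simp only: cd(1))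
  also have "\<dots> = (\<integral>p. iexp (seq_functional m c d p) \<partial>(\<mu> \<Otimes>\<^sub>M \<mu>))"
  proof -
    have "(\<Sum>j<m. \<kappa> j (c' j) + \<kappa> j (d' j)) = (\<Sum>j<m. \<kappa> j (c j) + \<kappa> j (d j))"
      by (intro sum.cong refl cd(2)) simp
    then show ?thesis unfolding gaussian_pair_char[OF G] by simp
  qed
  finally show "(\<integral>p. iexp (seq_functional m c d p) \<partial>distr (\<mu> \<Otimes>\<^sub>M \<mu>) (\<mu> \<Otimes>\<^sub>M \<mu>) T)
      = (\<integral>p. iexp (seq_functional m c d p) \<partial>(\<mu> \<Otimes>\<^sub>M \<mu>))" .
qed

definition rot :: "real \<Rightarrow> (nat \<Rightarrow> 'h::real_vector) \<times> (nat \<Rightarrow> 'h) \<Rightarrow> (nat \<Rightarrow> 'h) \<times> (nat \<Rightarrow> 'h)" where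
  "rot a p = (\<lambda>j. cos a *\<^sub>R fst p j + sin a *\<^sub>R snd p j, \<lambda>j. cos a *\<^sub>R snd p j - sin a *\<^sub>R fst p j)"

lemma measurable_rot[measurable]:
  "rot a \<in> measurable (seqM \<Otimes>\<^sub>M seqM) (seqM \<Otimes>\<^sub>M (seqM :: (nat \<Rightarrow> 'h::{real_inner,second_countable_topology}) measure))"
  unfolding rot_def[abs_def] by (intro measurable_Pair measurable_seqI) measurable

lemma gaussian_rot:
  fixes \<mu> :: "(nat \<Rightarrow> 'h::{real_inner,second_countable_topology}) measure"
  assumes G: "gaussian_seq \<kappa> \<mu>"
    and quad: "\<And>j a x y. \<kappa> j (cos a *\<^sub>R x - sin a *\<^sub>R y) + \<kappa> j (sin a *\<^sub>R x + cos a *\<^sub>R y) = \<kappa> j x + \<kappa> j y"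
  shows "distr (\<mu> \<Otimes>\<^sub>M \<mu>) (\<mu> \<Otimes>\<^sub>M \<mu>) (rot a) = \<mu> \<Otimes>\<^sub>M \<mu>"
proof (rule gaussian_pair_invariant[OF G measurable_rot])
  fix m and c d :: "nat \<Rightarrow> 'h"
  show "\<exists>c' d'. (\<forall>p. seq_functional m c d (rot a p) = seq_functional m c' d' p) \<and>
        (\<forall>j<m. \<kappa> j (c' j) + \<kappa> j (d' j) = \<kappa> j (c j) + \<kappa> j (d j))"
  proof (intro exI conjI allI impI)
    show "seq_functional m c d (rot a p) = seq_functional m (\<lambda>j. cos a *\<^sub>R c j - sin a *\<^sub>R d j) (\<lambda>j. sin a *\<^sub>R c j + cos a *\<^sub>R d j) p" for p
      unfolding seq_functional_def rot_def
      by (intro sum.cong refl) (simp add: inner_add_left inner_add_right inner_diff_left inner_diff_right algebra_simps)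
  qed (rule quad)
qed

text \<open>The reflection is applied to both copies at once, so that
  \<open>gaussian_pair_invariant\<close> covers it, and the first copy is then read off.\<close>

lemma gaussian_reflection:
  fixes \<mu> :: "(nat \<Rightarrow> 'h::{real_inner,second_countable_topology}) measure"
  assumes G: "gaussian_seq \<kappa> \<mu>" and R[measurable]: "R \<in> borel_measurable borel"
    and sym: "\<And>x y. inner (R x) y = inner x (R y)" and quad: "\<And>j x. \<kappa> j (R x) = \<kappa> j x"
  shows "distr \<mu> \<mu> (\<lambda>z j. R (z j)) = \<mu>"
proof -
  interpret prob_space \<mu> using G by (simp add: gaussian_seq_def)
  interpret P: pair_prob_space \<mu> \<mu> ..
  have sets: "sets \<mu> = sets seqM" using G by (simp add: gaussian_seq_def)
  define T where "T = (\<lambda>p :: (nat \<Rightarrow> 'h) \<times> (nat \<Rightarrow> 'h). (\<lambda>j. R (fst p j), \<lambda>j. R (snd p j)))"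
  have T: "T \<in> measurable (seqM \<Otimes>\<^sub>M seqM) (seqM \<Otimes>\<^sub>M seqM)"
    unfolding T_def by (intro measurable_Pair measurable_seqI) measurable
  have inv: "distr (\<mu> \<Otimes>\<^sub>M \<mu>) (\<mu> \<Otimes>\<^sub>M \<mu>) T = \<mu> \<Otimes>\<^sub>M \<mu>"
  proof (rule gaussian_pair_invariant[OF G T])
    fix m and c d :: "nat \<Rightarrow> 'h"
    show "\<exists>c' d'. (\<forall>p. seq_functional m c d (T p) = seq_functional m c' d' p) \<and>
          (\<forall>j<m. \<kappa> j (c' j) + \<kappa> j (d' j) = \<kappa> j (c j) + \<kappa> j (d j))"
    proof (intro exI conjI allI impI)
      show "seq_functional m c d (T p) = seq_functional m (\<lambda>j. R (c j)) (\<lambda>j. R (d j)) p" for p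
        by (simp add: seq_functional_def T_def sym)
    qed (simp add: quad)
  qed
  have R': "(\<lambda>z j. R (z j)) \<in> measurable \<mu> \<mu>"
  proof -
    have "(\<lambda>z j. R (z j)) \<in> measurable seqM (seqM :: (nat \<Rightarrow> 'h) measure)" by (intro measurable_seqI) measurable
    then show ?thesis using measurable_cong_sets[OF sets sets] by blast
  qed
  have T': "T \<in> measurable (\<mu> \<Otimes>\<^sub>M \<mu>) (\<mu> \<Otimes>\<^sub>M \<mu>)"
    using T measurable_cong_sets[OF sets_pair_measure_cong[OF sets sets] sets_pair_measure_cong[OF sets sets]] by blast
  have "distr \<mu> \<mu> (\<lambda>z j. R (z j)) = distr (distr (\<mu> \<Otimes>\<^sub>M \<mu>) \<mu> fst) \<mu> (\<lambda>z j. R (z j))"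
    by (simp add: distr_pair_fst)
  also have "\<dots> = distr (\<mu> \<Otimes>\<^sub>M \<mu>) \<mu> ((\<lambda>z j. R (z j)) \<circ> fst)" by (rule distr_distr[OF R' measurable_fst])
  also have "\<dots> = distr (\<mu> \<Otimes>\<^sub>M \<mu>) \<mu> (fst \<circ> T)" by (simp add: T_def o_def)
  also have "\<dots> = distr (distr (\<mu> \<Otimes>\<^sub>M \<mu>) (\<mu> \<Otimes>\<^sub>M \<mu>) T) \<mu> fst" by (rule distr_distr[OF measurable_fst T', symmetric])
  also have "\<dots> = \<mu>" unfolding inv by (rule distr_pair_fst)
  finally show ?thesis .
qed

section \<open>The law of a Gaussian sample\<close>

locale gaussian_data =
  fixes M :: "'w measure" and X :: "'w \<Rightarrow> 'h::{real_inner,banach,second_countable_topology}"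
    and Y :: "nat \<Rightarrow> 'w \<Rightarrow> 'h" and n :: nat
  assumes sample: "gaussian_sample M X Y n"
begin

sublocale prob_space M using sample by (simp add: gaussian_sample_def)

abbreviation \<Sigma> where "\<Sigma> \<equiv> covariance M X"

lemma n_pos: "1 \<le> n" and gaussX: "centered_gaussian M X"
  and indepY: "indep_vars (\<lambda>_. borel) Y {1..n}"
  and distrY: "j \<in> {1..n} \<Longrightarrow> distr M borel (Y j) = distr M borel X"
  using sample by (auto simp: gaussian_sample_def)

lemma measX[measurable]: "X \<in> borel_measurable M"
  using gaussX by (simp add: centered_gaussian_def)

lemma measY: "j \<in> {1..n} \<Longrightarrow> Y j \<in> borel_measurable M"
  using indepY by (simp add: indep_vars_def)

lemma X2: "integrable M (\<lambda>\<omega>. (norm (X \<omega>))\<^sup>2)"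
  by (rule centered_gaussian_integrable_norm2[OF prob_space_axioms gaussX])

sublocale cov: compact_nonneg \<Sigma> by (rule compact_nonneg_covariance[OF measX X2])

lemma transfer_Y:
  fixes g :: "'h \<Rightarrow> 'b::{banach,second_countable_topology}"
  assumes "j \<in> {1..n}" and g: "g \<in> borel_measurable borel"
  shows "(\<integral>\<omega>. g (Y j \<omega>) \<partial>M) = (\<integral>\<omega>. g (X \<omega>) \<partial>M)"
    and "integrable M (\<lambda>\<omega>. g (Y j \<omega>)) \<longleftrightarrow> integrable M (\<lambda>\<omega>. g (X \<omega>))"
  unfolding integral_distr[OF measY[OF assms(1)] g, symmetric] integral_distr[OF measX g, symmetric]
    integrable_distr_eq[OF measY[OF assms(1)] g, symmetric] integrable_distr_eq[OF measX g, symmetric]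
    distrY[OF assms(1)] by (rule refl)+

lemma transfer_Y_nn:
  assumes "j \<in> {1..n}" and g: "g \<in> borel_measurable borel"
  shows "(\<integral>\<^sup>+\<omega>. g (Y j \<omega>) \<partial>M) = (\<integral>\<^sup>+\<omega>. g (X \<omega>) \<partial>M)"
  using g nn_integral_distr[OF measY[OF assms(1)], of g] nn_integral_distr[OF measX, of g] distrY[OF assms(1)]
  by simp

lemma marginal:
  obtains \<sigma> where "0 \<le> \<sigma>" "\<sigma>\<^sup>2 = inner (\<Sigma> u) u"
    "distr M borel (\<lambda>\<omega>. inner (X \<omega>) u) = distr std_normal_distribution borel (\<lambda>x. \<sigma> * x)"
proof -
  obtain \<sigma> where s: "0 \<le> \<sigma>" "distr M borel (\<lambda>\<omega>. inner (X \<omega>) u) = distr std_normal_distribution borel (\<lambda>x. \<sigma> * x)"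
    using centered_gaussian_marginal[OF gaussX] by blast
  have "inner (\<Sigma> u) u = (\<integral>\<omega>. (inner (X \<omega>) u)\<^sup>2 \<partial>M)"
    by (simp add: inner_covariance(1)[OF measX X2] power2_eq_square)
  also have "\<dots> = (\<integral>x. (\<sigma> * x)\<^sup>2 \<partial>std_normal_distribution)"
    by (rule centered_gaussian_integral(1)[OF measX s(2)]) simp
  also have "\<dots> = \<sigma>\<^sup>2" by (simp add: power_mult_distrib std_normal_second_moment)
  finally show thesis using s by (intro that[of \<sigma>]) auto
qed

lemma char_X: "(\<integral>\<omega>. iexp (inner (X \<omega>) u) \<partial>M) = complex_of_real (exp (- inner (\<Sigma> u) u / 2))"
proof -
  obtain \<sigma> where s: "0 \<le> \<sigma>" "\<sigma>\<^sup>2 = inner (\<Sigma> u) u"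
    "distr M borel (\<lambda>\<omega>. inner (X \<omega>) u) = distr std_normal_distribution borel (\<lambda>x. \<sigma> * x)" by (rule marginal)
  have "(\<integral>\<omega>. iexp (inner (X \<omega>) u) \<partial>M) = (\<integral>x. iexp (\<sigma> * x) \<partial>std_normal_distribution)"
    by (rule centered_gaussian_integral(1)[OF measX s(3)]) simp
  also have "\<dots> = char std_normal_distribution \<sigma>" by (simp only: char_def)
  also have "\<dots> = complex_of_real (exp (- inner (\<Sigma> u) u / 2))" by (simp only: char_std_normal_distribution s(2))
  finally show ?thesis .
qed

lemma exp_quadratic_X:
  assumes "0 \<le> a" "4 * a * inner (\<Sigma> u) u \<le> 1"
  shows "(\<integral>\<^sup>+\<omega>. ennreal (exp (a * (inner (X \<omega>) u)\<^sup>2 + b * inner (X \<omega>) u)) \<partial>M)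
    \<le> ennreal (exp ((2 * a + b\<^sup>2) * inner (\<Sigma> u) u))"
proof -
  obtain \<sigma> where s: "0 \<le> \<sigma>" "\<sigma>\<^sup>2 = inner (\<Sigma> u) u"
    "distr M borel (\<lambda>\<omega>. inner (X \<omega>) u) = distr std_normal_distribution borel (\<lambda>x. \<sigma> * x)" by (rule marginal)
  have m: "(\<lambda>\<omega>. inner (X \<omega>) u) \<in> borel_measurable M" "(\<lambda>x. \<sigma> * x) \<in> borel_measurable std_normal_distribution" by simp_all
  have g: "(\<lambda>x::real. ennreal (exp (a * x\<^sup>2 + b * x))) \<in> borel_measurable borel" by measurable
  have "(\<integral>\<^sup>+\<omega>. ennreal (exp (a * (inner (X \<omega>) u)\<^sup>2 + b * inner (X \<omega>) u)) \<partial>M)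
      = (\<integral>\<^sup>+x. ennreal (exp (a * (\<sigma> * x)\<^sup>2 + b * (\<sigma> * x))) \<partial>std_normal_distribution)"
    using g nn_integral_distr[OF m(1), of "\<lambda>x. ennreal (exp (a * x\<^sup>2 + b * x))"]
      nn_integral_distr[OF m(2), of "\<lambda>x. ennreal (exp (a * x\<^sup>2 + b * x))"] s(3) by simp
  also have "\<dots> = (\<integral>\<^sup>+x. ennreal (exp ((a * \<sigma>\<^sup>2) * x\<^sup>2 + (b * \<sigma>) * x)) \<partial>std_normal_distribution)"
    by (simp add: power_mult_distrib mult_ac)
  also have "\<dots> \<le> ennreal (exp (2 * (a * \<sigma>\<^sup>2) + (b * \<sigma>)\<^sup>2))"
    by (rule nn_integral_std_normal_exp_quadratic) (use assms s cov.nonneg[of u] in \<open>auto simp: mult_ac\<close>)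
  also have "2 * (a * \<sigma>\<^sup>2) + (b * \<sigma>)\<^sup>2 = (2 * a + b\<^sup>2) * inner (\<Sigma> u) u"
    unfolding power_mult_distrib s(2) by (simp add: algebra_simps)
  finally show ?thesis .
qed

text \<open>Filling up with zeros makes the sample one random element of the full sequence space,
  whatever \<open>n\<close> is; the added components are degenerate Gaussian vectors.\<close>

definition Z :: "'w \<Rightarrow> nat \<Rightarrow> 'h" where
  "Z \<omega> j = (if j \<in> {1..n} then Y j \<omega> else 0)"

definition law :: "(nat \<Rightarrow> 'h) measure" where
  "law = distr M seqM Z"

lemma measZ[measurable]: "Z \<in> measurable M seqM"
proof (rule measurable_seqI)
  show "(\<lambda>\<omega>. Z \<omega> j) \<in> borel_measurable M" for j
  proof (cases "j \<in> {1..n}")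
    case True
    then have "(\<lambda>\<omega>. Z \<omega> j) = Y j" by (simp add: Z_def fun_eq_iff)
    then show ?thesis using measY[OF True] by simp
  next
    case False
    then have "(\<lambda>\<omega>. Z \<omega> j) = (\<lambda>_. 0)" unfolding Z_def by (simp only: if_False)
    then show ?thesis by simp
  qed
qed

lemma sets_law[measurable_cong]: "sets law = sets seqM" by (simp add: law_def)

lemma prob_law: "prob_space law" unfolding law_def by (rule prob_space_distr[OF measZ])

lemma scov_Z: "scov n (Z \<omega>) = sample_covariance Y n \<omega>"
  unfolding sample_covariance_eq_scov by (rule scov_cong) (simp add: Z_def)

definition \<kappa> :: "nat \<Rightarrow> 'h \<Rightarrow> real" where
  "\<kappa> j c = (if j \<in> {1..n} then inner (\<Sigma> c) c else 0)"

lemma gaussian_law: "gaussian_seq \<kappa> law"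
  unfolding gaussian_seq_def
proof (intro conjI allI prob_law sets_law)
  fix m and c :: "nat \<Rightarrow> 'h"
  define c' where "c' j = (if j < m then c j else 0)" for j
  \<comment> \<open>Both index ranges are enlarged to their union: outside \<open>{1..n}\<close> the
    summand vanishes identically, and from \<open>m\<close> on the coefficient \<open>c' j\<close>
    is 0.\<close>
  have swap: "(\<Sum>j<m. f j (c j)) = (\<Sum>j\<in>{1..n}. f j (c' j))"
    if "\<And>j x. j \<notin> {1..n} \<Longrightarrow> f j x = 0" "\<And>j. f j 0 = 0" for f :: "nat \<Rightarrow> 'h \<Rightarrow> real"
  proof -
    have "(\<Sum>j<m. f j (c j)) = (\<Sum>j\<in>{..<m} \<union> {1..n}. f j (c' j))"
      by (rule sum.mono_neutral_cong_left) (use that in \<open>auto simp: c'_def\<close>)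
    also have "\<dots> = (\<Sum>j\<in>{1..n}. f j (c' j))"
      by (rule sum.mono_neutral_right) (use that in auto)
    finally show ?thesis .
  qed
  have "(\<integral>z. iexp (\<Sum>j<m. inner (z j) (c j)) \<partial>law) = (\<integral>\<omega>. iexp (\<Sum>j<m. inner (Z \<omega> j) (c j)) \<partial>M)"
    unfolding law_def by (rule integral_distr) measurable
  also have "\<dots> = (\<integral>\<omega>. (\<Prod>j\<in>{1..n}. iexp (inner (Y j \<omega>) (c' j))) \<partial>M)"
  proof (rule Bochner_Integration.integral_cong[OF refl])
    fix \<omega>
    have "(\<Sum>j<m. inner (Z \<omega> j) (c j)) = (\<Sum>j\<in>{1..n}. inner (Z \<omega> j) (c' j))"
      by (rule swap) (auto simp: Z_def)
    also have "\<dots> = (\<Sum>j\<in>{1..n}. inner (Y j \<omega>) (c' j))" by (intro sum.cong) (auto simp: Z_def)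
    finally have e: "(\<Sum>j<m. inner (Z \<omega> j) (c j)) = (\<Sum>j\<in>{1..n}. inner (Y j \<omega>) (c' j))" .
    show "iexp (\<Sum>j<m. inner (Z \<omega> j) (c j)) = (\<Prod>j\<in>{1..n}. iexp (inner (Y j \<omega>) (c' j)))"
      unfolding e of_real_sum sum_distrib_left by (rule exp_sum) simp
  qed
  also have "\<dots> = (\<Prod>j\<in>{1..n}. \<integral>\<omega>. iexp (inner (Y j \<omega>) (c' j)) \<partial>M)"
  proof (rule indep_vars_lebesgue_integral)
    show "indep_vars (\<lambda>_. borel) (\<lambda>j \<omega>. iexp (inner (Y j \<omega>) (c' j))) {1..n}"
      by (rule indep_vars_compose2[OF indepY, where Y="\<lambda>j x. iexp (inner x (c' j))" and N="\<lambda>_. borel"]) simp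
    show "integrable M (\<lambda>\<omega>. iexp (inner (Y j \<omega>) (c' j)))" if "j \<in> {1..n}" for j
    proof (rule integrable_const_bound[where B=1])
      show "(\<lambda>\<omega>. iexp (inner (Y j \<omega>) (c' j))) \<in> borel_measurable M"
        by (rule measurable_compose[OF measY[OF that], of "\<lambda>x. iexp (inner x (c' j))"]) simp
    qed auto
  qed simp
  also have "\<dots> = (\<Prod>j\<in>{1..n}. complex_of_real (exp (- inner (\<Sigma> (c' j)) (c' j) / 2)))"
  proof (rule prod.cong[OF refl])
    fix j assume j: "j \<in> {1..n}"
    have "(\<integral>\<omega>. iexp (inner (Y j \<omega>) (c' j)) \<partial>M) = (\<integral>\<omega>. iexp (inner (X \<omega>) (c' j)) \<partial>M)"
      by (rule transfer_Y(1)[OF j]) simp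
    then show "(\<integral>\<omega>. iexp (inner (Y j \<omega>) (c' j)) \<partial>M) = complex_of_real (exp (- inner (\<Sigma> (c' j)) (c' j) / 2))"
      by (simp only: char_X)
  qed
  also have "\<dots> = complex_of_real (exp (\<Sum>j\<in>{1..n}. - inner (\<Sigma> (c' j)) (c' j) / 2))"
    by (simp only: of_real_prod[symmetric] exp_sum[symmetric] finite_atLeastAtMost)
  also have "(\<Sum>j\<in>{1..n}. - inner (\<Sigma> (c' j)) (c' j) / 2) = - (\<Sum>j\<in>{1..n}. \<kappa> j (c' j)) / 2"
    by (simp add: \<kappa>_def sum_negf sum_divide_distrib)
  also have "(\<Sum>j\<in>{1..n}. \<kappa> j (c' j)) = (\<Sum>j<m. \<kappa> j (c j))"
    by (rule swap[symmetric]) (auto simp: \<kappa>_def cov.zero)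
  finally show "(\<integral>z. iexp (\<Sum>j<m. inner (z j) (c j)) \<partial>law) = complex_of_real (exp (- (\<Sum>j<m. \<kappa> j (c j)) / 2))" .
qed

lemma rot_law: "distr (law \<Otimes>\<^sub>M law) (law \<Otimes>\<^sub>M law) (rot a) = law \<Otimes>\<^sub>M law"
proof (rule gaussian_rot[OF gaussian_law])
  fix j and b :: real and x y :: 'h
  have "inner (\<Sigma> (c *\<^sub>R x - s *\<^sub>R y)) (c *\<^sub>R x - s *\<^sub>R y) + inner (\<Sigma> (s *\<^sub>R x + c *\<^sub>R y)) (s *\<^sub>R x + c *\<^sub>R y) =
    (c\<^sup>2 + s\<^sup>2) * (inner (\<Sigma> x) x + inner (\<Sigma> y) y)" for c s :: real
    by (simp add: cov.diff cov.add cov.scaleR inner_diff_left inner_diff_right inner_add_left inner_add_right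
        power2_eq_square algebra_simps)
  from this[of "cos b" "sin b"] show "\<kappa> j (cos b *\<^sub>R x - sin b *\<^sub>R y) + \<kappa> j (sin b *\<^sub>R x + cos b *\<^sub>R y) = \<kappa> j x + \<kappa> j y"
    by (simp add: \<kappa>_def)
qed

lemma exp_quadratic_law:
  assumes "\<And>j. 0 \<le> a j" "\<And>j. 4 * a j * inner (\<Sigma> (c j)) (c j) \<le> 1"
  shows "(\<integral>\<^sup>+z. ennreal (exp (\<Sum>j=1..n. a j * (inner (z j) (c j))\<^sup>2 + b j * inner (z j) (c j))) \<partial>law)
    \<le> ennreal (exp (\<Sum>j=1..n. (2 * a j + (b j)\<^sup>2) * inner (\<Sigma> (c j)) (c j)))"
proof -
  let ?g = "\<lambda>j x. ennreal (exp (a j * (inner x (c j))\<^sup>2 + b j * inner x (c j)))"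
  have "(\<integral>\<^sup>+z. ennreal (exp (\<Sum>j=1..n. a j * (inner (z j) (c j))\<^sup>2 + b j * inner (z j) (c j))) \<partial>law)
      = (\<integral>\<^sup>+\<omega>. ennreal (exp (\<Sum>j=1..n. a j * (inner (Z \<omega> j) (c j))\<^sup>2 + b j * inner (Z \<omega> j) (c j))) \<partial>M)"
    unfolding law_def by (rule nn_integral_distr) measurable
  also have "\<dots> = (\<integral>\<^sup>+\<omega>. (\<Prod>j\<in>{1..n}. ?g j (Y j \<omega>)) \<partial>M)"
    by (intro nn_integral_cong) (simp add: exp_sum prod_ennreal Z_def cong: prod.cong)
  also have "\<dots> = (\<Prod>j\<in>{1..n}. \<integral>\<^sup>+\<omega>. ?g j (Y j \<omega>) \<partial>M)"
    by (intro indep_vars_nn_integral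
        indep_vars_compose2[OF indepY, where Y="?g" and N="\<lambda>_. borel"]) auto
  also have "\<dots> \<le> (\<Prod>j\<in>{1..n}. ennreal (exp ((2 * a j + (b j)\<^sup>2) * inner (\<Sigma> (c j)) (c j))))"
  proof (rule prod_mono_ennreal)
    fix j assume j: "j \<in> {1..n}"
    have "(\<integral>\<^sup>+\<omega>. ?g j (Y j \<omega>) \<partial>M) = (\<integral>\<^sup>+\<omega>. ?g j (X \<omega>) \<partial>M)" by (rule transfer_Y_nn[OF j]) simp
    then show "(\<integral>\<^sup>+\<omega>. ?g j (Y j \<omega>) \<partial>M) \<le> ennreal (exp ((2 * a j + (b j)\<^sup>2) * inner (\<Sigma> (c j)) (c j)))"
      using exp_quadratic_X[OF assms(1,2)[of j]] by simp
  qed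
  also have "\<dots> = ennreal (exp (\<Sum>j=1..n. (2 * a j + (b j)\<^sup>2) * inner (\<Sigma> (c j)) (c j)))"
    by (simp add: exp_sum prod_ennreal)
  finally show ?thesis .
qed

end

section \<open>Exponential moments along a rotation path\<close>

text \<open>Polarisation with a vector \<open>w\<close> parallel to \<open>D x\<close> and as long
  as \<open>x\<close>: the parallelogram law turns the bound on the form into a bound on
  \<open>norm x * norm (D x)\<close>.\<close>

lemma symmetric_norm_le:
  fixes D :: "'h::real_inner \<Rightarrow> 'h"
  assumes lin: "linear D" and sym: "\<And>x y. inner (D x) y = inner x (D y)"
    and bound: "\<And>v. \<bar>inner (D v) v\<bar> \<le> c * (norm v)\<^sup>2" and "0 \<le> c"
  shows "norm (D x) \<le> c * norm x"
proof (cases "D x = 0 \<or> x = 0")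
  case True
  then show ?thesis using assms(4) linear_0[OF lin] by auto
next
  case False
  define w where "w = (norm x / norm (D x)) *\<^sub>R D x"
  have nw: "norm w = norm x" using False by (simp add: w_def)
  have "4 * inner (D x) w = inner (D (x + w)) (x + w) - inner (D (x - w)) (x - w)"
    using sym[of w x] by (simp add: linear_add[OF lin] linear_diff[OF lin] inner_add_left inner_add_right
        inner_diff_left inner_diff_right inner_commute)
  also have "\<dots> \<le> c * (norm (x + w))\<^sup>2 + c * (norm (x - w))\<^sup>2"
    using bound[of "x + w"] bound[of "x - w"] by linarith
  also have "\<dots> = c * (2 * (norm x)\<^sup>2 + 2 * (norm w)\<^sup>2)"
    unfolding power2_norm_eq_inner distrib_left[symmetric]
    by (simp add: inner_add_left inner_add_right inner_diff_left inner_diff_right inner_commute)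
  finally have "4 * inner (D x) w \<le> 4 * (c * (norm x)\<^sup>2)" by (simp add: nw)
  moreover have "inner (D x) w = norm x * norm (D x)"
    using False by (simp add: w_def power2_norm_eq_inner[symmetric] power2_eq_square)
  ultimately have "norm x * norm (D x) \<le> norm x * (c * norm x)" by (simp add: power2_eq_square mult_ac)
  then show ?thesis by (rule mult_left_le_imp_le) (use False in simp)
qed

lemma prob_exp_Markov:
  assumes "prob_space P" and [measurable]: "g \<in> borel_measurable P"
    and "(\<integral>\<^sup>+x. ennreal (exp (g x)) \<partial>P) \<le> ennreal c" "0 \<le> c"
  shows "measure P {x\<in>space P. a \<le> g x} \<le> c * exp (- a)"
proof -
  interpret prob_space P by fact
  have "ennreal (measure P {x\<in>space P. a \<le> g x}) = (\<integral>\<^sup>+x. indicator {x\<in>space P. a \<le> g x} x \<partial>P)"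
    by (simp add: emeasure_eq_measure)
  also have "\<dots> \<le> (\<integral>\<^sup>+x. ennreal (exp (- a)) * ennreal (exp (g x)) \<partial>P)"
    by (intro nn_integral_mono) (auto simp: indicator_def ennreal_mult[symmetric] exp_add[symmetric] simp flip: ennreal_1 intro!: ennreal_leI)
  also have "\<dots> = ennreal (exp (- a)) * (\<integral>\<^sup>+x. ennreal (exp (g x)) \<partial>P)" by (rule nn_integral_cmult) measurable
  also have "\<dots> \<le> ennreal (exp (- a)) * ennreal c" by (rule mult_left_mono[OF assms(3)]) simp
  also have "\<dots> = ennreal (c * exp (- a))" using assms(4) by (simp add: ennreal_mult[symmetric] mult.commute)
  finally show ?thesis using assms(4) by (subst (asm) ennreal_le_iff) auto
qed

text \<open>Jensen's inequality for \<open>a \<mapsto> F\<^sup>a\<close> with \<open>F = E e\<^bsup>\<lambda>f\<^esup>\<close> turns the self-bounding exponent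
  \<open>d \<lambda> f\<close> on the right-hand side into \<open>F\<^sup>d\<close>, which is absorbed on the left.\<close>

lemma self_bounding_tail:
  assumes "prob_space P" and f[measurable]: "f \<in> borel_measurable P" and fi: "integrable P f"
    and fin: "integrable P (\<lambda>x. exp (l * f x))"
    and l: "0 < l" and d: "0 \<le> d" "d < 1" and m: "(\<integral>x. f x \<partial>P) \<le> m"
    and main: "(\<integral>\<^sup>+p. ennreal (exp (l * (f (snd p) - f (fst p)))) \<partial>(P \<Otimes>\<^sub>M P)) \<le> (\<integral>\<^sup>+x. ennreal (exp (c + d * (l * f x))) \<partial>P)"
    and e: "e = (1 - d) * l * \<tau> - l * m - c" "0 \<le> e"
  shows "measure P {x\<in>space P. \<tau> \<le> f x} \<le> exp (- e)"
proof -
  interpret prob_space P by fact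
  interpret PP: pair_prob_space P P ..
  define F where "F = (\<integral>x. exp (l * f x) \<partial>P)"
  define G where "G = (\<integral>x. exp (- (l * f x)) \<partial>P)"
  have nnF: "(\<integral>\<^sup>+x. ennreal (exp (l * f x)) \<partial>P) = ennreal F"
    unfolding F_def by (rule nn_integral_eq_integral[OF fin]) simp
  have F0: "0 < F"
  proof -
    have "0 \<le> F" unfolding F_def by (rule integral_nonneg_AE) simp
    moreover have "F \<noteq> 0"
    proof
      assume "F = 0"
      then have "AE x in P. exp (l * f x) = 0" using fin unfolding F_def by (subst (asm) integral_nonneg_eq_0_iff_AE) auto
      then have "AE x in P. False" by simp
      then show False by (simp add: AE_False)
    qed
    ultimately show ?thesis by simp
  qed
  \<comment> \<open>Jensen's inequality through the tangent of the exponential at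
    \<open>- (l * m)\<close>; if the integral on the right is infinite, nothing is to be
    shown.\<close>
  have exp_lower: "ennreal (exp (- (l * m))) \<le> (\<integral>\<^sup>+x. ennreal (exp (- (l * f x))) \<partial>P)"
  proof -
    have "exp (- (l * m)) * (1 + l * m - l * f x) \<le> exp (- (l * m)) * exp (l * m - l * f x)" for x
      using exp_ge_add_one_self[of "l * m - l * f x"] by (intro mult_left_mono) (linarith, simp)
    then have pt: "exp (- (l * m)) * (1 + l * m - l * f x) \<le> exp (- (l * f x))" for x
      by (simp add: exp_add[symmetric])
    show ?thesis
    proof (cases "(\<integral>\<^sup>+x. ennreal (exp (- (l * f x))) \<partial>P) = \<infinity>")
      case False
      then have i: "integrable P (\<lambda>x. exp (- (l * f x)))"
        by (intro integrableI_nonneg) (auto simp: less_top)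
      have "exp (- (l * m)) * 1 \<le> exp (- (l * m)) * (1 + l * m - l * (\<integral>x. f x \<partial>P))"
        using m l by (intro mult_left_mono) auto
      also have "\<dots> = (\<integral>x. exp (- (l * m)) * (1 + l * m - l * f x) \<partial>P)"
        using fi by (simp add: prob_space)
      also have "\<dots> \<le> (\<integral>x. exp (- (l * f x)) \<partial>P)"
        using fi i pt by (intro integral_mono) auto
      finally have "ennreal (exp (- (l * m))) \<le> ennreal (\<integral>x. exp (- (l * f x)) \<partial>P)" by (intro ennreal_leI) simp
      also have "\<dots> = (\<integral>\<^sup>+x. ennreal (exp (- (l * f x))) \<partial>P)" by (rule nn_integral_eq_integral[OF i, symmetric]) simp
      finally show ?thesis .
    qed simp
  qed
  have prod: "(\<integral>\<^sup>+p. ennreal (exp (l * (f (snd p) - f (fst p)))) \<partial>(P \<Otimes>\<^sub>M P))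
      = (\<integral>\<^sup>+x. ennreal (exp (- (l * f x))) \<partial>P) * ennreal F"
  proof -
    have "(\<integral>\<^sup>+p. ennreal (exp (l * (f (snd p) - f (fst p)))) \<partial>(P \<Otimes>\<^sub>M P))
      = (\<integral>\<^sup>+x. \<integral>\<^sup>+y. ennreal (exp (l * (f y - f x))) \<partial>P \<partial>P)"
      by (subst nn_integral_fst[symmetric]) simp_all
    also have "\<dots> = (\<integral>\<^sup>+x. \<integral>\<^sup>+y. ennreal (exp (- (l * f x))) * ennreal (exp (l * f y)) \<partial>P \<partial>P)"
      by (simp add: ennreal_mult[symmetric] exp_add[symmetric] algebra_simps)
    also have "\<dots> = (\<integral>\<^sup>+x. ennreal (exp (- (l * f x))) * ennreal F \<partial>P)"
      by (simp add: nn_integral_cmult nnF)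
    finally show ?thesis by (simp add: nn_integral_multc)
  qed
  have dF: "(\<integral>\<^sup>+x. ennreal (exp (c + d * (l * f x))) \<partial>P) \<le> ennreal (exp (c + d * ln F))"
  proof -
    \<comment> \<open>Convexity of the exponential between 0 and \<open>l * f x - ln F\<close>,
      multiplied by \<open>exp (c + d * ln F)\<close>.\<close>
    have pt: "exp (c + d * (l * f x)) \<le> exp (c + d * ln F) * (d / F * exp (l * f x) + (1 - d))" for x
    proof -
      have "exp ((1 - d) *\<^sub>R 0 + d *\<^sub>R (l * f x - ln F)) \<le> (1 - d) * exp 0 + d * exp (l * f x - ln F)"
        by (rule convex_onD[OF exp_convex]) (use d in auto)
      then have "exp (d * (l * f x - ln F)) \<le> d / F * exp (l * f x) + (1 - d)"
        using F0 by (simp add: exp_diff)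
      then have "exp (c + d * ln F) * exp (d * (l * f x - ln F)) \<le> exp (c + d * ln F) * (d / F * exp (l * f x) + (1 - d))"
        by (intro mult_left_mono) auto
      moreover have "exp (c + d * ln F) * exp (d * (l * f x - ln F)) = exp (c + d * (l * f x))"
        by (simp add: exp_add[symmetric] algebra_simps)
      ultimately show ?thesis by simp
    qed
    have i: "integrable P (\<lambda>x. exp (c + d * ln F) * (d / F * exp (l * f x) + (1 - d)))" using fin by simp
    have "(\<integral>\<^sup>+x. ennreal (exp (c + d * (l * f x))) \<partial>P) \<le> (\<integral>\<^sup>+x. ennreal (exp (c + d * ln F) * (d / F * exp (l * f x) + (1 - d))) \<partial>P)"
      by (intro nn_integral_mono ennreal_leI pt)
    also have "\<dots> = ennreal (\<integral>x. exp (c + d * ln F) * (d / F * exp (l * f x) + (1 - d)) \<partial>P)"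
      using d F0 by (intro nn_integral_eq_integral[OF i]) (auto intro!: mult_nonneg_nonneg add_nonneg_nonneg)
    also have "(\<integral>x. exp (c + d * ln F) * (d / F * exp (l * f x) + (1 - d)) \<partial>P) = exp (c + d * ln F) * (d / F * F + (1 - d))"
      using fin by (simp add: F_def prob_space)
    also have "\<dots> = exp (c + d * ln F)" using F0 by simp
    finally show ?thesis .
  qed
  have "ennreal (exp (- (l * m))) * ennreal F \<le> (\<integral>\<^sup>+x. ennreal (exp (- (l * f x))) \<partial>P) * ennreal F"
    by (rule mult_right_mono[OF exp_lower]) simp
  also have "\<dots> \<le> ennreal (exp (c + d * ln F))" using main dF unfolding prod by (rule order_trans)
  finally have "ennreal (exp (- (l * m)) * F) \<le> ennreal (exp (c + d * ln F))"
    using F0 by (simp add: ennreal_mult)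
  then have "exp (- (l * m)) * F \<le> exp (c + d * ln F)" by (subst (asm) ennreal_le_iff) auto
  moreover have "exp (- (l * m) + ln F) = exp (- (l * m)) * F" using F0 by (simp only: exp_add exp_ln)
  ultimately have "exp (- (l * m) + ln F) \<le> exp (c + d * ln F)" by simp
  then have "(1 - d) * ln F \<le> c + l * m" by (simp add: algebra_simps)
  \<comment> \<open>Absorption has bounded \<open>(1 - d) * ln F\<close> by
    \<open>c + l * m\<close>, which is where the form of \<open>e\<close> comes from.\<close>
  then have "e \<le> (1 - d) * (l * \<tau> - ln F)" unfolding e(1) by (simp add: algebra_simps)
  moreover from this have "0 \<le> l * \<tau> - ln F"
    using e(2) d by (metis diff_gt_0_iff_gt linorder_not_less mult_pos_neg order.strict_trans2 order_less_irrefl)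
  then have "(1 - d) * (l * \<tau> - ln F) \<le> l * \<tau> - ln F" using d by (simp add: mult_left_le_one_le)
  ultimately have el: "e \<le> l * \<tau> - ln F" by simp
  have "measure P {x\<in>space P. l * \<tau> \<le> l * f x} \<le> F * exp (- (l * \<tau>))"
    by (rule prob_exp_Markov) (use nnF F0 prob_space_axioms in auto)
  also have "\<dots> = exp (- (l * \<tau> - ln F))" using F0 by (simp add: exp_diff exp_minus field_simps)
  also have "\<dots> \<le> exp (- e)" using el by simp
  finally show ?thesis using l by simp
qed

text \<open>The first component of \<open>rot (- a)\<close>: from a point of the rotation path it
  recovers the preceding one.\<close>

definition rback :: "real \<Rightarrow> (nat \<Rightarrow> 'h::real_vector) \<times> (nat \<Rightarrow> 'h) \<Rightarrow> nat \<Rightarrow> 'h" where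
  "rback a p j = cos a *\<^sub>R fst p j - sin a *\<^sub>R snd p j"

lemma rot_0: "rot 0 p = p" by (simp add: rot_def)

lemma rot_rot: "rot a (rot b p) = rot (a + b) p"
  by (simp add: rot_def fun_eq_iff cos_add sin_add algebra_simps)

lemma fst_rot_pi_half: "fst (rot (pi / 2) p) = snd p" by (simp add: rot_def)

lemma rback_rot: "rback a (rot b p) = fst (rot (b - a) p)"
  by (simp add: rback_def rot_def fun_eq_iff cos_diff sin_diff algebra_simps)

lemma measurable_rback[measurable]:
  "rback a \<in> measurable (seqM \<Otimes>\<^sub>M seqM) (seqM :: (nat \<Rightarrow> 'h::{real_inner,second_countable_topology}) measure)"
proof (rule measurable_seqI)
  fix j
  show "(\<lambda>p. rback a p j) \<in> borel_measurable (seqM \<Otimes>\<^sub>M (seqM :: (nat \<Rightarrow> 'h) measure))"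
    unfolding rback_def
    by (intro borel_measurable_diff borel_measurable_scaleR borel_measurable_const
        measurable_compose[OF measurable_fst measurable_seq_component]
        measurable_compose[OF measurable_snd measurable_seq_component])
qed

context gaussian_data
begin

sublocale law: prob_space law by (rule prob_law)
sublocale law2: pair_prob_space law law ..

lemma sets_law2[measurable_cong]: "sets (law \<Otimes>\<^sub>M law) = sets (seqM \<Otimes>\<^sub>M seqM)"
  by (intro sets_pair_measure_cong sets_law)

lemma space_law[simp]: "space law = UNIV" by (simp add: law_def space_PiM)
lemma space_law2[simp]: "space (law \<Otimes>\<^sub>M law) = UNIV" by (simp add: space_pair_measure)

lemma nn_integral_rot:
  assumes [measurable]: "h \<in> borel_measurable (seqM \<Otimes>\<^sub>M seqM)"
  shows "(\<integral>\<^sup>+p. h (rot a p) \<partial>(law \<Otimes>\<^sub>M law)) = (\<integral>\<^sup>+p. h p \<partial>(law \<Otimes>\<^sub>M law))"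
proof -
  have "(\<integral>\<^sup>+p. h p \<partial>distr (law \<Otimes>\<^sub>M law) (law \<Otimes>\<^sub>M law) (rot a)) = (\<integral>\<^sup>+p. h (rot a p) \<partial>(law \<Otimes>\<^sub>M law))"
    by (rule nn_integral_distr) measurable
  then show ?thesis by (simp add: rot_law)
qed

lemma measure_rot:
  assumes [measurable]: "B \<in> sets (seqM \<Otimes>\<^sub>M seqM)"
  shows "measure (law \<Otimes>\<^sub>M law) {p. rot a p \<in> B} = measure (law \<Otimes>\<^sub>M law) B"
proof -
  have "measure (distr (law \<Otimes>\<^sub>M law) (law \<Otimes>\<^sub>M law) (rot a)) B = measure (law \<Otimes>\<^sub>M law) (rot a -` B \<inter> space (law \<Otimes>\<^sub>M law))"
    by (rule measure_distr) measurable
  then show ?thesis by (simp add: rot_law vimage_def)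
qed

lemma path_exp:
  assumes h[measurable]: "h \<in> borel_measurable (seqM \<Otimes>\<^sub>M seqM)" and K: "0 < K"
  shows "(\<integral>\<^sup>+p. ennreal (exp (\<Sum>k<K. h (rot (a k) p))) \<partial>(law \<Otimes>\<^sub>M law))
    \<le> (\<integral>\<^sup>+p. ennreal (exp (real K * h p)) \<partial>(law \<Otimes>\<^sub>M law))"
proof -
  have "exp (\<Sum>k<K. (1 / real K) *\<^sub>R (real K * h (rot (a k) p))) \<le> (\<Sum>k<K. 1 / real K * exp (real K * h (rot (a k) p)))" for p
    by (rule convex_on_sum[OF _ _ exp_convex]) (use K in auto)
  then have "exp (\<Sum>k<K. h (rot (a k) p)) \<le> (\<Sum>k<K. 1 / real K * exp (real K * h (rot (a k) p)))" for p
    using K by simp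
  then have "(\<integral>\<^sup>+p. ennreal (exp (\<Sum>k<K. h (rot (a k) p))) \<partial>(law \<Otimes>\<^sub>M law))
      \<le> (\<integral>\<^sup>+p. (\<Sum>k<K. ennreal (1 / real K) * ennreal (exp (real K * h (rot (a k) p)))) \<partial>(law \<Otimes>\<^sub>M law))"
    by (intro nn_integral_mono) (auto simp: ennreal_mult[symmetric] simp del: ennreal_leI intro!: ennreal_leI)
  also have "\<dots> = (\<Sum>k<K. ennreal (1 / real K) * (\<integral>\<^sup>+p. ennreal (exp (real K * h (rot (a k) p))) \<partial>(law \<Otimes>\<^sub>M law)))"
    by (subst nn_integral_sum) (auto simp: nn_integral_cmult)
  also have "\<dots> = (\<Sum>k<K. ennreal (1 / real K) * (\<integral>\<^sup>+p. ennreal (exp (real K * h p)) \<partial>(law \<Otimes>\<^sub>M law)))"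
    by (subst nn_integral_rot[where h="\<lambda>p. ennreal (exp (real K * h p))"]) auto
  also have "\<dots> = (ennreal (real K) * ennreal (1 / real K)) * (\<integral>\<^sup>+p. ennreal (exp (real K * h p)) \<partial>(law \<Otimes>\<^sub>M law))"
    by (simp add: ennreal_of_nat_eq_real_of_nat mult.assoc)
  also have "ennreal (real K) * ennreal (1 / real K) = 1"
    using K by (simp add: ennreal_mult[symmetric])
  finally show ?thesis by simp
qed

lemma path_telescope:
  fixes f :: "(nat \<Rightarrow> 'h) \<Rightarrow> real"
  assumes K: "0 < K"
  defines "\<delta> \<equiv> pi / (2 * real K)"
  shows "f (snd p) - f (fst p) =
    (\<Sum>k<K. f (fst (rot (real (Suc k) * \<delta>) p)) - f (rback \<delta> (rot (real (Suc k) * \<delta>) p)))"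
proof -
  have "rback \<delta> (rot (real (Suc k) * \<delta>) p) = fst (rot (real k * \<delta>) p)" for k
    unfolding rback_rot by (simp add: algebra_simps)
  then have "(\<Sum>k<K. f (fst (rot (real (Suc k) * \<delta>) p)) - f (rback \<delta> (rot (real (Suc k) * \<delta>) p)))
    = f (fst (rot (real K * \<delta>) p)) - f (fst (rot (real 0 * \<delta>) p))"
    by (simp only: sum_lessThan_telescope[where f="\<lambda>k. f (fst (rot (real k * \<delta>) p))"])
  moreover have "real K * \<delta> = pi / 2" using K by (simp add: \<delta>_def)
  ultimately show ?thesis by (simp only: fst_rot_pi_half mult_zero_left of_nat_0 rot_0)
qed

section \<open>The estimation error as a function of the data\<close>

abbreviation S where "S \<equiv> onorm \<Sigma>"

definition err :: "(nat \<Rightarrow> 'h) \<Rightarrow> real" where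
  "err z = onorm (\<lambda>x. scov n z x - \<Sigma> x)"

abbreviation qf :: "(nat \<Rightarrow> 'h) \<Rightarrow> 'h \<Rightarrow> real" where "qf z v \<equiv> inner (scov n z v) v"

lemma Sigma_qf: "0 \<le> inner (\<Sigma> v) v" "inner (\<Sigma> v) v \<le> S * (norm v)\<^sup>2"
  by (rule cov.nonneg, rule cov.inner_le_onorm)

lemma S_nonneg: "0 \<le> S" by (rule onorm_pos_le[OF cov.bounded_linear])

lemma qf_nonneg: "0 \<le> qf z v" by (rule compact_nonneg.nonneg[OF compact_nonneg_scov])

lemma qf_eq: "qf z v = (\<Sum>j=1..n. (inner (z j) v)\<^sup>2) / real n"
  by (simp add: inner_scov power2_eq_square)

lemma bounded_linear_err: "bounded_linear (\<lambda>x. scov n z x - \<Sigma> x)"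
  by (intro bounded_linear_sub compact_nonneg.bounded_linear[OF compact_nonneg_scov] cov.bounded_linear)

lemma err_nonneg: "0 \<le> err z" unfolding err_def by (rule onorm_pos_le[OF bounded_linear_err])

lemma norm_le_err: "norm (scov n z x - \<Sigma> x) \<le> err z * norm x"
  unfolding err_def by (rule onorm[OF bounded_linear_err])

lemma qf_le_err: "\<bar>qf z v - inner (\<Sigma> v) v\<bar> \<le> err z * (norm v)\<^sup>2"
proof -
  have "\<bar>inner (scov n z v - \<Sigma> v) v\<bar> \<le> norm (scov n z v - \<Sigma> v) * norm v" by (rule Cauchy_Schwarz_ineq2)
  also have "\<dots> \<le> err z * norm v * norm v" by (intro mult_right_mono norm_le_err) simp
  finally show ?thesis by (simp add: inner_diff_left power2_eq_square)
qed

lemma err_leI: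
  assumes "\<And>v. \<bar>qf z v - inner (\<Sigma> v) v\<bar> \<le> c * (norm v)\<^sup>2" "0 \<le> c"
  shows "err z \<le> c"
  unfolding err_def
proof (rule onorm_bound[OF assms(2)], rule symmetric_norm_le)
  interpret B: compact_nonneg "scov n z" by (rule compact_nonneg_scov)
  show "linear (\<lambda>x. scov n z x - \<Sigma> x)" using bounded_linear_err by (rule bounded_linear.linear)
  show "inner (scov n z x - \<Sigma> x) y = inner x (scov n z y - \<Sigma> y)" for x y
    by (simp add: inner_diff_left inner_diff_right B.symmetric cov.symmetric)
  show "\<bar>inner (scov n z v - \<Sigma> v) v\<bar> \<le> c * (norm v)\<^sup>2" for v
    using assms(1)[of v] by (simp add: inner_diff_left)
qed (rule assms(2))

text \<open>Countably many directions, dense up to scaling. Their norms are 0 or 1, so the form on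
  them is bounded by the operator norm directly.\<close>

definition test_vec :: "nat \<Rightarrow> 'h" where
  "test_vec = (SOME v. (\<forall>i. norm (v i) = 0 \<or> norm (v i) = 1) \<and> (\<forall>U. open U \<and> U \<noteq> {} \<longrightarrow> (\<exists>i c. c *\<^sub>R v i \<in> U)))"

lemma test_vec:
  shows norm_test_vec: "norm (test_vec i) = 0 \<or> norm (test_vec i) = 1"
    and test_vec_dense: "open U \<Longrightarrow> U \<noteq> {} \<Longrightarrow> \<exists>i c. c *\<^sub>R test_vec i \<in> U"
proof -
  obtain D :: "'h set" where D: "countable D" "\<And>X. open X \<Longrightarrow> X \<noteq> {} \<Longrightarrow> \<exists>d\<in>D. d \<in> X"
    using countable_dense_setE by blast
  define v where "v i = sgn (from_nat_into D i)" for i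
  have v1: "norm (v i) = 0 \<or> norm (v i) = 1" for i by (simp add: v_def norm_sgn)
  have v2: "\<exists>i c. c *\<^sub>R v i \<in> U" if U: "open U" "U \<noteq> {}" for U
  proof -
    obtain d where d: "d \<in> D" "d \<in> U" using D(2)[OF U] by blast
    obtain i where "from_nat_into D i = d" using from_nat_into_surj[OF D(1) d(1)] by blast
    then have "norm d *\<^sub>R v i = d" by (cases "d = 0") (simp_all add: v_def sgn_div_norm)
    then show ?thesis using d(2) by (intro exI[of _ i] exI[of _ "norm d"]) simp
  qed
  have "\<exists>v :: nat \<Rightarrow> 'h. (\<forall>i. norm (v i) = 0 \<or> norm (v i) = 1) \<and> (\<forall>U. open U \<and> U \<noteq> {} \<longrightarrow> (\<exists>i c. c *\<^sub>R v i \<in> (U::'h set)))"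
    by (intro exI[of _ v] conjI allI impI v1 v2) simp_all
  from someI_ex[OF this, folded test_vec_def]
  show "norm (test_vec i) = 0 \<or> norm (test_vec i) = 1" "open U \<Longrightarrow> U \<noteq> {} \<Longrightarrow> \<exists>i c. c *\<^sub>R test_vec i \<in> U"
    by simp_all
qed

text \<open>Finite maxima that increase to the operator norm. They are attained, which fixes a
  direction along which increments can be expanded, and they have finite exponential moments for
  small parameters.\<close>

definition ferr :: "nat \<Rightarrow> (nat \<Rightarrow> 'h) \<Rightarrow> real" where
  "ferr N z = Max ((\<lambda>i. \<bar>qf z (test_vec i) - inner (\<Sigma> (test_vec i)) (test_vec i)\<bar>) ` {..N})"

lemma ferr_ge: "i \<le> N \<Longrightarrow> \<bar>qf z (test_vec i) - inner (\<Sigma> (test_vec i)) (test_vec i)\<bar> \<le> ferr N z"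
  unfolding ferr_def by (intro Max_ge) auto

lemma ferr_attained: "\<exists>i\<le>N. ferr N z = \<bar>qf z (test_vec i) - inner (\<Sigma> (test_vec i)) (test_vec i)\<bar>"
proof -
  have "ferr N z \<in> (\<lambda>i. \<bar>qf z (test_vec i) - inner (\<Sigma> (test_vec i)) (test_vec i)\<bar>) ` {..N}"
    unfolding ferr_def by (rule Max_in) auto
  then show ?thesis by auto
qed

lemma norm_test_vec2: "(norm (test_vec i))\<^sup>2 \<le> 1"
  using norm_test_vec[of i] by auto

lemma Sigma_test: "inner (\<Sigma> (test_vec i)) (test_vec i) \<le> S"
  using Sigma_qf(2)[of "test_vec i"] mult_left_mono[OF norm_test_vec2[of i] S_nonneg] by simp

lemma ferr_le_err: "ferr N z \<le> err z"
proof -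
  obtain i where "ferr N z = \<bar>qf z (test_vec i) - inner (\<Sigma> (test_vec i)) (test_vec i)\<bar>" using ferr_attained by blast
  also have "\<dots> \<le> err z * (norm (test_vec i))\<^sup>2" by (rule qf_le_err)
  also have "\<dots> \<le> err z * 1" by (rule mult_left_mono[OF norm_test_vec2 err_nonneg])
  finally show ?thesis by simp
qed

text \<open>The set of vectors where the form exceeds the bound is open; if it were nonempty, it
  would contain a multiple of some test vector.\<close>

lemma err_le_iff:
  assumes "0 \<le> c"
  shows "err z \<le> c \<longleftrightarrow> (\<forall>N. ferr N z \<le> c)"
proof
  assume "err z \<le> c"
  then show "\<forall>N. ferr N z \<le> c" using ferr_le_err order_trans by blast
next
  assume le: "\<forall>N. ferr N z \<le> c"
  show "err z \<le> c"
  proof (rule err_leI[OF _ assms])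
    fix v
    let ?E = "\<lambda>v. scov n z v - \<Sigma> v"
    interpret E: bounded_linear ?E by (rule bounded_linear_err)
    have small: "\<bar>inner (?E (a *\<^sub>R test_vec i)) (a *\<^sub>R test_vec i)\<bar> \<le> c * (norm (a *\<^sub>R test_vec i))\<^sup>2" for a i
    proof (cases "norm (test_vec i) = 0")
      case False
      then have 1: "norm (test_vec i) = 1" using norm_test_vec by blast
      have "\<bar>inner (?E (test_vec i)) (test_vec i)\<bar> \<le> c"
        using ferr_ge[of i i z] le by (simp add: inner_diff_left) (meson order_trans)
      then have "a\<^sup>2 * \<bar>inner (?E (test_vec i)) (test_vec i)\<bar> \<le> a\<^sup>2 * c" by (rule mult_left_mono) simp
      moreover have "?E (a *\<^sub>R test_vec i) = a *\<^sub>R ?E (test_vec i)" by (rule E.scaleR)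
      ultimately show ?thesis using 1 by (simp add: abs_mult power2_eq_square mult_ac)
    qed (simp add: E.zero[simplified])
    define U where "U = {v. c * (norm v)\<^sup>2 < \<bar>inner (?E v) v\<bar>}"
    have "open U" unfolding U_def
      by (intro open_Collect_less continuous_intros linear_continuous_on bounded_linear_err
          cov.bounded_linear compact_nonneg.bounded_linear[OF compact_nonneg_scov])
    have "U = {}"
    proof (rule ccontr)
      assume "U \<noteq> {}"
      then obtain i a where "a *\<^sub>R test_vec i \<in> U" using test_vec_dense[OF \<open>open U\<close>] by blast
      then show False using small[of a i] unfolding U_def by simp
    qed
    then show "\<bar>qf z v - inner (\<Sigma> v) v\<bar> \<le> c * (norm v)\<^sup>2"
      by (auto simp: U_def inner_diff_left not_less)
  qed
qed

lemma measurable_scov[measurable]: "(\<lambda>z. scov n z x) \<in> borel_measurable (seqM :: (nat \<Rightarrow> 'h) measure)"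
  unfolding scov_def by measurable

lemma measurable_ferr[measurable]: "ferr N \<in> borel_measurable seqM"
proof (subst borel_measurable_iff_le, intro allI)
  fix c
  have "{z \<in> space seqM. ferr N z \<le> c} =
      {z \<in> space seqM. \<forall>i\<in>{..N}. \<bar>qf z (test_vec i) - inner (\<Sigma> (test_vec i)) (test_vec i)\<bar> \<le> c}"
    unfolding ferr_def by (subst Max_le_iff) auto
  also have "\<dots> \<in> sets seqM" by (intro sets.sets_Collect_finite_All') measurable
  finally show "{z \<in> space seqM. ferr N z \<le> c} \<in> sets seqM" .
qed

lemma measurable_err[measurable]: "err \<in> borel_measurable seqM"
proof (subst borel_measurable_iff_le, intro allI)
  fix c
  show "{z \<in> space seqM. err z \<le> c} \<in> sets seqM"
  proof (cases "0 \<le> c")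
    case True
    have "{z \<in> space seqM. ferr N z \<le> c} \<in> sets seqM" for N
      using measurable_ferr[of N] unfolding borel_measurable_iff_le by blast
    then show ?thesis unfolding err_le_iff[OF True] by (rule sets.sets_Collect_countable_All)
  next
    case False
    then have "\<not> err z \<le> c" for z using err_nonneg[of z] by linarith
    then have e: "{z \<in> space seqM. err z \<le> c} = {}" by blast
    show ?thesis unfolding e by simp
  qed
qed

lemma integrable_norm2_law: "j \<in> {1..n} \<Longrightarrow> integrable law (\<lambda>z. (norm (z j))\<^sup>2)"
proof -
  assume j: "j \<in> {1..n}"
  have "integrable M (\<lambda>\<omega>. (norm (Y j \<omega>))\<^sup>2)"
    using X2 transfer_Y(2)[OF j, of "\<lambda>x. (norm x)\<^sup>2"] by simp
  moreover have "(\<lambda>\<omega>. (norm (Z \<omega> j))\<^sup>2) = (\<lambda>\<omega>. (norm (Y j \<omega>))\<^sup>2)" using j by (simp add: Z_def)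
  ultimately show ?thesis
    unfolding law_def by (subst integrable_distr_eq) (simp_all, measurable)
qed

lemma err_le_norms: "err z \<le> (\<Sum>j=1..n. (norm (z j))\<^sup>2) + S"
proof (rule err_leI)
  fix v
  have "qf z v \<le> (\<Sum>j=1..n. (norm (z j))\<^sup>2) * (norm v)\<^sup>2"
  proof -
    have "qf z v \<le> (\<Sum>j=1..n. (inner (z j) v)\<^sup>2)"
    proof -
      define s where "s = (\<Sum>j=1..n. (inner (z j) v)\<^sup>2)"
      have "0 \<le> s" unfolding s_def by (rule sum_nonneg) simp
      then have "s * 1 \<le> s * real n" using n_pos by (intro mult_left_mono) auto
      then show ?thesis unfolding qf_eq s_def[symmetric] using n_pos by (simp add: divide_le_eq)
    qed
    also have "\<dots> \<le> (\<Sum>j=1..n. (norm (z j))\<^sup>2 * (norm v)\<^sup>2)"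
    proof (rule sum_mono)
      fix j
      have "\<bar>inner (z j) v\<bar>\<^sup>2 \<le> (norm (z j) * norm v)\<^sup>2" by (intro power_mono Cauchy_Schwarz_ineq2) simp
      then show "(inner (z j) v)\<^sup>2 \<le> (norm (z j))\<^sup>2 * (norm v)\<^sup>2" by (simp add: power_mult_distrib)
    qed
    finally show ?thesis by (simp add: sum_distrib_right)
  qed
  moreover have "0 \<le> (\<Sum>j=1..n. (norm (z j))\<^sup>2) * (norm v)\<^sup>2" by (intro mult_nonneg_nonneg sum_nonneg) auto
  ultimately show "\<bar>qf z v - inner (\<Sigma> v) v\<bar> \<le> ((\<Sum>j=1..n. (norm (z j))\<^sup>2) + S) * (norm v)\<^sup>2"
    using qf_nonneg[of z v] Sigma_qf[of v] by (simp add: distrib_right)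
qed (intro add_nonneg_nonneg sum_nonneg S_nonneg, simp)

lemma integrable_err: "integrable law err"
proof (rule Bochner_Integration.integrable_bound)
  show "integrable law (\<lambda>z. (\<Sum>j=1..n. (norm (z j))\<^sup>2) + S)"
    by (intro Bochner_Integration.integrable_add Bochner_Integration.integrable_sum integrable_norm2_law) auto
  show "AE z in law. norm (err z) \<le> norm ((\<Sum>j=1..n. (norm (z j))\<^sup>2) + S)"
  proof (rule AE_I2)
    fix z
    show "norm (err z) \<le> norm ((\<Sum>j=1..n. (norm (z j))\<^sup>2) + S)"
      using err_le_norms[of z] err_nonneg[of z] by simp
  qed
qed measurable

lemma expectation_err: "(\<integral>z. err z \<partial>law) = (\<integral>\<omega>. onorm (estimation_error M X Y n \<omega>) \<partial>M)"
proof -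
  have "(\<integral>z. err z \<partial>law) = (\<integral>\<omega>. err (Z \<omega>) \<partial>M)" unfolding law_def by (rule integral_distr) measurable
  also have "(\<lambda>\<omega>. err (Z \<omega>)) = (\<lambda>\<omega>. onorm (estimation_error M X Y n \<omega>))"
    by (simp add: err_def scov_Z estimation_error_def[abs_def])
  finally show ?thesis .
qed

section \<open>Concentration of the estimation error\<close>

lemma qf_rback: "qf (rback a p) v = (cos a)\<^sup>2 * qf (fst p) v - 2 * sin a * cos a * ((\<Sum>j=1..n. inner (fst p j) v * inner (snd p j) v) / real n)
    + (sin a)\<^sup>2 * qf (snd p) v"
proof -
  have "(inner (rback a p j) v)\<^sup>2 = (cos a)\<^sup>2 * (inner (fst p j) v)\<^sup>2 - 2 * sin a * cos a * (inner (fst p j) v * inner (snd p j) v)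
      + (sin a)\<^sup>2 * (inner (snd p j) v)\<^sup>2" for j
    by (simp add: rback_def inner_diff_left power2_eq_square algebra_simps)
  then have "(\<Sum>j=1..n. (inner (rback a p j) v)\<^sup>2) = (cos a)\<^sup>2 * (\<Sum>j=1..n. (inner (fst p j) v)\<^sup>2)
      - 2 * sin a * cos a * (\<Sum>j=1..n. inner (fst p j) v * inner (snd p j) v) + (sin a)\<^sup>2 * (\<Sum>j=1..n. (inner (snd p j) v)\<^sup>2)"
    by (simp add: sum.distrib sum_subtractf sum_distrib_left)
  then show ?thesis unfolding qf_eq by (simp add: add_divide_distrib diff_divide_distrib)
qed

text \<open>From \<open>real K * \<delta> = pi / 2 \<le> 2\<close> and
  \<open>\<bar>sin \<delta>\<bar> \<le> \<delta>\<close>: multiplied by the number of steps, the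
  second-order weight is of order \<open>1 / K\<close>, while the first-order weight stays
  bounded.\<close>

lemma step_size:
  assumes "0 < K"
  defines "\<delta> \<equiv> pi / (2 * real K)"
  shows "real K * (sin \<delta>)\<^sup>2 \<le> 4 / real K" "(real K * (2 * sin \<delta> * cos \<delta>))\<^sup>2 \<le> 16" "0 < \<delta>" "real K * \<delta> \<le> 2"
proof -
  show d: "0 < \<delta>" using assms by simp
  have Kd: "real K * \<delta> = pi / 2" using assms by simp
  then show K2: "real K * \<delta> \<le> 2" using pi_less_4 by simp
  have "\<bar>sin \<delta>\<bar> \<le> \<delta>" using abs_sin_x_le_abs_x[of \<delta>] d by simp
  then have s: "(sin \<delta>)\<^sup>2 \<le> \<delta>\<^sup>2" by (metis abs_ge_zero power2_abs power_mono)
  have "(real K)\<^sup>2 * (sin \<delta>)\<^sup>2 \<le> (real K)\<^sup>2 * \<delta>\<^sup>2" by (rule mult_left_mono[OF s]) simp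
  also have "\<dots> = (real K * \<delta>)\<^sup>2" by (simp add: power_mult_distrib)
  also have "\<dots> \<le> 2\<^sup>2" using K2 d by (intro power_mono) auto
  finally have Ks: "(real K)\<^sup>2 * (sin \<delta>)\<^sup>2 \<le> 4" by simp
  then show "real K * (sin \<delta>)\<^sup>2 \<le> 4 / real K" using assms by (simp add: le_divide_eq power2_eq_square mult_ac)
  have "(real K * (2 * sin \<delta> * cos \<delta>))\<^sup>2 = 4 * ((real K)\<^sup>2 * (sin \<delta>)\<^sup>2) * (cos \<delta>)\<^sup>2" by (simp add: power_mult_distrib)
  also have "\<dots> \<le> 4 * ((real K)\<^sup>2 * (sin \<delta>)\<^sup>2) * 1" by (intro mult_left_mono) (auto simp: abs_square_le_1)
  finally show "(real K * (2 * sin \<delta> * cos \<delta>))\<^sup>2 \<le> 16" using Ks by linarith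
qed

text \<open>The increment is bounded with the index \<open>i\<close> that is optimal at \<open>fst p\<close>; conditionally on
  \<open>fst p\<close> the bound is a quadratic polynomial in Gaussian variables.\<close>

lemma ferr_increment:
  obtains i and e :: real where "\<bar>e\<bar> = 1"
    "\<And>b. ferr N z - ferr N (rback a (z, b)) \<le> (sin a)\<^sup>2 * qf z (test_vec i) + (sin a)\<^sup>2 * qf b (test_vec i)
      + e * (2 * sin a * cos a) * ((\<Sum>j=1..n. inner (z j) (test_vec i) * inner (b j) (test_vec i)) / real n)"
    "qf z (test_vec i) \<le> S + ferr N z"
proof -
  obtain i where i: "i \<le> N" "ferr N z = \<bar>qf z (test_vec i) - inner (\<Sigma> (test_vec i)) (test_vec i)\<bar>"
    using ferr_attained by blast
  let ?v = "test_vec i"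
  define e :: real where "e = (if 0 \<le> qf z ?v - inner (\<Sigma> ?v) ?v then 1 else - 1)"
  have fz: "ferr N z = e * (qf z ?v - inner (\<Sigma> ?v) ?v)" unfolding i(2) e_def by simp
  show thesis
  proof (rule that[of e i])
    show "\<bar>e\<bar> = 1" by (simp add: e_def)
    show "qf z ?v \<le> S + ferr N z" using i(2) Sigma_test[of i] by linarith
    fix b
    define B where "B = (\<Sum>j=1..n. inner (z j) ?v * inner (b j) ?v) / real n"
    have qb: "qf (rback a (z, b)) ?v = (cos a)\<^sup>2 * qf z ?v - 2 * sin a * cos a * B + (sin a)\<^sup>2 * qf b ?v"
      unfolding qf_rback B_def by simp
    have "e * (qf (rback a (z, b)) ?v - inner (\<Sigma> ?v) ?v) \<le> \<bar>qf (rback a (z, b)) ?v - inner (\<Sigma> ?v) ?v\<bar>"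
      by (auto simp: e_def)
    then have "e * (qf (rback a (z, b)) ?v - inner (\<Sigma> ?v) ?v) \<le> ferr N (rback a (z, b))"
      using ferr_ge[OF i(1), of "rback a (z, b)"] by linarith
    then have "ferr N z - ferr N (rback a (z, b)) \<le> e * (qf z ?v - qf (rback a (z, b)) ?v)"
      unfolding fz by (simp add: algebra_simps)
    also have "\<dots> = e * ((sin a)\<^sup>2 * qf z ?v) + e * (2 * sin a * cos a) * B - e * ((sin a)\<^sup>2 * qf b ?v)"
      unfolding qb cos_squared_eq by (simp add: algebra_simps)
    also have "\<dots> \<le> (sin a)\<^sup>2 * qf z ?v + e * (2 * sin a * cos a) * B + (sin a)\<^sup>2 * qf b ?v"
      using qf_nonneg[of z ?v] qf_nonneg[of b ?v] mult_nonneg_nonneg[of "(sin a)\<^sup>2" "qf z ?v"]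
        mult_nonneg_nonneg[of "(sin a)\<^sup>2" "qf b ?v"] by (auto simp: e_def)
    finally show "ferr N z - ferr N (rback a (z, b)) \<le> (sin a)\<^sup>2 * qf z ?v + (sin a)\<^sup>2 * qf b ?v
      + e * (2 * sin a * cos a) * ((\<Sum>j=1..n. inner (z j) ?v * inner (b j) ?v) / real n)"
      by (simp add: B_def)
  qed
qed

text \<open>The bounds on \<open>K\<close> make \<open>real K * (sin \<delta>)\<^sup>2\<close> at
  most \<open>l * S / real n\<close> and keep the quadratic coefficient within the range of
  \<open>exp_quadratic_law\<close>. The form \<open>q\<close> at the fixed copy occurs with factor 1
  from its own quadratic term and 16 from the linear part; \<open>q \<le> S + ferr N z\<close> turns
  these 17 into the self-bounding term and into 17 of the 19 in the constant term, the other 2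
  coming from the quadratic part in \<open>b\<close>.\<close>

lemma ferr_exp_increment:
  assumes l: "0 < l" and S: "0 < S" and K: "4 * real n / (l * S) \<le> real K" "16 * l * S / real n \<le> real K" "0 < K"
  defines "\<delta> \<equiv> pi / (2 * real K)"
  shows "(\<integral>\<^sup>+b. ennreal (exp (real K * (l * (ferr N z - ferr N (rback \<delta> (z, b)))))) \<partial>law)
    \<le> ennreal (exp (19 * l\<^sup>2 * S\<^sup>2 / real n + 17 * l * S / real n * (l * ferr N z)))"
proof -
  note st = step_size[OF K(3), folded \<delta>_def]
  have n: "0 < real n" using n_pos by simp
  obtain e :: real and i where e: "\<bar>e\<bar> = 1"
    and inc: "\<And>b. ferr N z - ferr N (rback \<delta> (z, b)) \<le> (sin \<delta>)\<^sup>2 * qf z (test_vec i) + (sin \<delta>)\<^sup>2 * qf b (test_vec i)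
      + e * (2 * sin \<delta> * cos \<delta>) * ((\<Sum>j=1..n. inner (z j) (test_vec i) * inner (b j) (test_vec i)) / real n)"
    and qz: "qf z (test_vec i) \<le> S + ferr N z"
    by (rule ferr_increment[where N=N and z=z and a=\<delta>]) blast
  define v where "v = test_vec i"
  define q where "q = qf z v"
  have q0: "0 \<le> q" unfolding q_def by (rule qf_nonneg)
  have qS: "q \<le> S + ferr N z" using qz by (simp add: q_def v_def)
  have e2: "e\<^sup>2 = 1" using e by (metis power2_abs one_power2)
  define \<alpha> where "\<alpha> = l * (real K * (sin \<delta>)\<^sup>2) / real n"
  define \<beta> where "\<beta> j = l * e * (real K * (2 * sin \<delta> * cos \<delta>)) * inner (z j) v / real n" for j
  have Ks: "real K * (sin \<delta>)\<^sup>2 \<le> l * S / real n"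
  proof -
    have "4 / real K \<le> l * S / real n"
      using K l S n by (simp add: field_simps)
    then show ?thesis using st(1) by linarith
  qed
  have \<alpha>: "0 \<le> \<alpha>" using l n by (simp add: \<alpha>_def)
  have vS: "0 \<le> inner (\<Sigma> v) v" "inner (\<Sigma> v) v \<le> S" unfolding v_def by (rule cov.nonneg, rule Sigma_test)
  have "4 * \<alpha> * inner (\<Sigma> v) v \<le> 1"
  proof -
    have "4 * \<alpha> * inner (\<Sigma> v) v \<le> 4 * (l * (4 / real K) / real n) * S"
      unfolding \<alpha>_def using vS st(1) l n S by (intro mult_mono divide_right_mono mult_left_mono) auto
    also have "\<dots> = (16 * l * S / real n) / real K" by simp
    also have "\<dots> \<le> 1" using K(2,3) by (subst divide_le_eq_1_pos) simp_all
    finally show ?thesis .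
  qed
  note mgf = exp_quadratic_law[of "\<lambda>_. \<alpha>" "\<lambda>_. v" \<beta>, OF \<alpha> this]
  have pt: "real K * (l * (ferr N z - ferr N (rback \<delta> (z, b)))) \<le>
      l * (real K * (sin \<delta>)\<^sup>2) * q + (\<Sum>j=1..n. \<alpha> * (inner (b j) v)\<^sup>2 + \<beta> j * inner (b j) v)" for b
  proof -
    have "real K * (l * (ferr N z - ferr N (rback \<delta> (z, b)))) \<le> real K * (l * ((sin \<delta>)\<^sup>2 * q + (sin \<delta>)\<^sup>2 * qf b v
      + e * (2 * sin \<delta> * cos \<delta>) * ((\<Sum>j=1..n. inner (z j) v * inner (b j) v) / real n)))"
      using inc[of b] l by (intro mult_left_mono) (auto simp: v_def q_def)
    also have "\<dots> = l * (real K * (sin \<delta>)\<^sup>2) * q + (\<alpha> * (\<Sum>j=1..n. (inner (b j) v)\<^sup>2)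
      + (\<Sum>j=1..n. \<beta> j * inner (b j) v))"
      unfolding qf_eq \<alpha>_def \<beta>_def by (simp add: sum_distrib_left sum_divide_distrib distrib_left mult_ac)
    also have "\<dots> = l * (real K * (sin \<delta>)\<^sup>2) * q + (\<Sum>j=1..n. \<alpha> * (inner (b j) v)\<^sup>2 + \<beta> j * inner (b j) v)"
      by (simp add: sum.distrib sum_distrib_left)
    finally show ?thesis .
  qed
  have "(\<integral>\<^sup>+b. ennreal (exp (real K * (l * (ferr N z - ferr N (rback \<delta> (z, b)))))) \<partial>law)
     \<le> (\<integral>\<^sup>+b. ennreal (exp (l * (real K * (sin \<delta>)\<^sup>2) * q)) *
          ennreal (exp (\<Sum>j=1..n. \<alpha> * (inner (b j) v)\<^sup>2 + \<beta> j * inner (b j) v)) \<partial>law)"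
    using pt by (intro nn_integral_mono) (simp add: ennreal_mult[symmetric] exp_add[symmetric] ennreal_leI)
  also have "\<dots> = ennreal (exp (l * (real K * (sin \<delta>)\<^sup>2) * q)) *
      (\<integral>\<^sup>+b. ennreal (exp (\<Sum>j=1..n. \<alpha> * (inner (b j) v)\<^sup>2 + \<beta> j * inner (b j) v)) \<partial>law)"
    by (rule nn_integral_cmult) measurable
  also have "\<dots> \<le> ennreal (exp (l * (real K * (sin \<delta>)\<^sup>2) * q)) *
      ennreal (exp (\<Sum>j=1..n. (2 * \<alpha> + (\<beta> j)\<^sup>2) * inner (\<Sigma> v) v))"
    by (rule mult_left_mono[OF mgf]) simp
  also have "\<dots> = ennreal (exp (l * (real K * (sin \<delta>)\<^sup>2) * q + (\<Sum>j=1..n. (2 * \<alpha> + (\<beta> j)\<^sup>2) * inner (\<Sigma> v) v)))"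
    by (simp add: ennreal_mult[symmetric] exp_add)
  also have "\<dots> \<le> ennreal (exp (19 * l\<^sup>2 * S\<^sup>2 / real n + 17 * l * S / real n * (l * ferr N z)))"
  proof (rule ennreal_leI, subst exp_le_cancel_iff)
    have sb: "(\<Sum>j=1..n. (\<beta> j)\<^sup>2) = l\<^sup>2 * (real K * (2 * sin \<delta> * cos \<delta>))\<^sup>2 * q / real n"
    proof -
      have "(\<beta> j)\<^sup>2 = l\<^sup>2 * (real K * (2 * sin \<delta> * cos \<delta>))\<^sup>2 / (real n)\<^sup>2 * (inner (z j) v)\<^sup>2" for j
        using e2 by (simp add: \<beta>_def power_mult_distrib power_divide)
      then have "(\<Sum>j=1..n. (\<beta> j)\<^sup>2) = l\<^sup>2 * (real K * (2 * sin \<delta> * cos \<delta>))\<^sup>2 / (real n)\<^sup>2 * (\<Sum>j=1..n. (inner (z j) v)\<^sup>2)"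
        by (simp only: sum_distrib_left)
      also have "(\<Sum>j=1..n. (inner (z j) v)\<^sup>2) = real n * q" using n by (simp add: q_def qf_eq)
      finally show ?thesis using n by (simp add: power2_eq_square)
    qed
    have "(\<Sum>j=1..n. (2 * \<alpha> + (\<beta> j)\<^sup>2) * inner (\<Sigma> v) v) = (2 * (l * (real K * (sin \<delta>)\<^sup>2)) + (\<Sum>j=1..n. (\<beta> j)\<^sup>2)) * inner (\<Sigma> v) v"
      using n by (simp add: \<alpha>_def sum_distrib_right[symmetric] sum.distrib)
    also have "\<dots> \<le> (2 * (l * (l * S / real n)) + l\<^sup>2 * 16 * q / real n) * S"
      unfolding sb using Ks st(2) vS l q0 n S
      by (intro mult_mono add_mono mult_left_mono divide_right_mono mult_right_mono) (auto intro!: add_nonneg_nonneg)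
    finally have 1: "(\<Sum>j=1..n. (2 * \<alpha> + (\<beta> j)\<^sup>2) * inner (\<Sigma> v) v) \<le> 2 * (l\<^sup>2 * S\<^sup>2 / real n) + 16 * (l\<^sup>2 * S / real n * q)"
      by (simp add: power2_eq_square algebra_simps)
    have "l * (real K * (sin \<delta>)\<^sup>2) * q \<le> l * (l * S / real n) * q"
      using Ks l q0 by (intro mult_right_mono mult_left_mono) auto
    then have 2: "l * (real K * (sin \<delta>)\<^sup>2) * q \<le> l\<^sup>2 * S / real n * q" by (simp add: power2_eq_square mult_ac)
    have 3: "l\<^sup>2 * S / real n * q \<le> l\<^sup>2 * S / real n * (S + ferr N z)" using qS S n by (intro mult_left_mono) auto
    have 4: "l\<^sup>2 * S / real n * (S + ferr N z) = l\<^sup>2 * S\<^sup>2 / real n + l * S / real n * (l * ferr N z)"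
      by (simp add: power2_eq_square algebra_simps add_divide_distrib)
    show "l * (real K * (sin \<delta>)\<^sup>2) * q + (\<Sum>j=1..n. (2 * \<alpha> + (\<beta> j)\<^sup>2) * inner (\<Sigma> v) v)
       \<le> 19 * l\<^sup>2 * S\<^sup>2 / real n + 17 * l * S / real n * (l * ferr N z)"
      using 1 2 3 unfolding 4 by simp
  qed
  finally show ?thesis .
qed

lemma ferr_exp_difference:
  assumes l: "0 < l" and S: "0 < S"
  shows "(\<integral>\<^sup>+p. ennreal (exp (l * (ferr N (snd p) - ferr N (fst p)))) \<partial>(law \<Otimes>\<^sub>M law))
    \<le> (\<integral>\<^sup>+z. ennreal (exp (19 * l\<^sup>2 * S\<^sup>2 / real n + 17 * l * S / real n * (l * ferr N z))) \<partial>law)"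
proof -
  obtain K where K: "max 1 (max (4 * real n / (l * S)) (16 * l * S / real n)) \<le> real K" using real_arch_simple by blast
  then have K': "4 * real n / (l * S) \<le> real K" "16 * l * S / real n \<le> real K" "0 < K" by auto
  define \<delta> where "\<delta> = pi / (2 * real K)"
  define h where "h p = l * (ferr N (fst p) - ferr N (rback \<delta> p))" for p
  have h[measurable]: "h \<in> borel_measurable (seqM \<Otimes>\<^sub>M seqM)" 
    unfolding h_def[abs_def]
    by (intro borel_measurable_times borel_measurable_diff borel_measurable_const
        measurable_compose[OF measurable_fst measurable_ferr] measurable_compose[OF measurable_rback measurable_ferr])
  have "l * (ferr N (snd p) - ferr N (fst p)) = (\<Sum>k<K. h (rot (real (Suc k) * \<delta>) p))" for p
    unfolding path_telescope[OF K'(3), of "ferr N" p, folded \<delta>_def] h_def by (simp only: sum_distrib_left)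
  then have "(\<integral>\<^sup>+p. ennreal (exp (l * (ferr N (snd p) - ferr N (fst p)))) \<partial>(law \<Otimes>\<^sub>M law))
      \<le> (\<integral>\<^sup>+p. ennreal (exp (real K * h p)) \<partial>(law \<Otimes>\<^sub>M law))"
    using path_exp[OF h K'(3), of "\<lambda>k. real (Suc k) * \<delta>"] by simp
  also have "\<dots> = (\<integral>\<^sup>+z. \<integral>\<^sup>+b. ennreal (exp (real K * h (z, b))) \<partial>law \<partial>law)"
    by (rule law.nn_integral_fst[symmetric]) measurable
  also have "\<dots> \<le> (\<integral>\<^sup>+z. ennreal (exp (19 * l\<^sup>2 * S\<^sup>2 / real n + 17 * l * S / real n * (l * ferr N z))) \<partial>law)"
    using ferr_exp_increment[OF l S K', folded \<delta>_def] by (intro nn_integral_mono) (simp add: h_def)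
  finally show ?thesis .
qed

text \<open>The absorption in \<open>self_bounding_tail\<close> presupposes finiteness; for a
  maximum over finitely many directions it follows by summing the exponentials.\<close>

lemma integrable_exp_ferr:
  assumes l: "0 < l" "4 * l * S / real n \<le> 1"
  shows "integrable law (\<lambda>z. exp (l * ferr N z))"
proof (rule integrableI_nonneg)
  have n: "0 < real n" using n_pos by simp
  have pt: "exp (l * ferr N z) \<le> (\<Sum>i\<le>N. exp (l * S) * exp (\<Sum>j=1..n. l / real n * (inner (z j) (test_vec i))\<^sup>2 + 0 * inner (z j) (test_vec i)))" for z
  proof -
    obtain i where i: "i \<le> N" "ferr N z = \<bar>qf z (test_vec i) - inner (\<Sigma> (test_vec i)) (test_vec i)\<bar>"
      using ferr_attained by blast
    have "ferr N z \<le> S + qf z (test_vec i)"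
      using i(2) Sigma_test[of i] cov.nonneg[of "test_vec i"] qf_nonneg[of z "test_vec i"] S_nonneg by linarith
    then have "l * ferr N z \<le> l * (S + qf z (test_vec i))" using l by (intro mult_left_mono) auto
    also have "\<dots> = l * S + (\<Sum>j=1..n. l / real n * (inner (z j) (test_vec i))\<^sup>2 + 0 * inner (z j) (test_vec i))"
      by (simp add: qf_eq distrib_left sum_distrib_left sum_divide_distrib)
    finally have "exp (l * ferr N z) \<le> exp (l * S) * exp (\<Sum>j=1..n. l / real n * (inner (z j) (test_vec i))\<^sup>2 + 0 * inner (z j) (test_vec i))"
      by (simp add: exp_add[symmetric])
    also have "\<dots> \<le> (\<Sum>i\<le>N. exp (l * S) * exp (\<Sum>j=1..n. l / real n * (inner (z j) (test_vec i))\<^sup>2 + 0 * inner (z j) (test_vec i)))"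
      using i(1) by (intro member_le_sum) auto
    finally show ?thesis .
  qed
  have "(\<integral>\<^sup>+z. ennreal (exp (l * ferr N z)) \<partial>law) \<le>
      (\<integral>\<^sup>+z. (\<Sum>i\<le>N. ennreal (exp (l * S)) * ennreal (exp (\<Sum>j=1..n. l / real n * (inner (z j) (test_vec i))\<^sup>2 + 0 * inner (z j) (test_vec i)))) \<partial>law)"
  proof (intro nn_integral_mono)
    fix z
    have "ennreal (exp (l * ferr N z)) \<le> ennreal (\<Sum>i\<le>N. exp (l * S) * exp (\<Sum>j=1..n. l / real n * (inner (z j) (test_vec i))\<^sup>2 + 0 * inner (z j) (test_vec i)))"
      by (rule ennreal_leI[OF pt])
    then show "ennreal (exp (l * ferr N z)) \<le> (\<Sum>i\<le>N. ennreal (exp (l * S)) * ennreal (exp (\<Sum>j=1..n. l / real n * (inner (z j) (test_vec i))\<^sup>2 + 0 * inner (z j) (test_vec i))))"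
      by (simp add: ennreal_mult[symmetric] sum_ennreal del: mult_zero_left)
  qed
  also have "\<dots> = (\<Sum>i\<le>N. ennreal (exp (l * S)) * (\<integral>\<^sup>+z. ennreal (exp (\<Sum>j=1..n. l / real n * (inner (z j) (test_vec i))\<^sup>2 + 0 * inner (z j) (test_vec i))) \<partial>law))"
    by (subst nn_integral_sum) (auto simp: nn_integral_cmult simp del: mult_zero_left)
  also have "\<dots> < \<infinity>"
  proof -
    have "(\<integral>\<^sup>+z. ennreal (exp (\<Sum>j=1..n. l / real n * (inner (z j) (test_vec i))\<^sup>2 + 0 * inner (z j) (test_vec i))) \<partial>law) < \<infinity>" for i
    proof -
      have "4 * (l / real n) * inner (\<Sigma> (test_vec i)) (test_vec i) \<le> 4 * (l / real n) * S"
        using Sigma_test[of i] l n by (intro mult_left_mono) auto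
      then have "4 * (l / real n) * inner (\<Sigma> (test_vec i)) (test_vec i) \<le> 1" using l(2) by simp
      from exp_quadratic_law[of "\<lambda>_. l / real n" "\<lambda>_. test_vec i" "\<lambda>_. 0", OF _ this] l n
      show ?thesis by (simp add: le_less_trans[OF _ ennreal_less_top])
    qed
    then show ?thesis by (simp add: ennreal_mult_eq_top_iff less_top[symmetric] del: mult_zero_left)
  qed
  finally show "(\<integral>\<^sup>+z. ennreal (exp (l * ferr N z)) \<partial>law) < \<infinity>" .
qed auto

lemma err_tail:
  assumes g: "0 < g" "g \<le> S" and \<gamma>: "0 < \<gamma>" "\<gamma> < 1 / 2"
    and m: "(\<integral>z. err z \<partial>law) \<le> (1 - 2 * \<gamma>) * g / 2"
  shows "measure law {z. (1 - \<gamma>) * g / 2 < err z} \<le> exp (- (real n * \<gamma>\<^sup>2 * g\<^sup>2 / (640 * S\<^sup>2)))"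
proof -
  have n: "0 < real n" using n_pos by simp
  have S: "0 < S" using g by linarith
  define \<tau> where "\<tau> = (1 - \<gamma>) * g / 2"
  \<comment> \<open>With this \<open>l\<close> the losses \<open>d * \<tau>\<close> and
    \<open>c / l\<close> are at most 17/320 and 38/320 of \<open>\<gamma> * g\<close>. Of the
    available \<open>\<gamma> * g / 2\<close> at least \<open>\<gamma> * g / 4\<close> remains, and
    640 is \<open>4 * 160\<close>.\<close>
  define l where "l = real n * \<gamma> * g / (160 * S\<^sup>2)"
  define d where "d = 17 * l * S / real n"
  define c where "c = 19 * l\<^sup>2 * S\<^sup>2 / real n"
  have l: "0 < l" using n g \<gamma> S by (simp add: l_def)
  have d': "d = 17 * \<gamma> * g / (160 * S)" unfolding d_def l_def using n S by (simp add: power2_eq_square)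
  have gS: "g / S \<le> 1" using g S by simp
  have d: "0 \<le> d" "d \<le> 17 * \<gamma> / 160"
    using g S \<gamma> mult_left_mono[OF gS, of "17 * \<gamma> / 160"] by (simp_all add: d')
  have c': "c = l * (19 * \<gamma> * g / 160)"
    unfolding c_def power2_eq_square[of l] l_def using n S by (simp add: power2_eq_square)
  define e where "e = (1 - d) * l * \<tau> - l * ((1 - 2 * \<gamma>) * g / 2) - c"
  have "e = l * ((1 - d) * \<tau> - (1 - 2 * \<gamma>) * g / 2 - 19 * \<gamma> * g / 160)" by (simp add: e_def c' algebra_simps)
  also have "\<dots> \<ge> l * (\<gamma> * g / 4)"
  proof (rule mult_left_mono)
    have "d * \<tau> \<le> (17 * \<gamma> / 160) * (g / 2)"
      using d \<gamma> g unfolding \<tau>_def by (intro mult_mono) auto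
    then show "\<gamma> * g / 4 \<le> (1 - d) * \<tau> - (1 - 2 * \<gamma>) * g / 2 - 19 * \<gamma> * g / 160"
    proof -
      assume dt: "d * \<tau> \<le> (17 * \<gamma> / 160) * (g / 2)"
      have "(1 - d) * \<tau> - (1 - 2 * \<gamma>) * g / 2 = \<gamma> * g / 2 - d * \<tau>"
        by (simp add: \<tau>_def left_diff_distrib diff_divide_distrib)
      then show ?thesis using dt mult_pos_pos[OF \<gamma>(1) g(1)] by simp
    qed
  qed (use l in simp)
  finally have "l * (\<gamma> * g / 4) \<le> e" .
  moreover have "l * (\<gamma> * g / 4) = real n * \<gamma>\<^sup>2 * g\<^sup>2 / (640 * S\<^sup>2)" by (simp add: l_def power2_eq_square)
  ultimately have e: "real n * \<gamma>\<^sup>2 * g\<^sup>2 / (640 * S\<^sup>2) \<le> e" by simp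
  have e0: "0 \<le> e" using e n by (meson divide_nonneg_nonneg mult_nonneg_nonneg order_trans zero_le_power2 less_imp_le zero_le_numeral)
  have small: "4 * l * S / real n \<le> 1"
  proof -
    have "4 * l * S / real n = (4 * \<gamma> / 160) * (g / S)" unfolding l_def using n S by (simp add: power2_eq_square)
    also have "\<dots> \<le> (4 * \<gamma> / 160) * 1" using gS \<gamma> by (intro mult_left_mono) auto
    finally show ?thesis using \<gamma> by simp
  qed
  have fi: "integrable law (ferr N)" for N
  proof (rule Bochner_Integration.integrable_bound[OF integrable_err])
    have "0 \<le> ferr N z" for z using ferr_attained[of N z] by auto
    then show "AE z in law. norm (ferr N z) \<le> norm (err z)"
      using ferr_le_err[of N] err_nonneg by (intro AE_I2) simp
  qed measurable
  have tail: "measure law {z\<in>space law. \<tau> \<le> ferr N z} \<le> exp (- e)" for N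
  proof (rule self_bounding_tail[where f="ferr N" and l=l and d=d and c=c and m="(1 - 2 * \<gamma>) * g / 2"])
    show "d < 1" using d \<gamma> by simp
    have "(\<integral>z. ferr N z \<partial>law) \<le> (\<integral>z. err z \<partial>law)"
      using fi integrable_err ferr_le_err by (intro integral_mono) auto
    then show "(\<integral>z. ferr N z \<partial>law) \<le> (1 - 2 * \<gamma>) * g / 2" using m by linarith
    show "integrable law (\<lambda>z. exp (l * ferr N z))" by (rule integrable_exp_ferr[OF l small])
    show "(\<integral>\<^sup>+p. ennreal (exp (l * (ferr N (snd p) - ferr N (fst p)))) \<partial>(law \<Otimes>\<^sub>M law))
      \<le> (\<integral>\<^sup>+x. ennreal (exp (c + d * (l * ferr N x))) \<partial>law)"
      unfolding c_def d_def by (rule ferr_exp_difference[OF l S])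
  qed (use prob_law l d e0 fi in \<open>simp_all add: e_def\<close>)
  have \<tau>0: "0 \<le> \<tau>" using g \<gamma> by (simp add: \<tau>_def)
  \<comment> \<open>The bound for \<open>ferr N\<close> is uniform in \<open>N\<close>, so it passes
    to the increasing union.\<close>
  have un: "{z. \<tau> < err z} = (\<Union>N. {z. \<tau> < ferr N z})"
    using err_le_iff[OF \<tau>0] by (auto simp: not_le[symmetric])
  have mono: "ferr N z \<le> ferr (Suc N) z" for N z
  proof -
    obtain i where "i \<le> N" "ferr N z = \<bar>qf z (test_vec i) - inner (\<Sigma> (test_vec i)) (test_vec i)\<bar>" using ferr_attained by blast
    then show ?thesis using ferr_ge[of i "Suc N" z] by simp
  qed
  have "(\<lambda>N. measure law {z. \<tau> < ferr N z}) \<longlonglongrightarrow> measure law (\<Union>N. {z. \<tau> < ferr N z})"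
  proof (rule law.finite_Lim_measure_incseq)
    have "{z. \<tau> < ferr N z} \<in> sets law" for N
    proof -
      have "{z. \<tau> < ferr N z} = ferr N -` {\<tau><..} \<inter> space law" by auto
      then show ?thesis
        using measurable_sets[of "ferr N" law borel "{\<tau><..}"] measurable_ferr[of N]
          measurable_cong_sets[OF sets_law refl, of borel] by simp
    qed
    then show "range (\<lambda>N. {z. \<tau> < ferr N z}) \<subseteq> sets law" by auto
    show "incseq (\<lambda>N. {z. \<tau> < ferr N z})"
      by (rule incseq_SucI) (use mono in \<open>auto intro: less_le_trans\<close>)
  qed
  then have "measure law {z. \<tau> < err z} \<le> exp (- e)"
    unfolding un
  proof (rule LIMSEQ_le_const2)
    have "measure law {z. \<tau> < ferr N z} \<le> exp (- e)" for N
    proof -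
      have "measure law {z. \<tau> < ferr N z} \<le> measure law {z\<in>space law. \<tau> \<le> ferr N z}"
      proof (rule law.finite_measure_mono)
        have "{z \<in> space law. \<tau> \<le> ferr N z} = ferr N -` {\<tau>..} \<inter> space law" by auto
        then show "{z \<in> space law. \<tau> \<le> ferr N z} \<in> sets law"
          using measurable_sets[of "ferr N" law borel "{\<tau>..}"] measurable_ferr[of N]
            measurable_cong_sets[OF sets_law refl, of borel] by simp
      qed auto
      then show ?thesis using tail[of N] by linarith
    qed
    then show "\<exists>N0. \<forall>N\<ge>N0. measure law {z. \<tau> < ferr N z} \<le> exp (- e)" by blast
  qed
  also have "\<dots> \<le> exp (- (real n * \<gamma>\<^sup>2 * g\<^sup>2 / (640 * S\<^sup>2)))" using e by simp
  finally show ?thesis by (simp add: \<tau>_def)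
qed

end

section \<open>Measurability of empirical spectral projectors\<close>

text \<open>Only the components 1 to \<open>n\<close> enter, and they are continuous in the product
  topology; Weyl's inequality carries continuity from the operator to its eigenvalues.\<close>

lemma continuous_eigval_scov:
  fixes n i :: nat
  shows "continuous_on UNIV (\<lambda>z :: nat \<Rightarrow> 'h::{real_inner,banach,second_countable_topology}. eigval (scov n z) i)"
proof (rule continuous_at_imp_continuous_on, rule ballI)
  fix w :: "nat \<Rightarrow> 'h"
  define e where "e z = (\<Sum>j=1..n. (norm (z j) + norm (w j)) * norm (z j - w j)) / real n" for z :: "nat \<Rightarrow> 'h"
  have e0: "0 \<le> e z" for z unfolding e_def by (intro divide_nonneg_nonneg sum_nonneg mult_nonneg_nonneg) auto
  have "norm (scov n z x - scov n w x) \<le> e z * norm x" for z x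
  proof -
    have "scov n z x - scov n w x = (1 / real n) *\<^sub>R (\<Sum>j=1..n. inner (z j) x *\<^sub>R z j - inner (w j) x *\<^sub>R w j)"
      by (simp add: scov_def sum_subtractf scaleR_diff_right)
    then have "norm (scov n z x - scov n w x) \<le> (1 / real n) * (\<Sum>j=1..n. norm (inner (z j) x *\<^sub>R z j - inner (w j) x *\<^sub>R w j))"
      by (simp add: divide_right_mono norm_sum)
    also have "\<dots> \<le> (1 / real n) * (\<Sum>j=1..n. (norm (z j) + norm (w j)) * norm (z j - w j) * norm x)"
    proof (intro mult_left_mono sum_mono)
      fix j
      have "inner (z j) x *\<^sub>R z j - inner (w j) x *\<^sub>R w j = inner (z j) x *\<^sub>R (z j - w j) + inner (z j - w j) x *\<^sub>R w j"
        by (simp add: inner_diff_left scaleR_diff_left scaleR_diff_right)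
      then have "norm (inner (z j) x *\<^sub>R z j - inner (w j) x *\<^sub>R w j) \<le> \<bar>inner (z j) x\<bar> * norm (z j - w j) + \<bar>inner (z j - w j) x\<bar> * norm (w j)"
        using norm_triangle_ineq[of "inner (z j) x *\<^sub>R (z j - w j)" "inner (z j - w j) x *\<^sub>R w j"] by simp
      also have "\<dots> \<le> (norm (z j) * norm x) * norm (z j - w j) + (norm (z j - w j) * norm x) * norm (w j)"
        by (intro add_mono mult_right_mono Cauchy_Schwarz_ineq2) auto
      finally show "norm (inner (z j) x *\<^sub>R z j - inner (w j) x *\<^sub>R w j) \<le> (norm (z j) + norm (w j)) * norm (z j - w j) * norm x"
        by (simp add: algebra_simps)
    qed simp
    also have "\<dots> = e z * norm x" by (simp add: e_def sum_distrib_right sum_divide_distrib)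
    finally show ?thesis .
  qed
  then have W: "\<bar>eigval (scov n z) i - eigval (scov n w) i\<bar> \<le> e z" for z
    by (intro Weyl compact_nonneg_scov e0)
  have coord: "((\<lambda>z. z j) \<longlongrightarrow> w j) (at w)" for j
  proof -
    have "continuous_on UNIV (\<lambda>z :: nat \<Rightarrow> 'h. z j)" by (rule continuous_on_product_coordinates)
    then have "isCont (\<lambda>z. z j) w" unfolding continuous_on_eq_continuous_at[OF open_UNIV] by (rule bspec) simp
    then show ?thesis by (simp add: isCont_def)
  qed
  have "(e \<longlongrightarrow> (\<Sum>j=1..n. (norm (w j) + norm (w j)) * norm (w j - w j)) / real n) (at w)"
    unfolding e_def divide_inverse by (intro tendsto_mult tendsto_sum tendsto_add tendsto_norm tendsto_diff tendsto_const coord)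
  then have "(e \<longlongrightarrow> 0) (at w)" by simp
  then have "((\<lambda>z. eigval (scov n z) i - eigval (scov n w) i) \<longlongrightarrow> 0) (at w)"
    by (rule Lim_null_comparison[rotated]) (use W in simp)
  then show "isCont (\<lambda>z. eigval (scov n z) i) w" by (simp add: isCont_def LIM_zero_iff)
qed

lemma measurable_eigval_scov:
  "(\<lambda>z. eigval (scov n z) i) \<in> borel_measurable (seqM :: (nat \<Rightarrow> 'h::{real_inner,banach,second_countable_topology}) measure)"
proof -
  have "(\<lambda>z :: nat \<Rightarrow> 'h. eigval (scov n z) i) \<in> borel_measurable borel"
    by (rule borel_measurable_continuous_onI[OF continuous_eigval_scov])
  then show ?thesis using measurable_cong_sets[OF sets_PiM_equal_borel refl] by blast
qed

lemma measurable_scov_app: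
  fixes F :: "(nat \<Rightarrow> 'h) \<Rightarrow> 'h::{real_inner,banach,second_countable_topology}"
  assumes "F \<in> borel_measurable seqM"
  shows "(\<lambda>z. scov n z (F z)) \<in> borel_measurable seqM"
  unfolding scov_def
  by (intro borel_measurable_scaleR borel_measurable_const borel_measurable_sum borel_measurable_inner
      measurable_seq_component assms)

lemma measurable_projector_scov:
  fixes x :: "'h::{real_inner,banach,second_countable_topology}"
  shows "(\<lambda>z. spectral_projector (scov n z) (eigval (scov n z) i) x) \<in> borel_measurable seqM"
proof (rule borel_measurable_LIMSEQ_metric)
  let ?l = "\<lambda>z :: nat \<Rightarrow> 'h. eigval (scov n z) i"
  fix z :: "nat \<Rightarrow> 'h"
  interpret B: compact_nonneg "scov n z" by (rule compact_nonneg_scov)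
  have "?l z \<le> B.el 0" using B.decseq_el by (simp add: decseq_def)
  then show "(\<lambda>m. ((compact_nonneg.damped (scov n z) (?l z)) ^^ m) x) \<longlonglongrightarrow> spectral_projector (scov n z) (?l z) x"
    by (rule B.damped_tendsto_projector(1)[OF eigval_scov_eq_0 B.el_nonneg])
next
  let ?l = "\<lambda>z :: nat \<Rightarrow> 'h. eigval (scov n z) i"
  show "(\<lambda>z. ((compact_nonneg.damped (scov n z) (?l z)) ^^ m) x) \<in> borel_measurable seqM" for m
  proof (induction m)
    case (Suc m)
    define F where "F z = ((compact_nonneg.damped (scov n z) (?l z)) ^^ m) x" for z
    have F: "F \<in> borel_measurable seqM" using Suc by (simp add: F_def[abs_def])
    define y where "y z = scov n z (F z) - ?l z *\<^sub>R F z" for z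
    have y: "y \<in> borel_measurable seqM" unfolding y_def[abs_def]
      by (intro borel_measurable_diff measurable_scov_app F borel_measurable_scaleR measurable_eigval_scov)
    have "((compact_nonneg.damped (scov n z) (?l z)) ^^ Suc m) x =
        F z - (1 / (1 + (eigval (scov n z) 0)\<^sup>2)) *\<^sub>R (scov n z (y z) - ?l z *\<^sub>R y z)" for z
      by (simp add: F_def[symmetric] y_def compact_nonneg.damped_def[OF compact_nonneg_scov] Let_def)
    moreover have "(\<lambda>z. F z - (1 / (1 + (eigval (scov n z) 0)\<^sup>2)) *\<^sub>R (scov n z (y z) - ?l z *\<^sub>R y z)) \<in> borel_measurable seqM"
      by (intro borel_measurable_diff measurable_scov_app F y borel_measurable_scaleR measurable_eigval_scov
          borel_measurable_divide borel_measurable_const borel_measurable_add borel_measurable_power)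
    ultimately show ?case by simp
  qed simp
qed

text \<open>These facts are stated at every data point, also where the eigenvalue is multiple or
  zero, because the mean of the projector is taken over the whole sample space.\<close>

lemma projector_scov:
  fixes z :: "nat \<Rightarrow> 'h::{real_inner,banach,second_countable_topology}"
  shows "spectral_projector (scov n z) (eigval (scov n z) i) x \<in> eigenspace (scov n z) (eigval (scov n z) i)"
    and "y \<in> eigenspace (scov n z) (eigval (scov n z) i) \<Longrightarrow>
      inner (x - spectral_projector (scov n z) (eigval (scov n z) i) x) y = 0"
    and "norm (spectral_projector (scov n z) (eigval (scov n z) i) x) \<le> norm x"
proof -
  interpret B: compact_nonneg "scov n z" by (rule compact_nonneg_scov)
  have "B.el i \<le> B.el 0" using B.decseq_el by (simp add: decseq_def)
  note P = B.damped_tendsto_projector(2,3)[OF eigval_scov_eq_0 B.el_nonneg this, where x = x]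
  let ?P = "spectral_projector (scov n z) (B.el i) x"
  show 1: "?P \<in> eigenspace (scov n z) (B.el i)" by (rule P(1))
  show 2: "inner (x - ?P) y = 0" if "y \<in> eigenspace (scov n z) (B.el i)" for y using that by (rule P(2))
  have "(norm ?P)\<^sup>2 = inner x ?P" using 2[OF 1] by (simp add: inner_diff_left power2_norm_eq_inner)
  also have "\<dots> \<le> norm x * norm ?P" by (rule norm_cauchy_schwarz)
  finally show "norm ?P \<le> norm x" by (cases "?P = 0") (simp_all add: power2_eq_square)
qed

section \<open>Concentration of the empirical spectral projector\<close>

locale eigen_data = gaussian_data M X Y n
  for M :: "'w measure" and X :: "'w \<Rightarrow> 'h::{real_inner,banach,second_countable_topology}"
    and Y :: "nat \<Rightarrow> 'w \<Rightarrow> 'h" and n :: nat +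
  fixes r :: nat and \<theta> :: 'h and \<gamma> :: real
  assumes eigenpair: "simple_eigenpair \<Sigma> r \<theta>" and gam: "0 < \<gamma>" "\<gamma> < 1 / 2"
    and mean_err: "(\<integral>z. err z \<partial>law) \<le> (1 - 2 * \<gamma>) * spectral_gap \<Sigma> r / 2"
begin

abbreviation \<mu> where "\<mu> \<equiv> distinct_eigenvalue \<Sigma> r"
abbreviation g where "g \<equiv> spectral_gap \<Sigma> r"
abbreviation jr where "jr \<equiv> eigenvalue_index \<Sigma> r"
text \<open>As long as the error is at most \<open>\<tau>2\<close>, the empirical eigenvalue is separated from the others by
  \<open>\<eta>\<close>.  With high probability it is at most \<open>\<tau>1 < \<tau>2\<close>, which leaves room for
  interpolating between the points of a finite grid on the rotation path.\<close>

definition \<eta> where "\<eta> = \<gamma> * g / 2"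
definition \<tau>1 where "\<tau>1 = (1 - \<gamma>) * g / 2"
definition \<tau>2 where "\<tau>2 = (1 - \<gamma> / 2) * g / 2"

lemma mu_pos: "\<mu> \<in> pos_eigenvalues \<Sigma>" and r_pos: "1 \<le> r" and norm_theta: "norm \<theta> = 1"
  and theta_eig: "\<theta> \<in> eigenspace \<Sigma> \<mu>"
  using eigenpair by (simp_all add: simple_eigenpair_def)

lemma g_pos: "0 < g" and g_le_mu: "g \<le> \<mu>"
  using cov.spectral_gap_facts[OF mu_pos r_pos] by blast+

lemma Sigma_theta: "\<Sigma> \<theta> = \<mu> *\<^sub>R \<theta>" using theta_eig by (simp add: eigenspace_def)

lemma mu_le_S: "\<mu> \<le> S"
proof -
  have "norm (\<Sigma> \<theta>) \<le> S * norm \<theta>" by (rule onorm[OF cov.bounded_linear])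
  then show ?thesis using Sigma_theta norm_theta pos_eigenvalues_pos[OF mu_pos] by simp
qed

lemma g_le_S: "g \<le> S" using g_le_mu mu_le_S by linarith
lemma S_pos: "0 < S" using g_pos g_le_S by linarith

lemma eta_pos: "0 < \<eta>" and eta_le_S: "\<eta> \<le> S"
proof -
  show "0 < \<eta>" using gam g_pos by (simp add: \<eta>_def)
  have "\<gamma> * g \<le> 1 * g" using gam g_pos by (intro mult_right_mono) auto
  then show "\<eta> \<le> S" unfolding \<eta>_def using g_le_S g_pos by linarith
qed

lemma tau2: "g - 2 * \<tau>2 = \<eta>" "\<tau>2 < g / 2" "\<tau>2 \<le> S" "0 < \<tau>1"
proof -
  show "g - 2 * \<tau>2 = \<eta>" by (simp add: \<tau>2_def \<eta>_def field_simps)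
  then show t: "\<tau>2 < g / 2" using eta_pos by linarith
  show "\<tau>2 \<le> S" using t g_le_S g_pos by linarith
  show "0 < \<tau>1" using gam g_pos by (simp add: \<tau>1_def)
qed

text \<open>By Weyl's inequality each eigenvalue moves by at most \<open>\<tau>2\<close>, so a
  distance of at least \<open>g\<close> shrinks to no less than \<open>g - 2 * \<tau>2\<close>,
  which is \<eta>.\<close>

lemma good_gap:
  assumes "err z \<le> \<tau>2"
  shows "\<eta> \<le> eigval (scov n z) jr" "i \<noteq> jr \<Longrightarrow> \<eta> \<le> \<bar>eigval (scov n z) i - eigval (scov n z) jr\<bar>"
proof -
  have W: "\<bar>eigval (scov n z) i - eigval \<Sigma> i\<bar> \<le> \<tau>2" for i
    using Weyl[OF compact_nonneg_scov cov.compact_nonneg_axioms err_nonneg norm_le_err, of z i] assms by linarith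
  have j: "eigval \<Sigma> jr = \<mu>" by (rule cov.simple_eigenpair_facts[OF eigenpair])
  show "\<eta> \<le> eigval (scov n z) jr" using W[of jr] j g_le_mu tau2 g_pos by linarith
  assume "i \<noteq> jr"
  then have "eigval \<Sigma> i \<noteq> \<mu>" by (rule cov.simple_eigenpair_facts(2)[OF eigenpair])
  then have "g \<le> \<bar>eigval \<Sigma> i - \<mu>\<bar>" by (rule cov.spectral_gap_facts(3)[OF mu_pos r_pos])
  then show "\<eta> \<le> \<bar>eigval (scov n z) i - eigval (scov n z) jr\<bar>" using W[of jr] W[of i] j tau2 by linarith
qed

text \<open>Defined for all data through the projector, so that it is measurable and bounded without
  a choice of eigenvectors.\<close>

definition f :: "'h \<Rightarrow> (nat \<Rightarrow> 'h) \<Rightarrow> real" where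
  "f u z = inner (spectral_projector (scov n z) (eigval (scov n z) jr) \<theta>) u"

lemma f_measurable: "f u \<in> borel_measurable seqM"
  unfolding f_def[abs_def] by (intro borel_measurable_inner measurable_projector_scov borel_measurable_const)

lemma f_bound: "\<bar>f u z\<bar> \<le> norm u"
proof -
  have "\<bar>f u z\<bar> \<le> norm (spectral_projector (scov n z) (eigval (scov n z) jr) \<theta>) * norm u"
    unfolding f_def by (rule Cauchy_Schwarz_ineq2)
  also have "\<dots> \<le> 1 * norm u"
    using projector_scov(3)[of n z jr \<theta>] norm_theta by (intro mult_right_mono) auto
  finally show ?thesis by simp
qed

lemma f_good:
  assumes "err z \<le> \<tau>2"
  shows "f u z = inner (eigvec (scov n z) jr) \<theta> * inner (eigvec (scov n z) jr) u"
proof -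
  interpret B: compact_nonneg "scov n z" by (rule compact_nonneg_scov)
  have "0 < B.el jr" using good_gap(1)[OF assms] eta_pos by linarith
  moreover have "B.el i \<noteq> B.el jr" if "i \<noteq> jr" for i using good_gap(2)[OF assms that] eta_pos by auto
  ultimately show ?thesis unfolding f_def by (subst B.simple_spectral_projector) auto
qed

lemma scov_good:
  assumes "err z \<le> \<tau>2"
  shows "norm (scov n z x) \<le> 2 * S * norm x" "qf z x \<le> 2 * S * (norm x)\<^sup>2"
proof -
  have "norm (scov n z x) \<le> norm (\<Sigma> x) + norm (scov n z x - \<Sigma> x)"
    by (metis add.commute diff_add_cancel norm_triangle_ineq)
  also have "\<dots> \<le> S * norm x + err z * norm x" by (intro add_mono onorm[OF cov.bounded_linear] norm_le_err)
  also have "\<dots> \<le> S * norm x + S * norm x" using assms tau2(3) by (intro add_left_mono mult_right_mono) auto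
  finally show 1: "norm (scov n z x) \<le> 2 * S * norm x" by (simp add: mult_ac)
  have "qf z x \<le> norm (scov n z x) * norm x" by (rule norm_cauchy_schwarz)
  also have "\<dots> \<le> 2 * S * norm x * norm x" by (intro mult_right_mono 1) simp
  finally show "qf z x \<le> 2 * S * (norm x)\<^sup>2" by (simp add: power2_eq_square)
qed

lemma cross_bound: "\<bar>(\<Sum>j=1..n. inner (z j) v * inner (b j) v) / real n\<bar> \<le> (qf z v + qf b v) / 2"
proof -
  have "\<bar>\<Sum>j=1..n. inner (z j) v * inner (b j) v\<bar> \<le> (\<Sum>j=1..n. ((inner (z j) v)\<^sup>2 + (inner (b j) v)\<^sup>2) / 2)"
  proof (rule order_trans[OF sum_abs], rule sum_mono)
    fix j
    have "x * y \<le> (x\<^sup>2 + y\<^sup>2) / 2" for x y :: real using sum_squares_bound[of x y] by simp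
    from this[of "inner (z j) v" "inner (b j) v"] this[of "- inner (z j) v" "inner (b j) v"]
    show "\<bar>inner (z j) v * inner (b j) v\<bar> \<le> ((inner (z j) v)\<^sup>2 + (inner (b j) v)\<^sup>2) / 2"
      by (intro abs_leI) simp_all
  qed
  then have "\<bar>\<Sum>j=1..n. inner (z j) v * inner (b j) v\<bar> / real n \<le> (\<Sum>j=1..n. ((inner (z j) v)\<^sup>2 + (inner (b j) v)\<^sup>2) / 2) / real n"
    by (rule divide_right_mono) simp
  also have "\<dots> = (qf z v + qf b v) / 2"
    unfolding qf_eq by (simp add: sum.distrib sum_divide_distrib[symmetric] add_divide_distrib)
  finally show ?thesis by simp
qed

text \<open>The part of first order in \<open>a\<close> is linear in the second copy
  \<open>b\<close>; all else carries the factor \<open>(sin a)\<^sup>2\<close>. Given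
  \<open>z\<close>, an increment is thus Gaussian up to second order.\<close>

lemma inner_scov_rback: "inner (scov n z x - scov n (rback a (z, b)) x) w =
    (sin a)\<^sup>2 * (inner (scov n z x) w - inner (scov n b x) w)
    + sin a * cos a / real n * (\<Sum>j=1..n. inner (b j) (inner (z j) x *\<^sub>R w + inner (z j) w *\<^sub>R x))"
proof -
  have c2: "(cos a)\<^sup>2 = 1 - (sin a)\<^sup>2" by (rule cos_squared_eq)
  have summand: "inner (z j) x * inner (z j) w - inner (rback a (z, b) j) x * inner (rback a (z, b) j) w =
      (sin a)\<^sup>2 * (inner (z j) x * inner (z j) w - inner (b j) x * inner (b j) w)
      + sin a * cos a * inner (b j) (inner (z j) x *\<^sub>R w + inner (z j) w *\<^sub>R x)" for j
  proof -
    have "inner (rback a (z, b) j) x * inner (rback a (z, b) j) w =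
      (cos a)\<^sup>2 * (inner (z j) x * inner (z j) w) + (sin a)\<^sup>2 * (inner (b j) x * inner (b j) w)
      - sin a * cos a * inner (b j) (inner (z j) x *\<^sub>R w + inner (z j) w *\<^sub>R x)"
      by (simp add: rback_def inner_diff_left inner_add_right power2_eq_square algebra_simps)
    then show ?thesis unfolding c2 by (simp add: algebra_simps)
  qed
  have "inner (scov n z x - scov n (rback a (z, b)) x) w =
      (\<Sum>j=1..n. inner (z j) x * inner (z j) w - inner (rback a (z, b) j) x * inner (rback a (z, b) j) w) / real n"
    by (simp add: inner_diff_left inner_scov sum_subtractf diff_divide_distrib)
  also have "\<dots> = ((sin a)\<^sup>2 * (\<Sum>j=1..n. inner (z j) x * inner (z j) w - inner (b j) x * inner (b j) w)
      + sin a * cos a * (\<Sum>j=1..n. inner (b j) (inner (z j) x *\<^sub>R w + inner (z j) w *\<^sub>R x))) / real n"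
    unfolding summand by (simp add: sum.distrib sum_distrib_left)
  finally show ?thesis
    by (simp add: inner_scov sum_subtractf diff_divide_distrib add_divide_distrib right_diff_distrib)
qed

text \<open>On quadratic forms of unit vectors, the part with \<open>(sin \<delta>)\<^sup>2\<close>
  contributes at most \<open>2 * S * \<delta>\<close> and the cross term at most
  \<open>4 * S * \<delta>\<close>; \<open>symmetric_norm_le\<close> converts this into a norm
  bound.\<close>

lemma scov_rback_close:
  assumes z: "err z \<le> \<tau>2" and b: "err b \<le> \<tau>2" and d: "0 < \<delta>" "\<delta> \<le> 1"
  shows "norm (scov n z x - scov n (rback \<delta> (z, b)) x) \<le> (6 * S * \<delta>) * norm x"
proof (rule symmetric_norm_le)
  interpret A: compact_nonneg "scov n z" by (rule compact_nonneg_scov)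
  interpret B: compact_nonneg "scov n (rback \<delta> (z, b))" by (rule compact_nonneg_scov)
  show "linear (\<lambda>x. scov n z x - scov n (rback \<delta> (z, b)) x)"
    by (intro linear_compose_sub bounded_linear.linear A.bounded_linear B.bounded_linear)
  show "inner (scov n z x - scov n (rback \<delta> (z, b)) x) y = inner x (scov n z y - scov n (rback \<delta> (z, b)) y)" for x y
    by (simp add: inner_diff_left inner_diff_right A.symmetric B.symmetric)
  show "0 \<le> 6 * S * \<delta>" using S_nonneg d by simp
  fix v
  define c where "c = (\<Sum>j=1..n. inner (z j) v * inner (b j) v) / real n"
  have eq: "inner (scov n z v - scov n (rback \<delta> (z, b)) v) v = (sin \<delta>)\<^sup>2 * (qf z v - qf b v) + 2 * sin \<delta> * cos \<delta> * c"
    unfolding inner_diff_left qf_rback c_def cos_squared_eq by (simp add: algebra_simps)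
  have s: "\<bar>sin \<delta>\<bar> \<le> \<delta>" using abs_sin_x_le_abs_x[of \<delta>] d by simp
  have s2: "(sin \<delta>)\<^sup>2 \<le> \<delta>"
  proof -
    have "(sin \<delta>)\<^sup>2 = \<bar>sin \<delta>\<bar> * \<bar>sin \<delta>\<bar>" by (simp add: power2_eq_square)
    also have "\<dots> \<le> \<delta> * 1" using s d by (intro mult_mono) auto
    finally show ?thesis by simp
  qed
  define m where "m = S * (norm v)\<^sup>2"
  have m0: "0 \<le> m" using S_nonneg by (simp add: m_def)
  have q: "0 \<le> qf z v" "qf z v \<le> 2 * m" "0 \<le> qf b v" "qf b v \<le> 2 * m"
    using qf_nonneg scov_good(2)[OF z, of v] scov_good(2)[OF b, of v] by (simp_all add: m_def mult.assoc)
  have "\<bar>c\<bar> \<le> (qf z v + qf b v) / 2" unfolding c_def by (rule cross_bound)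
  also have "\<dots> \<le> (2 * m + 2 * m) / 2" by (intro divide_right_mono add_mono q) simp
  finally have c: "\<bar>c\<bar> \<le> 2 * m" by simp
  have "\<bar>(sin \<delta>)\<^sup>2 * (qf z v - qf b v)\<bar> \<le> \<delta> * (2 * m)"
    unfolding abs_mult using s2 q m0 d by (intro mult_mono) auto
  moreover have "\<bar>2 * sin \<delta> * cos \<delta> * c\<bar> \<le> 2 * \<delta> * 1 * (2 * m)"
    unfolding abs_mult using s c d m0 by (intro mult_mono) auto
  ultimately have "\<bar>inner (scov n z v - scov n (rback \<delta> (z, b)) v) v\<bar> \<le> \<delta> * (2 * m) + 2 * \<delta> * 1 * (2 * m)"
    unfolding eq by linarith
  then show "\<bar>inner (scov n z v - scov n (rback \<delta> (z, b)) v) v\<bar> \<le> 6 * S * \<delta> * (norm v)\<^sup>2"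
    by (simp add: m_def mult_ac)
qed

text \<open>Up to a factor, the vectors \<open>c j\<close> are the gradient at \<open>z\<close>;
  they do not depend on \<open>b\<close>. Their squared norms sum to a controlled amount because
  \<open>real n * qf z v\<close> is a sum of squared coordinates. The remainder constant 1016 is
  \<open>28 * 36 + 8\<close>, from \<open>projector_expansion\<close> with
  \<open>\<epsilon> = 6 * S * \<delta>\<close> and from the second-order part in
  \<open>inner_scov_rback\<close>.\<close>

lemma f_increment:
  assumes z: "err z \<le> \<tau>2" and d: "0 < \<delta>" "\<delta> \<le> 1" and u: "norm u \<le> 1"
  obtains c where "(\<Sum>j=1..n. (norm (c j))\<^sup>2) \<le> 32 * real n * S / \<eta>\<^sup>2"
    "\<And>b. err b \<le> \<tau>2 \<Longrightarrow> err (rback \<delta> (z, b)) \<le> \<tau>2 \<Longrightarrow>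
      \<bar>f u z - f u (rback \<delta> (z, b)) + sin \<delta> * cos \<delta> / real n * (\<Sum>j=1..n. inner (b j) (c j))\<bar> \<le> 1016 * S\<^sup>2 * \<delta>\<^sup>2 / \<eta>\<^sup>2"
proof -
  interpret A: compact_nonneg "scov n z" by (rule compact_nonneg_scov)
  define \<alpha> where "\<alpha> = A.eg jr"
  have n: "0 < real n" using n_pos by simp
  have n\<alpha>: "norm \<alpha> = 1" using A.norm_eg[of jr] good_gap(1)[OF z] eta_pos by (auto simp: \<alpha>_def)
  obtain w where w: "norm w \<le> 2 * norm u / \<eta>"
    and exp: "\<And>B \<epsilon>. compact_nonneg B \<Longrightarrow> 0 < eigval B jr \<Longrightarrow> 0 \<le> \<epsilon> \<Longrightarrow> (\<And>x. norm (scov n z x - B x) \<le> \<epsilon> * norm x) \<Longrightarrow>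
      \<bar>inner \<alpha> \<theta> * inner \<alpha> u - inner (eigvec B jr) \<theta> * inner (eigvec B jr) u
      + inner (scov n z \<alpha> - B \<alpha>) w\<bar> \<le> 28 * \<epsilon>\<^sup>2 * norm u / \<eta>\<^sup>2"
    unfolding \<alpha>_def
    by (rule projector_expansion[OF A.compact_nonneg_axioms eigval_scov_eq_0 eta_pos good_gap(1)[OF z] good_gap(2)[OF z] norm_theta, of u]) blast+
  have w2: "norm w \<le> 2 / \<eta>" using w u eta_pos by (smt (verit, best) divide_right_mono)
  define c where "c j = inner (z j) \<alpha> *\<^sub>R w + inner (z j) w *\<^sub>R \<alpha>" for j
  show thesis
  proof (rule that[of c])
    have "(norm (c j))\<^sup>2 \<le> 2 * (norm w)\<^sup>2 * (inner (z j) \<alpha>)\<^sup>2 + 2 * (inner (z j) w)\<^sup>2" for j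
    proof -
      have "norm (c j) \<le> \<bar>inner (z j) \<alpha>\<bar> * norm w + \<bar>inner (z j) w\<bar>"
        unfolding c_def by (rule order_trans[OF norm_triangle_ineq]) (simp add: n\<alpha>)
      then have "(norm (c j))\<^sup>2 \<le> (\<bar>inner (z j) \<alpha>\<bar> * norm w + \<bar>inner (z j) w\<bar>)\<^sup>2" by (intro power_mono) auto
      also have "\<dots> \<le> 2 * (\<bar>inner (z j) \<alpha>\<bar> * norm w)\<^sup>2 + 2 * \<bar>inner (z j) w\<bar>\<^sup>2"
        using zero_le_power2[of "\<bar>inner (z j) \<alpha>\<bar> * norm w - \<bar>inner (z j) w\<bar>"]
        unfolding power2_sum power2_diff by linarith
      finally show ?thesis by (simp add: power_mult_distrib mult_ac)
    qed
    then have "(\<Sum>j=1..n. (norm (c j))\<^sup>2) \<le> (\<Sum>j=1..n. 2 * (norm w)\<^sup>2 * (inner (z j) \<alpha>)\<^sup>2 + 2 * (inner (z j) w)\<^sup>2)"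
      by (intro sum_mono)
    also have "\<dots> = 2 * (norm w)\<^sup>2 * (\<Sum>j=1..n. (inner (z j) \<alpha>)\<^sup>2) + 2 * (\<Sum>j=1..n. (inner (z j) w)\<^sup>2)"
      by (simp only: sum.distrib sum_distrib_left)
    also have "\<dots> = 2 * (norm w)\<^sup>2 * (real n * qf z \<alpha>) + 2 * (real n * qf z w)"
      unfolding qf_eq using n by simp
    also have "\<dots> \<le> 2 * (norm w)\<^sup>2 * (real n * (2 * S)) + 2 * (real n * (2 * S * (norm w)\<^sup>2))"
      using scov_good(2)[OF z, of \<alpha>] scov_good(2)[OF z, of w] n\<alpha> n by (intro add_mono mult_left_mono) auto
    also have "\<dots> = 8 * real n * S * (norm w)\<^sup>2" by simp
    also have "\<dots> \<le> 8 * real n * S * (2 / \<eta>)\<^sup>2"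
      using w2 n S_pos by (intro mult_left_mono power_mono) auto
    finally show "(\<Sum>j=1..n. (norm (c j))\<^sup>2) \<le> 32 * real n * S / \<eta>\<^sup>2" by (simp add: power_divide)
    fix b assume b: "err b \<le> \<tau>2" and y: "err (rback \<delta> (z, b)) \<le> \<tau>2"
    let ?B = "scov n (rback \<delta> (z, b))"
    let ?T = "sin \<delta> * cos \<delta> / real n * (\<Sum>j=1..n. inner (b j) (c j))"
    have posB: "0 < eigval ?B jr" using good_gap(1)[OF y] eta_pos by linarith
    have "\<bar>inner \<alpha> \<theta> * inner \<alpha> u - inner (eigvec ?B jr) \<theta> * inner (eigvec ?B jr) u
      + inner (scov n z \<alpha> - ?B \<alpha>) w\<bar> \<le> 28 * (6 * S * \<delta>)\<^sup>2 * norm u / \<eta>\<^sup>2"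
      by (rule exp[OF compact_nonneg_scov posB _ scov_rback_close[OF z b d]]) (use S_nonneg d in simp)
    then have 1: "\<bar>f u z - f u (rback \<delta> (z, b)) + inner (scov n z \<alpha> - ?B \<alpha>) w\<bar> \<le> 28 * (6 * S * \<delta>)\<^sup>2 * norm u / \<eta>\<^sup>2"
      by (simp add: f_good[OF z] f_good[OF y] \<alpha>_def)
    have 2: "28 * (6 * S * \<delta>)\<^sup>2 * norm u / \<eta>\<^sup>2 \<le> 1008 * S\<^sup>2 * \<delta>\<^sup>2 / \<eta>\<^sup>2"
    proof (rule divide_right_mono)
      have "28 * (6 * S * \<delta>)\<^sup>2 * norm u \<le> 28 * (6 * S * \<delta>)\<^sup>2 * 1" using u by (intro mult_left_mono) auto
      then show "28 * (6 * S * \<delta>)\<^sup>2 * norm u \<le> 1008 * S\<^sup>2 * \<delta>\<^sup>2" by (simp add: power_mult_distrib)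
    qed simp
    have 3: "inner (scov n z \<alpha> - ?B \<alpha>) w = (sin \<delta>)\<^sup>2 * (inner (scov n z \<alpha>) w - inner (scov n b \<alpha>) w) + ?T"
      unfolding inner_scov_rback c_def by simp
    have in1: "\<bar>inner (scov n x \<alpha>) w\<bar> \<le> 2 * S * (2 / \<eta>)" if "err x \<le> \<tau>2" for x
    proof -
      have "\<bar>inner (scov n x \<alpha>) w\<bar> \<le> norm (scov n x \<alpha>) * norm w" by (rule Cauchy_Schwarz_ineq2)
      also have "\<dots> \<le> 2 * S * (2 / \<eta>)"
        using scov_good(1)[OF that, of \<alpha>] n\<alpha> w2 S_nonneg by (intro mult_mono) auto
      finally show ?thesis .
    qed
    have s: "(sin \<delta>)\<^sup>2 \<le> \<delta>\<^sup>2"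
      using abs_sin_x_le_abs_x[of \<delta>] d by (metis abs_ge_zero power2_abs power_mono)
    have "\<bar>(sin \<delta>)\<^sup>2 * (inner (scov n z \<alpha>) w - inner (scov n b \<alpha>) w)\<bar> \<le> \<delta>\<^sup>2 * (8 * S / \<eta>)"
      unfolding abs_mult using s in1[OF z] in1[OF b] by (intro mult_mono) auto
    also have "\<dots> \<le> \<delta>\<^sup>2 * (8 * S\<^sup>2 / \<eta>\<^sup>2)"
    proof (rule mult_left_mono)
      have "S / \<eta> * 1 \<le> S / \<eta> * (S / \<eta>)" using eta_pos eta_le_S S_pos by (intro mult_left_mono) auto
      then show "8 * S / \<eta> \<le> 8 * S\<^sup>2 / \<eta>\<^sup>2" by (simp add: power2_eq_square)
    qed simp
    finally have 4: "\<bar>(sin \<delta>)\<^sup>2 * (inner (scov n z \<alpha>) w - inner (scov n b \<alpha>) w)\<bar> \<le> 8 * (S\<^sup>2 * \<delta>\<^sup>2 / \<eta>\<^sup>2)" by (simp add: mult_ac)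
    have "1008 * S\<^sup>2 * \<delta>\<^sup>2 / \<eta>\<^sup>2 + 8 * (S\<^sup>2 * \<delta>\<^sup>2 / \<eta>\<^sup>2) = 1016 * S\<^sup>2 * \<delta>\<^sup>2 / \<eta>\<^sup>2" by simp
    then show "\<bar>f u z - f u (rback \<delta> (z, b)) + ?T\<bar> \<le> 1016 * S\<^sup>2 * \<delta>\<^sup>2 / \<eta>\<^sup>2"
      using 1 2 3 4 by linarith
  qed
qed

text \<open>The variance scale: deviations are measured in multiples of
  \<open>sqrt (L2 * t)\<close>.\<close>

definition L2 where "L2 = S\<^sup>2 / (real n * \<eta>\<^sup>2)"

lemma L2_pos: "0 < L2" using S_pos eta_pos n_pos by (simp add: L2_def)

text \<open>Increments are cut off outside the good set, so that their exponential moments are finite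
  without conditioning, which would destroy rotation invariance.\<close>

definition incr :: "'h \<Rightarrow> real \<Rightarrow> (nat \<Rightarrow> 'h) \<times> (nat \<Rightarrow> 'h) \<Rightarrow> real" where
  "incr u \<delta> p = (if err (fst p) \<le> \<tau>2 \<and> err (snd p) \<le> \<tau>2 \<and> err (rback \<delta> p) \<le> \<tau>2
     then f u (fst p) - f u (rback \<delta> p) else 0)"

lemma measurable_incr: "incr u \<delta> \<in> borel_measurable (seqM \<Otimes>\<^sub>M seqM)"
proof -
  note e = measurable_compose[OF measurable_fst measurable_err] measurable_compose[OF measurable_snd measurable_err]
    measurable_compose[OF measurable_rback measurable_err]
  have "{p. h p \<le> c} \<in> sets (seqM \<Otimes>\<^sub>M seqM)" if "h \<in> borel_measurable (seqM \<Otimes>\<^sub>M seqM)" for h :: "(nat \<Rightarrow> 'h) \<times> (nat \<Rightarrow> 'h) \<Rightarrow> real" and c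
    using borel_measurable_le[OF that borel_measurable_const] by (simp add: space_pair_measure space_PiM)
  then have "{p. err (fst p) \<le> \<tau>2} \<inter> {p. err (snd p) \<le> \<tau>2} \<inter> {p. err (rback \<delta> p) \<le> \<tau>2} \<in> sets (seqM \<Otimes>\<^sub>M seqM)"
    using e by (intro sets.Int) auto
  then have P: "{p \<in> space (seqM \<Otimes>\<^sub>M seqM). err (fst p) \<le> \<tau>2 \<and> err (snd p) \<le> \<tau>2 \<and> err (rback \<delta> p) \<le> \<tau>2} \<in> sets (seqM \<Otimes>\<^sub>M seqM)"
    by (simp add: space_pair_measure space_PiM Int_def conj_assoc)
  show ?thesis
    unfolding incr_def[abs_def]
    by (intro measurable_If P borel_measurable_diff borel_measurable_const
        measurable_compose[OF measurable_fst f_measurable] measurable_compose[OF measurable_rback f_measurable])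
qed

text \<open>For large \<open>K\<close> the second-order remainder adds at most 1 to the exponent, a
  factor of at most 3, and cut-off increments contribute at most 1; hence the factor 4. The linear
  part has a Gaussian exponential moment with exponent at most \<open>128 * l\<^sup>2 * L2\<close>.
  The bound on \<open>K\<close> contains 4064 as \<open>4 * 1016\<close>, where 4 bounds
  \<open>(real K * \<delta>)\<^sup>2\<close>.\<close>

lemma incr_exp:
  assumes u: "norm u \<le> 1" and K: "2 \<le> K" "4064 * \<bar>l\<bar> * S\<^sup>2 / \<eta>\<^sup>2 \<le> real K"
  defines "\<delta> \<equiv> pi / (2 * real K)"
  shows "(\<integral>\<^sup>+b. ennreal (exp (real K * (l * incr u \<delta> (z, b)))) \<partial>law) \<le> ennreal (4 * exp (128 * l\<^sup>2 * L2))"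
proof -
  have K0: "0 < K" using K by simp
  note st = step_size[OF K0, folded \<delta>_def]
  have n: "0 < real n" using n_pos by simp
  have X0: "0 \<le> 128 * l\<^sup>2 * L2" using L2_pos by simp
  show ?thesis
  proof (cases "err z \<le> \<tau>2")
    case False
    then have "(\<integral>\<^sup>+b. ennreal (exp (real K * (l * incr u \<delta> (z, b)))) \<partial>law) = 1"
      by (simp add: incr_def law.emeasure_space_1[simplified])
    also have "\<dots> \<le> ennreal (4 * exp (128 * l\<^sup>2 * L2))"
    proof -
      have "1 \<le> exp (128 * l\<^sup>2 * L2)" using X0 by simp
      then have "1 \<le> 4 * exp (128 * l\<^sup>2 * L2)" by linarith
      then show ?thesis by (rule ennreal_leI[of 1, unfolded ennreal_1])
    qed
    finally show ?thesis .
  next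
    case True
    have d1: "\<delta> \<le> 1"
    proof -
      have "2 * \<delta> \<le> real K * \<delta>" using K st(3) by (intro mult_right_mono) auto
      then show ?thesis using st(4) by linarith
    qed
    obtain c where c: "(\<Sum>j=1..n. (norm (c j))\<^sup>2) \<le> 32 * real n * S / \<eta>\<^sup>2"
      and inc: "\<And>b. err b \<le> \<tau>2 \<Longrightarrow> err (rback \<delta> (z, b)) \<le> \<tau>2 \<Longrightarrow>
        \<bar>f u z - f u (rback \<delta> (z, b)) + sin \<delta> * cos \<delta> / real n * (\<Sum>j=1..n. inner (b j) (c j))\<bar> \<le> 1016 * S\<^sup>2 * \<delta>\<^sup>2 / \<eta>\<^sup>2"
      using f_increment[OF True st(3) d1 u] by blast
    define \<beta> where "\<beta> = - (real K * l * (sin \<delta> * cos \<delta> / real n))"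
    define lin where "lin b = (\<Sum>j=1..n. 0 * (inner (b j) (c j))\<^sup>2 + \<beta> * inner (b j) (c j))" for b
    have lin_eq: "lin b = \<beta> * (\<Sum>j=1..n. inner (b j) (c j))" for b by (simp add: lin_def sum_distrib_left)
    have rem: "real K * \<bar>l\<bar> * (1016 * S\<^sup>2 * \<delta>\<^sup>2 / \<eta>\<^sup>2) \<le> 1"
    proof -
      have "(real K * \<delta>)\<^sup>2 \<le> 2\<^sup>2" using st(3,4) by (intro power_mono) auto
      then have "1016 * \<bar>l\<bar> * S\<^sup>2 / \<eta>\<^sup>2 * (real K * \<delta>)\<^sup>2 \<le> 1016 * \<bar>l\<bar> * S\<^sup>2 / \<eta>\<^sup>2 * 4"
        by (intro mult_left_mono) auto
      also have "\<dots> \<le> real K" using K(2) by simp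
      finally have "real K * (real K * \<bar>l\<bar> * (1016 * S\<^sup>2 * \<delta>\<^sup>2 / \<eta>\<^sup>2)) \<le> real K * 1"
        by (simp add: power_mult_distrib power2_eq_square[of "real K"] mult_ac)
      then show ?thesis by (rule mult_left_le_imp_le) (use K in simp)
    qed
    have pt: "exp (real K * (l * incr u \<delta> (z, b))) \<le> 1 + exp 1 * exp (lin b)" for b
    proof (cases "err b \<le> \<tau>2 \<and> err (rback \<delta> (z, b)) \<le> \<tau>2")
      case True2: True
      define q where "q = f u z - f u (rback \<delta> (z, b)) + sin \<delta> * cos \<delta> / real n * (\<Sum>j=1..n. inner (b j) (c j))"
      have "real K * (l * incr u \<delta> (z, b)) = real K * l * q + lin b"
        using True2 True by (simp add: incr_def q_def lin_eq \<beta>_def algebra_simps)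
      also have "real K * l * q \<le> 1"
      proof -
        have "real K * l * q \<le> \<bar>real K * l * q\<bar>" by simp
        also have "\<dots> = real K * \<bar>l\<bar> * \<bar>q\<bar>" by (simp add: abs_mult)
        also have "\<dots> \<le> real K * \<bar>l\<bar> * (1016 * S\<^sup>2 * \<delta>\<^sup>2 / \<eta>\<^sup>2)"
          using inc[of b] True2 by (intro mult_left_mono) (auto simp: q_def)
        finally show ?thesis using rem by linarith
      qed
      finally have "exp (real K * (l * incr u \<delta> (z, b))) \<le> exp (1 + lin b)" by simp
      then show ?thesis by (simp add: exp_add)
    qed (auto simp: incr_def)
    have "4 * 0 * inner (\<Sigma> (c j)) (c j) \<le> 1" for j by simp
    from exp_quadratic_law[of "\<lambda>_. 0" c "\<lambda>_. \<beta>", OF _ this]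
    have mgf: "(\<integral>\<^sup>+b. ennreal (exp (lin b)) \<partial>law) \<le> ennreal (exp (\<Sum>j=1..n. (2 * 0 + \<beta>\<^sup>2) * inner (\<Sigma> (c j)) (c j)))"
      unfolding lin_def by simp
    have X: "(\<Sum>j=1..n. (2 * 0 + \<beta>\<^sup>2) * inner (\<Sigma> (c j)) (c j)) \<le> 128 * l\<^sup>2 * L2"
    proof -
      have b2: "\<beta>\<^sup>2 \<le> 4 * l\<^sup>2 / (real n)\<^sup>2"
      proof -
        have "\<beta>\<^sup>2 = l\<^sup>2 / (4 * (real n)\<^sup>2) * (real K * (2 * sin \<delta> * cos \<delta>))\<^sup>2"
          by (simp add: \<beta>_def power_mult_distrib power_divide)
        also have "\<dots> \<le> l\<^sup>2 / (4 * (real n)\<^sup>2) * 16" using st(2) by (intro mult_left_mono) auto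
        finally show ?thesis by simp
      qed
      have "(\<Sum>j=1..n. (2 * 0 + \<beta>\<^sup>2) * inner (\<Sigma> (c j)) (c j)) \<le> (\<Sum>j=1..n. \<beta>\<^sup>2 * (S * (norm (c j))\<^sup>2))"
        by (intro sum_mono) (simp add: Sigma_qf mult_left_mono)
      also have "\<dots> = \<beta>\<^sup>2 * (S * (\<Sum>j=1..n. (norm (c j))\<^sup>2))" by (simp add: sum_distrib_left)
      also have "\<dots> \<le> 4 * l\<^sup>2 / (real n)\<^sup>2 * (S * (32 * real n * S / \<eta>\<^sup>2))"
        using b2 c S_nonneg by (intro mult_mono mult_left_mono) (auto intro!: mult_nonneg_nonneg sum_nonneg)
      also have "\<dots> = 128 * l\<^sup>2 * L2" unfolding L2_def using n by (simp add: power2_eq_square)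
      finally show ?thesis .
    qed
    have lm: "lin \<in> borel_measurable law" unfolding lin_def[abs_def] by measurable
    have "(\<integral>\<^sup>+b. ennreal (exp (real K * (l * incr u \<delta> (z, b)))) \<partial>law) \<le> (\<integral>\<^sup>+b. 1 + ennreal (exp 1) * ennreal (exp (lin b)) \<partial>law)"
    proof (rule nn_integral_mono)
      fix b
      have "ennreal (exp (real K * (l * incr u \<delta> (z, b)))) \<le> ennreal (1 + exp 1 * exp (lin b))" by (rule ennreal_leI[OF pt])
      then show "ennreal (exp (real K * (l * incr u \<delta> (z, b)))) \<le> 1 + ennreal (exp 1) * ennreal (exp (lin b))"
        by (simp add: ennreal_mult)
    qed
    also have "\<dots> = 1 + ennreal (exp 1) * (\<integral>\<^sup>+b. ennreal (exp (lin b)) \<partial>law)"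
      using lm by (simp add: nn_integral_add nn_integral_cmult law.emeasure_space_1[simplified])
    also have "\<dots> \<le> 1 + ennreal (exp 1) * ennreal (exp (128 * l\<^sup>2 * L2))"
      using order_trans[OF mgf ennreal_leI[of "exp _" "exp _"]] X by (intro add_left_mono mult_left_mono) auto
    also have "\<dots> = ennreal (1 + exp 1 * exp (128 * l\<^sup>2 * L2))" by (simp add: ennreal_mult)
    also have "\<dots> \<le> ennreal (4 * exp (128 * l\<^sup>2 * L2))"
    proof (rule ennreal_leI)
      have "exp (1::real) \<le> 3" by (rule exp_le)
      then have "exp 1 * exp (128 * l\<^sup>2 * L2) \<le> 3 * exp (128 * l\<^sup>2 * L2)" by (intro mult_right_mono) auto
      moreover have "1 \<le> exp (128 * l\<^sup>2 * L2)" using X0 by simp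
      ultimately show "1 + exp 1 * exp (128 * l\<^sup>2 * L2) \<le> 4 * exp (128 * l\<^sup>2 * L2)" by linarith
    qed
    finally show ?thesis .
  qed
qed

section \<open>Paths inside the good set\<close>

text \<open>The grid is so fine that \<open>2 * step \<le> \<gamma> / 2\<close>, the relative loss
  allowed when passing from \<open>\<tau>1\<close> to \<open>\<tau>2\<close>; the numerator 8
  suffices because \<open>pi < 4\<close>.\<close>

definition J :: nat where "J = nat \<lceil>8 / \<gamma>\<rceil>"
definition step :: real where "step = pi / (2 * real J)"

lemma J: "8 / \<gamma> \<le> real J" "0 < J"
proof -
  show 1: "8 / \<gamma> \<le> real J" unfolding J_def by (rule real_nat_ceiling_ge)
  have "0 < 8 / \<gamma>" using gam by simp
  then show "0 < J" using 1 by linarith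
qed

definition path_err :: "(nat \<Rightarrow> 'h) \<times> (nat \<Rightarrow> 'h) \<Rightarrow> real \<Rightarrow> real" where
  "path_err p a = err (fst (rot a p))"

text \<open>The three further angles at each grid point are those that
  \<open>path_err_interpolate\<close> combines.\<close>

definition bad :: "((nat \<Rightarrow> 'h) \<times> (nat \<Rightarrow> 'h)) set" where
  "bad = (\<Union>(i, k)\<in>{..J} \<times> {..<4}. {p. \<tau>1 < path_err p (real i * step + real k * (pi / 4))})"

lemma snd_rot: "snd (rot a p) = fst (rot (a + pi / 2) p)"
  by (simp add: rot_def cos_add sin_add fun_eq_iff)

text \<open>The cross covariance of the two copies is recovered from the sample covariances at angle
  \<open>pi / 4\<close>: the difference of the two components is twice the cross term.\<close>

lemma qf_rot: "qf (fst (rot d p)) v = (cos d)\<^sup>2 * qf (fst p) v + (sin d)\<^sup>2 * qf (snd p) v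
    + sin d * cos d * (qf (fst (rot (pi / 4) p)) v - qf (snd (rot (pi / 4) p)) v)"
proof -
  define A where "A = (\<Sum>j=1..n. (inner (fst p j) v)\<^sup>2)"
  define B where "B = (\<Sum>j=1..n. (inner (snd p j) v)\<^sup>2)"
  define C where "C = (\<Sum>j=1..n. inner (fst p j) v * inner (snd p j) v)"
  have e1: "qf (fst (rot a p)) v = ((cos a)\<^sup>2 * A + (sin a)\<^sup>2 * B + 2 * (sin a * cos a) * C) / real n" for a
  proof -
    have "(inner (fst (rot a p) j) v)\<^sup>2 = (cos a)\<^sup>2 * (inner (fst p j) v)\<^sup>2 + (sin a)\<^sup>2 * (inner (snd p j) v)\<^sup>2
        + 2 * (sin a * cos a) * (inner (fst p j) v * inner (snd p j) v)" for j
      by (simp add: rot_def inner_add_left power2_eq_square algebra_simps)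
    then show ?thesis unfolding qf_eq A_def B_def C_def by (simp add: sum.distrib sum_distrib_left)
  qed
  have e2: "qf (snd (rot a p)) v = ((cos a)\<^sup>2 * B + (sin a)\<^sup>2 * A - 2 * (sin a * cos a) * C) / real n" for a
  proof -
    have "(inner (snd (rot a p) j) v)\<^sup>2 = (cos a)\<^sup>2 * (inner (snd p j) v)\<^sup>2 + (sin a)\<^sup>2 * (inner (fst p j) v)\<^sup>2
        - 2 * (sin a * cos a) * (inner (fst p j) v * inner (snd p j) v)" for j
      by (simp add: rot_def inner_diff_left power2_eq_square algebra_simps)
    then show ?thesis unfolding qf_eq A_def B_def C_def by (simp add: sum.distrib sum_subtractf sum_distrib_left)
  qed
  have h: "(cos (pi / 4))\<^sup>2 = 1 / 2" "(sin (pi / 4))\<^sup>2 = 1 / 2" "sin (pi / 4) * cos (pi / 4) = 1 / 2"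
    by (simp_all add: cos_45 sin_45 power_divide)
  have A: "qf (fst p) v = A / real n" "qf (snd p) v = B / real n" unfolding qf_eq A_def B_def by simp_all
  show ?thesis unfolding e1 e2 h A by (simp add: add_divide_distrib diff_divide_distrib algebra_simps)
qed

text \<open>A half turn changes the sign of all data, which the sample covariance does not see. So
  angles matter modulo \<open>pi\<close> only.\<close>

lemma path_err_shift: "path_err p (a + pi) = path_err p a"
proof -
  have "fst (rot (a + pi) p) = (\<lambda>j. - fst (rot a p) j)" by (simp add: rot_def fun_eq_iff)
  moreover have "scov n (\<lambda>j. - z j) = scov n z" for z :: "nat \<Rightarrow> 'h" by (intro ext) (simp add: scov_def)
  ultimately show ?thesis by (simp add: path_err_def err_def)
qed

text \<open>The sample covariance at angle \<open>b + d\<close> is a combination of those at \<open>b\<close>, \<open>b + \<pi>/2\<close>,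
  \<open>b + \<pi>/4\<close> and \<open>b + 3\<pi>/4\<close>, with weights \<open>cos\<^sup>2 d\<close>, \<open>sin\<^sup>2 d\<close> and \<open>\<plusminus> sin d cos d\<close>.\<close>

lemma path_err_interpolate:
  assumes "path_err p b \<le> \<tau>" "path_err p (b + pi / 4) \<le> \<tau>" "path_err p (b + pi / 2) \<le> \<tau>" "path_err p (b + 3 * pi / 4) \<le> \<tau>"
    and d: "0 \<le> d"
  shows "path_err p (b + d) \<le> (1 + 2 * d) * \<tau>"
  unfolding path_err_def
proof (rule err_leI)
  have \<tau>: "0 \<le> \<tau>" using assms(1) err_nonneg[of "fst (rot b p)"] by (simp add: path_err_def)
  then show "0 \<le> (1 + 2 * d) * \<tau>" using d by simp
  fix v
  let ?q = "rot b p"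
  have E: "\<bar>qf w v - inner (\<Sigma> v) v\<bar> \<le> \<tau> * (norm v)\<^sup>2" if "err w \<le> \<tau>" for w
    using qf_le_err[of w v] mult_right_mono[OF that, of "(norm v)\<^sup>2"] by simp
  have s: "snd ?q = fst (rot (b + pi / 2) p)" "fst (rot (pi / 4) ?q) = fst (rot (b + pi / 4) p)"
    "snd (rot (pi / 4) ?q) = fst (rot (b + 3 * pi / 4) p)" "fst (rot d ?q) = fst (rot (b + d) p)"
    by (simp_all add: snd_rot rot_rot add.commute add.left_commute)
  define m where "m = \<tau> * (norm v)\<^sup>2"
  have m0: "0 \<le> m" using \<tau> by (simp add: m_def)
  define x1 where "x1 = qf (fst ?q) v - inner (\<Sigma> v) v"
  define x2 where "x2 = qf (snd ?q) v - inner (\<Sigma> v) v"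
  define x3 where "x3 = qf (fst (rot (pi / 4) ?q)) v - inner (\<Sigma> v) v"
  define x4 where "x4 = qf (snd (rot (pi / 4) ?q)) v - inner (\<Sigma> v) v"
  have x: "\<bar>x1\<bar> \<le> m" "\<bar>x2\<bar> \<le> m" "\<bar>x3\<bar> \<le> m" "\<bar>x4\<bar> \<le> m"
    unfolding x1_def x2_def x3_def x4_def m_def
    using assms(1-4) by (intro E; simp add: path_err_def s)+
  have eq: "qf (fst (rot (b + d) p)) v - inner (\<Sigma> v) v = (cos d)\<^sup>2 * x1 + (sin d)\<^sup>2 * x2 + sin d * cos d * (x3 - x4)"
  proof -
    have "(cos d)\<^sup>2 * inner (\<Sigma> v) v + (sin d)\<^sup>2 * inner (\<Sigma> v) v = inner (\<Sigma> v) v"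
      by (simp add: distrib_right[symmetric])
    then show ?thesis
      unfolding s(4)[symmetric] qf_rot[of d ?q v] x1_def x2_def x3_def x4_def right_diff_distrib by linarith
  qed
  have 1: "\<bar>(cos d)\<^sup>2 * x1 + (sin d)\<^sup>2 * x2\<bar> \<le> m"
  proof -
    have "\<bar>(cos d)\<^sup>2 * x1 + (sin d)\<^sup>2 * x2\<bar> \<le> (cos d)\<^sup>2 * \<bar>x1\<bar> + (sin d)\<^sup>2 * \<bar>x2\<bar>"
      by (rule order_trans[OF abs_triangle_ineq]) (simp add: abs_mult)
    also have "\<dots> \<le> (cos d)\<^sup>2 * m + (sin d)\<^sup>2 * m" using x by (intro add_mono mult_left_mono) auto
    also have "\<dots> = m" by (simp add: distrib_right[symmetric])
    finally show ?thesis .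
  qed
  have 2: "\<bar>sin d * cos d * (x3 - x4)\<bar> \<le> d * 1 * (2 * m)"
    unfolding abs_mult using abs_sin_x_le_abs_x[of d] d x m0 by (intro mult_mono) auto
  have "\<bar>(cos d)\<^sup>2 * x1 + (sin d)\<^sup>2 * x2 + sin d * cos d * (x3 - x4)\<bar> \<le> m + d * 1 * (2 * m)"
    using 1 2 by linarith
  then show "\<bar>qf (fst (rot (b + d) p)) v - inner (\<Sigma> v) v\<bar> \<le> (1 + 2 * d) * \<tau> * (norm v)\<^sup>2"
    unfolding eq by (simp add: m_def algebra_simps)
qed

text \<open>Interpolation starts from the last grid point before \<open>a\<close>. The second
  component is the path at \<open>a + pi / 2\<close>, and a quarter turn permutes the four angles
  modulo \<open>pi\<close>, so the same grid point serves. The factor \<open>1 + 2 * d\<close> is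
  absorbed by \<open>(1 + \<gamma> / 2) * (1 - \<gamma>) \<le> 1 - \<gamma> / 2\<close>.\<close>

lemma good_path:
  assumes p: "p \<notin> bad" and a: "0 \<le> a" "a \<le> pi / 2"
  shows "err (fst (rot a p)) \<le> \<tau>2" "err (snd (rot a p)) \<le> \<tau>2"
proof -
  have st: "0 < step" using J by (simp add: step_def)
  define i where "i = nat \<lfloor>a / step\<rfloor>"
  have i: "real i \<le> a / step" "a / step < real i + 1"
    using a st unfolding i_def by (simp_all add: of_nat_nat[of "\<lfloor>a / step\<rfloor>"] of_int_floor_le floor_correct)
  define d where "d = a - real i * step"
  have d: "0 \<le> d" "d \<le> step" using i st by (simp_all add: d_def field_simps)
  have "real i \<le> (pi / 2) / step" using i(1) divide_right_mono[OF a(2), of step] st by linarith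
  also have "(pi / 2) / step = real J" using J by (simp add: step_def)
  finally have iJ: "i \<le> J" by simp
  define b where "b = real i * step"
  have grid: "path_err p (b + real k * (pi / 4)) \<le> \<tau>1" if "k < 4" for k
    using p iJ that unfolding bad_def b_def by (auto simp: not_less[symmetric])
  have g0: "path_err p b \<le> \<tau>1" "path_err p (b + pi / 4) \<le> \<tau>1" "path_err p (b + pi / 2) \<le> \<tau>1" "path_err p (b + 3 * pi / 4) \<le> \<tau>1"
    using grid[of 0] grid[of 1] grid[of 2] grid[of 3] by (simp_all add: field_simps)
  have s1: "b + pi / 2 + pi / 2 = b + pi" "b + pi / 2 + pi / 4 = b + 3 * pi / 4" "b + pi / 2 + 3 * pi / 4 = b + pi / 4 + pi"
    by (simp_all add: field_simps)
  have "path_err p (b + d) \<le> (1 + 2 * d) * \<tau>1" by (rule path_err_interpolate[OF g0 d(1)])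
  moreover have "path_err p (b + pi / 2 + d) \<le> (1 + 2 * d) * \<tau>1"
    by (rule path_err_interpolate[OF _ _ _ _ d(1)]) (simp_all only: s1 path_err_shift g0)
  moreover have "(1 + 2 * d) * \<tau>1 \<le> \<tau>2"
  proof -
    have "2 * step = pi / real J" by (simp add: step_def)
    also have "\<dots> \<le> 4 / (8 / \<gamma>)" using J gam pi_less_4 by (intro frac_le) auto
    finally have "2 * d \<le> \<gamma> / 2" using d gam by simp
    then have "(1 + 2 * d) * \<tau>1 \<le> (1 + \<gamma> / 2) * \<tau>1" using tau2(4) by (intro mult_right_mono) auto
    also have "\<dots> \<le> \<tau>2"
    proof -
      have "(1 + \<gamma> / 2) * (1 - \<gamma>) \<le> 1 - \<gamma> / 2" using gam by (simp add: algebra_simps)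
      then have "(1 + \<gamma> / 2) * (1 - \<gamma>) * (g / 2) \<le> (1 - \<gamma> / 2) * (g / 2)" using g_pos by (intro mult_right_mono) auto
      then show ?thesis by (simp add: \<tau>1_def \<tau>2_def)
    qed
    finally show ?thesis .
  qed
  ultimately have "path_err p a \<le> \<tau>2" "path_err p (a + pi / 2) \<le> \<tau>2"
    by (simp_all add: b_def d_def algebra_simps)
  then show "err (fst (rot a p)) \<le> \<tau>2" "err (snd (rot a p)) \<le> \<tau>2"
    by (simp_all add: path_err_def snd_rot)
qed

lemma meas_law: "h \<in> borel_measurable seqM \<Longrightarrow> h \<in> borel_measurable law"
  using measurable_cong_sets[OF sets_law refl] by blast

lemma meas_law2: "h \<in> borel_measurable (seqM \<Otimes>\<^sub>M seqM) \<Longrightarrow> h \<in> borel_measurable (law \<Otimes>\<^sub>M law)"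
  using measurable_cong_sets[OF sets_law2 refl] by blast

lemma f_fst: "(\<lambda>p. f u (fst p)) \<in> borel_measurable (seqM \<Otimes>\<^sub>M seqM)"
  and f_snd: "(\<lambda>p. f u (snd p)) \<in> borel_measurable (seqM \<Otimes>\<^sub>M seqM)"
  by (rule measurable_compose[OF measurable_fst f_measurable], rule measurable_compose[OF measurable_snd f_measurable])

text \<open>\<open>D\<close> is the sum of the cut-off increments: rotation invariance bounds its
  exponential moments on the whole space, and off \<open>bad\<close> no increment is cut off, so the
  sum telescopes.\<close>

lemma path_difference:
  assumes u: "norm u \<le> 1"
  obtains D where "D \<in> borel_measurable (seqM \<Otimes>\<^sub>M seqM)"
    "(\<integral>\<^sup>+p. ennreal (exp (l * D p)) \<partial>(law \<Otimes>\<^sub>M law)) \<le> ennreal (4 * exp (128 * l\<^sup>2 * L2))"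
    "(\<integral>\<^sup>+p. ennreal (exp (- l * D p)) \<partial>(law \<Otimes>\<^sub>M law)) \<le> ennreal (4 * exp (128 * l\<^sup>2 * L2))"
    "\<And>p. p \<notin> bad \<Longrightarrow> D p = f u (snd p) - f u (fst p)"
proof -
  obtain K where "max 2 (4064 * \<bar>l\<bar> * S\<^sup>2 / \<eta>\<^sup>2) \<le> real K" using real_arch_simple by blast
  then have K: "2 \<le> K" "4064 * \<bar>l\<bar> * S\<^sup>2 / \<eta>\<^sup>2 \<le> real K" by auto
  then have K0: "0 < K" by simp
  define \<delta> where "\<delta> = pi / (2 * real K)"
  have d0: "0 \<le> \<delta>" by (simp add: \<delta>_def)
  have Kd: "real K * \<delta> = pi / 2" using K0 by (simp add: \<delta>_def)
  define D where "D p = (\<Sum>k<K. incr u \<delta> (rot (real (Suc k) * \<delta>) p))" for p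
  have D: "D \<in> borel_measurable (seqM \<Otimes>\<^sub>M seqM)"
    unfolding D_def[abs_def] by (intro borel_measurable_sum measurable_compose[OF measurable_rot measurable_incr])
  have E: "(\<integral>\<^sup>+p. ennreal (exp (s * D p)) \<partial>(law \<Otimes>\<^sub>M law)) \<le> ennreal (4 * exp (128 * l\<^sup>2 * L2))" if s: "\<bar>s\<bar> = \<bar>l\<bar>" for s
  proof -
    define h where "h p = s * incr u \<delta> p" for p
    have h: "h \<in> borel_measurable (seqM \<Otimes>\<^sub>M seqM)" unfolding h_def[abs_def]
      by (intro borel_measurable_times borel_measurable_const measurable_incr)
    have s2: "s\<^sup>2 = l\<^sup>2" using s by (rule abs_eq_iff[THEN iffD1, THEN disjE]) auto
    have "s * D p = (\<Sum>k<K. h (rot (real (Suc k) * \<delta>) p))" for p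
      unfolding D_def h_def by (rule sum_distrib_left)
    then have "(\<integral>\<^sup>+p. ennreal (exp (s * D p)) \<partial>(law \<Otimes>\<^sub>M law)) \<le> (\<integral>\<^sup>+p. ennreal (exp (real K * h p)) \<partial>(law \<Otimes>\<^sub>M law))"
      using path_exp[OF h K0, of "\<lambda>k. real (Suc k) * \<delta>"] by simp
    also have "\<dots> = (\<integral>\<^sup>+z. \<integral>\<^sup>+b. ennreal (exp (real K * h (z, b))) \<partial>law \<partial>law)"
    proof (rule law.nn_integral_fst[symmetric])
      have "(\<lambda>p. exp (real K * h p)) \<in> borel_measurable (seqM \<Otimes>\<^sub>M seqM)"
        by (rule measurable_compose[OF borel_measurable_times[OF borel_measurable_const h] borel_measurable_exp])
      then show "(\<lambda>p. ennreal (exp (real K * h p))) \<in> borel_measurable (law \<Otimes>\<^sub>M law)"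
        using measurable_compose[OF meas_law2 measurable_ennreal] by blast
    qed
    also have "\<dots> \<le> (\<integral>\<^sup>+z. ennreal (4 * exp (128 * l\<^sup>2 * L2)) \<partial>law)"
      using incr_exp[OF u K(1), of s] K(2) s s2 by (intro nn_integral_mono) (simp add: h_def \<delta>_def)
    also have "\<dots> = ennreal (4 * exp (128 * l\<^sup>2 * L2))" by (simp add: law.emeasure_space_1[simplified])
    finally show ?thesis .
  qed
  show thesis
  proof (rule that[OF D])
    show "(\<integral>\<^sup>+p. ennreal (exp (l * D p)) \<partial>(law \<Otimes>\<^sub>M law)) \<le> ennreal (4 * exp (128 * l\<^sup>2 * L2))"
      "(\<integral>\<^sup>+p. ennreal (exp (- l * D p)) \<partial>(law \<Otimes>\<^sub>M law)) \<le> ennreal (4 * exp (128 * l\<^sup>2 * L2))"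
      using E[of l] E[of "- l"] by simp_all
    fix p assume p: "p \<notin> bad"
    have "incr u \<delta> (rot (real (Suc k) * \<delta>) p) = f u (fst (rot (real (Suc k) * \<delta>) p)) - f u (rback \<delta> (rot (real (Suc k) * \<delta>) p))"
      if "k < K" for k
    proof -
      have "real (Suc k) * \<delta> \<le> real K * \<delta>" using \<open>k < K\<close> d0 by (intro mult_right_mono) auto
      then have 1: "0 \<le> real (Suc k) * \<delta>" "real (Suc k) * \<delta> \<le> pi / 2" using d0 Kd by auto
      have e: "real (Suc k) * \<delta> - \<delta> = real k * \<delta>" by (simp add: algebra_simps)
      have 2: "0 \<le> real k * \<delta>" "real k * \<delta> \<le> pi / 2" using 1 e d0 by auto
      show ?thesis
        unfolding incr_def rback_rot e using good_path[OF p 1] good_path(1)[OF p 2] by simp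
    qed
    then show "D p = f u (snd p) - f u (fst p)"
      unfolding path_telescope[OF K0, of "f u" p, folded \<delta>_def] D_def by (intro sum.cong) auto
  qed
qed

text \<open>\<open>rate\<close> is the exponent of \<open>err_tail\<close> rewritten with
  \<open>L2\<close>, and \<open>p0\<close> multiplies the tail by the number
  \<open>4 * (J + 1)\<close> of events that make up \<open>bad\<close>.\<close>

definition rate where "rate = 1 / (160 * L2)"
definition p0 where "p0 = 4 * (real J + 1) * exp (- rate)"

lemma rate_pos: "0 < rate" using L2_pos by (simp add: rate_def)

lemma rate_eq: "rate = real n * \<gamma>\<^sup>2 * g\<^sup>2 / (640 * S\<^sup>2)"
  by (simp add: rate_def L2_def \<eta>_def power_mult_distrib power_divide)

lemma err_tau1_tail: "measure law {z. \<tau>1 < err z} \<le> exp (- rate)"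
  unfolding rate_eq \<tau>1_def by (rule err_tail[OF g_pos g_le_S gam mean_err])

text \<open>An exponentially small probability is at most a multiple of \<open>L2\<close>; in this
  form the bad set fits into a variance bound of that order.\<close>

lemma p0_le: "p0 \<le> 640 * (real J + 1) * L2" "0 \<le> p0"
proof -
  have "exp (- rate) \<le> 1 / rate"
  proof -
    have "rate \<le> exp rate" using exp_ge_add_one_self[of rate] by linarith
    then show ?thesis using rate_pos by (simp add: exp_minus field_simps)
  qed
  then have "p0 \<le> 4 * (real J + 1) * (1 / rate)" unfolding p0_def by (intro mult_left_mono) auto
  then show "p0 \<le> 640 * (real J + 1) * L2" by (simp add: rate_def algebra_simps)
qed (simp add: p0_def)

section \<open>The bad set and the difference of two copies\<close>

lemma err_gt_sets: "{z. c < err z} \<in> sets seqM"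
  using borel_measurable_less[where f="\<lambda>_. c", OF borel_measurable_const measurable_err] by (simp add: space_PiM)

lemma path_err_gt: "{p. c < path_err p a} \<in> sets (seqM \<Otimes>\<^sub>M seqM)"
  "measure (law \<Otimes>\<^sub>M law) {p. c < path_err p a} = measure law {z. c < err z}"
proof -
  have B: "{p. c < err (fst p)} \<in> sets (seqM \<Otimes>\<^sub>M (seqM :: (nat \<Rightarrow> 'h) measure))"
    using borel_measurable_less[where f="\<lambda>_. c" and M="seqM \<Otimes>\<^sub>M (seqM :: (nat \<Rightarrow> 'h) measure)", OF borel_measurable_const measurable_compose[OF measurable_fst measurable_err]]
    by (simp add: space_pair_measure space_PiM)
  show "{p. c < path_err p a} \<in> sets (seqM \<Otimes>\<^sub>M seqM)"
    using measurable_sets[OF measurable_rot B, of a] by (simp add: path_err_def space_pair_measure space_PiM vimage_def)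
  have "measure (law \<Otimes>\<^sub>M law) {p. c < path_err p a} = measure (law \<Otimes>\<^sub>M law) {p. c < err (fst p)}"
    using measure_rot[OF B, of a] by (simp add: path_err_def)
  also have "\<dots> = measure (distr (law \<Otimes>\<^sub>M law) law fst) {z. c < err z}"
    using err_gt_sets[of c] by (subst measure_distr) (simp_all add: sets_law vimage_def)
  also have "distr (law \<Otimes>\<^sub>M law) law fst = law" by (rule law.distr_pair_fst)
  finally show "measure (law \<Otimes>\<^sub>M law) {p. c < path_err p a} = measure law {z. c < err z}" .
qed

lemma bad_sets: "bad \<in> sets (law \<Otimes>\<^sub>M law)" and measure_bad: "measure (law \<Otimes>\<^sub>M law) bad \<le> p0"
proof -
  let ?I = "{..J} \<times> {..<4::nat}"
  let ?A = "\<lambda>ik. {p. \<tau>1 < path_err p (real (fst ik) * step + real (snd ik) * (pi / 4))}"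
  have b: "bad = (\<Union>ik\<in>?I. ?A ik)" unfolding bad_def by (simp add: case_prod_beta)
  have A: "?A ik \<in> sets (law \<Otimes>\<^sub>M law)" for ik unfolding sets_law2 by (rule path_err_gt(1))
  show "bad \<in> sets (law \<Otimes>\<^sub>M law)" unfolding b by (intro sets.finite_UN A) auto
  have "measure (law \<Otimes>\<^sub>M law) bad \<le> (\<Sum>ik\<in>?I. measure (law \<Otimes>\<^sub>M law) (?A ik))"
    unfolding b by (rule law2.finite_measure_subadditive_finite) (use A in auto)
  also have "\<dots> = (\<Sum>ik\<in>?I. measure law {z. \<tau>1 < err z})" by (intro sum.cong refl path_err_gt(2))
  also have "\<dots> = real (card ?I) * measure law {z. \<tau>1 < err z}" by simp
  also have "\<dots> \<le> real (card ?I) * exp (- rate)" by (intro mult_left_mono err_tau1_tail) simp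
  also have "\<dots> = p0" by (simp add: p0_def algebra_simps)
  finally show "measure (law \<Otimes>\<^sub>M law) bad \<le> p0" .
qed

lemma difference_tail:
  assumes u: "norm u \<le> 1" and s: "0 < s"
  shows "measure (law \<Otimes>\<^sub>M law) {p. s \<le> \<bar>f u (snd p) - f u (fst p)\<bar>} \<le> p0 + 8 * exp (- s\<^sup>2 / (512 * L2))"
proof -
  \<comment> \<open>The minimiser of \<open>128 * l\<^sup>2 * L2 - l * s\<close>.\<close>
  define l where "l = s / (256 * L2)"
  have l: "0 < l" using s L2_pos by (simp add: l_def)
  obtain D where D: "D \<in> borel_measurable (seqM \<Otimes>\<^sub>M seqM)"
    "(\<integral>\<^sup>+p. ennreal (exp (l * D p)) \<partial>(law \<Otimes>\<^sub>M law)) \<le> ennreal (4 * exp (128 * l\<^sup>2 * L2))"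
    "(\<integral>\<^sup>+p. ennreal (exp (- l * D p)) \<partial>(law \<Otimes>\<^sub>M law)) \<le> ennreal (4 * exp (128 * l\<^sup>2 * L2))"
    "\<And>p. p \<notin> bad \<Longrightarrow> D p = f u (snd p) - f u (fst p)" using path_difference[OF u, of l] by blast
  have ex: "4 * exp (128 * l\<^sup>2 * L2) * exp (- (l * s)) = 4 * exp (- s\<^sup>2 / (512 * L2))"
  proof -
    have "128 * l\<^sup>2 * L2 + - (l * s) = - s\<^sup>2 / (512 * L2)"
      using L2_pos by (simp add: l_def power2_eq_square field_simps)
    then show ?thesis by (simp add: exp_add[symmetric])
  qed
  have tail: "measure (law \<Otimes>\<^sub>M law) {p. l * s \<le> c * D p} \<le> 4 * exp (- s\<^sup>2 / (512 * L2))"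
    and tsets: "{p. l * s \<le> c * D p} \<in> sets (law \<Otimes>\<^sub>M law)"
    if c: "(\<integral>\<^sup>+p. ennreal (exp (c * D p)) \<partial>(law \<Otimes>\<^sub>M law)) \<le> ennreal (4 * exp (128 * l\<^sup>2 * L2))" for c
  proof -
    have m: "(\<lambda>p. c * D p) \<in> borel_measurable (law \<Otimes>\<^sub>M law)"
      by (intro borel_measurable_times borel_measurable_const meas_law2 D)
    show "measure (law \<Otimes>\<^sub>M law) {p. l * s \<le> c * D p} \<le> 4 * exp (- s\<^sup>2 / (512 * L2))"
      using prob_exp_Markov[OF law2.prob_space_axioms m c, of "l * s"] ex by simp
    show "{p. l * s \<le> c * D p} \<in> sets (law \<Otimes>\<^sub>M law)"
      using borel_measurable_le[OF borel_measurable_const m, of "l * s"] by simp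
  qed
  let ?T = "{p. l * s \<le> l * D p} \<union> {p. l * s \<le> - l * D p}"
  have "{p. s \<le> \<bar>f u (snd p) - f u (fst p)\<bar>} \<subseteq> bad \<union> ?T"
  proof
    fix p assume p: "p \<in> {p. s \<le> \<bar>f u (snd p) - f u (fst p)\<bar>}"
    show "p \<in> bad \<union> ?T"
    proof (cases "p \<in> bad")
      case False
      then have "s \<le> D p \<or> s \<le> - D p" using p D(4) by auto
      then have "l * s \<le> l * D p \<or> l * s \<le> l * - D p" using l 
        using mult_left_mono[of s "D p" l] mult_left_mono[of s "- D p" l] by fastforce
      then show ?thesis by auto
    qed simp
  qed
  moreover have T: "?T \<in> sets (law \<Otimes>\<^sub>M law)" by (intro sets.Un tsets D)
  ultimately have "measure (law \<Otimes>\<^sub>M law) {p. s \<le> \<bar>f u (snd p) - f u (fst p)\<bar>} \<le> measure (law \<Otimes>\<^sub>M law) (bad \<union> ?T)"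
    by - (rule law2.finite_measure_mono[OF _ sets.Un[OF bad_sets T]])
  also have "\<dots> \<le> measure (law \<Otimes>\<^sub>M law) bad + measure (law \<Otimes>\<^sub>M law) ?T"
    by (rule measure_Un_le[OF bad_sets T])
  also have "measure (law \<Otimes>\<^sub>M law) ?T \<le> measure (law \<Otimes>\<^sub>M law) {p. l * s \<le> l * D p} + measure (law \<Otimes>\<^sub>M law) {p. l * s \<le> - l * D p}"
    by (intro measure_Un_le tsets D)
  finally show ?thesis using tail[OF D(2)] tail[OF D(3)] measure_bad by linarith
qed

text \<open>6912 is \<open>2 * 12 * 288\<close>, from the two exponential moments in
  \<open>second_moment\<close>, and 2560 is \<open>4 * 640\<close>, from the bad set, where squared
  differences are at most 4.\<close>

definition V :: real where "V = 6912 + 2560 * (real J + 1)"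

lemma V_pos: "0 < V" by (simp add: V_def add_pos_nonneg)

lemma f_diff_bound: "norm u \<le> 1 \<Longrightarrow> \<bar>f u z - f u w\<bar> \<le> 2"
  using f_bound[of u z] f_bound[of u w] by linarith

lemma second_moment:
  assumes u: "norm u \<le> 1"
  shows "(\<integral>\<^sup>+p. ennreal ((f u (snd p) - f u (fst p))\<^sup>2) \<partial>(law \<Otimes>\<^sub>M law)) \<le> ennreal (V * L2)"
proof -
  \<comment> \<open>With \<open>l\<^sup>2 = 1 / (144 * L2)\<close> the exponent
    \<open>128 * l\<^sup>2 * L2\<close> is below 1, so both exponential moments are at most 12;
    together they dominate the square of \<open>l * D p\<close>.\<close>
  define l where "l = 1 / (12 * sqrt L2)"
  have l: "0 < l" "l\<^sup>2 = 1 / (144 * L2)" using L2_pos by (simp_all add: l_def power_divide power_mult_distrib)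
  obtain D where D: "D \<in> borel_measurable (seqM \<Otimes>\<^sub>M seqM)"
    "(\<integral>\<^sup>+p. ennreal (exp (l * D p)) \<partial>(law \<Otimes>\<^sub>M law)) \<le> ennreal (4 * exp (128 * l\<^sup>2 * L2))"
    "(\<integral>\<^sup>+p. ennreal (exp (- l * D p)) \<partial>(law \<Otimes>\<^sub>M law)) \<le> ennreal (4 * exp (128 * l\<^sup>2 * L2))"
    "\<And>p. p \<notin> bad \<Longrightarrow> D p = f u (snd p) - f u (fst p)" using path_difference[OF u, of l] by blast
  define M2 where "M2 = 288 * L2"
  have M2: "0 \<le> M2" using L2_pos by (simp add: M2_def)
  have e3: "4 * exp (128 * l\<^sup>2 * L2) \<le> 12"
  proof -
    have "128 * l\<^sup>2 * L2 \<le> 1" using l L2_pos by simp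
    then have "exp (128 * l\<^sup>2 * L2) \<le> exp 1" by simp
    then show ?thesis using exp_le by linarith
  qed
  have sq: "x\<^sup>2 \<le> 2 * (exp x + exp (- x))" for x :: real
  proof -
    have "1 + \<bar>x\<bar> + \<bar>x\<bar>\<^sup>2 / 2 \<le> exp \<bar>x\<bar>" by (rule exp_lower_Taylor_quadratic) simp
    moreover have "exp \<bar>x\<bar> \<le> exp x + exp (- x)" by (cases "0 \<le> x") auto
    ultimately show ?thesis using abs_ge_zero[of x] by simp
  qed
  have pt: "(f u (snd p) - f u (fst p))\<^sup>2 \<le> 4 * indicator bad p + M2 * exp (l * D p) + M2 * exp (- l * D p)" for p
  proof (cases "p \<in> bad")
    case True
    have "(f u (snd p) - f u (fst p))\<^sup>2 \<le> 2\<^sup>2" using f_diff_bound[OF u, of "snd p" "fst p"] power_mono[of "\<bar>f u (snd p) - f u (fst p)\<bar>" 2 2] by simp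
    moreover have "0 \<le> M2 * exp (l * D p)" "0 \<le> M2 * exp (- l * D p)" using M2 by simp_all
    ultimately show ?thesis using True by simp
  next
    case False
    have "(l * D p)\<^sup>2 \<le> 2 * (exp (l * D p) + exp (- (l * D p)))" by (rule sq)
    then have "144 * L2 * (l * D p)\<^sup>2 \<le> 144 * L2 * (2 * (exp (l * D p) + exp (- (l * D p))))"
      using L2_pos by (intro mult_left_mono) auto
    moreover have "144 * L2 * (l * D p)\<^sup>2 = (D p)\<^sup>2" using L2_pos by (simp add: power_mult_distrib l(2))
    moreover have "144 * L2 * (2 * (exp (l * D p) + exp (- (l * D p)))) = M2 * exp (l * D p) + M2 * exp (- l * D p)"
      by (simp add: M2_def algebra_simps)
    ultimately have "(D p)\<^sup>2 \<le> M2 * exp (l * D p) + M2 * exp (- l * D p)" by simp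
    then show ?thesis using False by (simp only: D(4)[OF False, symmetric]) simp
  qed
  have me: "(\<lambda>p. ennreal (exp (c * D p))) \<in> borel_measurable (law \<Otimes>\<^sub>M law)" for c
    by (rule measurable_compose[OF measurable_compose[OF meas_law2[OF borel_measurable_times[OF borel_measurable_const D(1)]] borel_measurable_exp] measurable_ennreal])
  have "(\<integral>\<^sup>+p. ennreal ((f u (snd p) - f u (fst p))\<^sup>2) \<partial>(law \<Otimes>\<^sub>M law))
      \<le> (\<integral>\<^sup>+p. 4 * indicator bad p + ennreal M2 * ennreal (exp (l * D p)) + ennreal M2 * ennreal (exp (- l * D p)) \<partial>(law \<Otimes>\<^sub>M law))"
  proof (rule nn_integral_mono)
    fix p
    have "ennreal ((f u (snd p) - f u (fst p))\<^sup>2) \<le> ennreal (4 * indicator bad p + M2 * exp (l * D p) + M2 * exp (- l * D p))"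
      by (rule ennreal_leI[OF pt])
    also have "\<dots> = 4 * indicator bad p + ennreal M2 * ennreal (exp (l * D p)) + ennreal M2 * ennreal (exp (- l * D p))"
      using M2 by (simp add: ennreal_mult indicator_def)
    finally show "ennreal ((f u (snd p) - f u (fst p))\<^sup>2) \<le> \<dots>" .
  qed
  also have "\<dots> = 4 * emeasure (law \<Otimes>\<^sub>M law) bad + ennreal M2 * (\<integral>\<^sup>+p. ennreal (exp (l * D p)) \<partial>(law \<Otimes>\<^sub>M law))
      + ennreal M2 * (\<integral>\<^sup>+p. ennreal (exp (- l * D p)) \<partial>(law \<Otimes>\<^sub>M law))"
  proof -
    have m1: "(\<lambda>p. ennreal M2 * ennreal (exp (c * D p))) \<in> borel_measurable (law \<Otimes>\<^sub>M law)" for c using me[of c] by measurable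
    have m0: "(\<lambda>p. 4 * indicator bad p :: ennreal) \<in> borel_measurable (law \<Otimes>\<^sub>M law)" using bad_sets by measurable
    have m01: "(\<lambda>p. 4 * indicator bad p + ennreal M2 * ennreal (exp (l * D p))) \<in> borel_measurable (law \<Otimes>\<^sub>M law)"
      using m0 m1[of l] by (rule borel_measurable_add)
    have "(\<integral>\<^sup>+p. 4 * indicator bad p \<partial>(law \<Otimes>\<^sub>M law)) = 4 * emeasure (law \<Otimes>\<^sub>M law) bad"
      by (rule nn_integral_cmult_indicator[OF bad_sets])
    then show ?thesis
      unfolding nn_integral_add[OF m01 m1] nn_integral_add[OF m0 m1] nn_integral_cmult[OF me] by simp
  qed
  also have "\<dots> \<le> ennreal (4 * p0) + ennreal M2 * ennreal 12 + ennreal M2 * ennreal 12"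
  proof (intro add_mono mult_left_mono order_trans[OF D(2)] order_trans[OF D(3)] ennreal_leI e3)
    have "4 * emeasure (law \<Otimes>\<^sub>M law) bad = ennreal (4 * measure (law \<Otimes>\<^sub>M law) bad)"
      by (simp add: law2.emeasure_eq_measure ennreal_mult)
    also have "\<dots> \<le> ennreal (4 * p0)" using measure_bad by (intro ennreal_leI) simp
    finally show "4 * emeasure (law \<Otimes>\<^sub>M law) bad \<le> ennreal (4 * p0)" .
  qed simp_all
  also have "\<dots> = ennreal (4 * p0 + M2 * 12 + M2 * 12)" 
    using M2 p0_le(2) by (simp only: ennreal_mult[symmetric, OF M2] ennreal_plus[symmetric] zero_le_numeral mult_nonneg_nonneg add_nonneg_nonneg)
  also have "\<dots> \<le> ennreal (V * L2)"
  proof (rule ennreal_leI)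
    have "4 * p0 \<le> 4 * (640 * (real J + 1) * L2)" using p0_le(1) by simp
    then show "4 * p0 + M2 * 12 + M2 * 12 \<le> V * L2" by (simp add: V_def M2_def algebra_simps)
  qed
  finally show ?thesis .
qed

section \<open>Variance and concentration of the projector coordinates\<close>

abbreviation Ef where "Ef u \<equiv> (\<integral>z. f u z \<partial>law)"

lemma integrable_f: "integrable law (f u)"
  by (rule law.integrable_const_bound[of _ "norm u"]) (use f_bound meas_law[OF f_measurable] in auto)

text \<open>By Jensen's inequality in the second copy, the variance is at most the second moment of
  the difference of two independent copies.\<close>

lemma variance_f:
  assumes u: "norm u \<le> 1"
  shows "law.variance (f u) \<le> V * L2"
proof -
  have b: "\<bar>f u z - c\<bar> \<le> norm u + \<bar>c\<bar>" for z c using f_bound[of u z] by linarith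
  have i2: "integrable law (\<lambda>z. (f u z - c)\<^sup>2)" for c
  proof (rule law.integrable_const_bound[of _ "(norm u + \<bar>c\<bar>)\<^sup>2"])
    show "AE z in law. norm ((f u z - c)\<^sup>2) \<le> (norm u + \<bar>c\<bar>)\<^sup>2"
    proof (rule AE_I2)
      fix z
      have "\<bar>f u z - c\<bar>\<^sup>2 \<le> (norm u + \<bar>c\<bar>)\<^sup>2" by (rule power_mono[OF b]) simp
      then show "norm ((f u z - c)\<^sup>2) \<le> (norm u + \<bar>c\<bar>)\<^sup>2" by simp
    qed
    show "(\<lambda>z. (f u z - c)\<^sup>2) \<in> borel_measurable law"
      by (intro borel_measurable_power borel_measurable_diff meas_law[OF f_measurable] borel_measurable_const)
  qed
  have J: "(Ef u - c)\<^sup>2 \<le> (\<integral>z. (f u z - c)\<^sup>2 \<partial>law)" for c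
  proof -
    have "(\<integral>z. (Ef u - c)\<^sup>2 + 2 * (Ef u - c) * (f u z - Ef u) \<partial>law) \<le> (\<integral>z. (f u z - c)\<^sup>2 \<partial>law)"
    proof (rule integral_mono[OF _ i2])
      show "integrable law (\<lambda>z. (Ef u - c)\<^sup>2 + 2 * (Ef u - c) * (f u z - Ef u))" using integrable_f by simp
      fix z
      have "0 \<le> ((f u z - c) - (Ef u - c))\<^sup>2" by simp
      then show "(Ef u - c)\<^sup>2 + 2 * (Ef u - c) * (f u z - Ef u) \<le> (f u z - c)\<^sup>2"
        by (simp add: power2_eq_square algebra_simps)
    qed
    then show ?thesis using integrable_f by (simp add: law.prob_space[simplified])
  qed
  have "ennreal (law.variance (f u)) = (\<integral>\<^sup>+a. ennreal ((f u a - Ef u)\<^sup>2) \<partial>law)"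
    by (rule nn_integral_eq_integral[symmetric]) (use i2 in auto)
  also have "\<dots> \<le> (\<integral>\<^sup>+a. \<integral>\<^sup>+b. ennreal ((f u b - f u a)\<^sup>2) \<partial>law \<partial>law)"
  proof (rule nn_integral_mono)
    fix a
    have "ennreal ((f u a - Ef u)\<^sup>2) \<le> ennreal (\<integral>b. (f u b - f u a)\<^sup>2 \<partial>law)"
      using J[of "f u a"] by (intro ennreal_leI) (simp add: power2_commute)
    also have "\<dots> = (\<integral>\<^sup>+b. ennreal ((f u b - f u a)\<^sup>2) \<partial>law)"
      by (rule nn_integral_eq_integral[symmetric]) (use i2 in auto)
    finally show "ennreal ((f u a - Ef u)\<^sup>2) \<le> \<dots>" .
  qed
  also have "\<dots> = (\<integral>\<^sup>+p. ennreal ((f u (snd p) - f u (fst p))\<^sup>2) \<partial>(law \<Otimes>\<^sub>M law))"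
  proof -
    have "(\<lambda>p. (f u (snd p) - f u (fst p))\<^sup>2) \<in> borel_measurable (law \<Otimes>\<^sub>M law)"
      by (intro borel_measurable_power borel_measurable_diff meas_law2 f_fst f_snd)
    then have "(\<lambda>p. ennreal ((f u (snd p) - f u (fst p))\<^sup>2)) \<in> borel_measurable (law \<Otimes>\<^sub>M law)"
      by (rule measurable_compose[OF _ measurable_ennreal])
    from law.nn_integral_fst[OF this] show ?thesis by simp
  qed
  also have "\<dots> \<le> ennreal (V * L2)" by (rule second_moment[OF u])
  finally show ?thesis by (rule ennreal_le_iff[THEN iffD1, rotated]) (use V_pos L2_pos in simp)
qed

text \<open>Desymmetrisation: by Chebyshev's inequality one copy is within \<open>v\<close> of the
  mean with probability at least 3/4, and then a deviation of \<open>s + v\<close> in the other copy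
  forces a difference of at least \<open>s\<close>. The factor 64 produces the exponent
  \<open>8 * t\<close> in \<open>difference_tail\<close>.\<close>

lemma f_concentration:
  assumes u: "norm u \<le> 1" and t: "1 \<le> t"
  shows "measure law {z. (64 + 2 * sqrt V) * sqrt (L2 * t) \<le> \<bar>f u z - Ef u\<bar>} \<le> 4 / 3 * (p0 + 8 * exp (- 8 * t))"
proof -
  define s where "s = 64 * sqrt (L2 * t)"
  define v where "v = 2 * sqrt V * sqrt (L2 * t)"
  have Lt: "0 < L2 * t" using L2_pos t by simp
  have s: "0 < s" "s\<^sup>2 / (512 * L2) = 8 * t" using Lt L2_pos t by (simp_all add: s_def power_mult_distrib)
  have v: "0 < v" "v\<^sup>2 = 4 * (V * (L2 * t))" using Lt V_pos t L2_pos by (simp_all add: v_def power_mult_distrib)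
  define A where "A = {z. s + v \<le> \<bar>f u z - Ef u\<bar>}"
  define B where "B = {z. \<bar>f u z - Ef u\<bar> < v}"
  have m: "(\<lambda>z. \<bar>f u z - Ef u\<bar>) \<in> borel_measurable law"
    by (intro borel_measurable_abs borel_measurable_diff meas_law[OF f_measurable] borel_measurable_const)
  have A: "A \<in> sets law" using borel_measurable_le[OF borel_measurable_const m, of "s + v"] by (simp add: A_def)
  have B: "B \<in> sets law" using borel_measurable_less[OF m borel_measurable_const, of v] by (simp add: B_def)
  have B4: "3 / 4 \<le> measure law B"
  proof -
    have i2: "integrable law (\<lambda>z. (f u z)\<^sup>2)"
    proof (rule law.integrable_const_bound[of _ "(norm u)\<^sup>2"])
      show "AE z in law. norm ((f u z)\<^sup>2) \<le> (norm u)\<^sup>2"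
      proof (rule AE_I2)
        fix z
        have "\<bar>f u z\<bar>\<^sup>2 \<le> (norm u)\<^sup>2" by (rule power_mono[OF f_bound]) simp
        then show "norm ((f u z)\<^sup>2) \<le> (norm u)\<^sup>2" by simp
      qed
    qed (intro borel_measurable_power meas_law[OF f_measurable])
    have "measure law {z. v \<le> \<bar>f u z - Ef u\<bar>} \<le> law.variance (f u) / v\<^sup>2"
      using law.Chebyshev_inequality[OF meas_law[OF f_measurable] i2 v(1)] by simp
    also have "\<dots> \<le> (V * L2) / v\<^sup>2" by (intro divide_right_mono variance_f u) simp
    also have "\<dots> \<le> 1 / 4" using v(2) V_pos L2_pos t by (simp add: field_simps)
    finally have "measure law {z. v \<le> \<bar>f u z - Ef u\<bar>} \<le> 1 / 4" .
    moreover have "{z. v \<le> \<bar>f u z - Ef u\<bar>} = space law - B" by (auto simp: B_def)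
    ultimately show ?thesis using law.prob_compl[OF B] by simp
  qed
  have "measure law B * measure law A = measure (law \<Otimes>\<^sub>M law) (B \<times> A)"
    using law.emeasure_pair_measure_Times[OF B A]
    by (simp add: law.emeasure_eq_measure law2.emeasure_eq_measure ennreal_mult[symmetric])
  also have "\<dots> \<le> measure (law \<Otimes>\<^sub>M law) {p. s \<le> \<bar>f u (snd p) - f u (fst p)\<bar>}"
  proof (rule law2.finite_measure_mono)
    show "B \<times> A \<subseteq> {p. s \<le> \<bar>f u (snd p) - f u (fst p)\<bar>}" by (auto simp: A_def B_def)
    have "(\<lambda>p. \<bar>f u (snd p) - f u (fst p)\<bar>) \<in> borel_measurable (law \<Otimes>\<^sub>M law)"
      by (intro borel_measurable_abs borel_measurable_diff meas_law2 f_fst f_snd)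
    from borel_measurable_le[OF borel_measurable_const this, of s]
    show "{p. s \<le> \<bar>f u (snd p) - f u (fst p)\<bar>} \<in> sets (law \<Otimes>\<^sub>M law)" by simp
  qed
  also have "\<dots> \<le> p0 + 8 * exp (- 8 * t)" using difference_tail[OF u s(1)] s(2) by simp
  finally have 1: "measure law B * measure law A \<le> p0 + 8 * exp (- 8 * t)" .
  have "3 / 4 * measure law A \<le> measure law B * measure law A" using B4 by (intro mult_right_mono) auto
  from order_trans[OF this 1] have "measure law A \<le> 4 / 3 * (p0 + 8 * exp (- 8 * t))" by simp
  moreover have "s + v = (64 + 2 * sqrt V) * sqrt (L2 * t)" by (simp add: s_def v_def algebra_simps)
  ultimately show ?thesis by (simp add: A_def)
qed

end

section \<open>The mean of the empirical projector\<close>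

definition reflection :: "'h::real_inner \<Rightarrow> 'h \<Rightarrow> 'h" where
  "reflection \<theta> x = (2 * inner x \<theta>) *\<^sub>R \<theta> - x"

lemma reflection_facts:
  assumes "norm \<theta> = 1"
  shows "linear (reflection \<theta>)" "inner (reflection \<theta> x) y = inner x (reflection \<theta> y)"
    "reflection \<theta> (reflection \<theta> x) = x" "reflection \<theta> \<theta> = \<theta>" "inner x \<theta> = 0 \<Longrightarrow> reflection \<theta> x = - x"
proof -
  have t: "inner \<theta> \<theta> = 1" using assms by (simp add: norm_eq_1)
  show "linear (reflection \<theta>)"
    by (rule linearI) (simp_all add: reflection_def inner_add_left scaleR_add_left scaleR_diff_right algebra_simps)
  show "inner (reflection \<theta> x) y = inner x (reflection \<theta> y)"
    by (simp add: reflection_def inner_diff_left inner_diff_right inner_commute)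
  show "reflection \<theta> \<theta> = \<theta>" by (simp add: reflection_def t scaleR_2)
  have "inner (reflection \<theta> x) \<theta> = inner x \<theta>" by (simp add: reflection_def inner_diff_left t)
  then show "reflection \<theta> (reflection \<theta> x) = x" unfolding reflection_def[of \<theta> "reflection \<theta> x"] by (simp add: reflection_def)
  show "reflection \<theta> x = - x" if "inner x \<theta> = 0" using that by (simp add: reflection_def)
qed

context eigen_data
begin

lemma empirical_eigenvalue_eq: "empirical_eigenvalue M X Y n r \<omega> = eigval (scov n (Z \<omega>)) jr"
  unfolding empirical_eigenvalue_def scov_Z[symmetric] compact_nonneg.eigenvalue_seq_eq[OF compact_nonneg_scov] ..

lemma Ef_eq_expectation:
  "Ef u = (\<integral>\<omega>. inner (spectral_projector (sample_covariance Y n \<omega>) (empirical_eigenvalue M X Y n r \<omega>) \<theta>) u \<partial>M)"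
proof -
  have "Ef u = (\<integral>\<omega>. f u (Z \<omega>) \<partial>M)" unfolding law_def by (rule integral_distr[OF measZ f_measurable])
  then show ?thesis unfolding f_def empirical_eigenvalue_eq scov_Z .
qed

text \<open>At \<theta> the linear term is \<open>C (e \<omega>)\<close>, as the reduced resolvent
  annihilates \<theta>, and this vector is orthogonal to \<theta>. So the coordinate along \<theta>
  only sees the two projectors.\<close>

lemma bias_eq: "bias M X Y n r \<theta> = Ef \<theta> - 1"
proof -
  define C where "C = reduced_resolvent \<Sigma> r"
  note CL = cov.bounded_linear_reduced_resolvent[OF mu_pos r_pos, folded C_def]
  define Q where "Q \<omega> = spectral_projector (scov n (Z \<omega>)) (eigval (scov n (Z \<omega>)) jr) \<theta>" for \<omega>
  define e where "e \<omega> = scov n (Z \<omega>) \<theta> - \<Sigma> \<theta>" for \<omega>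
  have P: "spectral_projector \<Sigma> \<mu> x = inner \<theta> x *\<^sub>R \<theta>" for x by (rule cov.simple_eigenpair_facts(3)[OF eigenpair])
  have tt: "inner \<theta> \<theta> = 1" using norm_theta by (simp add: norm_eq_1)
  have E: "estimation_error M X Y n \<omega> x = scov n (Z \<omega>) x - \<Sigma> x" for \<omega> x by (simp add: estimation_error_def scov_Z)
  have E0: "estimation_error M X Y n \<omega> 0 = 0" for \<omega>
    unfolding E using bounded_linear.linear[OF bounded_linear_err, of "Z \<omega>", THEN linear_0] .
  have R: "remainder M X Y n r \<omega> \<theta> = Q \<omega> - \<theta> - C (e \<omega>)" for \<omega>
    unfolding remainder_def linear_term_def Let_def empirical_eigenvalue_eq scov_Z[symmetric] C_def[symmetric] P CL(2)[OF theta_eig] tt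
    by (simp add: Q_def e_def E0) (simp add: E)
  have em: "e \<in> borel_measurable M" unfolding e_def[abs_def]
    by (intro borel_measurable_diff measurable_compose[OF measZ measurable_scov] borel_measurable_const)
  have ie: "integrable M e"
  proof (rule Bochner_Integration.integrable_bound[OF _ em])
    show "integrable M (\<lambda>\<omega>. err (Z \<omega>))" by (rule integrable_distr[OF measZ integrable_err[unfolded law_def]])
    show "AE \<omega> in M. norm (e \<omega>) \<le> norm (err (Z \<omega>))"
    proof (rule AE_I2)
      fix \<omega>
      show "norm (e \<omega>) \<le> norm (err (Z \<omega>))"
        using norm_le_err[of "Z \<omega>" \<theta>] norm_theta abs_ge_self[of "err (Z \<omega>)"] unfolding e_def by simp
    qed
  qed
  have iC: "integrable M (\<lambda>\<omega>. C (e \<omega>))" by (rule integrable_bounded_linear[OF CL(1) ie])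
  have iQ: "integrable M Q"
  proof (rule integrable_const_bound[of _ 1])
    show "AE \<omega> in M. norm (Q \<omega>) \<le> 1" using projector_scov(3)[of n _ jr \<theta>] norm_theta by (simp add: Q_def)
    show "Q \<in> borel_measurable M" unfolding Q_def[abs_def] by (rule measurable_compose[OF measZ measurable_projector_scov])
  qed
  have iR: "integrable M (\<lambda>\<omega>. remainder M X Y n r \<omega> \<theta>)"
    unfolding R by (intro Bochner_Integration.integrable_diff iQ iC integrable_const)
  have "bias M X Y n r \<theta> = (\<integral>\<omega>. inner (remainder M X Y n r \<omega> \<theta>) \<theta> \<partial>M)"
    unfolding bias_def mean_remainder_def by (rule integral_inner_left[symmetric, OF iR])
  also have "\<dots> = (\<integral>\<omega>. inner (Q \<omega>) \<theta> - 1 \<partial>M)"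
    unfolding R inner_diff_left tt CL(3)[OF theta_eig] by simp
  also have "\<dots> = (\<integral>\<omega>. inner (Q \<omega>) \<theta> \<partial>M) - 1"
    using integrable_inner_left[OF iQ] by (simp add: prob_space)
  finally show ?thesis unfolding Ef_eq_expectation by (simp add: Q_def empirical_eigenvalue_eq scov_Z)
qed

text \<open>The reflection preserves the covariance form because \<theta> is an eigenvector, and it
  conjugates the sample covariance. The projector applied to \<theta> is thus reflected, while
  \<open>u\<close> is mapped to \<open>- u\<close>, so \<open>f u\<close> changes its sign under a
  map that preserves the law.\<close>

lemma Ef_orthogonal:
  assumes u: "inner u \<theta> = 0"
  shows "Ef u = 0"
proof -
  define R where "R = reflection \<theta>"
  note RF = reflection_facts[OF norm_theta, folded R_def]
  have R_eq: "R x = (2 * inner x \<theta>) *\<^sub>R \<theta> - x" for x by (simp add: R_def reflection_def)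
  have tt: "inner \<theta> \<theta> = 1" using norm_theta by (simp add: norm_eq_1)
  have Rm: "R \<in> borel_measurable borel" unfolding R_eq[abs_def]
    by (intro borel_measurable_continuous_onI continuous_intros)
  define T where "T = (\<lambda>z :: nat \<Rightarrow> 'h. \<lambda>j. R (z j))"
  have quad: "\<kappa> j (R x) = \<kappa> j x" for j x
  proof -
    have a: "\<Sigma> (R x) = (2 * inner x \<theta> * \<mu>) *\<^sub>R \<theta> - \<Sigma> x"
      unfolding R_eq by (simp add: cov.diff cov.scaleR Sigma_theta)
    have b: "inner (\<Sigma> x) \<theta> = \<mu> * inner x \<theta>" unfolding cov.symmetric Sigma_theta by simp
    have "inner (\<Sigma> (R x)) (R x) = inner (\<Sigma> x) x"
      unfolding a by (simp add: R_eq inner_diff_left inner_diff_right b tt inner_commute[of \<theta> x] algebra_simps)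
    then show ?thesis by (simp add: \<kappa>_def)
  qed
  have law_T: "distr law law T = law" unfolding T_def by (rule gaussian_reflection[OF gaussian_law Rm RF(2) quad])
  have "T \<in> measurable law seqM" unfolding T_def
    by (rule measurable_seqI) (intro meas_law measurable_compose[OF measurable_seq_component Rm])
  then have Tm: "T \<in> measurable law law" using measurable_cong_sets[OF refl sets_law] by blast
  have flip: "f u (T z) = - f u z" for z
  proof -
    interpret B: compact_nonneg "scov n z" by (rule compact_nonneg_scov)
    interpret IC: isometric_conjugate R R "scov n z" "scov n (T z)"
    proof (rule isometric_conjugate.intro)
      show "linear R" by (rule RF(1))
      show "inner (R x) (R y) = inner x y" for x y by (simp add: RF(2) RF(3))
      show "inner (R x) y = inner x (R y)" for x y by (rule RF(2))
      show "linear (scov n z)" by (rule bounded_linear.linear[OF B.bounded_linear])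
      show "scov n (T z) x = R (scov n z (R x))" for x
        by (simp add: scov_def T_def RF(2) linear_scale[OF RF(1)] linear_sum[OF RF(1)])
    qed
    have ev: "eigval (scov n (T z)) = eigval (scov n z)"
      using IC.eigenvalue_seq_conj unfolding compact_nonneg.eigenvalue_seq_eq[OF compact_nonneg_scov] .
    have "spectral_projector (scov n (T z)) (eigval (scov n z) jr) (R \<theta>) = R (spectral_projector (scov n z) (eigval (scov n z) jr) \<theta>)"
      by (rule IC.spectral_projector_conj[OF projector_scov(1,2)])
    then show ?thesis unfolding f_def ev RF(4) by (simp add: RF(2) RF(5)[OF u])
  qed
  have "Ef u = (\<integral>z. f u z \<partial>distr law law T)" unfolding law_T ..
  also have "\<dots> = (\<integral>z. f u (T z) \<partial>law)" by (rule integral_distr[OF Tm meas_law[OF f_measurable]])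
  also have "\<dots> = - Ef u" unfolding flip by simp
  finally show ?thesis by simp
qed

lemma Ef_eq: "Ef u = (1 + bias M X Y n r \<theta>) * inner \<theta> u"
proof -
  define v where "v = u - inner \<theta> u *\<^sub>R \<theta>"
  have tt: "inner \<theta> \<theta> = 1" using norm_theta by (simp add: norm_eq_1)
  have "inner v \<theta> = 0" by (simp add: v_def inner_diff_left tt inner_commute[of u])
  then have 0: "Ef v = 0" by (rule Ef_orthogonal)
  have "f u z = inner \<theta> u * f \<theta> z + f v z" for z by (simp add: f_def v_def inner_diff_right)
  then have "Ef u = (\<integral>z. inner \<theta> u * f \<theta> z + f v z \<partial>law)" by simp
  also have "\<dots> = inner \<theta> u * Ef \<theta> + Ef v" using integrable_f by simp
  finally show ?thesis by (simp add: 0 bias_eq)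
qed

text \<open>On the good set the eigenspace is a line, so every unit eigenvector agrees with the
  greedy one up to a sign, which cancels.\<close>

lemma f_empirical:
  assumes z: "err z \<le> \<tau>2" and h: "h \<in> eigenspace (scov n z) (eigval (scov n z) jr)" "norm h = 1"
  shows "f u z = inner h \<theta> * inner h u"
proof -
  interpret B: compact_nonneg "scov n z" by (rule compact_nonneg_scov)
  define a where "a = B.eg jr"
  have "0 < B.el jr" using good_gap(1)[OF z] eta_pos by linarith
  moreover have "B.el i \<noteq> B.el jr" if "i \<noteq> jr" for i using good_gap(2)[OF z that] eta_pos by auto
  ultimately have P: "spectral_projector (scov n z) (B.el jr) h = inner a h *\<^sub>R a"
    unfolding a_def by (rule B.simple_spectral_projector)
  have "spectral_projector (scov n z) (B.el jr) h = h"
    unfolding spectral_projector_def by (rule orthogonal_projection_eqI[OF B.subspace_eigenspace h(1)]) simp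
  then have ha: "h = inner a h *\<^sub>R a" using P by simp
  have na: "norm a = 1" using B.norm_eg[of jr] \<open>0 < B.el jr\<close> by (auto simp: a_def)
  have "\<bar>inner a h\<bar> = 1" using arg_cong[OF ha, of norm] na h(2) by simp
  then have c: "inner a h * inner a h = 1" by (metis abs_mult_self_eq mult_1)
  have "inner h \<theta> * inner h u = inner (inner a h *\<^sub>R a) \<theta> * inner (inner a h *\<^sub>R a) u" using ha by simp
  also have "\<dots> = (inner a h * inner a h) * (inner a \<theta> * inner a u)" by simp
  also have "\<dots> = f u z" using c f_good[OF z, of u] by (simp add: a_def)
  finally show ?thesis ..
qed

end

section \<open>From projectors to eigenvectors\<close>

text \<open>With \<open>s = sqrt B\<close>, \<open>p * (q - s * a)\<close> is
  \<open>(p * q - B * a) + s * a * (s - p)\<close>, and both terms are at most \<open>e\<close> in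
  absolute value, the second because
  \<open>s * \<bar>s - p\<bar> \<le> \<bar>B - p\<^sup>2\<bar>\<close>. Division by \<open>p\<close>
  is safe since \<open>p\<^sup>2 \<ge> 2 * \<gamma> - e \<ge> \<gamma>\<close>.\<close>

lemma normalised_inner_bound:
  fixes p q a B e \<gamma> :: real
  assumes p: "0 \<le> p" and 1: "\<bar>p\<^sup>2 - B\<bar> \<le> e" and 2: "\<bar>p * q - B * a\<bar> \<le> e"
    and B: "2 * \<gamma> \<le> B" and g: "0 < \<gamma>" and e: "e \<le> \<gamma>" and a: "\<bar>a\<bar> \<le> 1"
  shows "\<bar>q - sqrt B * a\<bar> \<le> 2 * e / sqrt \<gamma>"
proof -
  define s where "s = sqrt B"
  have s: "0 < s" "s * s = B" using B g by (simp_all add: s_def)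
  have "\<gamma> \<le> p\<^sup>2" using 1 B e by (simp add: abs_le_iff)
  then have gp: "sqrt \<gamma> \<le> p" using p by (rule real_le_lsqrt[rotated])
  have "s * \<bar>s - p\<bar> \<le> (s + p) * \<bar>s - p\<bar>" using p by (intro mult_right_mono) auto
  also have "\<dots> = \<bar>(s + p) * (s - p)\<bar>" using s p by (simp add: abs_mult)
  also have "(s + p) * (s - p) = B - p\<^sup>2" using s by (simp add: algebra_simps power2_eq_square)
  finally have 3: "s * \<bar>s - p\<bar> \<le> e" using 1 by (simp add: abs_minus_commute)
  have "\<bar>s * a * (s - p)\<bar> = (s * \<bar>s - p\<bar>) * \<bar>a\<bar>" using s by (simp add: abs_mult)
  also have "\<dots> \<le> (s * \<bar>s - p\<bar>) * 1" using a s by (intro mult_left_mono) auto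
  finally have 4: "\<bar>s * a * (s - p)\<bar> \<le> e" using 3 by simp
  have eq: "p * (q - s * a) = (p * q - B * a) + s * a * (s - p)" unfolding s(2)[symmetric] by (simp add: algebra_simps)
  have "\<bar>p * (q - s * a)\<bar> \<le> 2 * e" unfolding eq using 2 4 by linarith
  then have "p * \<bar>q - s * a\<bar> \<le> 2 * e" using p by (simp add: abs_mult)
  moreover have "sqrt \<gamma> * \<bar>q - s * a\<bar> \<le> p * \<bar>q - s * a\<bar>" using gp by (intro mult_right_mono) auto
  ultimately have "sqrt \<gamma> * \<bar>q - s * a\<bar> \<le> 2 * e" by linarith
  then show ?thesis using g by (simp add: s_def field_simps)
qed

text \<open>This is \<open>64 + 2 * sqrt V\<close> with \<open>V\<close> and \<open>J\<close>
  unfolded, so that it is visibly a function of \<gamma> alone.\<close>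

definition deviation_const :: "real \<Rightarrow> real" where
  "deviation_const \<gamma> = 64 + 2 * sqrt (6912 + 2560 * (real (nat \<lceil>8 / \<gamma>\<rceil>) + 1))"

text \<open>A sum of three requirements: the first makes the tail of the error a fraction of
  \<open>exp (- t)\<close>, the second keeps deviations below \<gamma>, the third is the factor in
  the final bound. The first summand is at least 1, so the square of the constant dominates it
  too.\<close>

definition eigenvector_const :: "real \<Rightarrow> real" where
  "eigenvector_const \<gamma> = 160 * (1 + 64 * (real (nat \<lceil>8 / \<gamma>\<rceil>) + 1)) + deviation_const \<gamma> / \<gamma>
     + 4 * deviation_const \<gamma> / (\<gamma> * sqrt \<gamma>)"

lemma eigenvector_const:
  assumes "0 < \<gamma>"
  defines "C \<equiv> eigenvector_const \<gamma>"
  shows "160 * (1 + 64 * (real (nat \<lceil>8 / \<gamma>\<rceil>) + 1)) \<le> C\<^sup>2" "deviation_const \<gamma> \<le> C * \<gamma>"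
    "4 * deviation_const \<gamma> / (\<gamma> * sqrt \<gamma>) \<le> C" "0 < C" "0 < deviation_const \<gamma>"
proof -
  define j where "j = 160 * (1 + 64 * (real (nat \<lceil>8 / \<gamma>\<rceil>) + 1))"
  have j: "1 \<le> j" by (simp add: j_def)
  show d: "0 < deviation_const \<gamma>" unfolding deviation_const_def by (intro add_pos_nonneg mult_nonneg_nonneg) auto
  have p: "0 < deviation_const \<gamma> / \<gamma>" "0 < 4 * deviation_const \<gamma> / (\<gamma> * sqrt \<gamma>)" using d assms by simp_all
  have C: "C = j + deviation_const \<gamma> / \<gamma> + 4 * deviation_const \<gamma> / (\<gamma> * sqrt \<gamma>)" by (simp add: C_def eigenvector_const_def j_def)
  show "0 < C" "4 * deviation_const \<gamma> / (\<gamma> * sqrt \<gamma>) \<le> C" using C j p by linarith+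
  have C1: "1 \<le> C" "j \<le> C" "deviation_const \<gamma> / \<gamma> \<le> C" using C j p by linarith+
  then show "deviation_const \<gamma> \<le> C * \<gamma>" using assms by (simp add: field_simps)
  have "C * 1 \<le> C * C" using C1 by (intro mult_left_mono) auto
  then show "j \<le> C\<^sup>2" using C1 unfolding power2_eq_square by linarith
qed

context eigen_data
begin

lemma unit_vector_bound:
  assumes hat: "empirical_eigenvector M X Y n r \<theta> \<theta>h" and t: "1 \<le> t" and b: "2 * \<gamma> \<le> 1 + bias M X Y n r \<theta>"
    and small: "eigenvector_const \<gamma> * S * sqrt (t / real n) \<le> \<eta>" and u: "norm u = 1"
  shows "1 - exp (- t) \<le> measure M {\<omega> \<in> space M. \<bar>inner (\<theta>h \<omega> - sqrt (1 + bias M X Y n r \<theta>) *\<^sub>R \<theta>) u\<bar>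
            \<le> eigenvector_const \<gamma> * (S / g) * sqrt (t / real n)}"
proof -
  define C where "C = eigenvector_const \<gamma>"
  define c where "c = deviation_const \<gamma>"
  have cV: "c = 64 + 2 * sqrt V" by (simp add: c_def deviation_const_def V_def J_def)
  have C: "160 * (1 + 64 * (real J + 1)) \<le> C\<^sup>2" "c \<le> C * \<gamma>" "4 * c / (\<gamma> * sqrt \<gamma>) \<le> C" "0 < C" "0 < c"
    using eigenvector_const[OF gam(1)] by (simp_all add: C_def c_def J_def)
  have n: "0 < real n" using n_pos by simp
  define x where "x = L2 * t"
  have x0: "0 < x" using L2_pos t by (simp add: x_def)
  \<comment> \<open>The smallness hypothesis, squared and divided by
    \<open>\<eta>\<^sup>2\<close>.\<close>
  have C2: "C\<^sup>2 * x \<le> 1"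
  proof -
    have "(C * S * sqrt (t / real n))\<^sup>2 \<le> \<eta>\<^sup>2" 
      using small[folded C_def] C(4) S_nonneg t n by (intro power_mono mult_nonneg_nonneg) simp_all
    then have "C\<^sup>2 * S\<^sup>2 * (t / real n) \<le> \<eta>\<^sup>2" using t n by (simp add: power_mult_distrib)
    then have "C\<^sup>2 * S\<^sup>2 * (t / real n) / \<eta>\<^sup>2 \<le> \<eta>\<^sup>2 / \<eta>\<^sup>2" by (rule divide_right_mono) simp
    then show ?thesis using eta_pos by (simp add: x_def L2_def)
  qed
  define e where "e = c * sqrt x"
  have e: "e \<le> \<gamma>"
  proof -
    have "(C * sqrt x)\<^sup>2 \<le> 1\<^sup>2" using C2 x0 by (simp add: power_mult_distrib)
    then have "C * sqrt x \<le> 1" by (rule power2_le_imp_le) simp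
    then have "C * \<gamma> * sqrt x \<le> \<gamma>" using gam mult_left_mono[of "C * sqrt x" 1 \<gamma>] by (simp add: mult_ac)
    moreover have "c * sqrt x \<le> C * \<gamma> * sqrt x" using C(2) x0 by (intro mult_right_mono) auto
    ultimately show ?thesis by (simp add: e_def)
  qed
  have e_le: "2 * e / sqrt \<gamma> \<le> C * (S / g) * sqrt (t / real n)"
  proof -
    have "x = (S / \<eta>)\<^sup>2 * (t / real n)" by (simp add: x_def L2_def power_divide)
    then have "sqrt x = \<bar>S / \<eta>\<bar> * sqrt (t / real n)" by (simp only: real_sqrt_mult real_sqrt_abs)
    then have "sqrt x = S / \<eta> * sqrt (t / real n)" using S_nonneg eta_pos by simp
    then have "2 * e / sqrt \<gamma> = (4 * c / (\<gamma> * sqrt \<gamma>)) * ((S / g) * sqrt (t / real n))"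
      using gam g_pos by (simp add: e_def \<eta>_def field_simps)
    also have "\<dots> \<le> C * ((S / g) * sqrt (t / real n))" using C(3) S_nonneg g_pos t n by (intro mult_right_mono) auto
    finally show ?thesis by (simp add: mult_ac)
  qed
  define Bd where "Bd = {z. \<tau>1 < err z} \<union> {z. e \<le> \<bar>f \<theta> z - Ef \<theta>\<bar>} \<union> {z. e \<le> \<bar>f u z - Ef u\<bar>}"
  have m: "{z. e \<le> \<bar>f v z - Ef v\<bar>} \<in> sets law" for v
  proof -
    have "(\<lambda>z. \<bar>f v z - Ef v\<bar>) \<in> borel_measurable law"
      by (intro borel_measurable_abs borel_measurable_diff meas_law[OF f_measurable] borel_measurable_const)
    from borel_measurable_le[OF borel_measurable_const this, of e] show ?thesis by simp
  qed
  have s1: "{z. \<tau>1 < err z} \<in> sets law" unfolding sets_law by (rule err_gt_sets)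
  have Bd: "Bd \<in> sets law" unfolding Bd_def by (intro sets.Un s1 m)
  \<comment> \<open>\<open>C\<^sup>2 * L2 * t \<le> 1\<close> makes \<open>rate\<close> at least
    \<open>(1 + 64 * (real J + 1)) * t\<close>, enough to absorb the number of events and still
    leave \<open>exp (- t)\<close>.\<close>
  have rate: "exp (- rate) * (64 * (real J + 1)) \<le> exp (- t)"
  proof -
    have "C\<^sup>2 * L2 * t \<le> 1" using C2 by (simp add: x_def mult_ac)
    then have "C\<^sup>2 * t \<le> 1 / L2" using L2_pos by (simp add: field_simps)
    then have "C\<^sup>2 * t / 160 \<le> rate" by (simp add: rate_def)
    moreover have "160 * (1 + 64 * (real J + 1)) * t \<le> C\<^sup>2 * t" using C(1) t by (intro mult_right_mono) auto
    ultimately have "160 * ((1 + 64 * (real J + 1)) * t) \<le> 160 * rate" by (simp add: mult.assoc[symmetric])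
    then have "(1 + 64 * (real J + 1)) * t \<le> rate" by (simp only: mult_le_cancel_left_pos zero_less_numeral)
    moreover have "64 * (real J + 1) * 1 \<le> 64 * (real J + 1) * t" using t by (intro mult_left_mono) auto
    ultimately have "64 * (real J + 1) \<le> rate - t" by (simp add: algebra_simps)
    also have "\<dots> \<le> exp (rate - t)" using exp_ge_add_one_self[of "rate - t"] by linarith
    finally have "exp (- rate) * (64 * (real J + 1)) \<le> exp (- rate) * exp (rate - t)" by (intro mult_left_mono) auto
    then show ?thesis by (simp add: exp_add[symmetric])
  qed
  have p0': "p0 \<le> exp (- t) / 16" using rate by (simp add: p0_def algebra_simps)
  have r1: "exp (- rate) \<le> exp (- t) / 64"
  proof -
    have "exp (- rate) * (64 * 1) \<le> exp (- rate) * (64 * (real J + 1))" by (intro mult_left_mono) auto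
    then show ?thesis using rate by linarith
  qed
  have e8: "exp (- 8 * t) \<le> exp (- t) / 128"
  proof -
    have "(2::real) ^ 7 \<le> exp 1 ^ 7" using exp_ge_add_one_self[of 1] by (intro power_mono) auto
    also have "\<dots> = exp 7" using exp_of_nat_mult[of 7 "1::real"] by simp
    also have "\<dots> \<le> exp (7 * t)" using t by simp
    finally have "exp (- 8 * t) * 128 \<le> exp (- 8 * t) * exp (7 * t)" by (intro mult_left_mono) auto
    then show ?thesis by (simp add: exp_add[symmetric])
  qed
  have tail: "measure law {z. e \<le> \<bar>f v z - Ef v\<bar>} \<le> 4 / 3 * (p0 + 8 * exp (- 8 * t))" if "norm v = 1" for v
    using f_concentration[of v t] that t by (simp add: e_def cV x_def)
  have "measure law Bd \<le> measure law ({z. \<tau>1 < err z} \<union> {z. e \<le> \<bar>f \<theta> z - Ef \<theta>\<bar>}) + measure law {z. e \<le> \<bar>f u z - Ef u\<bar>}"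
    unfolding Bd_def by (intro measure_Un_le sets.Un s1 m)
  also have "\<dots> \<le> (measure law {z. \<tau>1 < err z} + measure law {z. e \<le> \<bar>f \<theta> z - Ef \<theta>\<bar>}) + measure law {z. e \<le> \<bar>f u z - Ef u\<bar>}"
    by (intro add_right_mono measure_Un_le s1 m)
  \<comment> \<open>With \<open>E = exp (- t)\<close>, the budget is \<open>E / 64\<close> for the
    error and \<open>E / 6\<close> for each of the two coordinates.\<close>
  also have "\<dots> \<le> exp (- t)"
  proof -
    define E where "E = exp (- t)"
    have E: "0 \<le> E" by (simp add: E_def)
    have "p0 + 8 * exp (- 8 * t) \<le> E / 16 + 8 * (E / 128)"
      using p0' e8 unfolding E_def[symmetric] by (intro add_mono mult_left_mono) auto
    then have "4 / 3 * (p0 + 8 * exp (- 8 * t)) \<le> 4 / 3 * (E / 16 + 8 * (E / 128))" by (rule mult_left_mono) simp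
    from order_trans[OF tail this] norm_theta u
    have v: "measure law {z. e \<le> \<bar>f \<theta> z - Ef \<theta>\<bar>} \<le> E / 6" "measure law {z. e \<le> \<bar>f u z - Ef u\<bar>} \<le> E / 6" by auto
    have "measure law {z. \<tau>1 < err z} \<le> E / 64" using order_trans[OF err_tau1_tail r1] by (simp add: E_def)
    from add_mono[OF add_mono[OF this v(1)] v(2)] show ?thesis
      unfolding E_def[symmetric] by (rule order_trans) (use E in simp)
  qed
  finally have Bd_le: "measure law Bd \<le> exp (- t)" .
  let ?B = "1 + bias M X Y n r \<theta>"
  let ?G = "{\<omega> \<in> space M. \<bar>inner (\<theta>h \<omega> - sqrt ?B *\<^sub>R \<theta>) u\<bar> \<le> C * (S / g) * sqrt (t / real n)}"
  have \<theta>h: "\<theta>h \<in> borel_measurable M" using hat by (simp add: empirical_eigenvector_def)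
  have G: "?G \<in> sets M"
  proof -
    have "(\<lambda>\<omega>. \<bar>inner (\<theta>h \<omega> - sqrt ?B *\<^sub>R \<theta>) u\<bar>) \<in> borel_measurable M"
      by (intro borel_measurable_abs borel_measurable_inner borel_measurable_diff \<theta>h borel_measurable_const)
    from borel_measurable_le[OF this borel_measurable_const] show ?thesis .
  qed
  have sub: "space M - (Z -` Bd \<inter> space M) \<subseteq> ?G"
  proof
    fix \<omega> assume "\<omega> \<in> space M - (Z -` Bd \<inter> space M)"
    then have w: "\<omega> \<in> space M" "Z \<omega> \<notin> Bd" by auto
    have h: "\<theta>h \<omega> \<in> eigenspace (scov n (Z \<omega>)) (eigval (scov n (Z \<omega>)) jr)" "norm (\<theta>h \<omega>) = 1" "0 \<le> inner (\<theta>h \<omega>) \<theta>"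
      using hat w(1) unfolding empirical_eigenvector_def empirical_eigenvalue_eq scov_Z by auto
    have "\<tau>1 \<le> \<tau>2" using gam g_pos by (simp add: \<tau>1_def \<tau>2_def)
    then have er: "err (Z \<omega>) \<le> \<tau>2" using w(2) by (auto simp: Bd_def)
    have d: "\<bar>f \<theta> (Z \<omega>) - Ef \<theta>\<bar> \<le> e" "\<bar>f u (Z \<omega>) - Ef u\<bar> \<le> e" using w(2) by (auto simp: Bd_def)
    have tt: "inner \<theta> \<theta> = 1" using norm_theta by (simp add: norm_eq_1)
    have "\<bar>inner (\<theta>h \<omega>) u - sqrt ?B * inner \<theta> u\<bar> \<le> 2 * e / sqrt \<gamma>"
    proof (rule normalised_inner_bound[OF h(3) _ _ b gam(1) e])
      show "\<bar>(inner (\<theta>h \<omega>) \<theta>)\<^sup>2 - ?B\<bar> \<le> e"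
        using d(1) unfolding Ef_eq f_empirical[OF er h(1,2)] tt by (simp add: power2_eq_square)
      show "\<bar>inner (\<theta>h \<omega>) \<theta> * inner (\<theta>h \<omega>) u - ?B * inner \<theta> u\<bar> \<le> e"
        using d(2) unfolding Ef_eq f_empirical[OF er h(1,2)] .
      show "\<bar>inner \<theta> u\<bar> \<le> 1" using Cauchy_Schwarz_ineq2[of \<theta> u] norm_theta u by simp
    qed
    then show "\<omega> \<in> ?G" using w(1) e_le by (simp add: inner_diff_left)
  qed
  have ZB: "Z -` Bd \<inter> space M \<in> sets M" using Bd unfolding sets_law by (rule measurable_sets[OF measZ])
  have "1 - measure law Bd = 1 - measure M (Z -` Bd \<inter> space M)"
    using Bd unfolding law_def by (subst measure_distr[OF measZ]) simp_all
  also have "\<dots> = measure M (space M - (Z -` Bd \<inter> space M))" using prob_compl[OF ZB] by simp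
  also have "\<dots> \<le> measure M ?G" by (rule finite_measure_mono[OF sub G])
  finally show ?thesis using Bd_le unfolding C_def by linarith
qed

end

theorem eigenvector_const_admissible:
  fixes \<gamma> :: real
  assumes g: "0 < \<gamma>" "\<gamma> < 1 / 2"
  shows "admissible_constant TYPE('w) TYPE('h::{real_inner,banach,second_countable_topology}) \<gamma> (eigenvector_const \<gamma>)"
  unfolding admissible_constant_def
proof (intro allI impI)
  fix M :: "'w measure" and X :: "'w \<Rightarrow> 'h" and Y n r \<theta> \<theta>h and t :: real and u :: 'h
  assume 1: "gaussian_sample M X Y n" and 2: "simple_eigenpair (covariance M X) r \<theta>"
    and hat: "empirical_eigenvector M X Y n r \<theta> \<theta>h" and t: "1 \<le> t"
    and 3: "(\<integral>\<omega>. onorm (estimation_error M X Y n \<omega>) \<partial>M) \<le> (1 - 2 * \<gamma>) * spectral_gap (covariance M X) r / 2"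
    and b: "2 * \<gamma> \<le> 1 + bias M X Y n r \<theta>"
    and small: "eigenvector_const \<gamma> * onorm (covariance M X) * max (sqrt (t / real n)) (t / real n)
          \<le> \<gamma> * spectral_gap (covariance M X) r / 2"
  interpret gaussian_data M X Y n by unfold_locales (rule 1)
  interpret eigen_data M X Y n r \<theta> \<gamma>
    by unfold_locales (use 2 3 g in \<open>simp_all add: expectation_err\<close>)
  define C where "C = eigenvector_const \<gamma>"
  have C: "0 < C" using eigenvector_const(4)[OF g(1)] by (simp add: C_def)
  let ?h = "\<lambda>\<omega>. \<theta>h \<omega> - sqrt (1 + bias M X Y n r \<theta>) *\<^sub>R \<theta>"
  have "C * S * sqrt (t / real n) \<le> C * S * max (sqrt (t / real n)) (t / real n)"
    using C S_nonneg by (intro mult_left_mono) auto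
  then have small': "C * S * sqrt (t / real n) \<le> \<eta>" using small by (simp add: \<eta>_def C_def)
  let ?c = "C * (S / g) * sqrt (t / real n)"
  have n: "0 < real n" using n_pos by simp
  show "1 - exp (- t) \<le> measure M {\<omega> \<in> space M. \<bar>inner (?h \<omega>) u\<bar> \<le> eigenvector_const \<gamma> * (S / g) * sqrt (t / real n) * norm u}"
  proof (cases "u = 0")
    case True
    then show ?thesis by (simp add: prob_space)
  next
    case False
    define v where "v = (1 / norm u) *\<^sub>R u"
    have v: "norm v = 1" "u = norm u *\<^sub>R v" using False by (simp_all add: v_def)
    have "\<bar>inner (?h \<omega>) u\<bar> \<le> ?c * norm u \<longleftrightarrow> \<bar>inner (?h \<omega>) v\<bar> \<le> ?c" for \<omega>
    proof -
      have "\<bar>inner (?h \<omega>) u\<bar> = \<bar>inner (?h \<omega>) v\<bar> * norm u" by (subst v(2)) (simp add: abs_mult mult_ac)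
      then show ?thesis using False by (simp only: mult_le_cancel_right_pos zero_less_norm_iff not_False_eq_True)
    qed
    then show ?thesis using unit_vector_bound[OF hat t b small'[unfolded C_def] v(1)] by (simp only: C_def)
  qed
qed

section \<open>Embedding into the sequence space\<close>

text \<open>\<iota> takes coordinates in an orthonormal basis, and \<kappa> sums the series with
  given coefficients, which converges because they are square-summable.\<close>

lemma ell2_embedding:
  obtains \<iota> :: "'h::{real_inner,banach,second_countable_topology} \<Rightarrow> ell2" and \<kappa> :: "ell2 \<Rightarrow> 'h"
  where "linear \<iota>" "\<And>x y. inner (\<iota> x) (\<iota> y) = inner x y" "\<And>x z. inner (\<iota> x) z = inner x (\<kappa> z)"
proof -
  obtain e :: "nat \<Rightarrow> 'h" where "orthonormal_basis e"
    using orthonormal_basis_exists orthonormal_basis.intro by metis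
  then interpret orthonormal_basis e .
  define \<iota> where "\<iota> x = Abs_ell2 (\<lambda>i. inner (e i) x)" for x
  have c: "coord (\<iota> x) = (\<lambda>i. inner (e i) x)" for x
    unfolding \<iota>_def using summable_coordinates[of x] by (simp add: Abs_ell2_inverse)
  have "\<exists>y. ((\<lambda>i. coord z i *\<^sub>R e i) has_sum y) UNIV" for z
    using expansion_has_sum[OF summable_coord] by metis
  then obtain \<kappa> where \<kappa>: "\<And>z. ((\<lambda>i. coord z i *\<^sub>R e i) has_sum \<kappa> z) UNIV" by metis
  show thesis
  proof (rule that)
    show "linear \<iota>"
      by (rule linearI) (simp_all add: coord_inject[symmetric] c plus_ell2.rep_eq scaleR_ell2.rep_eq inner_add_right)
    show "inner (\<iota> x) (\<iota> y) = inner x y" for x y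
      unfolding inner_ell2_def c by (rule sums_unique[OF Parseval, symmetric])
    show "inner (\<iota> x) z = inner x (\<kappa> z)" for x z
    proof -
      have "((\<lambda>i. inner x (coord z i *\<^sub>R e i)) has_sum inner x (\<kappa> z)) UNIV"
        by (rule has_sum_bounded_linear[OF bounded_linear_inner_right \<kappa>])
      then have "(\<lambda>i. inner x (coord z i *\<^sub>R e i)) sums inner x (\<kappa> z)" by (rule has_sum_imp_sums)
      then show ?thesis unfolding inner_ell2_def c by (simp add: sums_iff inner_commute mult.commute)
    qed
  qed
qed

text \<open>The image measure is taken on the range of \<open>\<Phi>\<close> with the finest sigma-algebra, because an
  empirical eigenvector is required at every point of the sample space, and the range need not be
  measurable in the ambient space.\<close>

definition image_space :: "'w measure \<Rightarrow> ('w \<Rightarrow> 'v) \<Rightarrow> 'v measure" where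
  "image_space M \<Phi> = measure_of (\<Phi> ` space M) {A. A \<subseteq> \<Phi> ` space M \<and> \<Phi> -` A \<inter> space M \<in> sets M} (\<lambda>_. 0)"

definition push :: "'w measure \<Rightarrow> ('w \<Rightarrow> 'v) \<Rightarrow> 'v measure" where
  "push M \<Phi> = distr M (image_space M \<Phi>) \<Phi>"

lemma sets_image_space:
  fixes \<Phi> :: "'w \<Rightarrow> 'v"
  shows "sets (image_space M \<Phi>) = {A. A \<subseteq> \<Phi> ` space M \<and> \<Phi> -` A \<inter> space M \<in> sets M}"
  unfolding image_space_def
proof (intro sigma_algebra.sets_measure_of_eq sigma_algebra_iff2[THEN iffD2] conjI allI ballI impI)
  let ?G = "{A. A \<subseteq> \<Phi> ` space M \<and> \<Phi> -` A \<inter> space M \<in> sets M}"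
  fix A assume "A \<in> ?G"
  moreover have "\<Phi> -` (\<Phi> ` space M - A) \<inter> space M = space M - (\<Phi> -` A \<inter> space M)" by auto
  ultimately show "\<Phi> ` space M - A \<in> ?G" by auto
next
  let ?G = "{A. A \<subseteq> \<Phi> ` space M \<and> \<Phi> -` A \<inter> space M \<in> sets M}"
  fix A :: "nat \<Rightarrow> 'v set" assume A: "range A \<subseteq> ?G"
  then have "(\<Union>i. \<Phi> -` A i \<inter> space M) \<in> sets M" by (intro sets.countable_UN) auto
  moreover have "\<Phi> -` (\<Union>i. A i) \<inter> space M = (\<Union>i. \<Phi> -` A i \<inter> space M)" by auto
  ultimately show "(\<Union>i. A i) \<in> ?G" using A by auto
qed auto

lemma space_image_space: "space (image_space M \<Phi>) = \<Phi> ` space M"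
  by (simp add: image_space_def space_measure_of_conv)

lemma space_push: "space (push M \<Phi>) = \<Phi> ` space M" by (simp add: push_def space_image_space)

lemma measurable_image_space: "\<Phi> \<in> measurable M (image_space M \<Phi>)"
  by (rule measurableI) (auto simp: sets_image_space space_image_space)

lemma measurable_push: "h \<in> measurable (push M \<Phi>) N \<longleftrightarrow> (\<lambda>\<omega>. h (\<Phi> \<omega>)) \<in> measurable M N"
proof
  assume "h \<in> measurable (push M \<Phi>) N"
  then have "h \<in> measurable (image_space M \<Phi>) N" by (simp add: push_def)
  then show "(\<lambda>\<omega>. h (\<Phi> \<omega>)) \<in> measurable M N" by (rule measurable_compose[OF measurable_image_space])
next
  assume h: "(\<lambda>\<omega>. h (\<Phi> \<omega>)) \<in> measurable M N"
  show "h \<in> measurable (push M \<Phi>) N"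
  proof (rule measurableI)
    show "h z \<in> space N" if "z \<in> space (push M \<Phi>)" for z
      using that measurable_space[OF h] by (auto simp: space_push)
    fix A assume "A \<in> sets N"
    then have "(\<lambda>\<omega>. h (\<Phi> \<omega>)) -` A \<inter> space M \<in> sets M" by (rule measurable_sets[OF h])
    moreover have "\<Phi> -` (h -` A \<inter> \<Phi> ` space M) \<inter> space M = (\<lambda>\<omega>. h (\<Phi> \<omega>)) -` A \<inter> space M" by auto
    ultimately show "h -` A \<inter> space (push M \<Phi>) \<in> sets (push M \<Phi>)"
      unfolding space_push by (simp add: push_def sets_image_space)
  qed
qed

lemma integral_push:
  fixes h :: "'v \<Rightarrow> 'b::{banach,second_countable_topology}"
  assumes "(\<lambda>\<omega>. h (\<Phi> \<omega>)) \<in> borel_measurable M"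
  shows "(\<integral>z. h z \<partial>push M \<Phi>) = (\<integral>\<omega>. h (\<Phi> \<omega>) \<partial>M)"
proof -
  have "h \<in> borel_measurable (image_space M \<Phi>)" using assms measurable_push[of h M \<Phi> borel] by (simp add: push_def)
  then show ?thesis unfolding push_def by (rule integral_distr[OF measurable_image_space])
qed

lemma distr_push:
  assumes "(\<lambda>\<omega>. h (\<Phi> \<omega>)) \<in> measurable M N"
  shows "distr (push M \<Phi>) N h = distr M N (\<lambda>\<omega>. h (\<Phi> \<omega>))"
proof -
  have "h \<in> measurable (image_space M \<Phi>) N" using assms measurable_push[of h M \<Phi> N] by (simp add: push_def)
  then show ?thesis unfolding push_def by (subst distr_distr[OF _ measurable_image_space]) (simp_all add: comp_def)
qed

lemma measure_push:
  assumes "{\<omega> \<in> space M. P (\<Phi> \<omega>)} \<in> sets M"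
  shows "measure (push M \<Phi>) {z \<in> space (push M \<Phi>). P z} = measure M {\<omega> \<in> space M. P (\<Phi> \<omega>)}"
proof -
  have eq: "\<Phi> -` {z \<in> \<Phi> ` space M. P z} \<inter> space M = {\<omega> \<in> space M. P (\<Phi> \<omega>)}" by auto
  have "{z \<in> \<Phi> ` space M. P z} \<in> sets (image_space M \<Phi>)" unfolding sets_image_space using assms eq by auto
  from measure_distr[OF measurable_image_space this] show ?thesis unfolding space_push unfolding push_def eq .
qed

lemma prob_space_push: "prob_space M \<Longrightarrow> prob_space (push M \<Phi>)"
  unfolding push_def by (rule prob_space.prob_space_distr[OF _ measurable_image_space])

text \<open>Independence is a property of the joint and marginal laws, and these are preserved by
  the push-forward.\<close>

lemma indep_vars_push:
  assumes "prob_space M" "I \<noteq> {}" and m: "\<And>i. i \<in> I \<Longrightarrow> (\<lambda>\<omega>. Y i (\<Phi> \<omega>)) \<in> measurable M (N i)"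
    and ind: "prob_space.indep_vars M N (\<lambda>i \<omega>. Y i (\<Phi> \<omega>)) I"
  shows "prob_space.indep_vars (push M \<Phi>) N Y I"
proof -
  interpret M: prob_space M by fact
  interpret P: prob_space "push M \<Phi>" by (rule prob_space_push) fact
  have m': "Y i \<in> measurable (push M \<Phi>) (N i)" if "i \<in> I" for i unfolding measurable_push by (rule m[OF that])
  have "(\<lambda>\<omega>. \<lambda>i\<in>I. Y i (\<Phi> \<omega>)) \<in> measurable M (PiM I N)" by (rule measurable_restrict[OF m])
  then have "distr (push M \<Phi>) (PiM I N) (\<lambda>x. \<lambda>i\<in>I. Y i x) = distr M (PiM I N) (\<lambda>\<omega>. \<lambda>i\<in>I. Y i (\<Phi> \<omega>))" by (rule distr_push)
  also have "\<dots> = (\<Pi>\<^sub>M i\<in>I. distr M (N i) (\<lambda>\<omega>. Y i (\<Phi> \<omega>)))"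
    by (rule M.indep_vars_iff_distr_eq_PiM'[OF assms(2), THEN iffD1, OF _ ind]) (rule m)
  also have "\<dots> = (\<Pi>\<^sub>M i\<in>I. distr (push M \<Phi>) (N i) (Y i))" by (intro PiM_cong refl distr_push[symmetric] m)
  finally show ?thesis by (rule P.indep_vars_iff_distr_eq_PiM'[OF assms(2), THEN iffD2, rotated]) (rule m')
qed

locale embedded_data = gaussian_data M X Y n
  for M :: "'w measure" and X :: "'w \<Rightarrow> 'h::{real_inner,banach,second_countable_topology}"
    and Y :: "nat \<Rightarrow> 'w \<Rightarrow> 'h" and n :: nat +
  fixes \<iota> :: "'h \<Rightarrow> 'k::{real_inner,banach,second_countable_topology}" and \<kappa>' :: "'k \<Rightarrow> 'h" and \<theta>h :: "'w \<Rightarrow> 'h"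
  assumes lin: "linear \<iota>" and iso: "inner (\<iota> x) (\<iota> y) = inner x y" and adj: "inner (\<iota> x) z = inner x (\<kappa>' z)"
    and meas_hat: "\<theta>h \<in> borel_measurable M"
begin

text \<open>All random vectors of the statement are packed into one sequence: slot 0 for
  \<open>X\<close>, slot 1 for the eigenvector, slots from 2 on for the observations. The
  eigenvector is stored as well because it need not be a function of the data.\<close>

definition \<Phi> :: "'w \<Rightarrow> nat \<Rightarrow> 'k" where
  "\<Phi> \<omega> k = (case k of 0 \<Rightarrow> \<iota> (X \<omega>) | Suc 0 \<Rightarrow> \<iota> (\<theta>h \<omega>) | Suc (Suc j) \<Rightarrow> \<iota> (Y j \<omega>))"

abbreviation M' where "M' \<equiv> push M \<Phi>"
definition X' :: "(nat \<Rightarrow> 'k) \<Rightarrow> 'k" where "X' z = z 0"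
definition \<theta>h' :: "(nat \<Rightarrow> 'k) \<Rightarrow> 'k" where "\<theta>h' z = z 1"
definition Y' :: "nat \<Rightarrow> (nat \<Rightarrow> 'k) \<Rightarrow> 'k" where "Y' j z = z (Suc (Suc j))"

lemma Phi_simps: "X' (\<Phi> \<omega>) = \<iota> (X \<omega>)" "\<theta>h' (\<Phi> \<omega>) = \<iota> (\<theta>h \<omega>)" "Y' j (\<Phi> \<omega>) = \<iota> (Y j \<omega>)"
  by (simp_all add: X'_def \<theta>h'_def Y'_def \<Phi>_def)

lemma meas_emb: "\<iota> \<in> borel_measurable borel"
proof (rule borel_measurable_innerI)
  show "(\<lambda>x. inner (\<iota> x) c) \<in> borel_measurable borel" for c
    unfolding adj by (intro borel_measurable_continuous_onI continuous_intros)
qed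

lemma norm_iota: "norm (\<iota> x) = norm x" by (simp add: norm_eq_sqrt_inner iso)

lemma bounded_linear_emb: "bounded_linear \<iota>"
  by (rule bounded_linear_intro[where K=1]) (simp_all add: linear_add[OF lin] linear_scale[OF lin] norm_iota)

lemma gaussian_sample': "gaussian_sample M' X' Y' n"
  unfolding gaussian_sample_def
proof (intro conjI ballI)
  show "prob_space M'" by (rule prob_space_push[OF prob_space_axioms])
  show "1 \<le> n" by (rule n_pos)
  have mX: "(\<lambda>\<omega>. X' (\<Phi> \<omega>)) \<in> borel_measurable M" unfolding Phi_simps by (rule measurable_compose[OF measX meas_emb])
  have mY: "(\<lambda>\<omega>. Y' j (\<Phi> \<omega>)) \<in> borel_measurable M" if "j \<in> {1..n}" for j
    unfolding Phi_simps by (rule measurable_compose[OF measY[OF that] meas_emb])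
  show "centered_gaussian M' X'"
    unfolding centered_gaussian_def
  proof (intro conjI allI)
    show X': "X' \<in> borel_measurable M'" unfolding measurable_push by (rule mX)
    fix u
    have "(\<lambda>\<omega>. inner (X' (\<Phi> \<omega>)) u) \<in> borel_measurable M" by (intro borel_measurable_inner mX borel_measurable_const)
    then have "distr M' borel (\<lambda>z. inner (X' z) u) = distr M borel (\<lambda>\<omega>. inner (X \<omega>) (\<kappa>' u))"
      by (subst distr_push) (simp_all add: Phi_simps adj)
    then show "\<exists>\<sigma>\<ge>0. distr M' borel (\<lambda>z. inner (X' z) u) =
        (if \<sigma> = 0 then return borel 0 else density lborel (normal_density 0 \<sigma>))"
      using gaussX by (simp add: centered_gaussian_def)
  qed
  show "prob_space.indep_vars M' (\<lambda>_. borel) Y' {1..n}"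
  proof (rule indep_vars_push[OF prob_space_axioms])
    show "{1..n} \<noteq> {}" using n_pos by simp
    show "(\<lambda>\<omega>. Y' j (\<Phi> \<omega>)) \<in> borel_measurable M" if "j \<in> {1..n}" for j by (rule mY[OF that])
    show "indep_vars (\<lambda>_. borel) (\<lambda>j \<omega>. Y' j (\<Phi> \<omega>)) {1..n}"
      unfolding Phi_simps by (rule indep_vars_compose2[OF indepY meas_emb])
  qed
  fix j assume j: "j \<in> {1..n}"
  have "distr M' borel (Y' j) = distr (distr M borel (Y j)) borel \<iota>"
    unfolding distr_push[where h="Y' j", OF mY[OF j]] Phi_simps by (subst distr_distr[OF meas_emb measY[OF j]]) (simp add: comp_def)
  also have "\<dots> = distr (distr M borel X) borel \<iota>" by (simp add: distrY[OF j])
  also have "\<dots> = distr M' borel X'"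
    unfolding distr_push[where h=X', OF mX] Phi_simps by (subst distr_distr[OF meas_emb measX]) (simp add: comp_def)
  finally show "distr M' borel (Y' j) = distr M' borel X'" .
qed

lemma covariance': "covariance M' X' z = \<iota> (\<Sigma> (\<kappa>' z))"
proof -
  have m: "(\<lambda>\<omega>. inner (\<iota> (X \<omega>)) z *\<^sub>R \<iota> (X \<omega>)) \<in> borel_measurable M"
    by (intro borel_measurable_scaleR borel_measurable_inner measurable_compose[OF measX meas_emb] borel_measurable_const)
  have "covariance M' X' z = (\<integral>\<omega>. inner (\<iota> (X \<omega>)) z *\<^sub>R \<iota> (X \<omega>) \<partial>M)"
    unfolding covariance_eq by (subst integral_push) (simp_all add: Phi_simps m)
  also have "\<dots> = (\<integral>\<omega>. \<iota> (inner (X \<omega>) (\<kappa>' z) *\<^sub>R X \<omega>) \<partial>M)" by (simp add: adj linear_scale[OF lin])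
  also have "\<dots> = \<iota> (\<Sigma> (\<kappa>' z))"
    unfolding covariance_eq by (rule integral_bounded_linear[OF bounded_linear_emb integrable_inner_scaleR[OF measX X2]])
  finally show ?thesis .
qed

lemma sample_covariance': "sample_covariance Y' n (\<Phi> \<omega>) z = \<iota> (sample_covariance Y n \<omega> (\<kappa>' z))"
  by (simp add: sample_covariance_def tensor_def Phi_simps adj linear_scale[OF lin] linear_sum[OF lin])

lemma bounded_linear_sample_covariance: "bounded_linear (sample_covariance Y n \<omega>)"
  unfolding sample_covariance_eq_scov by (rule compact_nonneg.bounded_linear[OF compact_nonneg_scov])

lemma bounded_linear_estimation_error: "bounded_linear (estimation_error M X Y n \<omega>)"
  using bounded_linear_sub[OF bounded_linear_sample_covariance cov.bounded_linear] by (simp add: estimation_error_def[abs_def])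

sublocale cov_conj: isometric_conjugate \<iota> \<kappa>' \<Sigma> "covariance M' X'"
  by (rule isometric_conjugate.intro[OF lin iso adj bounded_linear.linear[OF cov.bounded_linear] covariance'])

lemma sample_conj: "isometric_conjugate \<iota> \<kappa>' (sample_covariance Y n \<omega>) (sample_covariance Y' n (\<Phi> \<omega>))"
  by (rule isometric_conjugate.intro[OF lin iso adj bounded_linear.linear[OF bounded_linear_sample_covariance] sample_covariance'])

lemma error_conj: "isometric_conjugate \<iota> \<kappa>' (estimation_error M X Y n \<omega>) (estimation_error M' X' Y' n (\<Phi> \<omega>))"
proof (rule isometric_conjugate.intro[OF lin iso adj bounded_linear.linear[OF bounded_linear_estimation_error]])
  show "estimation_error M' X' Y' n (\<Phi> \<omega>) z = \<iota> (estimation_error M X Y n \<omega> (\<kappa>' z))" for z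
    by (simp add: estimation_error_def sample_covariance' covariance' linear_diff[OF lin])
qed

lemma onorm_covariance': "onorm (covariance M' X') = S" by (rule cov_conj.onorm_conj[OF cov.bounded_linear])

lemma mean_error': "(\<integral>z. onorm (estimation_error M' X' Y' n z) \<partial>M') = (\<integral>\<omega>. onorm (estimation_error M X Y n \<omega>) \<partial>M)"
proof -
  have o: "onorm (estimation_error M' X' Y' n (\<Phi> \<omega>)) = onorm (estimation_error M X Y n \<omega>)" for \<omega>
    by (rule isometric_conjugate.onorm_conj[OF error_conj bounded_linear_estimation_error])
  have "onorm (estimation_error M X Y n \<omega>) = err (Z \<omega>)" for \<omega>
    by (simp add: err_def scov_Z estimation_error_def[abs_def])
  then have "(\<lambda>\<omega>. onorm (estimation_error M X Y n \<omega>)) \<in> borel_measurable M"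
    using measurable_compose[OF measZ measurable_err] by simp
  then show ?thesis by (subst integral_push) (simp_all add: o)
qed

lemma empirical_eigenvalue': "empirical_eigenvalue M' X' Y' n r (\<Phi> \<omega>) = empirical_eigenvalue M X Y n r \<omega>"
  unfolding empirical_eigenvalue_def cov_conj.eigenvalue_index_conj isometric_conjugate.eigenvalue_seq_conj[OF sample_conj] ..

lemma empirical_eigenvector':
  assumes "empirical_eigenvector M X Y n r \<theta> \<theta>h"
  shows "empirical_eigenvector M' X' Y' n r (\<iota> \<theta>) \<theta>h'"
  unfolding empirical_eigenvector_def
proof (intro conjI ballI)
  show "\<theta>h' \<in> borel_measurable M'" unfolding measurable_push Phi_simps by (rule measurable_compose[OF meas_hat meas_emb])
  fix z assume "z \<in> space M'"
  then obtain \<omega> where w: "\<omega> \<in> space M" "z = \<Phi> \<omega>" by (auto simp: space_push)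
  have h: "\<theta>h \<omega> \<in> eigenspace (sample_covariance Y n \<omega>) (empirical_eigenvalue M X Y n r \<omega>)" "norm (\<theta>h \<omega>) = 1" "0 \<le> inner (\<theta>h \<omega>) \<theta>"
    using assms w(1) by (simp_all add: empirical_eigenvector_def)
  show "\<theta>h' z \<in> eigenspace (sample_covariance Y' n z) (empirical_eigenvalue M' X' Y' n r z)"
    unfolding w(2) empirical_eigenvalue' Phi_simps isometric_conjugate.emb_in_eigenspace[OF sample_conj] by (rule h(1))
  show "norm (\<theta>h' z) = 1" "0 \<le> inner (\<theta>h' z) (\<iota> \<theta>)" unfolding w(2) Phi_simps norm_iota iso by (rule h)+
qed

end

lemma admissible_constant_transfer:
  assumes g: "0 < \<gamma>" "\<gamma> < 1 / 2"
    and adm: "admissible_constant TYPE(nat \<Rightarrow> ell2) TYPE(ell2) \<gamma> C"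
  shows "admissible_constant TYPE('w) TYPE('h::{real_inner,banach,second_countable_topology}) \<gamma> C"
  unfolding admissible_constant_def
proof (intro allI impI)
  fix M :: "'w measure" and X :: "'w \<Rightarrow> 'h" and Y n r \<theta> \<theta>h and t :: real and u :: 'h
  assume 1: "gaussian_sample M X Y n" and 2: "simple_eigenpair (covariance M X) r \<theta>"
    and hat: "empirical_eigenvector M X Y n r \<theta> \<theta>h" and t: "1 \<le> t"
    and 3: "(\<integral>\<omega>. onorm (estimation_error M X Y n \<omega>) \<partial>M) \<le> (1 - 2 * \<gamma>) * spectral_gap (covariance M X) r / 2"
    and b: "2 * \<gamma> \<le> 1 + bias M X Y n r \<theta>"
    and small: "C * onorm (covariance M X) * max (sqrt (t / real n)) (t / real n)
          \<le> \<gamma> * spectral_gap (covariance M X) r / 2"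
  have \<theta>h: "\<theta>h \<in> borel_measurable M" using hat by (simp add: empirical_eigenvector_def)
  obtain \<iota> :: "'h \<Rightarrow> ell2" and \<kappa>' where \<iota>: "linear \<iota>" "\<And>x y. inner (\<iota> x) (\<iota> y) = inner x y" "\<And>x z. inner (\<iota> x) z = inner x (\<kappa>' z)"
    by (rule ell2_embedding) blast
  interpret embedded_data M X Y n \<iota> \<kappa>' \<theta>h
    by (intro embedded_data.intro gaussian_data.intro embedded_data_axioms.intro 1 \<iota> \<theta>h)
  interpret E: eigen_data M X Y n r \<theta> \<gamma>
    by unfold_locales (use 2 3 g in \<open>simp_all add: expectation_err\<close>)
  interpret G': gaussian_data M' X' Y' n by (rule gaussian_data.intro[OF gaussian_sample'])
  have pair': "simple_eigenpair (covariance M' X') r (\<iota> \<theta>)" by (rule cov_conj.simple_eigenpair_conj[OF 2])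
  interpret E': eigen_data M' X' Y' n r "\<iota> \<theta>" \<gamma>
    by unfold_locales
      (use pair' 3 g in \<open>simp_all add: G'.expectation_err mean_error' cov_conj.spectral_gap_conj\<close>)
  \<comment> \<open>The bias is compared through the mean of a projector coordinate, which
    transports along \<iota>; this replaces a transport of the series for the reduced
    resolvent.\<close>
  have bias': "bias M' X' Y' n r (\<iota> \<theta>) = bias M X Y n r \<theta>"
  proof -
    let ?h = "\<lambda>\<omega>. inner (spectral_projector (sample_covariance Y n \<omega>) (empirical_eigenvalue M X Y n r \<omega>) \<theta>) \<theta>"
    have eq: "inner (spectral_projector (sample_covariance Y' n (\<Phi> \<omega>)) (empirical_eigenvalue M' X' Y' n r (\<Phi> \<omega>)) (\<iota> \<theta>)) (\<iota> \<theta>) = ?h \<omega>" for \<omega>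
    proof -
      have "spectral_projector (sample_covariance Y' n (\<Phi> \<omega>)) (empirical_eigenvalue M X Y n r \<omega>) (\<iota> \<theta>)
          = \<iota> (spectral_projector (sample_covariance Y n \<omega>) (empirical_eigenvalue M X Y n r \<omega>) \<theta>)"
        unfolding E.empirical_eigenvalue_eq scov_Z
        by (rule isometric_conjugate.spectral_projector_conj[OF sample_conj])
          (rule projector_scov(1,2)[where n=n and z="Z \<omega>", unfolded scov_Z], assumption?)+
      then show ?thesis unfolding empirical_eigenvalue' by (simp add: \<iota>(2))
    qed
    have "(\<lambda>\<omega>. E.f \<theta> (Z \<omega>)) \<in> borel_measurable M" by (rule measurable_compose[OF measZ E.f_measurable])
    then have "?h \<in> borel_measurable M" unfolding E.f_def E.empirical_eigenvalue_eq scov_Z .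
    then show ?thesis
      unfolding E.bias_eq E'.bias_eq E.Ef_eq_expectation E'.Ef_eq_expectation
      by (subst integral_push) (simp_all add: eq)
  qed
  let ?B = "1 + bias M X Y n r \<theta>"
  let ?c = "C * (onorm (covariance M X) / spectral_gap (covariance M X) r) * sqrt (t / real n) * norm u"
  have ev: "inner (\<theta>h' (\<Phi> \<omega>) - sqrt ?B *\<^sub>R \<iota> \<theta>) (\<iota> u) = inner (\<theta>h \<omega> - sqrt ?B *\<^sub>R \<theta>) u" for \<omega>
    by (simp add: Phi_simps inner_diff_left \<iota>(2))
  have "1 - exp (- t) \<le> measure M' {z \<in> space M'. \<bar>inner (\<theta>h' z - sqrt ?B *\<^sub>R \<iota> \<theta>) (\<iota> u)\<bar> \<le> ?c}"
    using adm[unfolded admissible_constant_def, rule_format, OF gaussian_sample' pair' empirical_eigenvector'[OF hat] t, of "\<iota> u"] 3 b small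
    unfolding mean_error' cov_conj.spectral_gap_conj onorm_covariance' bias' norm_iota by simp
  also have "\<dots> = measure M {\<omega> \<in> space M. \<bar>inner (\<theta>h' (\<Phi> \<omega>) - sqrt ?B *\<^sub>R \<iota> \<theta>) (\<iota> u)\<bar> \<le> ?c}"
  proof (rule measure_push)
    have "(\<lambda>\<omega>. \<bar>inner (\<theta>h \<omega> - sqrt ?B *\<^sub>R \<theta>) u\<bar>) \<in> borel_measurable M"
      by (intro borel_measurable_abs borel_measurable_inner borel_measurable_diff \<theta>h borel_measurable_const)
    from borel_measurable_le[OF this borel_measurable_const]
    show "{\<omega> \<in> space M. \<bar>inner (\<theta>h' (\<Phi> \<omega>) - sqrt ?B *\<^sub>R \<iota> \<theta>) (\<iota> u)\<bar> \<le> ?c} \<in> sets M" unfolding ev .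
  qed
  finally show "1 - exp (- t) \<le> measure M {\<omega> \<in> space M. \<bar>inner (\<theta>h \<omega> - sqrt ?B *\<^sub>R \<theta>) u\<bar> \<le> ?c}" unfolding ev .
qed

theorem theorem6:
  fixes \<gamma> :: real
  assumes "0 < \<gamma>" and "\<gamma> < 1 / 2"
  shows "0 < bound_constant \<gamma> \<and>
    (\<forall>(M :: 'w measure) (X :: 'w \<Rightarrow> 'h::{real_inner,banach,second_countable_topology})
        (Y :: nat \<Rightarrow> 'w \<Rightarrow> 'h) (n :: nat) (r :: nat) (\<theta> :: 'h) (\<theta>h :: 'w \<Rightarrow> 'h) (t :: real) (u :: 'h).
        gaussian_sample M X Y n \<longrightarrow>
        simple_eigenpair (covariance M X) r \<theta> \<longrightarrow>
        empirical_eigenvector M X Y n r \<theta> \<theta>h \<longrightarrow>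
        1 \<le> t \<longrightarrow>
        (\<integral>\<omega>. onorm (estimation_error M X Y n \<omega>) \<partial>M)
          \<le> (1 - 2 * \<gamma>) * spectral_gap (covariance M X) r / 2 \<longrightarrow>
        2 * \<gamma> \<le> 1 + bias M X Y n r \<theta> \<longrightarrow>
        bound_constant \<gamma> * onorm (covariance M X) * max (sqrt (t / real n)) (t / real n)
          \<le> \<gamma> * spectral_gap (covariance M X) r / 2 \<longrightarrow>
        1 - exp (- t) \<le> measure M {\<omega> \<in> space M.
          \<bar>inner (\<theta>h \<omega> - sqrt (1 + bias M X Y n r \<theta>) *\<^sub>R \<theta>) u\<bar>
            \<le> bound_constant \<gamma> * (onorm (covariance M X) / spectral_gap (covariance M X) r)
                 * sqrt (t / real n) * norm u})"
proof -
  have "\<exists>C. 0 < C \<and> admissible_constant TYPE(nat \<Rightarrow> ell2) TYPE(ell2) \<gamma> C"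
    using eigenvector_const(4)[OF assms(1)] eigenvector_const_admissible[OF assms] by blast
  \<comment> \<open>The choice returns some positive constant admissible on \<open>ell2\<close>,
    possibly different from \<open>eigenvector_const \<gamma>\<close>, so the other spaces are
    reached by transfer only.\<close>
  then have "0 < bound_constant \<gamma> \<and> admissible_constant TYPE(nat \<Rightarrow> ell2) TYPE(ell2) \<gamma> (bound_constant \<gamma>)"
    unfolding bound_constant_def by (rule someI_ex)
  then have "0 < bound_constant \<gamma>" "admissible_constant TYPE('w) TYPE('h) \<gamma> (bound_constant \<gamma>)"
    using admissible_constant_transfer[OF assms] by blast+
  then show ?thesis unfolding admissible_constant_def by blast
qed

end
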